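(* Let $\mathcal K=(K,\mathcal F(K))$ be a field of definable characteristic zero which is definably algebraically closed and of hyper-infinite transcendence degree. Let $R$ be a definable subfield of $K$ generated by a hyperfinite set, i.e. $R=\mathbf Q(A)^{\rm def}$ for some $A\in\mathcal F(K)$. Let $n\in\mathbf N$ and let $\mathcal I\subseteq R[x_i]^{\rm def}_{i<n}$ be a definable prime ideal. Then: (1) $\mathcal I$ has a generic zero. (2) Let $r\le n$ and let $\mathcal I_r=\mathcal I\cap R[x_i]^{\rm def}_{i<r}$. Then every generic zero $\bar\alpha\in K^{(r)}$ of $\mathcal I_r$ can be extended to a generic zero $\bar\alpha\bar\beta\in K^{(n)}$ of $\mathcal I$.
   Context: **Definable finite power sets.** "Definable" means first-order definable with parameters. Let $X,Y$ be definable sets in a structure and $\in^*\subseteq X\times Y$ a definable relation. $Y$ is a definable finite power set of $X$ with respect to $\in^*$ (written $\mathcal F(X)=Y$) if: (i) $B,C\in\mathcal F(X)$ are equal iff for all $x\in X$, $x\in^* B\iff x\in^* C$; (ii) there is $\emptyset^*\in\mathcal F(X)$ with $x\notin^*\emptyset^*$ for all $x\in X$; (iii) for each $a\in X$ there is $\{a\}^*\in\mathcal F(X)$ with $x\in^*\{a\}^*\iff x=a$; (iv) for $B,C\in\mathcal F(X)$ there is $B\cup^*C\in\mathcal F(X)$ with $x\in^* B\cup^* C\iff x\in^*B\lor x\in^*C$; (v) every definable $\mathcal U\subseteq\mathcal F(X)$ such that $\emptyset^*\in\mathcal U$ and $B\cup^*\{x\}^*\in\mathcal U$ for all $B\in\mathcal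 U$, $x\in X$, equals $\mathcal F(X)$. For $a\in\mathcal F(X)$ let $\operatorname{ext}(a)=\{x\in X: x\in^*a\}$. A definable set $X$ is hyperfinite if it has a definable finite power set $\mathcal F(X)$ and $X=\operatorname{ext}(a)$ for some $a\in\mathcal F(X)$. **Fields.** Consider structures $\mathcal K=(K,\mathcal F(K))$ with a field sort $K$, a second sort $\mathcal F(K)$ and a relation $\in^*$ making $\mathcal F(K)$ a definable finite power set of $K$; definability is meant in $\mathcal K^{eq}$. Let $K_0$ be the set of $x\in K$ for which there is $F\in\mathcal F(K)$ with $x\in^*F$ and, for all $z\in^* F$, if $z\ne0$ then $z-1\in^*F$. $\mathcal K$ has definable characteristic zero if $-1\notin K_0$. In that case put $\mathbf N=K_0$, which with $+,\cdot$ is a model of Peano Arithmetic (ordered by $x\le y\iff y-x\in\mathbf N$) satisfying induction for all $\mathcal K$-definable subsets; $\mathbf Z=\mathbf N\cup-\mathbf N$; $\mathbf Q\subseteq K$ is the field of quotients $a/b$, $a,b\in\mathbf Z$, $b\neq0$. In $\mathcal K^{eq}$ every definable set $X$ has a definable finite power set $\mathcal F(X)$, unique up to a definable bijection preserving extensions. For $n\in\mathbf N$, $(n)=\{i\in\mathbf N:i<n\}$, and for a definable set $X$, $X^{(n)}$ is the (definable) set of hyperfinite functions $(n)\to X$ (elements of $\mathcal F((n)\times X)$ whose extension is such a function); $\bar\alpha\bar\beta$ denotes concatenation of such sequences. **Non-standard polynomials.** For $R\subseteq K$ a definable subring and $n\in\mathbf N$, $R[x_i]^{\rm def}_{i<n}$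 is the set of hyperfinite partial functions $p$ from $\mathbf N^{(n)}$ to $R\setminus\{0\}$ (with hyperfinite domain); $I\in\mathbf N^{(n)}$ is regarded as the monomial $x^I=\prod_{k<n}x_k^{I(k)}$, and $p_I$ is $p(I)$ if $I\in\operatorname{dom}(p)$ and $0$ otherwise. It is a definable ring: sums are computed coefficientwise; $x^Iq$ is the polynomial with coefficient $q_J$ at $x^{I+J}$; and $pq$ is defined by definable recursion on hyperfinite $A\subseteq\operatorname{dom}(p)$ via $p_{|\emptyset}q=0$, $p_{|A\cup\{I\}}q=p_{|A}q+p_Ix^Iq$ for $I\notin A$. For $r\le n$, $R[x_i]^{\rm def}_{i<r}$ is regarded as the subring of polynomials in the first $r$ variables. For $f\in K^{(n)}$ the value $\operatorname{ev}(p,f)\in K$ is defined by definable recursion: $\operatorname{ev}(x^I,f)=\prod_{m<n}f(m)^{I(m)}$ (powers and products by recursion on $\mathbf N$), and $\operatorname{ev}(p,f)=G(\operatorname{dom} p)$, where $G$ is the unique definable function on hyperfinite subsets of $\operatorname{dom}(p)$ with $G(\emptyset)=0$ and $G(A\cup\{I\})=G(A)+p_I\operatorname{ev}(x^I,f)$ for $I\notin A$. For $A\in\mathcal F(K)$, $\mathbf Q[A]^{\rm def}=\{\operatorname{ev}(p,f):p\in\mathbf Q[x_i]^{\rm def}_{i<n}\}$ for any $n\in\mathbf N$, $f\in K^{(n)}$ with image $\operatorname{ext}(A)$ (such $f$ exists and the ring does not depend on it), and $\mathbf Q(A)^{\rm def}\subseteq K$ is its field of fractions. For $a\in K$ and $p\in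 R[x]^{\rm def}:=R[x_i]^{\rm def}_{i<1}$, $p(a)$ is the value of $p$ at the sequence of length $1$ with value $a$. An element $a\in K$ is definably algebraic over $A\in\mathcal F(K)$ if $p(a)=0$ for some non-zero $p\in R[x]^{\rm def}$ with $R=\mathbf Q[A]^{\rm def}$. $\mathcal K$ is definably algebraically closed if every non-constant $p\in K[x]^{\rm def}$ has a zero in $K$. $\mathcal K$ has hyper-infinite transcendence degree if for every $A\in\mathcal F(K)$ some $x\in K$ is not definably algebraic over $A$. **Generic zeros.** $\alpha\in K^{(n)}$ is a generic zero of a definable ideal $\mathcal I\subset R[x_i]^{\rm def}_{i<n}$ if for all $p\in R[x_i]^{\rm def}_{i<n}$: $\operatorname{ev}(p,\alpha)=0\iff p\in\mathcal I$. *)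

theory Defs
  imports "HOL-Algebra.Ideal"
begin

text \<open>
  The structure has two sorts: the field \<open>'k\<close> and the sort \<open>'f\<close> of (codes of) its hyperfinite
  subsets, linked by a relation \<open>mem :: 'k \<Rightarrow> 'f \<Rightarrow> bool\<close>.  The language consists of \<open>+\<close>, \<open>*\<close>, \<open>mem\<close>
  and equality on both sorts; parameters (among them \<open>0\<close> and \<open>1\<close>) occur as constants.  Variables
  are de Bruijn indices, separately for each sort.
\<close>

datatype 'k ktm = KVar nat | KPar 'k | KAdd "'k ktm" "'k ktm" | KMul "'k ktm" "'k ktm"

datatype 'f ftm = FVar nat | FPar 'f

datatype ('k, 'f) fm =
    KEq "'k ktm" "'k ktm"
  | FEq "'f ftm" "'f ftm"
  | Mem "'k ktm" "'f ftm"
  | Neg "('k, 'f) fm"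
  | Conj "('k, 'f) fm" "('k, 'f) fm"
  | ExK "('k, 'f) fm"
  | ExF "('k, 'f) fm"

primrec kval :: "'k::field list \<Rightarrow> 'k ktm \<Rightarrow> 'k" where
  "kval xs (KVar i) = xs ! i"
| "kval xs (KPar c) = c"
| "kval xs (KAdd s t) = kval xs s + kval xs t"
| "kval xs (KMul s t) = kval xs s * kval xs t"

primrec fval :: "'f list \<Rightarrow> 'f ftm \<Rightarrow> 'f" where
  "fval Bs (FVar i) = Bs ! i"
| "fval Bs (FPar B) = B"

text \<open>
  A tuple of the home sorts, and an element of \<open>K\<^sup>e\<^sup>q\<close>, i.e. a class of a definable equivalence
  relation on tuples of fixed arity.
\<close>

type_synonym ('k, 'f) tup = "'k list \<times> 'f list"
type_synonym ('k, 'f) imag = "('k, 'f) tup set"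

definition tcat :: "('k, 'f) tup \<Rightarrow> ('k, 'f) tup \<Rightarrow> ('k, 'f) tup" where
  "tcat t u = (fst t @ fst u, snd t @ snd u)"

text \<open>Elements of the home sorts, and pairs, as elements of \<open>K\<^sup>e\<^sup>q\<close>.\<close>

definition kel :: "'k \<Rightarrow> ('k, 'f) imag" where
  "kel x = {([x], [])}"

definition fel :: "'f \<Rightarrow> ('k, 'f) imag" where
  "fel B = {([], [B])}"

definition pr :: "('k, 'f) imag \<Rightarrow> ('k, 'f) imag \<Rightarrow> ('k, 'f) imag" where
  "pr x y = {tcat t u | t u. t \<in> x \<and> u \<in> y}"

definition prods :: "('k, 'f) imag set \<Rightarrow> ('k, 'f) imag set \<Rightarrow> ('k, 'f) imag set" where
  "prods X Y = {pr x y | x y. x \<in> X \<and> y \<in> Y}"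

locale kfield =
  fixes mem :: "'k::field \<Rightarrow> 'f \<Rightarrow> bool"
begin

subsection \<open>Definable sets\<close>

primrec sat :: "'k list \<Rightarrow> 'f list \<Rightarrow> ('k, 'f) fm \<Rightarrow> bool" where
  "sat xs Bs (KEq s t) = (kval xs s = kval xs t)"
| "sat xs Bs (FEq s t) = (fval Bs s = fval Bs t)"
| "sat xs Bs (Mem s t) = mem (kval xs s) (fval Bs t)"
| "sat xs Bs (Neg \<phi>) = (\<not> sat xs Bs \<phi>)"
| "sat xs Bs (Conj \<phi> \<psi>) = (sat xs Bs \<phi> \<and> sat xs Bs \<psi>)"
| "sat xs Bs (ExK \<phi>) = (\<exists>x. sat (x # xs) Bs \<phi>)"
| "sat xs Bs (ExF \<phi>) = (\<exists>B. sat xs (B # Bs) \<phi>)"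

text \<open>
  Definable sets of tuples of arity \<open>(a, b)\<close>.  A free variable whose index exceeds the arity denotes
  \<open>[] ! i\<close> for an \<open>i\<close> that does not depend on the tuple, so it only acts as one more parameter.
\<close>

definition home_definable :: "nat \<Rightarrow> nat \<Rightarrow> ('k, 'f) tup set \<Rightarrow> bool" where
  "home_definable a b D \<longleftrightarrow>
     (\<exists>\<phi>. D = {(xs, Bs). length xs = a \<and> length Bs = b \<and> sat xs Bs \<phi>})"

text \<open>
  Definable sets of \<open>K\<^sup>e\<^sup>q\<close>.  Relations and functions between such sets are definable if the set of
  the pairs \<open>pr x y\<close> is.
\<close>

definition definable :: "('k, 'f) imag set \<Rightarrow> bool" where
  "definable X \<longleftrightarrow>
     (\<exists>a b D E. home_definable a b D \<and> equiv D E \<and>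
        home_definable (a + a) (b + b) {tcat t u | t u. (t, u) \<in> E} \<and> X = D // E)"

text \<open>
  For a map \<open>g\<close> on a set \<open>S\<close> of HOL objects: \<open>c\<close> and \<open>d\<close> represent its arguments and its values
  by elements of \<open>K\<^sup>e\<^sup>q\<close>.
\<close>

definition definable_map ::
  "('a \<Rightarrow> ('k, 'f) imag) \<Rightarrow> ('b \<Rightarrow> ('k, 'f) imag) \<Rightarrow> 'a set \<Rightarrow> ('a \<Rightarrow> 'b) \<Rightarrow> bool" where
  "definable_map c d S g \<longleftrightarrow> definable ((\<lambda>x. pr (c x) (d (g x))) ` S)"

subsection \<open>Definable finite power sets\<close>

definition fin_power_set ::
  "('k, 'f) imag set \<Rightarrow> ('k, 'f) imag set \<Rightarrow> (('k, 'f) imag \<Rightarrow> ('k, 'f) imag \<Rightarrow> bool) \<Rightarrow> bool" where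
  "fin_power_set X Y M \<longleftrightarrow>
     definable X \<and> definable Y \<and> definable {pr x B | x B. x \<in> X \<and> B \<in> Y \<and> M x B} \<and>
     (\<forall>B\<in>Y. \<forall>C\<in>Y. B = C \<longleftrightarrow> (\<forall>x\<in>X. M x B \<longleftrightarrow> M x C)) \<and>
     (\<exists>Z\<in>Y. \<forall>x\<in>X. \<not> M x Z) \<and>
     (\<forall>a\<in>X. \<exists>B\<in>Y. \<forall>x\<in>X. M x B \<longleftrightarrow> x = a) \<and>
     (\<forall>B\<in>Y. \<forall>C\<in>Y. \<exists>D\<in>Y. \<forall>x\<in>X. M x D \<longleftrightarrow> M x B \<or> M x C) \<and>
     (\<forall>U. definable U \<and> U \<subseteq> Y \<and>
          (\<forall>Z\<in>Y. (\<forall>x\<in>X. \<not> M x Z) \<longrightarrow> Z \<in> U) \<and>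
          (\<forall>B\<in>U. \<forall>a\<in>X. \<forall>C\<in>Y. (\<forall>x\<in>X. M x C \<longleftrightarrow> M x B \<or> x = a) \<longrightarrow> C \<in> U)
        \<longrightarrow> U = Y)"

text \<open>The standing assumption: \<open>'f\<close> with \<open>mem\<close> is a definable finite power set of \<open>'k\<close>.\<close>

definition is_power_set_structure :: bool where
  "is_power_set_structure \<longleftrightarrow>
     fin_power_set (range kel) (range fel) (\<lambda>u v. \<exists>x B. u = kel x \<and> v = fel B \<and> mem x B)"

text \<open>
  A choice of \<open>\<F>(X)\<close> with its membership relation.  Since \<open>\<F>(X)\<close> is unique up to a definable
  bijection preserving extensions, nothing below depends on the choice.
\<close>

definition FP :: "('k, 'f) imag set \<Rightarrow> ('k, 'f) imag set \<times> (('k, 'f) imag \<Rightarrow> ('k, 'f) imag \<Rightarrow> bool)"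
  where "FP X = (SOME (Y, M). fin_power_set X Y M)"

definition ext :: "('k, 'f) imag set \<Rightarrow> ('k, 'f) imag \<Rightarrow> ('k, 'f) imag set" where
  "ext X a = {x \<in> X. snd (FP X) x a}"

text \<open>The extensions of the elements of \<open>\<F>(X)\<close>, and the element of \<open>\<F>(X)\<close> with a given extension.\<close>

definition HF :: "('k, 'f) imag set \<Rightarrow> ('k, 'f) imag set set" where
  "HF X = ext X ` fst (FP X)"

definition hcode :: "('k, 'f) imag set \<Rightarrow> ('k, 'f) imag set \<Rightarrow> ('k, 'f) imag" where
  "hcode X S = (THE a. a \<in> fst (FP X) \<and> ext X a = S)"

subsection \<open>Non-standard numbers\<close>

definition K0 :: "'k set" where
  "K0 = {x. \<exists>F. mem x F \<and> (\<forall>z. mem z F \<longrightarrow> z \<noteq> 0 \<longrightarrow> mem (z - 1) F)}"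

definition definable_char_zero :: bool where
  "definable_char_zero \<longleftrightarrow> - 1 \<notin> K0"

abbreviation NN :: "'k set" where
  "NN \<equiv> K0"

definition ZZ :: "'k set" where
  "ZZ = NN \<union> uminus ` NN"

definition QQ :: "'k set" where
  "QQ = {a / b | a b. a \<in> ZZ \<and> b \<in> ZZ \<and> b \<noteq> 0}"

definition nle :: "'k \<Rightarrow> 'k \<Rightarrow> bool" where
  "nle x y \<longleftrightarrow> y - x \<in> NN"

definition below :: "'k \<Rightarrow> 'k set" where
  "below n = {i \<in> NN. nle i n \<and> i \<noteq> n}"

text \<open>\<open>nrec c s k\<close> is \<open>g k\<close> for the definable \<open>g\<close> on \<open>NN\<close> with \<open>g 0 = c\<close>, \<open>g (i + 1) = s i (g i)\<close>.\<close>

definition nrec :: "'k \<Rightarrow> ('k \<Rightarrow> 'k \<Rightarrow> 'k) \<Rightarrow> 'k \<Rightarrow> 'k" where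
  "nrec c s k = (THE v. \<exists>g. definable_map kel kel NN g \<and> g 0 = c \<and>
                   (\<forall>i\<in>NN. g (i + 1) = s i (g i)) \<and> v = g k)"

definition npow :: "'k \<Rightarrow> 'k \<Rightarrow> 'k" where
  "npow x k = nrec 1 (\<lambda>_ v. v * x) k"

subsection \<open>Hyperfinite sequences\<close>

text \<open>
  A sequence in \<open>X\<^sup>(\<^sup>n\<^sup>)\<close>, for \<open>X \<subseteq> K\<close>, is a function on \<open>(n)\<close> whose graph is the extension of an
  element of \<open>\<F>((n) \<times> X)\<close>; it is represented as a HOL function extended by \<open>0\<close> outside \<open>(n)\<close>.
\<close>

definition seq_graph :: "'k \<Rightarrow> ('k \<Rightarrow> 'k) \<Rightarrow> ('k, 'f) imag set" where
  "seq_graph n f = (\<lambda>i. pr (kel i) (kel (f i))) ` below n"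

definition seqs :: "'k set \<Rightarrow> 'k \<Rightarrow> ('k \<Rightarrow> 'k) set" where
  "seqs X n = {f. (\<forall>i. i \<notin> below n \<longrightarrow> f i = 0) \<and>
                  seq_graph n f \<in> HF (prods (kel ` below n) (kel ` X))}"

definition seq_append :: "'k \<Rightarrow> ('k \<Rightarrow> 'k) \<Rightarrow> ('k \<Rightarrow> 'k) \<Rightarrow> 'k \<Rightarrow> 'k" where
  "seq_append r f g = (\<lambda>i. if i \<in> below r then f i else g (i - r))"

subsection \<open>Non-standard polynomials\<close>

abbreviation monoms :: "'k \<Rightarrow> ('k \<Rightarrow> 'k) set" where
  "monoms n \<equiv> seqs NN n"

definition mcode :: "'k \<Rightarrow> ('k \<Rightarrow> 'k) \<Rightarrow> ('k, 'f) imag" where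
  "mcode n I = hcode (prods (kel ` below n) (kel ` NN)) (seq_graph n I)"

text \<open>
  A polynomial is represented by its coefficient function, which is \<open>0\<close> outside the domain of the
  partial function.  As exponent sequences are extended by \<open>0\<close> too, \<open>polys R r\<close> for \<open>r \<le> n\<close> is
  literally the set of those elements of \<open>polys R n\<close> that involve only the first \<open>r\<close> variables.
\<close>

definition pdom :: "(('k \<Rightarrow> 'k) \<Rightarrow> 'k) \<Rightarrow> ('k \<Rightarrow> 'k) set" where
  "pdom p = {I. p I \<noteq> 0}"

definition poly_graph :: "'k \<Rightarrow> (('k \<Rightarrow> 'k) \<Rightarrow> 'k) \<Rightarrow> ('k, 'f) imag set" where
  "poly_graph n p = (\<lambda>I. pr (mcode n I) (kel (p I))) ` pdom p"

definition polys :: "'k set \<Rightarrow> 'k \<Rightarrow> (('k \<Rightarrow> 'k) \<Rightarrow> 'k) set" where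
  "polys R n = {p. pdom p \<subseteq> monoms n \<and>
                   poly_graph n p \<in> HF (prods (mcode n ` monoms n) (kel ` (R - {0})))}"

definition pcode :: "'k set \<Rightarrow> 'k \<Rightarrow> (('k \<Rightarrow> 'k) \<Rightarrow> 'k) \<Rightarrow> ('k, 'f) imag" where
  "pcode R n p = hcode (prods (mcode n ` monoms n) (kel ` (R - {0}))) (poly_graph n p)"

definition definable_poly_set :: "'k set \<Rightarrow> 'k \<Rightarrow> (('k \<Rightarrow> 'k) \<Rightarrow> 'k) set \<Rightarrow> bool" where
  "definable_poly_set R n P \<longleftrightarrow> P \<subseteq> polys R n \<and> definable (pcode R n ` P)"

text \<open>The hyperfinite subsets of \<open>dom(p)\<close>, and their codes in \<open>\<F>(dom(p))\<close>.\<close>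

definition hsubsets :: "'k \<Rightarrow> (('k \<Rightarrow> 'k) \<Rightarrow> 'k) \<Rightarrow> ('k \<Rightarrow> 'k) set set" where
  "hsubsets n p = {A. A \<subseteq> pdom p \<and> mcode n ` A \<in> HF (mcode n ` pdom p)}"

definition scode :: "'k \<Rightarrow> (('k \<Rightarrow> 'k) \<Rightarrow> 'k) \<Rightarrow> ('k \<Rightarrow> 'k) set \<Rightarrow> ('k, 'f) imag" where
  "scode n p A = hcode (mcode n ` pdom p) (mcode n ` A)"

text \<open>\<open>x\<^sup>I q\<close>: the coefficient \<open>q\<^sub>J\<close> sits at \<open>x\<^sup>I\<^sup>+\<^sup>J\<close>.\<close>

definition mshift :: "('k \<Rightarrow> 'k) \<Rightarrow> (('k \<Rightarrow> 'k) \<Rightarrow> 'k) \<Rightarrow> ('k \<Rightarrow> 'k) \<Rightarrow> 'k" where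
  "mshift I q = (\<lambda>L. q (\<lambda>k. L k - I k))"

definition padd :: "(('k \<Rightarrow> 'k) \<Rightarrow> 'k) \<Rightarrow> (('k \<Rightarrow> 'k) \<Rightarrow> 'k) \<Rightarrow> ('k \<Rightarrow> 'k) \<Rightarrow> 'k" where
  "padd p q = (\<lambda>I. p I + q I)"

definition pmul ::
  "'k set \<Rightarrow> 'k \<Rightarrow> (('k \<Rightarrow> 'k) \<Rightarrow> 'k) \<Rightarrow> (('k \<Rightarrow> 'k) \<Rightarrow> 'k) \<Rightarrow> ('k \<Rightarrow> 'k) \<Rightarrow> 'k" where
  "pmul R n p q = (THE s. \<exists>G.
     G ` hsubsets n p \<subseteq> polys R n \<and>
     definable_map (scode n p) (pcode R n) (hsubsets n p) G \<and>
     G {} = (\<lambda>_. 0) \<and>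
     (\<forall>A\<in>hsubsets n p. \<forall>I\<in>pdom p - A.
        G (insert I A) = padd (G A) (\<lambda>L. p I * mshift I q L)) \<and>
     s = G (pdom p))"

definition poly_ring :: "'k set \<Rightarrow> 'k \<Rightarrow> (('k \<Rightarrow> 'k) \<Rightarrow> 'k) ring" where
  "poly_ring R n =
     \<lparr>carrier = polys R n, mult = pmul R n, one = (\<lambda>I. if I = (\<lambda>_. 0) then 1 else 0),
      zero = (\<lambda>_. 0), add = padd\<rparr>"

definition mev :: "'k \<Rightarrow> ('k \<Rightarrow> 'k) \<Rightarrow> ('k \<Rightarrow> 'k) \<Rightarrow> 'k" where
  "mev n I f = nrec 1 (\<lambda>m v. v * npow (f m) (I m)) n"

definition ev :: "'k \<Rightarrow> (('k \<Rightarrow> 'k) \<Rightarrow> 'k) \<Rightarrow> ('k \<Rightarrow> 'k) \<Rightarrow> 'k" where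
  "ev n p f = (THE v. \<exists>G.
     definable_map (scode n p) kel (hsubsets n p) G \<and>
     G {} = 0 \<and>
     (\<forall>A\<in>hsubsets n p. \<forall>I\<in>pdom p - A. G (insert I A) = G A + p I * mev n I f) \<and>
     v = G (pdom p))"

definition ev1 :: "(('k \<Rightarrow> 'k) \<Rightarrow> 'k) \<Rightarrow> 'k \<Rightarrow> 'k" where
  "ev1 p a = ev 1 p (\<lambda>i. if i = 0 then a else 0)"

subsection \<open>Fields\<close>

text \<open>\<open>QA A\<close> is \<open>\<bold>Q[A]\<^sup>d\<^sup>e\<^sup>f\<close> (it does not depend on \<open>n\<close> and \<open>f\<close>) and \<open>QAfrac A\<close> is \<open>\<bold>Q(A)\<^sup>d\<^sup>e\<^sup>f\<close>.\<close>

definition QA :: "'f \<Rightarrow> 'k set" where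
  "QA A = {ev n p f | n p f. n \<in> NN \<and> f \<in> seqs UNIV n \<and> f ` below n = {x. mem x A} \<and>
                             p \<in> polys QQ n}"

definition QAfrac :: "'f \<Rightarrow> 'k set" where
  "QAfrac A = {a / b | a b. a \<in> QA A \<and> b \<in> QA A \<and> b \<noteq> 0}"

definition definably_algebraic :: "'f \<Rightarrow> 'k \<Rightarrow> bool" where
  "definably_algebraic A a \<longleftrightarrow> (\<exists>p\<in>polys (QA A) 1. p \<noteq> (\<lambda>_. 0) \<and> ev1 p a = 0)"

definition definably_alg_closed :: bool where
  "definably_alg_closed \<longleftrightarrow>
     (\<forall>p\<in>polys UNIV 1. \<not> pdom p \<subseteq> {\<lambda>_. 0} \<longrightarrow> (\<exists>a. ev1 p a = 0))"

definition hyperinfinite_trdeg :: bool where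
  "hyperinfinite_trdeg \<longleftrightarrow> (\<forall>A. \<exists>x. \<not> definably_algebraic A x)"

definition generic_zero :: "'k set \<Rightarrow> 'k \<Rightarrow> (('k \<Rightarrow> 'k) \<Rightarrow> 'k) set \<Rightarrow> ('k \<Rightarrow> 'k) \<Rightarrow> bool" where
  "generic_zero R n P \<alpha> \<longleftrightarrow> \<alpha> \<in> seqs UNIV n \<and> (\<forall>p\<in>polys R n. ev n p \<alpha> = 0 \<longleftrightarrow> p \<in> P)"

end

end

theory Submission
  imports Defs
begin

text \<open>
  Sequences and polynomials are coded by hyperfinitely supported functions; every set definable in
  \<open>\<K>\<^sup>e\<^sup>q\<close> has a definable finite power set, and \<open>\<^bold>N\<close> satisfies definable induction, so that
  algebra with non-standard polynomials runs as in the finite case.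

  A generic zero of \<open>\<I>\<close> is built by definable induction on the number of variables.  Let \<open>\<alpha>\<close> be a
  generic zero of \<open>\<I>\<^sub>r\<close> and let \<open>\<tau>\<close> be definably transcendental over the parameters of \<open>R\<close> and
  \<open>\<alpha>\<close>; a polynomial in \<open>r + 1\<close> variables vanishes at \<open>(\<alpha>, \<tau>)\<close> only if all its coefficients with
  respect to the last variable lie in \<open>\<I>\<^sub>r\<close>.  If all of \<open>\<I>\<^sub>r\<^sub>+\<^sub>1\<close> vanishes there, \<open>\<tau>\<close> extends
  \<open>\<alpha>\<close>.  Otherwise a zero \<open>b\<close> of \<open>p(\<alpha>, x)\<close> does, for \<open>p \<in> \<I>\<^sub>r\<^sub>+\<^sub>1\<close> of least degree among those
  that do not vanish at \<open>(\<alpha>, \<tau>)\<close>: this follows by pseudo-division by \<open>p\<close>, and by an element of least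
  degree of the kernel of evaluation at \<open>(\<alpha>, b)\<close>.
\<close>

section \<open>Definability in the home sorts\<close>

text \<open>The obstacle is definability. Induction over non-standard numbers and over hyperfinite
  sets holds for definable statements only, whereas \<open>ev\<close>, \<open>pmul\<close> and
  \<open>nrec\<close> are descriptions that quantify over definable functions, and their codes
  change with the number of variables. Each is replaced by a first-order expression, uniform in all
  arguments, whose intermediate results form a hyperfinite table. Power sets reach all sorts from K
  alone: K is not hyperfinite, so a slope avoiding a hyperfinite set of bad values exists, and a
  linear form then injects a hyperfinite set of pairs into K. Tuples become hyperfinite sets of
  pairs, and imaginaries are quotients of tuples. In the algebra, the fraction field of the
  polynomials modulo the ideal in r variables is never formed. A polynomial in the next variable is
  zero over that field exactly when it vanishes at the transcendental point, and a coefficient is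
  non-zero there when it lies outside the prime ideal. Pseudo-division modulo this vanishing
  therefore takes the place of division with remainder.\<close>

primrec ktm_sub :: "'k ktm \<Rightarrow> (nat \<Rightarrow> 'k ktm) \<Rightarrow> 'k ktm" where
  "ktm_sub (KVar i) \<sigma> = \<sigma> i"
| "ktm_sub (KPar c) \<sigma> = KPar c"
| "ktm_sub (KAdd s t) \<sigma> = KAdd (ktm_sub s \<sigma>) (ktm_sub t \<sigma>)"
| "ktm_sub (KMul s t) \<sigma> = KMul (ktm_sub s \<sigma>) (ktm_sub t \<sigma>)"

primrec ftm_sub :: "'f ftm \<Rightarrow> (nat \<Rightarrow> 'f ftm) \<Rightarrow> 'f ftm" where
  "ftm_sub (FVar i) \<tau> = \<tau> i"
| "ftm_sub (FPar B) \<tau> = FPar B"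

primrec fm_sub :: "('k, 'f) fm \<Rightarrow> (nat \<Rightarrow> 'k ktm) \<Rightarrow> (nat \<Rightarrow> 'f ftm) \<Rightarrow> ('k, 'f) fm" where
  "fm_sub (KEq s t) \<sigma> \<tau> = KEq (ktm_sub s \<sigma>) (ktm_sub t \<sigma>)"
| "fm_sub (FEq s t) \<sigma> \<tau> = FEq (ftm_sub s \<tau>) (ftm_sub t \<tau>)"
| "fm_sub (Mem s t) \<sigma> \<tau> = Mem (ktm_sub s \<sigma>) (ftm_sub t \<tau>)"
| "fm_sub (Neg \<phi>) \<sigma> \<tau> = Neg (fm_sub \<phi> \<sigma> \<tau>)"
| "fm_sub (Conj \<phi> \<psi>) \<sigma> \<tau> = Conj (fm_sub \<phi> \<sigma> \<tau>) (fm_sub \<psi> \<sigma> \<tau>)"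
| "fm_sub (ExK \<phi>) \<sigma> \<tau> =
     ExK (fm_sub \<phi> (case_nat (KVar 0) (\<lambda>i. ktm_sub (\<sigma> i) (\<lambda>j. KVar (Suc j)))) \<tau>)"
| "fm_sub (ExF \<phi>) \<sigma> \<tau> =
     ExF (fm_sub \<phi> \<sigma> (case_nat (FVar 0) (\<lambda>i. ftm_sub (\<tau> i) (\<lambda>j. FVar (Suc j)))))"

lemma kval_sub:
  assumes "\<And>i. kval xs' (\<sigma> i) = xs ! i"
  shows "kval xs' (ktm_sub t \<sigma>) = kval xs t"
  by (induction t) (simp_all add: assms)

lemma fval_sub:
  assumes "\<And>i. fval Bs' (\<tau> i) = Bs ! i"
  shows "fval Bs' (ftm_sub t \<tau>) = fval Bs t"
  by (induction t) (simp_all add: assms)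

lemma ex_append_Suc:
  "(\<exists>ys. length ys = Suc n \<and> P ys) \<longleftrightarrow> (\<exists>ys. length ys = n \<and> (\<exists>y. P (ys @ [y])))"
  by (metis length_append_singleton length_Suc_conv_rev)

context kfield
begin

lemma sat_sub:
  assumes "\<And>i. kval xs' (\<sigma> i) = xs ! i" and "\<And>i. fval Bs' (\<tau> i) = Bs ! i"
  shows "sat xs' Bs' (fm_sub \<phi> \<sigma> \<tau>) = sat xs Bs \<phi>"
  using assms
proof (induction \<phi> arbitrary: xs xs' Bs Bs' \<sigma> \<tau>)
  case (ExK \<phi>)
  have "sat (x # xs') Bs' (fm_sub \<phi> (case_nat (KVar 0) (\<lambda>i. ktm_sub (\<sigma> i) (\<lambda>j. KVar (Suc j)))) \<tau>)
        = sat (x # xs) Bs \<phi>" for x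
  proof (rule ExK.IH)
    fix i show "kval (x # xs') (case_nat (KVar 0) (\<lambda>i. ktm_sub (\<sigma> i) (\<lambda>j. KVar (Suc j))) i) = (x # xs) ! i"
      using ExK.prems(1) by (cases i) (simp_all add: kval_sub[where xs = xs'])
  qed (rule ExK.prems)
  then show ?case by simp
next
  case (ExF \<phi>)
  have "sat xs' (B # Bs') (fm_sub \<phi> \<sigma> (case_nat (FVar 0) (\<lambda>i. ftm_sub (\<tau> i) (\<lambda>j. FVar (Suc j)))))
        = sat xs (B # Bs) \<phi>" for B
  proof (rule ExF.IH)
    fix i show "fval (B # Bs') (case_nat (FVar 0) (\<lambda>i. ftm_sub (\<tau> i) (\<lambda>j. FVar (Suc j))) i) = (B # Bs) ! i"
      using ExF.prems(2) by (cases i) (simp_all add: fval_sub[where Bs = Bs'])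
  qed (rule ExF.prems)
  then show ?case by simp
qed (simp_all add: kval_sub fval_sub)

text \<open>Only tuples of arity (a, b) are constrained, so \<open>Q\<close> can be any HOL
  predicate that agrees there with a formula. Closure properties compose for predicates, while
  \<open>home_definable\<close> speaks about sets.\<close>

definition hdp :: "nat \<Rightarrow> nat \<Rightarrow> ('k list \<Rightarrow> 'f list \<Rightarrow> bool) \<Rightarrow> bool" where
  "hdp a b Q \<longleftrightarrow> (\<exists>\<phi>. \<forall>xs Bs. length xs = a \<longrightarrow> length Bs = b \<longrightarrow> (sat xs Bs \<phi> \<longleftrightarrow> Q xs Bs))"

lemma home_definable_iff:
  "home_definable a b D \<longleftrightarrow>
     (\<forall>t\<in>D. length (fst t) = a \<and> length (snd t) = b) \<and> hdp a b (\<lambda>xs Bs. (xs, Bs) \<in> D)"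
proof
  assume "home_definable a b D"
  then show "(\<forall>t\<in>D. length (fst t) = a \<and> length (snd t) = b) \<and> hdp a b (\<lambda>xs Bs. (xs, Bs) \<in> D)"
    unfolding home_definable_def hdp_def by auto
next
  assume R: "(\<forall>t\<in>D. length (fst t) = a \<and> length (snd t) = b) \<and> hdp a b (\<lambda>xs Bs. (xs, Bs) \<in> D)"
  then obtain \<phi> where "\<And>xs Bs. length xs = a \<Longrightarrow> length Bs = b \<Longrightarrow> sat xs Bs \<phi> \<longleftrightarrow> (xs, Bs) \<in> D"
    unfolding hdp_def by blast
  then have "D = {(xs, Bs). length xs = a \<and> length Bs = b \<and> sat xs Bs \<phi>}"
    using R by fastforce
  then show "home_definable a b D" unfolding home_definable_def by blast
qed

lemma hdp_cong:
  assumes "\<And>xs Bs. length xs = a \<Longrightarrow> length Bs = b \<Longrightarrow> Q xs Bs \<longleftrightarrow> Q' xs Bs"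
  shows "hdp a b Q \<longleftrightarrow> hdp a b Q'"
  unfolding hdp_def using assms by simp

lemma hdp_fm:
  assumes "\<And>xs Bs. length xs = a \<Longrightarrow> length Bs = b \<Longrightarrow> sat xs Bs \<phi> \<longleftrightarrow> Q xs Bs"
  shows "hdp a b Q"
  unfolding hdp_def using assms by blast

lemma hdp_not: "hdp a b Q \<Longrightarrow> hdp a b (\<lambda>xs Bs. \<not> Q xs Bs)"
  unfolding hdp_def by (metis sat.simps(4))

lemma hdp_conj: "hdp a b Q \<Longrightarrow> hdp a b Q' \<Longrightarrow> hdp a b (\<lambda>xs Bs. Q xs Bs \<and> Q' xs Bs)"
  unfolding hdp_def by (metis sat.simps(5))

lemma hdp_True: "hdp a b (\<lambda>xs Bs. True)"
  by (rule hdp_fm[where \<phi> = "KEq (KPar 0) (KPar 0)"]) simp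

lemma hdp_False: "hdp a b (\<lambda>xs Bs. False)"
  using hdp_not[OF hdp_True] by simp

text \<open>Slicing a tuple, inserting parameters and rotating a tuple are all instances, for
  suitable terms.\<close>

lemma hdp_sub:
  assumes "hdp a b Q"
  shows "hdp a' b' (\<lambda>xs Bs. Q (map (\<lambda>i. kval xs (\<sigma> i)) [0..<a]) (map (\<lambda>i. fval Bs (\<tau> i)) [0..<b]))"
proof -
  obtain \<phi> where \<phi>: "\<And>xs Bs. length xs = a \<Longrightarrow> length Bs = b \<Longrightarrow> sat xs Bs \<phi> \<longleftrightarrow> Q xs Bs"
    using assms unfolding hdp_def by blast
  \<comment> \<open>Beyond the end of a list, \<open>!\<close> yields a value that depends only on
    the excess of the index. A free variable outside the arity is therefore a constant, and
    \<open>\<sigma>'\<close> and \<open>\<tau>'\<close> put that parameter in its place.\<close>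
  have oob: "map f [0..<c] ! i = [] ! (i - c)" if "\<not> i < c" for i c and f :: "nat \<Rightarrow> 'z"
    by (metis append_Nil2 nth_append that length_map length_upt diff_zero)
  have oob': "map f [0..<c] ! i = [] ! (i - c)" if "\<not> i < c" for i c and f :: "nat \<Rightarrow> 'y"
    by (metis append_Nil2 nth_append that length_map length_upt diff_zero)
  define \<sigma>' where "\<sigma>' i = (if i < a then \<sigma> i else KPar ([] ! (i - a)))" for i
  define \<tau>' where "\<tau>' i = (if i < b then \<tau> i else FPar ([] ! (i - b)))" for i
  show ?thesis
  proof (rule hdp_fm[where \<phi> = "fm_sub \<phi> \<sigma>' \<tau>'"])
    fix xs Bs
    have "sat xs Bs (fm_sub \<phi> \<sigma>' \<tau>') = sat (map (\<lambda>i. kval xs (\<sigma> i)) [0..<a]) (map (\<lambda>i. fval Bs (\<tau> i)) [0..<b]) \<phi>"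
      by (rule sat_sub) (auto simp: \<sigma>'_def \<tau>'_def oob oob')
    then show "sat xs Bs (fm_sub \<phi> \<sigma>' \<tau>') = Q (map (\<lambda>i. kval xs (\<sigma> i)) [0..<a]) (map (\<lambda>i. fval Bs (\<tau> i)) [0..<b])"
      by (simp add: \<phi>)
  qed
qed

lemma hdp_slice:
  assumes "hdp a b Q" and "p + a \<le> a'" and "q + b \<le> b'"
  shows "hdp a' b' (\<lambda>xs Bs. Q (take a (drop p xs)) (take b (drop q Bs)))"
proof (rule iffD1[OF hdp_cong hdp_sub[OF assms(1)]])
  fix xs :: "'k list" and Bs :: "'f list" assume "length xs = a'" "length Bs = b'"
  then have "map (\<lambda>i. kval xs (KVar (p + i))) [0..<a] = take a (drop p xs)"
    "map (\<lambda>i. fval Bs (FVar (q + i))) [0..<b] = take b (drop q Bs)"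
    using assms by (auto intro!: nth_equalityI)
  then show "Q (map (\<lambda>i. kval xs (KVar (p + i))) [0..<a]) (map (\<lambda>i. fval Bs (FVar (q + i))) [0..<b])
    = Q (take a (drop p xs)) (take b (drop q Bs))" by (simp only:)
qed

lemma hdp_slice2:
  assumes "hdp (a1 + a2) (b1 + b2) Q" and "p1 + a1 \<le> a'" "q1 + b1 \<le> b'" "p2 + a2 \<le> a'" "q2 + b2 \<le> b'"
  shows "hdp a' b' (\<lambda>xs Bs. Q (take a1 (drop p1 xs) @ take a2 (drop p2 xs))
                            (take b1 (drop q1 Bs) @ take b2 (drop q2 Bs)))"
proof (rule iffD1[OF hdp_cong hdp_sub[OF assms(1)]])
  let ?s = "\<lambda>i. if i < a1 then KVar (p1 + i) else KVar (p2 + (i - a1))"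
  let ?t = "\<lambda>i. if i < b1 then FVar (q1 + i) else FVar (q2 + (i - b1))"
  fix xs :: "'k list" and Bs :: "'f list" assume "length xs = a'" "length Bs = b'"
  then have "map (\<lambda>i. kval xs (?s i)) [0..<a1 + a2] = take a1 (drop p1 xs) @ take a2 (drop p2 xs)"
    "map (\<lambda>i. fval Bs (?t i)) [0..<b1 + b2] = take b1 (drop q1 Bs) @ take b2 (drop q2 Bs)"
    using assms by (auto intro!: nth_equalityI simp: nth_append)
  then show "Q (map (\<lambda>i. kval xs (?s i)) [0..<a1 + a2]) (map (\<lambda>i. fval Bs (?t i)) [0..<b1 + b2])
    = Q (take a1 (drop p1 xs) @ take a2 (drop p2 xs)) (take b1 (drop q1 Bs) @ take b2 (drop q2 Bs))" by (simp only:)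
qed

lemma hdp_param:
  assumes "hdp (a + a1) (b + b1) Q" and "length ps = a1" "length Cs = b1"
  shows "hdp a b (\<lambda>xs Bs. Q (xs @ ps) (Bs @ Cs))"
proof (rule iffD1[OF hdp_cong hdp_sub[OF assms(1)]])
  let ?s = "\<lambda>i. if i < a then KVar i else KPar (ps ! (i - a))"
  let ?t = "\<lambda>i. if i < b then FVar i else FPar (Cs ! (i - b))"
  fix xs :: "'k list" and Bs :: "'f list" assume "length xs = a" "length Bs = b"
  then have "map (\<lambda>i. kval xs (?s i)) [0..<a + a1] = xs @ ps"
    "map (\<lambda>i. fval Bs (?t i)) [0..<b + b1] = Bs @ Cs"
    using assms by (auto intro!: nth_equalityI simp: nth_append)
  then show "Q (map (\<lambda>i. kval xs (?s i)) [0..<a + a1]) (map (\<lambda>i. fval Bs (?t i)) [0..<b + b1]) = Q (xs @ ps) (Bs @ Cs)"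
    by (simp only:)
qed

text \<open>\<open>ExK\<close> binds index 0, the head of the list, but the bound element is wanted
  at the end; a substitution rotates the list first.\<close>

lemma hdp_exK:
  assumes "hdp (Suc a) b Q"
  shows "hdp a b (\<lambda>xs Bs. \<exists>y. Q (xs @ [y]) Bs)"
proof -
  have "hdp (Suc a) b (\<lambda>xs Bs. Q (tl xs @ [hd xs]) Bs)"
  proof (rule iffD1[OF hdp_cong hdp_sub[OF assms]])
    let ?s = "\<lambda>i. if i < a then KVar (Suc i) else KVar 0"
    fix xs :: "'k list" and Bs :: "'f list" assume L: "length xs = Suc a" "length Bs = b"
    then have "map (\<lambda>i. kval xs (?s i)) [0..<Suc a] = tl xs @ [hd xs]"
      by (cases xs; auto intro!: nth_equalityI simp: nth_append less_Suc_eq simp del: upt_Suc)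
    moreover have "map (\<lambda>i. fval Bs (FVar i)) [0..<b] = Bs"
      using L by (auto intro!: nth_equalityI)
    ultimately show "Q (map (\<lambda>i. kval xs (?s i)) [0..<Suc a]) (map (\<lambda>i. fval Bs (FVar i)) [0..<b]) = Q (tl xs @ [hd xs]) Bs"
      by (simp only:)
  qed
  then obtain \<phi> where \<phi>: "\<And>xs Bs. length xs = Suc a \<Longrightarrow> length Bs = b \<Longrightarrow> sat xs Bs \<phi> \<longleftrightarrow> Q (tl xs @ [hd xs]) Bs"
    unfolding hdp_def by blast
  show ?thesis
    by (rule hdp_fm[where \<phi> = "ExK \<phi>"]) (simp add: \<phi>)
qed

lemma hdp_exF:
  assumes "hdp a (Suc b) Q"
  shows "hdp a b (\<lambda>xs Bs. \<exists>C. Q xs (Bs @ [C]))"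
proof -
  have "hdp a (Suc b) (\<lambda>xs Bs. Q xs (tl Bs @ [hd Bs]))"
  proof (rule iffD1[OF hdp_cong hdp_sub[OF assms]])
    let ?t = "\<lambda>i. if i < b then FVar (Suc i) else FVar 0"
    fix xs :: "'k list" and Bs :: "'f list" assume L: "length xs = a" "length Bs = Suc b"
    then have "map (\<lambda>i. fval Bs (?t i)) [0..<Suc b] = tl Bs @ [hd Bs]"
      by (cases Bs; auto intro!: nth_equalityI simp: nth_append less_Suc_eq simp del: upt_Suc)
    moreover have "map (\<lambda>i. kval xs (KVar i)) [0..<a] = xs"
      using L by (auto intro!: nth_equalityI)
    ultimately show "Q (map (\<lambda>i. kval xs (KVar i)) [0..<a]) (map (\<lambda>i. fval Bs (?t i)) [0..<Suc b]) = Q xs (tl Bs @ [hd Bs])"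
      by (simp only:)
  qed
  then obtain \<phi> where \<phi>: "\<And>xs Bs. length xs = a \<Longrightarrow> length Bs = Suc b \<Longrightarrow> sat xs Bs \<phi> \<longleftrightarrow> Q xs (tl Bs @ [hd Bs])"
    unfolding hdp_def by blast
  show ?thesis
    by (rule hdp_fm[where \<phi> = "ExF \<phi>"]) (simp add: \<phi>)
qed

lemma hdp_exs:
  assumes "hdp (a + a1) (b + b1) Q"
  shows "hdp a b (\<lambda>xs Bs. \<exists>ys Cs. length ys = a1 \<and> length Cs = b1 \<and> Q (xs @ ys) (Bs @ Cs))"
proof -
  have 1: "hdp a b' (\<lambda>xs Bs. \<exists>ys. length ys = n \<and> Q (xs @ ys) Bs)" if "hdp (a + n) b' Q" for b' Q n
    using that
  proof (induction n arbitrary: Q)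
    case (Suc n)
    have "hdp a b' (\<lambda>xs Bs. \<exists>ys. length ys = n \<and> (\<exists>y. Q ((xs @ ys) @ [y]) Bs))"
      by (rule Suc.IH, rule hdp_exK) (use Suc.prems in simp)
    then show ?case
      by (simp add: ex_append_Suc)
  qed simp
  have 2: "hdp a b (\<lambda>xs Bs. \<exists>Cs. length Cs = n \<and> Q xs (Bs @ Cs))" if "hdp a (b + n) Q" for Q n
    using that
  proof (induction n arbitrary: Q)
    case (Suc n)
    have "hdp a b (\<lambda>xs Bs. \<exists>ys. length ys = n \<and> (\<exists>y. Q xs ((Bs @ ys) @ [y])))"
      by (rule Suc.IH, rule hdp_exF) (use Suc.prems in simp)
    then show ?case
      by (simp add: ex_append_Suc)
  qed simp
  show ?thesis
    by (rule iffD1[OF hdp_cong 2[OF 1[OF assms]]]) blast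
qed

end

section \<open>Coded sets\<close>

text \<open>
  A coded set is a set of HOL objects with an injection into the imaginaries whose image is definable.
  This allows sequences, polynomials and hyperfinite sets to be treated as elements of
  \<open>K\<^sup>e\<^sup>q\<close> while they remain HOL functions and sets.
\<close>

type_synonym ('a, 'k, 'f) coded = "'a set \<times> ('a \<Rightarrow> ('k, 'f) imag)"

definition car :: "('a, 'k, 'f) coded \<Rightarrow> 'a set" where "car X = fst X"
definition cod :: "('a, 'k, 'f) coded \<Rightarrow> 'a \<Rightarrow> ('k, 'f) imag" where "cod X = snd X"

lemma car_pair [simp]: "car (A, c) = A" and cod_pair [simp]: "cod (A, c) = c"
  by (simp_all add: car_def cod_def)

definition cprod :: "('a, 'k, 'f) coded \<Rightarrow> ('b, 'k, 'f) coded \<Rightarrow> ('a \<times> 'b, 'k, 'f) coded" (infixr "\<times>\<^sub>c" 80) where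
  "X \<times>\<^sub>c Y = (car X \<times> car Y, \<lambda>(x, y). pr (cod X x) (cod Y y))"

lemma car_cprod [simp]: "car (X \<times>\<^sub>c Y) = car X \<times> car Y"
  and cod_cprod [simp]: "cod (X \<times>\<^sub>c Y) (x, y) = pr (cod X x) (cod Y y)"
  by (simp_all add: cprod_def)

text \<open>Pairs are concatenations of tuples, hence associative on the nose. Both bracketings of a
  triple product have the same codes, which is what reassociation in \<open>dp_assoc\<close> rests
  on.\<close>

lemma pr_assoc: "pr (pr x y) z = pr x (pr y z)"
proof -
  have 1: "tcat (tcat t u) v = tcat t (tcat u v)" for t u v :: "('k, 'f) tup"
    by (simp add: tcat_def)
  have "pr (pr x y) z = {tcat (tcat t u) v | t u v. t \<in> x \<and> u \<in> y \<and> v \<in> z}"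
    unfolding pr_def by blast
  also have "\<dots> = pr x (pr y z)"
    unfolding 1 unfolding pr_def by blast
  finally show ?thesis .
qed

section \<open>Coded sets and the formulas behind them\<close>

context kfield
begin

definition cset :: "('a, 'k, 'f) coded \<Rightarrow> bool" where
  "cset X \<longleftrightarrow> inj_on (cod X) (car X) \<and> definable (cod X ` car X)"

definition dp :: "('a, 'k, 'f) coded \<Rightarrow> ('a \<Rightarrow> bool) \<Rightarrow> bool" where
  "dp X P \<longleftrightarrow> cset X \<and> definable (cod X ` {x \<in> car X. P x})"

definition df :: "('a, 'k, 'f) coded \<Rightarrow> ('b, 'k, 'f) coded \<Rightarrow> ('a \<Rightarrow> 'b) \<Rightarrow> bool" where
  "df X Y f \<longleftrightarrow> cset X \<and> cset Y \<and> f ` car X \<subseteq> car Y \<and> dp (X \<times>\<^sub>c Y) (\<lambda>z. snd z = f (fst z))"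

text \<open>The presentation of a coded set as a quotient: the codes are the classes of an
  equivalence relation on tuples, and the two \<open>hdp\<close> clauses make the underlying set and
  the relation definable. It turns questions about imaginaries into questions about
  formulas.\<close>

definition arity :: "('a, 'k, 'f) coded \<Rightarrow> nat \<Rightarrow> nat \<Rightarrow> bool" where
  "arity X a b \<longleftrightarrow> (\<forall>x\<in>car X. cod X x \<noteq> {}) \<and>
     (\<forall>x\<in>car X. \<forall>y\<in>car X. \<forall>t. t \<in> cod X x \<longrightarrow> t \<in> cod X y \<longrightarrow> x = y) \<and>
     (\<forall>x\<in>car X. \<forall>t\<in>cod X x. length (fst t) = a \<and> length (snd t) = b) \<and>
     hdp a b (\<lambda>xs Bs. \<exists>x\<in>car X. (xs, Bs) \<in> cod X x) \<and>
     hdp (a + a) (b + b) (\<lambda>xs Bs. \<exists>x\<in>car X. (take a xs, take b Bs) \<in> cod X x \<and> (drop a xs, drop b Bs) \<in> cod X x)"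

lemma arityD:
  assumes "arity X a b"
  shows "x \<in> car X \<Longrightarrow> cod X x \<noteq> {}"
    and "x \<in> car X \<Longrightarrow> y \<in> car X \<Longrightarrow> t \<in> cod X x \<Longrightarrow> t \<in> cod X y \<Longrightarrow> x = y"
    and "x \<in> car X \<Longrightarrow> (xs, Bs) \<in> cod X x \<Longrightarrow> length xs = a \<and> length Bs = b"
    and "hdp a b (\<lambda>xs Bs. \<exists>x\<in>car X. (xs, Bs) \<in> cod X x)"
    and "hdp (a + a) (b + b) (\<lambda>xs Bs. \<exists>x\<in>car X. (take a xs, take b Bs) \<in> cod X x \<and> (drop a xs, drop b Bs) \<in> cod X x)"
  using assms unfolding arity_def by fastforce+

text \<open>The tuples in \<open>x\<close> have a fixed arity, so a concatenation splits in only one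
  place.\<close>

lemma mem_pr:
  assumes "\<And>t. t \<in> x \<Longrightarrow> length (fst t) = a \<and> length (snd t) = b"
  shows "(xs, Bs) \<in> pr x y \<longleftrightarrow> (take a xs, take b Bs) \<in> x \<and> (drop a xs, drop b Bs) \<in> y"
proof
  assume "(xs, Bs) \<in> pr x y"
  then show "(take a xs, take b Bs) \<in> x \<and> (drop a xs, drop b Bs) \<in> y"
    using assms unfolding pr_def tcat_def by fastforce
next
  assume A: "(take a xs, take b Bs) \<in> x \<and> (drop a xs, drop b Bs) \<in> y"
  have "(xs, Bs) = tcat (take a xs, take b Bs) (drop a xs, drop b Bs)"
    by (simp add: tcat_def)
  then show "(xs, Bs) \<in> pr x y" unfolding pr_def using A by blast
qed

lemma arity_imp_definable:
  assumes "arity X a b"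
  shows "definable (cod X ` car X)"
proof -
  define D where "D = (\<Union>x\<in>car X. cod X x)"
  define E where "E = {(t, u). \<exists>x\<in>car X. t \<in> cod X x \<and> u \<in> cod X x}"
  note A = arityD[OF assms]
  have len: "length (fst t) = a \<and> length (snd t) = b" if "t \<in> cod X x" "x \<in> car X" for t x
    using A(3)[of x "fst t" "snd t"] that by simp
  have "home_definable a b D"
    unfolding home_definable_iff D_def using A(4) len by auto
  moreover have "equiv D E"
    unfolding equiv_def refl_on_def sym_def trans_def D_def E_def using A(2) by blast
  moreover have "home_definable (a + a) (b + b) {tcat t u | t u. (t, u) \<in> E}"
  proof -
    define S where "S = {tcat t u | t u. (t, u) \<in> E}"
    have S: "S = (\<Union>x\<in>car X. pr (cod X x) (cod X x))"
      unfolding S_def E_def pr_def by blast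
    have "(xs, Bs) \<in> pr (cod X x) y \<longleftrightarrow> (take a xs, take b Bs) \<in> cod X x \<and> (drop a xs, drop b Bs) \<in> y"
      if "x \<in> car X" for x y xs Bs by (rule mem_pr) (use len that in blast)
    then have mem: "(xs, Bs) \<in> S \<longleftrightarrow>
       (\<exists>x\<in>car X. (take a xs, take b Bs) \<in> cod X x \<and> (drop a xs, drop b Bs) \<in> cod X x)" for xs Bs
      unfolding S by auto
    have "length (fst t) = a + a \<and> length (snd t) = b + b" if tS: "t \<in> S" for t
    proof -
      obtain x u v where "x \<in> car X" "u \<in> cod X x" "v \<in> cod X x" "t = tcat u v"
        using tS unfolding S pr_def by blast
      then show ?thesis using len[of u x] len[of v x] by (simp add: tcat_def)
    qed
    then show ?thesis
      unfolding S_def[symmetric] home_definable_iff mem using A(5) by blast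
  qed
  moreover have "cod X ` car X = D // E"
  proof -
    have E: "E `` {t} = cod X x" if "t \<in> cod X x" "x \<in> car X" for t x
    proof (rule Set.set_eqI)
      fix u show "u \<in> E `` {t} \<longleftrightarrow> u \<in> cod X x"
      proof
        assume "u \<in> E `` {t}"
        then obtain y where y: "y \<in> car X" "t \<in> cod X y" "u \<in> cod X y" unfolding E_def by blast
        then show "u \<in> cod X x" using A(2)[OF y(1) that(2) y(2) that(1)] by simp
      next
        assume "u \<in> cod X x"
        then show "u \<in> E `` {t}" using that unfolding E_def by blast
      qed
    qed
    show ?thesis
    proof
      show "cod X ` car X \<subseteq> D // E"
      proof
        fix c assume "c \<in> cod X ` car X"
        then obtain x t where x: "c = cod X x" "x \<in> car X" "t \<in> cod X x" using A(1) by fast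
        then show "c \<in> D // E" using E[OF x(3,2)] unfolding quotient_def D_def by auto
      qed
      show "D // E \<subseteq> cod X ` car X"
        unfolding quotient_def D_def using E by auto
    qed
  qed
  ultimately show ?thesis unfolding definable_def by blast
qed

lemma definable_imp_arity:
  assumes "definable (cod X ` car X)" and "inj_on (cod X) (car X)"
  shows "\<exists>a b. arity X a b"
proof -
  obtain a b D E where D: "home_definable a b D" and eq: "equiv D E"
    and E: "home_definable (a + a) (b + b) {tcat t u | t u. (t, u) \<in> E}" and X: "cod X ` car X = D // E"
    using assms(1) unfolding definable_def by blast
  have len: "length (fst t) = a \<and> length (snd t) = b" if "t \<in> D" for t
    using D that unfolding home_definable_iff by blast
  have ED: "E \<subseteq> D \<times> D" using eq unfolding equiv_def by blast
  have cls: "\<exists>t\<in>D. cod X x = E `` {t}" if "x \<in> car X" for x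
    using X that unfolding quotient_def by blast
  have ne: "cod X x \<noteq> {}" if "x \<in> car X" for x
    using cls[OF that] eq unfolding equiv_def refl_on_def by blast
  have sub: "cod X x \<subseteq> D" if "x \<in> car X" for x
    using cls[OF that] ED by blast
  have uniq: "x = y" if xy: "x \<in> car X" "y \<in> car X" "t \<in> cod X x" "t \<in> cod X y" for x y t
  proof -
    obtain u v where uv: "cod X x = E `` {u}" "cod X y = E `` {v}"
      using cls[OF xy(1)] cls[OF xy(2)] by blast
    then have "(u, v) \<in> E" using that eq unfolding equiv_def sym_def trans_def by blast
    then have "cod X x = cod X y" using uv eq by (metis equiv_class_eq)
    then show ?thesis using assms(2) that by (meson inj_onD)
  qed
  have rep: "\<exists>x\<in>car X. cod X x = E `` {t}" if "t \<in> D" for t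
    using quotientI[OF that, of E] unfolding X[symmetric] by force
  have U: "t \<in> D \<longleftrightarrow> (\<exists>x\<in>car X. t \<in> cod X x)" for t
  proof
    assume t: "t \<in> D"
    then show "\<exists>x\<in>car X. t \<in> cod X x" using rep[OF t] equiv_class_self[OF eq t] by auto
  next
    assume "\<exists>x\<in>car X. t \<in> cod X x"
    then show "t \<in> D" using sub by blast
  qed
  have EE: "(t, u) \<in> E \<longleftrightarrow> (\<exists>x\<in>car X. t \<in> cod X x \<and> u \<in> cod X x)" for t u
  proof
    assume tu: "(t, u) \<in> E"
    then have t: "t \<in> D" using ED by blast
    show "\<exists>x\<in>car X. t \<in> cod X x \<and> u \<in> cod X x"
      using rep[OF t] equiv_class_self[OF eq t] tu by auto
  next
    assume "\<exists>x\<in>car X. t \<in> cod X x \<and> u \<in> cod X x"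
    then obtain x where x: "x \<in> car X" "t \<in> cod X x" "u \<in> cod X x" by blast
    obtain d where "cod X x = E `` {d}" using cls[OF x(1)] by blast
    then have "(d, t) \<in> E" "(d, u) \<in> E" using x by auto
    then show "(t, u) \<in> E" using eq by (meson equivE symD transD)
  qed
  have "hdp a b (\<lambda>xs Bs. \<exists>x\<in>car X. (xs, Bs) \<in> cod X x)"
    using D unfolding home_definable_iff U by blast
  moreover have "hdp (a + a) (b + b) (\<lambda>xs Bs. \<exists>x\<in>car X. (take a xs, take b Bs) \<in> cod X x \<and> (drop a xs, drop b Bs) \<in> cod X x)"
  proof -
    define S where "S = {tcat t u | t u. (t, u) \<in> E}"
    have S: "S = (\<Union>x\<in>car X. pr (cod X x) (cod X x))"
      unfolding S_def EE pr_def by blast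
    have "(xs, Bs) \<in> pr (cod X x) y \<longleftrightarrow> (take a xs, take b Bs) \<in> cod X x \<and> (drop a xs, drop b Bs) \<in> y"
      if "x \<in> car X" for x y xs Bs by (rule mem_pr) (use len sub that in blast)
    then have mem: "(xs, Bs) \<in> S \<longleftrightarrow>
       (\<exists>x\<in>car X. (take a xs, take b Bs) \<in> cod X x \<and> (drop a xs, drop b Bs) \<in> cod X x)" for xs Bs
      unfolding S by auto
    show ?thesis using E unfolding S_def[symmetric] home_definable_iff mem by blast
  qed
  moreover have "\<forall>x\<in>car X. \<forall>t\<in>cod X x. length (fst t) = a \<and> length (snd t) = b"
    using sub len by blast
  moreover have "\<forall>x\<in>car X. cod X x \<noteq> {}" using ne by blast
  moreover have "\<forall>x\<in>car X. \<forall>y\<in>car X. \<forall>t. t \<in> cod X x \<longrightarrow> t \<in> cod X y \<longrightarrow> x = y"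
    using uniq by blast
  ultimately have "arity X a b" unfolding arity_def by (intro conjI)
  then show ?thesis by blast
qed

lemma hdp_eqI:
  assumes "hdp a b Q"
    and "\<And>xs Bs. length xs = a \<Longrightarrow> length Bs = b \<Longrightarrow> Q' xs Bs \<longleftrightarrow> Q xs Bs"
  shows "hdp a b Q'"
  using hdp_cong[of a b Q' Q, OF assms(2)] assms(1) by blast

lemma arity_inj: "arity X a b \<Longrightarrow> inj_on (cod X) (car X)"
  unfolding inj_on_def by (metis arityD(1,2) all_not_in_conv)

lemma cset_iff_arity: "cset X \<longleftrightarrow> (\<exists>a b. arity X a b)"
  unfolding cset_def using arity_imp_definable arity_inj definable_imp_arity by blast

text \<open>The basic closure rules for \<open>dp\<close> reduce to those for \<open>hdp\<close>
  through this equivalence. A definable subset inherits its classes from \<open>X\<close>, so a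
  formula is required only for the union of the selected classes.\<close>

lemma dp_iff_hdp:
  assumes "arity X a b"
  shows "dp X P \<longleftrightarrow> hdp a b (\<lambda>xs Bs. \<exists>x\<in>car X. P x \<and> (xs, Bs) \<in> cod X x)"
proof
  let ?Y = "({x \<in> car X. P x}, cod X)"
  note A = arityD[OF assms]
  {
    assume "dp X P"
    then have "definable (cod ?Y ` car ?Y)" by (simp add: dp_def)
    moreover have "inj_on (cod ?Y) (car ?Y)"
      using arity_inj[OF assms] by (auto simp: inj_on_def)
    ultimately obtain a' b' where Y: "arity ?Y a' b'" using definable_imp_arity by blast
    show "hdp a b (\<lambda>xs Bs. \<exists>x\<in>car X. P x \<and> (xs, Bs) \<in> cod X x)"
    \<comment> \<open>A non-empty subset shares a tuple with \<open>X\<close> and so has arity (a,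
      b). The empty subset does not determine an arity and is treated apart.\<close>
    proof (cases "\<exists>x\<in>car X. P x")
      case True
      then obtain x where x: "x \<in> car X" "P x" by blast
      then obtain t where t: "t \<in> cod X x" using A(1) by blast
      have "a = a' \<and> b = b'"
        using A(3)[OF x(1), of "fst t" "snd t"] arityD(3)[OF Y, of x "fst t" "snd t"] x t by auto
      then have "hdp a b (\<lambda>xs Bs. \<exists>x\<in>car ?Y. (xs, Bs) \<in> cod ?Y x)" using arityD(4)[OF Y] by simp
      then show ?thesis by (rule hdp_eqI) auto
    next
      case False
      then have "(\<lambda>xs Bs. \<exists>x\<in>car X. P x \<and> (xs, Bs) \<in> cod X x) = (\<lambda>xs Bs. False)" by blast
      then show ?thesis using hdp_False by simp
    qed
  }
  assume H: "hdp a b (\<lambda>xs Bs. \<exists>x\<in>car X. P x \<and> (xs, Bs) \<in> cod X x)"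
  have "hdp (a + a) (b + b) (\<lambda>xs Bs. (\<exists>x\<in>car X. (take a xs, take b Bs) \<in> cod X x \<and> (drop a xs, drop b Bs) \<in> cod X x)
     \<and> (\<exists>x\<in>car X. P x \<and> (take a (drop 0 xs), take b (drop 0 Bs)) \<in> cod X x))"
    by (rule hdp_conj[OF A(5) hdp_slice[OF H]]) simp_all
  then have "hdp (a + a) (b + b) (\<lambda>xs Bs. \<exists>x\<in>car ?Y. (take a xs, take b Bs) \<in> cod ?Y x \<and> (drop a xs, drop b Bs) \<in> cod ?Y x)"
    by (rule hdp_eqI) (simp, metis A(2))
  moreover have "hdp a b (\<lambda>xs Bs. \<exists>x\<in>car ?Y. (xs, Bs) \<in> cod ?Y x)"
    using H by (rule hdp_eqI) auto
  moreover have "\<forall>x\<in>car ?Y. cod ?Y x \<noteq> {}" using A(1) by simp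
  moreover have "\<forall>x\<in>car ?Y. \<forall>y\<in>car ?Y. \<forall>t. t \<in> cod ?Y x \<longrightarrow> t \<in> cod ?Y y \<longrightarrow> x = y"
    using assms unfolding arity_def by simp
  moreover have "\<forall>x\<in>car ?Y. \<forall>t\<in>cod ?Y x. length (fst t) = a \<and> length (snd t) = b"
    using assms unfolding arity_def car_pair cod_pair by blast
  ultimately have "arity ?Y a b"
    unfolding arity_def by (intro conjI)
  from arity_imp_definable[OF this] have "definable (cod X ` {x \<in> car X. P x})" by simp
  moreover have "cset X" unfolding cset_iff_arity using assms by blast
  ultimately show "dp X P" unfolding dp_def by simp
qed

section \<open>Boolean operations, products and quantifiers\<close>

lemma dp_cong: "(\<And>x. x \<in> car X \<Longrightarrow> P x \<longleftrightarrow> Q x) \<Longrightarrow> dp X P \<longleftrightarrow> dp X Q"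
  unfolding dp_def by (metis (mono_tags, lifting) Collect_cong)

lemma dp_congI: "dp X Q \<Longrightarrow> (\<And>x. x \<in> car X \<Longrightarrow> P x \<longleftrightarrow> Q x) \<Longrightarrow> dp X P"
  using dp_cong by metis

lemma dp_cset: "dp X P \<Longrightarrow> cset X"
  by (simp add: dp_def)

lemma df_cset: "df X Y f \<Longrightarrow> cset X" "df X Y f \<Longrightarrow> cset Y"
  by (simp_all add: df_def)

lemma df_mem: "df X Y f \<Longrightarrow> x \<in> car X \<Longrightarrow> f x \<in> car Y"
  by (auto simp: df_def)

lemma df_cong: "df X Y g \<Longrightarrow> (\<And>x. x \<in> car X \<Longrightarrow> f x = g x) \<Longrightarrow> df X Y f"
  unfolding df_def by (auto elim: dp_congI simp: image_subset_iff)

lemma dp_const: "cset X \<Longrightarrow> dp X (\<lambda>_. P)"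
proof -
  assume X: "cset X"
  then obtain a b where A: "arity X a b" using cset_iff_arity by blast
  show ?thesis
    by (cases P) (use arityD(4)[OF A] hdp_False in \<open>simp_all add: dp_iff_hdp[OF A]\<close>)
qed

lemma dp_not: "dp X P \<Longrightarrow> dp X (\<lambda>x. \<not> P x)"
proof -
  assume P: "dp X P"
  obtain a b where A: "arity X a b" using dp_cset[OF P] cset_iff_arity by blast
  note H = P[unfolded dp_iff_hdp[OF A]]
  have "hdp a b (\<lambda>xs Bs. (\<exists>x\<in>car X. (xs, Bs) \<in> cod X x) \<and> \<not> (\<exists>x\<in>car X. P x \<and> (xs, Bs) \<in> cod X x))"
    by (rule hdp_conj[OF arityD(4)[OF A] hdp_not[OF H]])
  then show ?thesis unfolding dp_iff_hdp[OF A]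
    by (rule hdp_eqI) (metis arityD(2)[OF A])
qed

lemma dp_conj: "dp X P \<Longrightarrow> dp X Q \<Longrightarrow> dp X (\<lambda>x. P x \<and> Q x)"
proof -
  assume P: "dp X P" and Q: "dp X Q"
  obtain a b where A: "arity X a b" using dp_cset[OF P] cset_iff_arity by blast
  have "hdp a b (\<lambda>xs Bs. (\<exists>x\<in>car X. P x \<and> (xs, Bs) \<in> cod X x) \<and> (\<exists>x\<in>car X. Q x \<and> (xs, Bs) \<in> cod X x))"
    by (rule hdp_conj[OF P[unfolded dp_iff_hdp[OF A]] Q[unfolded dp_iff_hdp[OF A]]])
  then show ?thesis unfolding dp_iff_hdp[OF A]
    by (rule hdp_eqI) (metis arityD(2)[OF A])
qed

lemma dp_disj: "dp X P \<Longrightarrow> dp X Q \<Longrightarrow> dp X (\<lambda>x. P x \<or> Q x)"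
  using dp_not[OF dp_conj[OF dp_not dp_not]] by simp

lemma dp_imp: "dp X P \<Longrightarrow> dp X Q \<Longrightarrow> dp X (\<lambda>x. P x \<longrightarrow> Q x)"
  using dp_not[OF dp_conj[OF _ dp_not]] by simp

lemma dp_iff: "dp X P \<Longrightarrow> dp X Q \<Longrightarrow> dp X (\<lambda>x. P x \<longleftrightarrow> Q x)"
  using dp_conj[OF dp_imp dp_imp, of X P Q Q P] by (simp add: iff_conv_conj_imp)

lemma arity_cprod_mem:
  assumes "arity X a b" "x \<in> car X"
  shows "(xs, Bs) \<in> cod (X \<times>\<^sub>c Y) (x, y) \<longleftrightarrow> (take a xs, take b Bs) \<in> cod X x \<and> (drop a xs, drop b Bs) \<in> cod Y y"
  unfolding cod_cprod by (rule mem_pr) (metis arityD(3)[OF assms(1)] assms(2) prod.collapse)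

lemma arity_cprod:
  assumes X: "arity X a b" and Y: "arity Y a' b'"
  shows "arity (X \<times>\<^sub>c Y) (a + a') (b + b')"
  unfolding arity_def
proof (intro conjI ballI allI impI)
  note A = arityD[OF X] and B = arityD[OF Y]
  note mem = arity_cprod_mem[OF X, where Y = Y]
  fix z assume "z \<in> car (X \<times>\<^sub>c Y)"
  then obtain x y where z: "z = (x, y)" "x \<in> car X" "y \<in> car Y" by auto
  show "cod (X \<times>\<^sub>c Y) z \<noteq> {}"
    using A(1)[OF z(2)] B(1)[OF z(3)] unfolding z(1) cod_cprod pr_def by blast
  fix z' t assume "z' \<in> car (X \<times>\<^sub>c Y)" and t: "t \<in> cod (X \<times>\<^sub>c Y) z" "t \<in> cod (X \<times>\<^sub>c Y) z'"
  then obtain x' y' where z': "z' = (x', y')" "x' \<in> car X" "y' \<in> car Y" by auto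
  show "z = z'" using t A(2) B(2) z z'
    by (metis mem prod.collapse)
next
  note A = arityD[OF X] and B = arityD[OF Y]
  note mem = arity_cprod_mem[OF X, where Y = Y]
  fix z t assume "z \<in> car (X \<times>\<^sub>c Y)" and t: "t \<in> cod (X \<times>\<^sub>c Y) z"
  then obtain x y where z: "z = (x, y)" "x \<in> car X" "y \<in> car Y" by auto
  have "(take a (fst t), take b (snd t)) \<in> cod X x \<and> (drop a (fst t), drop b (snd t)) \<in> cod Y y"
    using t mem[OF z(2), of "fst t" "snd t" y] unfolding z(1) by simp
  then have "length (take a (fst t)) = a" "length (drop a (fst t)) = a'"
     "length (take b (snd t)) = b" "length (drop b (snd t)) = b'"
    using A(3)[OF z(2)] B(3)[OF z(3)] by blast+
  moreover have "length (fst t) = length (take a (fst t)) + length (drop a (fst t))"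
    "length (snd t) = length (take b (snd t)) + length (drop b (snd t))" by (simp_all add: min_def)
  ultimately show "length (fst t) = a + a'" "length (snd t) = b + b'" by linarith+
next
  note A = arityD[OF X] and B = arityD[OF Y]
  note mem = arity_cprod_mem[OF X, where Y = Y]
  have "hdp (a + a') (b + b') (\<lambda>xs Bs. (\<exists>x\<in>car X. (take a (drop 0 xs), take b (drop 0 Bs)) \<in> cod X x) \<and>
       (\<exists>y\<in>car Y. (take a' (drop a xs), take b' (drop b Bs)) \<in> cod Y y))"
    by (rule hdp_conj[OF hdp_slice[OF A(4)] hdp_slice[OF B(4)]]) simp_all
  then show "hdp (a + a') (b + b') (\<lambda>xs Bs. \<exists>z\<in>car (X \<times>\<^sub>c Y). (xs, Bs) \<in> cod (X \<times>\<^sub>c Y) z)"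
    by (rule hdp_eqI) (simp del: cod_cprod add: mem; blast)
  have "hdp (a + a' + (a + a')) (b + b' + (b + b'))
     (\<lambda>xs Bs. (\<exists>x\<in>car X. (take a (take a (drop 0 xs) @ take a (drop (a + a') xs)), take b (take b (drop 0 Bs) @ take b (drop (b + b') Bs))) \<in> cod X x
               \<and> (drop a (take a (drop 0 xs) @ take a (drop (a + a') xs)), drop b (take b (drop 0 Bs) @ take b (drop (b + b') Bs))) \<in> cod X x)
           \<and> (\<exists>y\<in>car Y. (take a' (take a' (drop a xs) @ take a' (drop (a + a' + a) xs)), take b' (take b' (drop b Bs) @ take b' (drop (b + b' + b) Bs))) \<in> cod Y y
               \<and> (drop a' (take a' (drop a xs) @ take a' (drop (a + a' + a) xs)), drop b' (take b' (drop b Bs) @ take b' (drop (b + b' + b) Bs))) \<in> cod Y y))"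
    by (rule hdp_conj[OF hdp_slice2[OF A(5)] hdp_slice2[OF B(5)]]) simp_all
  then show "hdp (a + a' + (a + a')) (b + b' + (b + b')) (\<lambda>xs Bs. \<exists>z\<in>car (X \<times>\<^sub>c Y).
      (take (a + a') xs, take (b + b') Bs) \<in> cod (X \<times>\<^sub>c Y) z \<and> (drop (a + a') xs, drop (b + b') Bs) \<in> cod (X \<times>\<^sub>c Y) z)"
  proof (rule hdp_eqI)
    fix xs :: "'k list" and Bs :: "'f list"
    assume L: "length xs = a + a' + (a + a')" "length Bs = b + b' + (b + b')"
    have e: "take a (take a (drop 0 xs) @ take a (drop (a + a') xs)) = take a (take (a + a') xs)"
      "drop a (take a (drop 0 xs) @ take a (drop (a + a') xs)) = take a (drop (a + a') xs)"
      "take b (take b (drop 0 Bs) @ take b (drop (b + b') Bs)) = take b (take (b + b') Bs)"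
      "drop b (take b (drop 0 Bs) @ take b (drop (b + b') Bs)) = take b (drop (b + b') Bs)"
      "take a' (take a' (drop a xs) @ take a' (drop (a + a' + a) xs)) = drop a (take (a + a') xs)"
      "drop a' (take a' (drop a xs) @ take a' (drop (a + a' + a) xs)) = drop a (drop (a + a') xs)"
      "take b' (take b' (drop b Bs) @ take b' (drop (b + b' + b) Bs)) = drop b (take (b + b') Bs)"
      "drop b' (take b' (drop b Bs) @ take b' (drop (b + b' + b) Bs)) = drop b (drop (b + b') Bs)"
      using L by (simp_all add: min_def drop_take ac_simps)
    show "(\<exists>z\<in>car (X \<times>\<^sub>c Y). (take (a + a') xs, take (b + b') Bs) \<in> cod (X \<times>\<^sub>c Y) z \<and> (drop (a + a') xs, drop (b + b') Bs) \<in> cod (X \<times>\<^sub>c Y) z)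
       \<longleftrightarrow> (((\<exists>x\<in>car X. (take a (take a (drop 0 xs) @ take a (drop (a + a') xs)), take b (take b (drop 0 Bs) @ take b (drop (b + b') Bs))) \<in> cod X x
               \<and> (drop a (take a (drop 0 xs) @ take a (drop (a + a') xs)), drop b (take b (drop 0 Bs) @ take b (drop (b + b') Bs))) \<in> cod X x)
           \<and> (\<exists>y\<in>car Y. (take a' (take a' (drop a xs) @ take a' (drop (a + a' + a) xs)), take b' (take b' (drop b Bs) @ take b' (drop (b + b' + b) Bs))) \<in> cod Y y
               \<and> (drop a' (take a' (drop a xs) @ take a' (drop (a + a' + a) xs)), drop b' (take b' (drop b Bs) @ take b' (drop (b + b' + b) Bs))) \<in> cod Y y)))"
      unfolding e car_cprod by (simp del: cod_cprod add: mem; blast)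
  qed
qed

lemma dp_cprod_iff_hdp:
  assumes X: "arity X a b" and Y: "arity Y a' b'"
  shows "dp (X \<times>\<^sub>c Y) P \<longleftrightarrow> hdp (a + a') (b + b') (\<lambda>xs Bs. \<exists>x\<in>car X. \<exists>y\<in>car Y. P (x, y) \<and>
     (take a xs, take b Bs) \<in> cod X x \<and> (drop a xs, drop b Bs) \<in> cod Y y)"
  unfolding dp_iff_hdp[OF arity_cprod[OF X Y]]
  by (rule hdp_cong) (simp del: cod_cprod add: arity_cprod_mem[OF X]; blast)

lemma cset_cprod [simp]: "cset X \<Longrightarrow> cset Y \<Longrightarrow> cset (X \<times>\<^sub>c Y)"
  using arity_cprod cset_iff_arity by metis

text \<open>A quantifier over imaginaries becomes a block of quantifiers over representing tuples:
  every element has a representative, and each representative belongs to one element.\<close>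

lemma dp_bex:
  assumes "cset X" "cset Y" and P: "dp (X \<times>\<^sub>c Y) (\<lambda>z. P (fst z) (snd z))"
  shows "dp X (\<lambda>x. \<exists>y\<in>car Y. P x y)"
proof -
  obtain a b a' b' where X: "arity X a b" and Y: "arity Y a' b'" using assms cset_iff_arity by metis
  note A = arityD[OF X] and B = arityD[OF Y]
  show ?thesis unfolding dp_iff_hdp[OF X]
  proof (rule hdp_eqI[OF hdp_exs[OF P[unfolded dp_cprod_iff_hdp[OF X Y]]]])
    fix xs :: "'k list" and Bs :: "'f list" assume L: "length xs = a" "length Bs = b"
    have "\<exists>ys Cs. (ys, Cs) \<in> cod Y y \<and> length ys = a' \<and> length Cs = b'" if "y \<in> car Y" for y
      using B(1)[OF that] B(3)[OF that] by fastforce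
    then show "(\<exists>x\<in>car X. (\<exists>y\<in>car Y. P x y) \<and> (xs, Bs) \<in> cod X x)
      \<longleftrightarrow> (\<exists>ys Cs. length ys = a' \<and> length Cs = b' \<and> (\<exists>x\<in>car X. \<exists>y\<in>car Y. P (fst (x, y)) (snd (x, y)) \<and>
         (take a (xs @ ys), take b (Bs @ Cs)) \<in> cod X x \<and> (drop a (xs @ ys), drop b (Bs @ Cs)) \<in> cod Y y))"
      using L by simp blast
  qed
qed

lemma dp_ball:
  assumes "cset X" "cset Y" and P: "dp (X \<times>\<^sub>c Y) (\<lambda>z. P (fst z) (snd z))"
  shows "dp X (\<lambda>x. \<forall>y\<in>car Y. P x y)"
  using dp_not[OF dp_bex[OF assms(1,2) dp_not[OF P]]] by simp

lemma dp_weak1: "dp X P \<Longrightarrow> cset Y \<Longrightarrow> dp (X \<times>\<^sub>c Y) (\<lambda>z. P (fst z))"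
proof -
  assume P: "dp X P" and cY: "cset Y"
  then obtain a b a' b' where X: "arity X a b" and Y: "arity Y a' b'" using dp_cset cset_iff_arity by metis
  have "hdp (a + a') (b + b') (\<lambda>xs Bs. (\<exists>x\<in>car X. P x \<and> (take a (drop 0 xs), take b (drop 0 Bs)) \<in> cod X x) \<and>
       (\<exists>y\<in>car Y. (take a' (drop a xs), take b' (drop b Bs)) \<in> cod Y y))"
    by (rule hdp_conj[OF hdp_slice[OF P[unfolded dp_iff_hdp[OF X]]] hdp_slice[OF arityD(4)[OF Y]]]) simp_all
  then show ?thesis unfolding dp_cprod_iff_hdp[OF X Y]
    by (rule hdp_eqI) (simp; blast)
qed

lemma dp_weak2: "dp Y P \<Longrightarrow> cset X \<Longrightarrow> dp (X \<times>\<^sub>c Y) (\<lambda>z. P (snd z))"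
proof -
  assume P: "dp Y P" and cX: "cset X"
  then obtain a b a' b' where X: "arity X a b" and Y: "arity Y a' b'" using dp_cset cset_iff_arity by metis
  have "hdp (a + a') (b + b') (\<lambda>xs Bs. (\<exists>x\<in>car X. (take a (drop 0 xs), take b (drop 0 Bs)) \<in> cod X x) \<and>
       (\<exists>y\<in>car Y. P y \<and> (take a' (drop a xs), take b' (drop b Bs)) \<in> cod Y y))"
    by (rule hdp_conj[OF hdp_slice[OF arityD(4)[OF X]] hdp_slice[OF P[unfolded dp_iff_hdp[OF Y]]]]) simp_all
  then show ?thesis unfolding dp_cprod_iff_hdp[OF X Y]
    by (rule hdp_eqI) (simp; blast)
qed

lemma dp_swap:
  assumes P: "dp (X \<times>\<^sub>c Y) (\<lambda>z. P (fst z) (snd z))" and "cset X" "cset Y"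
  shows "dp (Y \<times>\<^sub>c X) (\<lambda>z. P (snd z) (fst z))"
proof -
  obtain a b a' b' where X: "arity X a b" and Y: "arity Y a' b'" using assms cset_iff_arity by metis
  show ?thesis unfolding dp_cprod_iff_hdp[OF Y X]
    by (rule hdp_eqI[OF hdp_slice2[OF P[unfolded dp_cprod_iff_hdp[OF X Y]], where ?p1.0 = a' and ?q1.0 = b' and ?p2.0 = 0 and ?q2.0 = 0]])
      (simp_all, blast)
qed

lemma dp_assoc:
  "dp ((X \<times>\<^sub>c Y) \<times>\<^sub>c Z) P \<longleftrightarrow>
     cset ((X \<times>\<^sub>c Y) \<times>\<^sub>c Z) \<and> definable (cod (X \<times>\<^sub>c (Y \<times>\<^sub>c Z)) ` {z \<in> car (X \<times>\<^sub>c (Y \<times>\<^sub>c Z)). P ((fst z, fst (snd z)), snd (snd z))})"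
proof -
  have "cod ((X \<times>\<^sub>c Y) \<times>\<^sub>c Z) ` {z \<in> car ((X \<times>\<^sub>c Y) \<times>\<^sub>c Z). P z} =
    cod (X \<times>\<^sub>c (Y \<times>\<^sub>c Z)) ` {z \<in> car (X \<times>\<^sub>c (Y \<times>\<^sub>c Z)). P ((fst z, fst (snd z)), snd (snd z))}"
    by (auto simp: pr_assoc image_iff) (force simp: pr_assoc)+
  then show ?thesis unfolding dp_def by simp
qed

lemma dp_assocI:
  assumes "cset X" "cset Y" "cset Z"
  shows "dp (X \<times>\<^sub>c (Y \<times>\<^sub>c Z)) (\<lambda>z. P (fst z) (fst (snd z)) (snd (snd z))) \<Longrightarrow> dp ((X \<times>\<^sub>c Y) \<times>\<^sub>c Z) (\<lambda>z. P (fst (fst z)) (snd (fst z)) (snd z))"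
    and "dp ((X \<times>\<^sub>c Y) \<times>\<^sub>c Z) (\<lambda>z. P (fst (fst z)) (snd (fst z)) (snd z)) \<Longrightarrow> dp (X \<times>\<^sub>c (Y \<times>\<^sub>c Z)) (\<lambda>z. P (fst z) (fst (snd z)) (snd (snd z)))"
  using dp_assoc[of X Y Z "\<lambda>z. P (fst (fst z)) (snd (fst z)) (snd z)"] assms
  by (auto simp: dp_def cset_cprod)

text \<open>Composition, projection and pairing of maps all involve a condition on the two outer
  components of a triple.\<close>

lemma dp_13:
  assumes P: "dp (X \<times>\<^sub>c Z) (\<lambda>z. P (fst z) (snd z))" and "cset X" "cset Y" "cset Z"
  shows "dp (X \<times>\<^sub>c (Y \<times>\<^sub>c Z)) (\<lambda>z. P (fst z) (snd (snd z)))"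
proof -
  obtain a b a' b' a'' b'' where X: "arity X a b" and Y: "arity Y a' b'" and Z: "arity Z a'' b''"
    using assms cset_iff_arity by metis
  have H: "hdp (a + (a' + a'')) (b + (b' + b''))
     (\<lambda>xs Bs. (\<exists>x\<in>car X. \<exists>y\<in>car Z. P (fst (x, y)) (snd (x, y)) \<and> (take a (take a (drop 0 xs) @ take a'' (drop (a + a') xs)), take b (take b (drop 0 Bs) @ take b'' (drop (b + b') Bs))) \<in> cod X x
               \<and> (drop a (take a (drop 0 xs) @ take a'' (drop (a + a') xs)), drop b (take b (drop 0 Bs) @ take b'' (drop (b + b') Bs))) \<in> cod Z y)
           \<and> (\<exists>y\<in>car Y. (take a' (drop a xs), take b' (drop b Bs)) \<in> cod Y y))"
    by (rule hdp_conj[OF hdp_slice2[OF P[unfolded dp_cprod_iff_hdp[OF X Z]]] hdp_slice[OF arityD(4)[OF Y]]]) simp_all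
  show ?thesis unfolding dp_cprod_iff_hdp[OF X arity_cprod[OF Y Z]]
    by (rule hdp_eqI[OF H], simp del: cod_cprod add: arity_cprod_mem[OF Y] take_drop ac_simps)
      (simp add: take_drop[symmetric] add.commute, blast)
qed

lemma dp_eq_diag: "cset X \<Longrightarrow> dp (X \<times>\<^sub>c X) (\<lambda>z. fst z = snd z)"
proof -
  assume "cset X"
  then obtain a b where X: "arity X a b" using cset_iff_arity by metis
  show ?thesis unfolding dp_cprod_iff_hdp[OF X X]
    by (rule hdp_eqI[OF arityD(5)[OF X]]) auto
qed

end

section \<open>Definable maps and their closure properties\<close>

named_theorems dfn "rules for the definability of predicates and maps"

context kfield
begin

lemma df_cprod_dp: "df X Y f \<Longrightarrow> dp (X \<times>\<^sub>c Y) (\<lambda>z. snd z = f (fst z))"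
  by (simp add: df_def)

lemma dp_comp:
  assumes P: "dp Y P" and f: "df X Y f"
  shows "dp X (\<lambda>x. P (f x))"
proof -
  have "dp X (\<lambda>x. \<exists>y\<in>car Y. y = f x \<and> P y)"
    by (intro dp_bex dp_conj df_cprod_dp[OF f] dp_weak2[OF P] df_cset[OF f])
  then show ?thesis by (rule dp_congI) (use df_mem[OF f] in blast)
qed

lemma df_id: "cset X \<Longrightarrow> df X X (\<lambda>x. x)"
  unfolding df_def by (auto intro: dp_congI[OF dp_eq_diag])

lemma df_comp:
  assumes g: "df Y Z g" and f: "df X Y f"
  shows "df X Z (\<lambda>x. g (f x))"
proof -
  note c = df_cset[OF f] df_cset(2)[OF g]
  have 1: "dp ((X \<times>\<^sub>c Z) \<times>\<^sub>c Y) (\<lambda>z. snd z = f (fst (fst z)))"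
    by (rule dp_assocI(1)[where P = "\<lambda>x z y. y = f x"], (rule c)+, rule dp_13[where P = "\<lambda>x y. y = f x"])
      (rule df_cprod_dp[OF f] c)+
  have 2: "dp ((X \<times>\<^sub>c Z) \<times>\<^sub>c Y) (\<lambda>z. snd (fst z) = g (snd z))"
    by (rule dp_assocI(1)[where P = "\<lambda>x z y. z = g y"], (rule c)+,
        rule dp_weak2[where P = "\<lambda>z. fst z = g (snd z)"],
        rule dp_swap[where P = "\<lambda>y z. z = g y"]) (rule df_cprod_dp[OF g] c)+
  have "dp (X \<times>\<^sub>c Z) (\<lambda>z. \<exists>y\<in>car Y. y = f (fst z) \<and> snd z = g y)"
    by (rule dp_bex) (intro cset_cprod c dp_conj 1 2)+
  then have "dp (X \<times>\<^sub>c Z) (\<lambda>z. snd z = g (f (fst z)))"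
    by (rule dp_congI) (use df_mem[OF f] in auto)
  then show ?thesis
    unfolding df_def using c df_mem[OF f] df_mem[OF g] by auto
qed

lemma df_fst: assumes "df W (X \<times>\<^sub>c Y) f" "cset X" "cset Y" shows "df W X (\<lambda>w. fst (f w))"
proof -
  have "dp ((X \<times>\<^sub>c Y) \<times>\<^sub>c X) (\<lambda>z. snd z = fst (fst z))"
    by (rule dp_assocI(1)[where P = "\<lambda>x y x'. x' = x"], (rule assms)+, rule dp_13[where P = "\<lambda>x x'. x' = x"])
      (rule dp_congI[OF dp_eq_diag] assms | auto)+
  then have "df (X \<times>\<^sub>c Y) X fst"
    unfolding df_def using assms by auto
  from df_comp[OF this assms(1)] show ?thesis .
qed

lemma df_snd: assumes "df W (X \<times>\<^sub>c Y) f" "cset X" "cset Y" shows "df W Y (\<lambda>w. snd (f w))"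
proof -
  have "dp ((X \<times>\<^sub>c Y) \<times>\<^sub>c Y) (\<lambda>z. snd z = snd (fst z))"
    by (rule dp_assocI(1)[where P = "\<lambda>x y y'. y' = y"], (rule assms)+, rule dp_weak2[where P = "\<lambda>z. snd z = fst z"])
      (rule dp_congI[OF dp_eq_diag] assms | auto)+
  then have "df (X \<times>\<^sub>c Y) Y snd"
    unfolding df_def using assms by auto
  from df_comp[OF this assms(1)] show ?thesis .
qed

lemma df_Pair:
  assumes f: "df X Y f" and g: "df X Z g"
  shows "df X (Y \<times>\<^sub>c Z) (\<lambda>x. (f x, g x))"
proof -
  note c = df_cset[OF f] df_cset[OF g]
  have 1: "dp (X \<times>\<^sub>c (Y \<times>\<^sub>c Z)) (\<lambda>z. fst (snd z) = f (fst z))"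
    by (rule dp_assocI(2)[where P = "\<lambda>x y z. y = f x"], (rule c)+,
        rule dp_weak1[where P = "\<lambda>z. snd z = f (fst z)"]) (rule df_cprod_dp[OF f] c)+
  have 2: "dp (X \<times>\<^sub>c (Y \<times>\<^sub>c Z)) (\<lambda>z. snd (snd z) = g (fst z))"
    by (rule dp_13[where P = "\<lambda>x z. z = g x"]) (rule df_cprod_dp[OF g] c)+
  have "dp (X \<times>\<^sub>c (Y \<times>\<^sub>c Z)) (\<lambda>z. snd z = (f (fst z), g (fst z)))"
    by (rule dp_congI[OF dp_conj[OF 1 2]]) auto
  then show ?thesis unfolding df_def using c df_mem[OF f] df_mem[OF g] by auto
qed

text \<open>A tuple representing \<open>c\<close> enters the formula for equality of classes as a
  list of parameters.\<close>

lemma dp_singleton: assumes "cset Y" "c \<in> car Y" shows "dp Y (\<lambda>y. y = c)"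
proof -
  obtain a b where Y: "arity Y a b" using assms cset_iff_arity by metis
  note A = arityD[OF Y]
  obtain t0 where "t0 \<in> cod Y c" using A(1)[OF assms(2)] by blast
  then obtain ps Cs where t: "(ps, Cs) \<in> cod Y c" by (cases t0) simp
  have len: "length ps = a" "length Cs = b" using A(3)[OF assms(2) t] by blast+
  show ?thesis unfolding dp_iff_hdp[OF Y]
  proof (rule hdp_eqI[OF hdp_param[OF A(5) len]])
    fix xs :: "'k list" and Bs :: "'f list" assume L: "length xs = a" "length Bs = b"
    have "(\<exists>x\<in>car Y. x = c \<and> (xs, Bs) \<in> cod Y x) \<longleftrightarrow> (\<exists>x\<in>car Y. (xs, Bs) \<in> cod Y x \<and> (ps, Cs) \<in> cod Y x)"
      using assms(2) t A(2)[OF _ assms(2) _ t] by metis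
    then show "(\<exists>x\<in>car Y. x = c \<and> (xs, Bs) \<in> cod Y x) \<longleftrightarrow>
       (\<exists>x\<in>car Y. (take a (xs @ ps), take b (Bs @ Cs)) \<in> cod Y x \<and> (drop a (xs @ ps), drop b (Bs @ Cs)) \<in> cod Y x)"
      using L by simp
  qed
qed

lemma df_const: assumes "cset X" "cset Y" "c \<in> car Y" shows "df X Y (\<lambda>_. c)"
proof -
  have "dp (X \<times>\<^sub>c Y) (\<lambda>z. snd z = c)"
    using dp_weak2[OF dp_singleton[OF assms(2,3)] assms(1)] .
  then show ?thesis unfolding df_def using assms by auto
qed

lemma dp_eq:
  assumes "df X Y f" "df X Y g" shows "dp X (\<lambda>x. f x = g x)"
  using dp_comp[OF dp_eq_diag df_Pair[OF assms]] df_cset[OF assms(1)] by simp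

lemma df_If:
  assumes P: "dp X P" and f: "df X Y f" and g: "df X Y g"
  shows "df X Y (\<lambda>x. if P x then f x else g x)"
proof -
  note c = df_cset[OF f]
  have "dp (X \<times>\<^sub>c Y) (\<lambda>z. (P (fst z) \<and> snd z = f (fst z)) \<or> (\<not> P (fst z) \<and> snd z = g (fst z)))"
    by (intro dp_disj dp_conj dp_not dp_weak1[OF P] c df_cprod_dp[OF f] df_cprod_dp[OF g])
  then have "dp (X \<times>\<^sub>c Y) (\<lambda>z. snd z = (if P (fst z) then f (fst z) else g (fst z)))"
    by (rule dp_congI) auto
  then show ?thesis unfolding df_def using c df_mem[OF f] df_mem[OF g] by auto
qed

lemma df_graphI:
  assumes "cset X" "cset Y" "dp (X \<times>\<^sub>c Y) (\<lambda>z. R (fst z) (snd z))"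
    and "\<And>x. x \<in> car X \<Longrightarrow> f x \<in> car Y"
    and "\<And>x y. x \<in> car X \<Longrightarrow> y \<in> car Y \<Longrightarrow> y = f x \<longleftrightarrow> R x y"
  shows "df X Y f"
proof -
  have "dp (X \<times>\<^sub>c Y) (\<lambda>z. snd z = f (fst z))"
    by (rule dp_congI[OF assms(3)]) (use assms(5) in auto)
  then show ?thesis unfolding df_def using assms by auto
qed

lemma definable_map_iff_df:
  assumes "cset (S, c)" "cset (T, d)" "g ` S \<subseteq> T"
  shows "definable_map c d S g \<longleftrightarrow> df (S, c) (T, d) g"
proof -
  have "cod ((S, c) \<times>\<^sub>c (T, d)) ` {z \<in> car ((S, c) \<times>\<^sub>c (T, d)). snd z = g (fst z)} = (\<lambda>x. pr (c x) (d (g x))) ` S"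
  proof -
    have "{z \<in> car ((S, c) \<times>\<^sub>c (T, d)). snd z = g (fst z)} = (\<lambda>x. (x, g x)) ` S"
      using assms(3) by auto
    then show ?thesis by (simp add: image_image)
  qed
  then show ?thesis
    unfolding definable_map_def df_def dp_def using assms by auto
qed

lemma df_comp2:
  assumes "df (A \<times>\<^sub>c B) C (\<lambda>z. h (fst z) (snd z))" "df X A f" "df X B g"
  shows "df X C (\<lambda>x. h (f x) (g x))"
  using df_comp[OF assms(1) df_Pair[OF assms(2,3)]] by simp

lemma df_comp3:
  assumes "df (A \<times>\<^sub>c (B \<times>\<^sub>c C)) D (\<lambda>z. h (fst z) (fst (snd z)) (snd (snd z)))" "df X A f" "df X B g" "df X C k"
  shows "df X D (\<lambda>x. h (f x) (g x) (k x))"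
  using df_comp[OF assms(1) df_Pair[OF assms(2) df_Pair[OF assms(3,4)]]] by simp

lemma dp_comp2:
  assumes "dp (A \<times>\<^sub>c B) (\<lambda>z. P (fst z) (snd z))" "df X A f" "df X B g"
  shows "dp X (\<lambda>x. P (f x) (g x))"
  using dp_comp[OF assms(1) df_Pair[OF assms(2,3)]] by simp

text \<open>Since \<open>f\<close> leaves codes unchanged, the codes of its graph are those of the
  diagonal of \<open>X\<close>. Inclusions and changes of presentation become definable in this
  way.\<close>

lemma df_recode:
  assumes "cset X" "cset Y" "\<And>x. x \<in> car X \<Longrightarrow> f x \<in> car Y \<and> cod Y (f x) = cod X x"
  shows "df X Y f"
proof -
  have "definable (cod (X \<times>\<^sub>c X) ` {z \<in> car (X \<times>\<^sub>c X). fst z = snd z})"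
    using dp_eq_diag[OF assms(1)] unfolding dp_def by simp
  moreover have "cod (X \<times>\<^sub>c X) ` {z \<in> car (X \<times>\<^sub>c X). fst z = snd z} = cod (X \<times>\<^sub>c Y) ` {z \<in> car (X \<times>\<^sub>c Y). snd z = f (fst z)}"
  proof -
    have "{z \<in> car (X \<times>\<^sub>c Y). snd z = f (fst z)} = (\<lambda>x. (x, f x)) ` car X"
      "{z \<in> car (X \<times>\<^sub>c X). fst z = snd z} = (\<lambda>x. (x, x)) ` car X"
      using assms(3) by auto
    then show ?thesis using assms(3) by (auto simp: image_image)
  qed
  ultimately show ?thesis unfolding df_def dp_def using assms by auto
qed

lemmas [dfn] = df_If df_Pair df_fst df_snd dp_iff dp_imp dp_disj dp_conj dp_not cset_cprod df_id dp_const

subsection \<open>Subsets and quotients\<close>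

lemma dp_sub_iff:
  assumes "dp X (\<lambda>x. x \<in> A)" "A \<subseteq> car X"
  shows "cset (A, cod X)" and "dp (A, cod X) P \<longleftrightarrow> dp X (\<lambda>x. x \<in> A \<and> P x)"
proof -
  have "{x \<in> car X. x \<in> A} = A" using assms by auto
  then show c: "cset (A, cod X)"
    using assms unfolding dp_def cset_def by (auto intro: inj_on_subset)
  have "{x \<in> car X. x \<in> A \<and> P x} = {x \<in> A. P x}" using assms by auto
  then show "dp (A, cod X) P \<longleftrightarrow> dp X (\<lambda>x. x \<in> A \<and> P x)"
    unfolding dp_def using c dp_cset[OF assms(1)] by simp
qed

lemma df_sub_incl:
  assumes "dp X (\<lambda>x. x \<in> A)" "A \<subseteq> car X"
  shows "df (A, cod X) X (\<lambda>x. x)"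
  by (rule df_recode) (use dp_sub_iff(1)[OF assms] assms(2) dp_cset[OF assms(1)] in auto)

lemma df_sub_dom:
  assumes "df X Y f" "dp X (\<lambda>x. x \<in> A)" "A \<subseteq> car X"
  shows "df (A, cod X) Y f"
  using df_comp[OF assms(1) df_sub_incl[OF assms(2,3)]] .

text \<open>The quotient of \<open>X\<close> by the kernel of \<open>h\<close>: a value is coded by
  the union of the classes in its fibre. Objects without codes of their own receive them as soon as
  equality of the values of \<open>h\<close> is definable.\<close>

definition img :: "('a, 'k, 'f) coded \<Rightarrow> ('a \<Rightarrow> 'b) \<Rightarrow> ('b, 'k, 'f) coded" where
  "img X h = (h ` car X, \<lambda>b. \<Union>{cod X x | x. x \<in> car X \<and> h x = b})"

lemma mem_img: "t \<in> cod (img X h) b \<longleftrightarrow> (\<exists>x\<in>car X. h x = b \<and> t \<in> cod X x)"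
  unfolding img_def cod_def by auto

lemma car_img: "car (img X h) = h ` car X"
  by (simp add: img_def)

lemma
  assumes h: "dp (X \<times>\<^sub>c X) (\<lambda>z. h (fst z) = h (snd z))" and X: "cset X"
  shows cset_img: "cset (img X h)" and df_img: "df X (img X h) h"
proof -
  obtain a b where Xa: "arity X a b" using X cset_iff_arity by metis
  note A = arityD[OF Xa]
  have B: "arity (img X h) a b"
    unfolding arity_def
  proof (intro conjI)
    show "\<forall>x\<in>car (img X h). cod (img X h) x \<noteq> {}"
    proof
      fix x assume "x \<in> car (img X h)"
      then obtain y where y: "y \<in> car X" "x = h y" by (auto simp: car_img)
      then obtain t where "t \<in> cod X y" using A(1) by fast
      then have "t \<in> cod (img X h) x" using y by (auto simp: mem_img)
      then show "cod (img X h) x \<noteq> {}" by auto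
    qed
    show "\<forall>x\<in>car (img X h). \<forall>y\<in>car (img X h). \<forall>t. t \<in> cod (img X h) x \<longrightarrow> t \<in> cod (img X h) y \<longrightarrow> x = y"
      unfolding mem_img by (metis A(2))
    show "\<forall>x\<in>car (img X h). \<forall>t\<in>cod (img X h) x. length (fst t) = a \<and> length (snd t) = b"
      unfolding mem_img Ball_def by (metis A(3) prod.collapse)
    show "hdp a b (\<lambda>xs Bs. \<exists>x\<in>car (img X h). (xs, Bs) \<in> cod (img X h) x)"
      using A(4) by (rule hdp_eqI) (auto simp: mem_img car_img)
    show "hdp (a + a) (b + b) (\<lambda>xs Bs. \<exists>x\<in>car (img X h). (take a xs, take b Bs) \<in> cod (img X h) x \<and> (drop a xs, drop b Bs) \<in> cod (img X h) x)"
      using h[unfolded dp_cprod_iff_hdp[OF Xa Xa]] by (rule hdp_eqI) (auto simp: mem_img car_img, metis+)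
  qed
  show c: "cset (img X h)" using B cset_iff_arity by metis
  have "dp (X \<times>\<^sub>c img X h) (\<lambda>z. snd z = h (fst z))"
    unfolding dp_cprod_iff_hdp[OF Xa B]
    using h[unfolded dp_cprod_iff_hdp[OF Xa Xa]] by (rule hdp_eqI) (auto simp: mem_img car_img, metis+)
  then show "df X (img X h) h"
    unfolding df_def using X c by (auto simp: car_img)
qed

subsection \<open>The home sorts\<close>

definition Kc :: "('k, 'k, 'f) coded" where "Kc = (UNIV, kel)"
definition Fc :: "('f, 'k, 'f) coded" where "Fc = (UNIV, fel)"

lemma car_Kc [simp]: "car Kc = UNIV" and car_Fc [simp]: "car Fc = UNIV"
  and cod_Kc [simp]: "cod Kc = kel" and cod_Fc [simp]: "cod Fc = fel"
  by (simp_all add: Kc_def Fc_def)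

lemma arity_Kc: "arity Kc 1 0"
  unfolding arity_def
proof (intro conjI)
  show "hdp (1 + 1) (0 + 0) (\<lambda>xs Bs. \<exists>x\<in>car Kc. (take 1 xs, take 0 Bs) \<in> cod Kc x \<and> (drop 1 xs, drop 0 Bs) \<in> cod Kc x)"
    by (rule hdp_fm[where \<phi> = "KEq (KVar 0) (KVar 1)"]) (auto simp: kel_def numeral_2_eq_2 length_Suc_conv)
  show "hdp 1 0 (\<lambda>xs Bs. \<exists>x\<in>car Kc. (xs, Bs) \<in> cod Kc x)"
    using hdp_True by (rule hdp_eqI) (auto simp: kel_def length_Suc_conv)
qed (auto simp: kel_def)

lemma arity_Fc: "arity Fc 0 1"
  unfolding arity_def
proof (intro conjI)
  show "hdp (0 + 0) (1 + 1) (\<lambda>xs Bs. \<exists>x\<in>car Fc. (take 0 xs, take 1 Bs) \<in> cod Fc x \<and> (drop 0 xs, drop 1 Bs) \<in> cod Fc x)"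
    by (rule hdp_fm[where \<phi> = "FEq (FVar 0) (FVar 1)"]) (auto simp: fel_def numeral_2_eq_2 length_Suc_conv)
  show "hdp 0 1 (\<lambda>xs Bs. \<exists>x\<in>car Fc. (xs, Bs) \<in> cod Fc x)"
    using hdp_True by (rule hdp_eqI) (auto simp: fel_def length_Suc_conv)
qed (auto simp: fel_def)

lemma cset_Kc [dfn]: "cset Kc" and cset_Fc [dfn]: "cset Fc"
  using arity_Kc arity_Fc cset_iff_arity by blast+

lemma dp_eq_K [dfn]: "df X Kc f \<Longrightarrow> df X Kc g \<Longrightarrow> dp X (\<lambda>x. f x = g x)"
  by (rule dp_eq)

lemma df_const_K [dfn]: "cset X \<Longrightarrow> df X Kc (\<lambda>_. c)" and df_const_F [dfn]: "cset X \<Longrightarrow> df X Fc (\<lambda>_. B)"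
  by (simp_all add: df_const cset_Kc cset_Fc)

lemma dp_ex_K [dfn]: "cset X \<Longrightarrow> dp (X \<times>\<^sub>c Kc) (\<lambda>z. P (fst z) (snd z)) \<Longrightarrow> dp X (\<lambda>x. \<exists>y. P x y)"
  and dp_all_K [dfn]: "cset X \<Longrightarrow> dp (X \<times>\<^sub>c Kc) (\<lambda>z. P (fst z) (snd z)) \<Longrightarrow> dp X (\<lambda>x. \<forall>y. P x y)"
  and dp_ex_F [dfn]: "cset X \<Longrightarrow> dp (X \<times>\<^sub>c Fc) (\<lambda>z. Q (fst z) (snd z)) \<Longrightarrow> dp X (\<lambda>x. \<exists>y. Q x y)"
  using dp_bex[OF _ cset_Kc, of X P] dp_ball[OF _ cset_Kc, of X P] dp_bex[OF _ cset_Fc, of X Q] by auto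

lemma dp_mem: "dp (Kc \<times>\<^sub>c Fc) (\<lambda>z. mem (fst z) (snd z))"
  unfolding dp_cprod_iff_hdp[OF arity_Kc arity_Fc]
  by (rule hdp_fm[where \<phi> = "Mem (KVar 0) (FVar 0)"]) (auto simp: kel_def fel_def length_Suc_conv)

lemma KK_plus: "df (Kc \<times>\<^sub>c Kc) Kc (\<lambda>z. fst z + snd z)"
proof (rule df_graphI[where R = "\<lambda>z y. y = fst z + snd z"])
  show "dp ((Kc \<times>\<^sub>c Kc) \<times>\<^sub>c Kc) (\<lambda>z. snd z = fst (fst z) + snd (fst z))"
    unfolding dp_cprod_iff_hdp[OF arity_cprod[OF arity_Kc arity_Kc] arity_Kc]
    by (rule hdp_fm[where \<phi> = "KEq (KVar 2) (KAdd (KVar 0) (KVar 1))"])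
      (auto simp: kel_def pr_def tcat_def length_Suc_conv numeral_2_eq_2)
qed (auto intro: cset_cprod cset_Kc)

lemma KK_times: "df (Kc \<times>\<^sub>c Kc) Kc (\<lambda>z. fst z * snd z)"
proof (rule df_graphI[where R = "\<lambda>z y. y = fst z * snd z"])
  show "dp ((Kc \<times>\<^sub>c Kc) \<times>\<^sub>c Kc) (\<lambda>z. snd z = fst (fst z) * snd (fst z))"
    unfolding dp_cprod_iff_hdp[OF arity_cprod[OF arity_Kc arity_Kc] arity_Kc]
    by (rule hdp_fm[where \<phi> = "KEq (KVar 2) (KMul (KVar 0) (KVar 1))"])
      (auto simp: kel_def pr_def tcat_def length_Suc_conv numeral_2_eq_2)
qed (auto intro: cset_cprod cset_Kc)

lemmas df_plus [dfn] = df_comp2[OF KK_plus] and df_times [dfn] = df_comp2[OF KK_times]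
  and dp_memI [dfn] = dp_comp2[OF dp_mem]

lemma df_minus [dfn]:
  assumes "df X Kc f" "df X Kc g" shows "df X Kc (\<lambda>x. f x - g x)"
proof (rule df_graphI[where R = "\<lambda>x y. y + g x = f x"])
  note [dfn] = df_comp[OF assms(1)] df_comp[OF assms(2)] df_cset[OF assms(1)]
  show "dp (X \<times>\<^sub>c Kc) (\<lambda>z. snd z + g (fst z) = f (fst z))" by (rule dfn)+
qed (auto simp: df_cset[OF assms(1)] eq_diff_eq)

lemma df_inverse [dfn]:
  assumes "df X Kc f" shows "df X Kc (\<lambda>x. inverse (f x))"
proof (rule df_graphI[where R = "\<lambda>x y. (f x = 0 \<and> y = 0) \<or> f x * y = 1"])
  note [dfn] = df_comp[OF assms(1)] df_cset[OF assms(1)]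
  show "dp (X \<times>\<^sub>c Kc) (\<lambda>z. (f (fst z) = 0 \<and> snd z = 0) \<or> f (fst z) * snd z = 1)"
    by (rule dfn)+
  fix x y show "y = inverse (f x) \<longleftrightarrow> (f x = 0 \<and> y = 0) \<or> f x * y = 1"
    using inverse_unique[of "f x" y] by (cases "f x = 0") auto
qed (auto simp: df_cset[OF assms(1)])

lemma df_divide [dfn]: "df X Kc f \<Longrightarrow> df X Kc g \<Longrightarrow> df X Kc (\<lambda>x. f x / g x)"
  unfolding divide_inverse by (rule df_times df_inverse | assumption)+

section \<open>Hyperfinite sets\<close>

definition hp :: "('a, 'k, 'f) coded \<Rightarrow> bool" where
  "hp X \<longleftrightarrow> cset X \<and> (\<exists>Y M. fin_power_set (cod X ` car X) Y M)"

text \<open>Hyperfinite subsets as sets of the objects themselves. The choice in \<open>FP\<close>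
  affects their codes only; that the sets do not depend on it follows from
  \<open>HFs_eqI\<close>.\<close>

definition HFs :: "('a, 'k, 'f) coded \<Rightarrow> 'a set set" where
  "HFs X = {S. S \<subseteq> car X \<and> cod X ` S \<in> HF (cod X ` car X)}"

definition Fin :: "('a, 'k, 'f) coded \<Rightarrow> ('a set, 'k, 'f) coded" where
  "Fin X = (HFs X, \<lambda>S. hcode (cod X ` car X) (cod X ` S))"

lemma car_Fin [simp]: "car (Fin X) = HFs X"
  by (simp add: Fin_def)

lemma hp_cset: "hp X \<Longrightarrow> cset X"
  by (simp add: hp_def)

lemma HFs_sub: "S \<in> HFs X \<Longrightarrow> S \<subseteq> car X"
  by (simp add: HFs_def)

lemma fin_power_setD:
  assumes "fin_power_set X Y M"
  shows "definable Y" "definable {pr x B | x B. x \<in> X \<and> B \<in> Y \<and> M x B}"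
    "\<And>B C. B \<in> Y \<Longrightarrow> C \<in> Y \<Longrightarrow> (\<forall>x\<in>X. M x B \<longleftrightarrow> M x C) \<Longrightarrow> B = C"
    "\<exists>Z\<in>Y. \<forall>x\<in>X. \<not> M x Z"
    "\<And>a. a \<in> X \<Longrightarrow> \<exists>B\<in>Y. \<forall>x\<in>X. M x B \<longleftrightarrow> x = a"
    "\<And>B C. B \<in> Y \<Longrightarrow> C \<in> Y \<Longrightarrow> \<exists>D\<in>Y. \<forall>x\<in>X. M x D \<longleftrightarrow> M x B \<or> M x C"
    "\<And>U. definable U \<Longrightarrow> U \<subseteq> Y \<Longrightarrow> (\<And>Z. Z \<in> Y \<Longrightarrow> (\<forall>x\<in>X. \<not> M x Z) \<Longrightarrow> Z \<in> U) \<Longrightarrow>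
       (\<And>B a C. B \<in> U \<Longrightarrow> a \<in> X \<Longrightarrow> C \<in> Y \<Longrightarrow> (\<forall>x\<in>X. M x C \<longleftrightarrow> M x B \<or> x = a) \<Longrightarrow> C \<in> U) \<Longrightarrow> U = Y"
proof -
  note A = assms[unfolded fin_power_set_def]
  from A show "definable Y" by (elim conjE)
  from A show "definable {pr x B | x B. x \<in> X \<and> B \<in> Y \<and> M x B}" by (elim conjE)
  from A show "\<exists>Z\<in>Y. \<forall>x\<in>X. \<not> M x Z" by (elim conjE)
  from A have 1: "\<forall>B\<in>Y. \<forall>C\<in>Y. B = C \<longleftrightarrow> (\<forall>x\<in>X. M x B \<longleftrightarrow> M x C)" by (elim conjE)
  from A have 2: "\<forall>a\<in>X. \<exists>B\<in>Y. \<forall>x\<in>X. M x B \<longleftrightarrow> x = a" by (elim conjE)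
  from A have 3: "\<forall>B\<in>Y. \<forall>C\<in>Y. \<exists>D\<in>Y. \<forall>x\<in>X. M x D \<longleftrightarrow> M x B \<or> M x C" by (elim conjE)
  from A have 4: "\<forall>U. definable U \<and> U \<subseteq> Y \<and>
          (\<forall>Z\<in>Y. (\<forall>x\<in>X. \<not> M x Z) \<longrightarrow> Z \<in> U) \<and>
          (\<forall>B\<in>U. \<forall>a\<in>X. \<forall>C\<in>Y. (\<forall>x\<in>X. M x C \<longleftrightarrow> M x B \<or> x = a) \<longrightarrow> C \<in> U)
        \<longrightarrow> U = Y" by (elim conjE)
  show "\<And>B C. B \<in> Y \<Longrightarrow> C \<in> Y \<Longrightarrow> (\<forall>x\<in>X. M x B \<longleftrightarrow> M x C) \<Longrightarrow> B = C" using 1 by blast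
  show "\<And>a. a \<in> X \<Longrightarrow> \<exists>B\<in>Y. \<forall>x\<in>X. M x B \<longleftrightarrow> x = a" using 2 by blast
  show "\<And>B C. B \<in> Y \<Longrightarrow> C \<in> Y \<Longrightarrow> \<exists>D\<in>Y. \<forall>x\<in>X. M x D \<longleftrightarrow> M x B \<or> M x C" using 3 by blast
  fix U
  assume U: "definable U" "U \<subseteq> Y" "\<And>Z. Z \<in> Y \<Longrightarrow> (\<forall>x\<in>X. \<not> M x Z) \<Longrightarrow> Z \<in> U"
    "\<And>B a C. B \<in> U \<Longrightarrow> a \<in> X \<Longrightarrow> C \<in> Y \<Longrightarrow> (\<forall>x\<in>X. M x C \<longleftrightarrow> M x B \<or> x = a) \<Longrightarrow> C \<in> U"
  show "U = Y" by (rule 4[rule_format]) (use U in simp)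
qed

text \<open>These are the clauses of \<open>fin_power_set\<close> for the pair chosen by
  \<open>FP\<close>, carried over to HOL sets along \<open>s\<close>, which sends a code to its
  extension. The hypothesis \<open>hp X\<close> guarantees that the choice succeeds.\<close>

lemma
  assumes "hp X"
  shows cset_Fin: "cset (Fin X)"
    and dp_in_Fin: "dp (X \<times>\<^sub>c Fin X) (\<lambda>z. fst z \<in> snd z)"
    and HFs_empty: "{} \<in> HFs X"
    and HFs_insert: "\<And>x S. x \<in> car X \<Longrightarrow> S \<in> HFs X \<Longrightarrow> insert x S \<in> HFs X"
    and HFs_induct: "\<And>P S. S \<in> HFs X \<Longrightarrow> dp (Fin X) P \<Longrightarrow> P {} \<Longrightarrow>
      (\<And>x S. x \<in> car X \<Longrightarrow> S \<in> HFs X \<Longrightarrow> P S \<Longrightarrow> P (insert x S)) \<Longrightarrow> P S"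
proof -
  let ?X = "cod X ` car X"
  define Y where "Y = fst (FP ?X)"
  define M where "M = snd (FP ?X)"
  have X: "cset X" and inj: "inj_on (cod X) (car X)" using assms by (auto simp: hp_def cset_def)
  have "\<exists>p. case p of (Y, M) \<Rightarrow> fin_power_set ?X Y M" using assms unfolding hp_def by auto
  then have "case FP ?X of (Y, M) \<Rightarrow> fin_power_set ?X Y M" unfolding FP_def by (rule someI_ex)
  then have "fin_power_set ?X Y M" unfolding Y_def M_def by (simp add: case_prod_beta)
  note F = fin_power_setD[OF this]
  define s where "s B = {x \<in> car X. M (cod X x) B}" for B
  have ext: "ext ?X B = cod X ` s B" for B
    unfolding ext_def s_def M_def by auto
  have cod_s: "cod (Fin X) (s B) = B" if B: "B \<in> Y" for B
  proof -
    have "C = B" if "C \<in> Y" "cod X ` s C = cod X ` s B" for C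
    proof -
      have "s C = s B" using inj_on_image_eq_iff[OF inj, of "s C" "s B"] that unfolding s_def by auto
      then show ?thesis using F(3)[OF that(1) B] unfolding s_def by blast
    qed
    then have "(THE a. a \<in> Y \<and> ext ?X a = cod X ` s B) = B"
      using B unfolding ext by (intro the_equality) auto
    then show ?thesis unfolding Fin_def hcode_def Y_def[symmetric] by simp
  qed
  have HFs: "HFs X = s ` Y"
  proof -
    have "S \<in> HFs X \<longleftrightarrow> S \<in> s ` Y" for S
    proof
      assume "S \<in> HFs X"
      then obtain B where B: "B \<in> Y" "cod X ` S = cod X ` s B" "S \<subseteq> car X"
        unfolding HFs_def HF_def Y_def[symmetric] ext by auto
      then have "S = s B" using inj_on_image_eq_iff[OF inj, of S "s B"] unfolding s_def by auto
      then show "S \<in> s ` Y" using B by blast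
    next
      assume "S \<in> s ` Y"
      then show "S \<in> HFs X" unfolding HFs_def HF_def Y_def[symmetric] ext s_def by blast
    qed
    then show ?thesis by blast
  qed
  have codY: "cod (Fin X) ` HFs X = Y"
    unfolding HFs image_image using cod_s by simp
  show c: "cset (Fin X)"
    unfolding cset_def car_Fin codY using F(1) cod_s HFs by (auto simp: inj_on_def)
  have "cod (X \<times>\<^sub>c Fin X) ` {z \<in> car (X \<times>\<^sub>c Fin X). fst z \<in> snd z} = {pr x B | x B. x \<in> ?X \<and> B \<in> Y \<and> M x B}"
  proof -
    define I where "I = {(x, B). x \<in> car X \<and> B \<in> Y \<and> M (cod X x) B}"
    have "{z \<in> car (X \<times>\<^sub>c Fin X). fst z \<in> snd z} = (\<lambda>(x, B). (x, s B)) ` I"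
      unfolding car_cprod car_Fin HFs s_def I_def by auto
    then have "cod (X \<times>\<^sub>c Fin X) ` {z \<in> car (X \<times>\<^sub>c Fin X). fst z \<in> snd z} = (\<lambda>(x, B). pr (cod X x) B) ` I"
      by (auto simp: image_image I_def cod_s intro!: image_cong)
    moreover have "(\<lambda>(x, B). pr (cod X x) B) ` I = {pr x B | x B. x \<in> ?X \<and> B \<in> Y \<and> M x B}"
      unfolding I_def by fast
    ultimately show ?thesis by simp
  qed
  then show "dp (X \<times>\<^sub>c Fin X) (\<lambda>z. fst z \<in> snd z)"
    unfolding dp_def using X c F(2) by simp
  show "{} \<in> HFs X"
  proof -
    obtain Z where "Z \<in> Y" "\<forall>x\<in>?X. \<not> M x Z" using F(4) by blast
    then have "s Z = {}" "s Z \<in> HFs X" unfolding s_def HFs by auto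
    then show ?thesis by simp
  qed
  show "insert x S \<in> HFs X" if xS: "x \<in> car X" "S \<in> HFs X" for x S
  proof -
    obtain B where B: "B \<in> Y" "S = s B" using xS HFs by auto
    obtain C where C: "C \<in> Y" "\<forall>y\<in>?X. M y C \<longleftrightarrow> y = cod X x" using F(5) xS by blast
    obtain D where D: "D \<in> Y" "\<forall>y\<in>?X. M y D \<longleftrightarrow> M y B \<or> M y C" using F(6) B C by blast
    have "s D = insert x S" unfolding B s_def using C D xS inj by (auto simp: inj_on_def)
    then show ?thesis using HFs D by blast
  qed
  fix P S
  assume S: "S \<in> HFs X" and P: "dp (Fin X) P" and emp: "P {}"
    and step: "\<And>x S. x \<in> car X \<Longrightarrow> S \<in> HFs X \<Longrightarrow> P S \<Longrightarrow> P (insert x S)"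
  have "cod (Fin X) ` {S \<in> HFs X. P S} = Y"
  proof (rule F(7))
    show "definable (cod (Fin X) ` {S \<in> HFs X. P S})" using P unfolding dp_def by simp
    show "cod (Fin X) ` {S \<in> HFs X. P S} \<subseteq> Y" using codY by blast
  next
    fix Z assume Z: "Z \<in> Y" "\<forall>x\<in>?X. \<not> M x Z"
    then have "s Z = {}" unfolding s_def by auto
    then show "Z \<in> cod (Fin X) ` {S \<in> HFs X. P S}" using cod_s[OF Z(1)] HFs Z(1) emp
      by (metis (mono_tags, lifting) CollectI image_eqI)
  next
    fix B a C assume B: "B \<in> cod (Fin X) ` {S \<in> HFs X. P S}" and a: "a \<in> ?X"
      and C: "C \<in> Y" "\<forall>x\<in>?X. M x C \<longleftrightarrow> M x B \<or> x = a"
    obtain T where T: "B = cod (Fin X) T" "T \<in> HFs X" "P T" using B by blast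
    obtain B' where B': "T = s B'" "B' \<in> Y" using T HFs by blast
    have "B' = B" using T B' cod_s by simp
    obtain x where x: "a = cod X x" "x \<in> car X" using a by blast
    have "s C = insert x T" unfolding B'(1) \<open>B' = B\<close> s_def using C x inj by (auto simp: inj_on_def)
    then have "P (s C)" using step[OF x(2) T(2,3)] by simp
    moreover have "s C \<in> HFs X" "cod (Fin X) (s C) = C" using C HFs cod_s by auto
    ultimately show "C \<in> cod (Fin X) ` {S \<in> HFs X. P S}" by (metis (mono_tags, lifting) CollectI image_eqI)
  qed
  then have "cod (Fin X) S \<in> cod (Fin X) ` {S \<in> HFs X. P S}" using S codY by blast
  then show "P S" using c S unfolding cset_def inj_on_def by auto
qed

lemma dp_inI:
  assumes "hp X" "df W X f" "df W (Fin X) S" shows "dp W (\<lambda>w. f w \<in> S w)"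
  by (rule dp_comp2[OF dp_in_Fin[OF assms(1)] assms(2,3)])

text \<open>The set \<open>h z\<close> is hyperfinite if and only if some \<open>S\<close> in
  \<open>Fin X\<close> has the same elements, a first-order condition on \<open>z\<close>.
  Hyperfiniteness thereby becomes an admissible statement for \<open>HFs_induct\<close>, which is
  how closure under images, unions and internal power sets is proved.\<close>

lemma
  assumes X: "hp X" and Z: "cset Z" and sub: "\<And>z. z \<in> car Z \<Longrightarrow> h z \<subseteq> car X"
    and mem: "dp (Z \<times>\<^sub>c X) (\<lambda>w. snd w \<in> h (fst w))"
  shows dp_HFs: "dp Z (\<lambda>z. h z \<in> HFs X)"
    and df_Fin: "(\<And>z. z \<in> car Z \<Longrightarrow> h z \<in> HFs X) \<Longrightarrow> df Z (Fin X) h"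
proof -
  note c = hp_cset[OF X] cset_Fin[OF X] Z
  have 1: "dp (Z \<times>\<^sub>c Fin X) (\<lambda>w. \<forall>x\<in>car X. x \<in> snd w \<longleftrightarrow> x \<in> h (fst w))"
  proof (rule dp_ball)
    show "dp ((Z \<times>\<^sub>c Fin X) \<times>\<^sub>c X) (\<lambda>z. snd z \<in> snd (fst z) \<longleftrightarrow> snd z \<in> h (fst (fst z)))"
      by (rule dp_iff dp_inI[OF X] dp_comp2[OF mem[unfolded fst_conv]] dp_comp2[where P = "\<lambda>z x. x \<in> h z", OF mem] dfn c)+
  qed (simp_all add: c)
  have "dp Z (\<lambda>z. \<exists>S\<in>car (Fin X). \<forall>x\<in>car X. x \<in> S \<longleftrightarrow> x \<in> h z)"
    by (rule dp_bex[OF _ _ 1]) (rule c)+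
  then show "dp Z (\<lambda>z. h z \<in> HFs X)"
  proof (rule dp_congI)
    fix z assume z: "z \<in> car Z"
    show "h z \<in> HFs X \<longleftrightarrow> (\<exists>S\<in>car (Fin X). \<forall>x\<in>car X. x \<in> S \<longleftrightarrow> x \<in> h z)"
    proof
      assume "\<exists>S\<in>car (Fin X). \<forall>x\<in>car X. x \<in> S \<longleftrightarrow> x \<in> h z"
      then obtain S where S: "S \<in> HFs X" "\<forall>x\<in>car X. x \<in> S \<longleftrightarrow> x \<in> h z" by auto
      then have "S = h z" using HFs_sub[OF S(1)] sub[OF z] by blast
      then show "h z \<in> HFs X" using S by simp
    qed auto
  qed
  assume *: "\<And>z. z \<in> car Z \<Longrightarrow> h z \<in> HFs X"
  show "df Z (Fin X) h"
  proof (rule df_graphI[OF _ _ 1])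
    fix z S assume "z \<in> car Z" "S \<in> car (Fin X)"
    then show "S = h z \<longleftrightarrow> (\<forall>x\<in>car X. x \<in> S \<longleftrightarrow> x \<in> h z)" using HFs_sub[of S X] sub[of z] by auto
  qed (use c * in auto)
qed

text \<open>A criterion for power sets: a definable family of subsets that contains the empty set,
  admits insertion of a point and obeys induction. Indices with the same set are identified by
  \<open>img\<close>, which provides the codes. Two inductions, one for each inclusion, show that
  the family consists of the extensions of the power set chosen by \<open>FP\<close>.\<close>

lemma
  assumes X: "cset X" and Z: "cset Z" and sub: "\<And>z. z \<in> car Z \<Longrightarrow> h z \<subseteq> car X"
    and mem: "dp (Z \<times>\<^sub>c X) (\<lambda>w. snd w \<in> h (fst w))"
    and emp: "\<exists>z\<in>car Z. h z = {}"
    and ins: "\<And>z x. z \<in> car Z \<Longrightarrow> x \<in> car X \<Longrightarrow> \<exists>z'\<in>car Z. h z' = insert x (h z)"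
    and ind: "\<And>Q z. dp Z (\<lambda>z. Q (h z)) \<Longrightarrow> Q {} \<Longrightarrow>
      (\<And>z x. z \<in> car Z \<Longrightarrow> x \<in> car X \<Longrightarrow> Q (h z) \<Longrightarrow> Q (insert x (h z))) \<Longrightarrow> z \<in> car Z \<Longrightarrow> Q (h z)"
  shows hpI: "hp X" and HFs_eqI: "HFs X = h ` car Z"
proof -
  note memI = dp_comp2[where P = "\<lambda>z x. x \<in> h z", OF mem]
  have eq: "dp (Z \<times>\<^sub>c Z) (\<lambda>z. h (fst z) = h (snd z))"
  proof (rule dp_congI)
    show "dp (Z \<times>\<^sub>c Z) (\<lambda>z. \<forall>x\<in>car X. x \<in> h (fst z) \<longleftrightarrow> x \<in> h (snd z))"
      by (rule dp_ball) (rule dp_iff memI dfn Z X)+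
  qed (use sub in fastforce)
  let ?W = "img Z h"
  have W: "cset ?W" and hW: "df Z ?W h" by (rule cset_img df_img, rule eq, rule Z)+
  have carW: "car ?W = h ` car Z" by (rule car_img)
  have injX: "inj_on (cod X) (car X)" and injW: "inj_on (cod ?W) (car ?W)" using X W by (auto simp: cset_def)
  define M where "M u v \<longleftrightarrow> (\<exists>x\<in>car X. \<exists>S\<in>car ?W. u = cod X x \<and> v = cod ?W S \<and> x \<in> S)" for u v
  have M: "M (cod X x) (cod ?W S) \<longleftrightarrow> x \<in> S" if "x \<in> car X" "S \<in> car ?W" for x S
    unfolding M_def using that inj_onD[OF injX] inj_onD[OF injW] by metis
  have "fin_power_set (cod X ` car X) (cod ?W ` car ?W) M"
    unfolding fin_power_set_def
  proof (intro conjI ballI allI impI)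
    show "definable (cod X ` car X)" "definable (cod ?W ` car ?W)" using X W by (auto simp: cset_def)
    have "dp (X \<times>\<^sub>c ?W) (\<lambda>w. \<exists>z\<in>car Z. snd w = h z \<and> fst w \<in> h z)"
      by (rule dp_bex) (rule dp_conj memI dp_eq[where Y = ?W] df_comp[OF hW] dfn Z X W)+
    then have "dp (X \<times>\<^sub>c ?W) (\<lambda>w. fst w \<in> snd w)"
      by (rule dp_congI) (auto simp: carW)
    then have "definable (cod (X \<times>\<^sub>c ?W) ` {w \<in> car (X \<times>\<^sub>c ?W). fst w \<in> snd w})" by (simp add: dp_def)
    moreover have "cod (X \<times>\<^sub>c ?W) ` {w \<in> car (X \<times>\<^sub>c ?W). fst w \<in> snd w} =
      {pr x B | x B. x \<in> cod X ` car X \<and> B \<in> cod ?W ` car ?W \<and> M x B}"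
    proof -
      have "cod (X \<times>\<^sub>c ?W) ` {w \<in> car (X \<times>\<^sub>c ?W). fst w \<in> snd w} =
         (\<lambda>(x, S). pr (cod X x) (cod ?W S)) ` {(x, S). x \<in> car X \<and> S \<in> car ?W \<and> M (cod X x) (cod ?W S)}"
        by (rule image_cong) (use M in auto)
      also have "\<dots> = {pr x B | x B. x \<in> cod X ` car X \<and> B \<in> cod ?W ` car ?W \<and> M x B}" by fast
      finally show ?thesis .
    qed
    ultimately show "definable {pr x B | x B. x \<in> cod X ` car X \<and> B \<in> cod ?W ` car ?W \<and> M x B}" by simp
  next
    fix B C assume "B \<in> cod ?W ` car ?W" "C \<in> cod ?W ` car ?W"
    then obtain S T where ST: "B = cod ?W S" "C = cod ?W T" "S \<in> car ?W" "T \<in> car ?W" by blast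
    have "S \<subseteq> car X" "T \<subseteq> car X" using ST sub unfolding carW by blast+
    then have "S = T \<longleftrightarrow> (\<forall>x\<in>car X. x \<in> S \<longleftrightarrow> x \<in> T)" by blast
    moreover have "B = C \<longleftrightarrow> S = T" using ST injW by (auto simp: inj_on_def)
    moreover have "(\<forall>x\<in>cod X ` car X. M x B \<longleftrightarrow> M x C) \<longleftrightarrow> (\<forall>x\<in>car X. x \<in> S \<longleftrightarrow> x \<in> T)"
      unfolding ball_simps(9) ST(1,2) by (rule ball_cong[OF refl]) (simp only: M[OF _ ST(3)] M[OF _ ST(4)])
    ultimately show "B = C \<longleftrightarrow> (\<forall>x\<in>cod X ` car X. M x B \<longleftrightarrow> M x C)" by blast
  next
    obtain z0 where z0: "z0 \<in> car Z" "h z0 = {}" using emp by blast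
    then have e: "{} \<in> car ?W" unfolding carW by (metis image_eqI)
    then have "\<forall>x\<in>cod X ` car X. \<not> M x (cod ?W {})"
      unfolding ball_simps(9) using M by blast
    then show "\<exists>Z\<in>cod ?W ` car ?W. \<forall>x\<in>cod X ` car X. \<not> M x Z" using e by blast
  next
    fix a assume "a \<in> cod X ` car X"
    then obtain x where x: "x \<in> car X" "a = cod X x" by blast
    obtain z where z: "z \<in> car Z" "h z = {}" using emp by blast
    then obtain z' where z': "z' \<in> car Z" "h z' = {x}" using ins[OF z(1) x(1)] by auto
    then have W': "{x} \<in> car ?W" unfolding carW by (metis image_eqI)
    show "\<exists>B\<in>cod ?W ` car ?W. \<forall>y\<in>cod X ` car X. M y B \<longleftrightarrow> y = a"
    proof (intro bexI ballI)
      fix y assume "y \<in> cod X ` car X"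
      then obtain y' where "y' \<in> car X" "y = cod X y'" by blast
      then show "M y (cod ?W {x}) \<longleftrightarrow> y = a" using M[OF _ W'] x inj_onD[OF injX] by (metis singleton_iff)
    qed (use W' in blast)
  next
    fix B C assume "B \<in> cod ?W ` car ?W" "C \<in> cod ?W ` car ?W"
    then obtain z1 z2 where ST: "B = cod ?W (h z1)" "C = cod ?W (h z2)" "z1 \<in> car Z" "z2 \<in> car Z" unfolding carW by blast
    \<comment> \<open>Closure under unions is not among the hypotheses: the second set is built up
      point by point while the first stays fixed.\<close>
    have "\<exists>z'\<in>car Z. h z' = h z1 \<union> h z2"
    proof (rule ind[of "\<lambda>S. \<exists>z'\<in>car Z. h z' = h z1 \<union> S"])
      have "dp Z (\<lambda>z. \<exists>z'\<in>car Z. \<forall>x\<in>car X. x \<in> h z' \<longleftrightarrow> x \<in> h z1 \<or> x \<in> h z)"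
        by (rule dp_bex dp_ball dp_iff memI df_const[OF _ Z ST(3)] dfn Z X)+
      then show "dp Z (\<lambda>z. \<exists>z'\<in>car Z. h z' = h z1 \<union> h z)"
      proof (rule dp_congI, intro bex_cong refl)
        fix z z' assume "z \<in> car Z" "z' \<in> car Z"
        then show "h z' = h z1 \<union> h z \<longleftrightarrow> (\<forall>x\<in>car X. x \<in> h z' \<longleftrightarrow> x \<in> h z1 \<or> x \<in> h z)"
          using sub[of z] sub[of z'] sub[OF ST(3)] by blast
      qed
      fix z x assume "z \<in> car Z" and x: "x \<in> car X" and "\<exists>z'\<in>car Z. h z' = h z1 \<union> h z"
      then obtain z' where z': "z' \<in> car Z" "h z' = h z1 \<union> h z" by blast
      then show "\<exists>z'\<in>car Z. h z' = h z1 \<union> insert x (h z)" using ins[OF z'(1) x] by simp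
    qed (use ST in auto)
    then obtain z' where z': "z' \<in> car Z" "h z' = h z1 \<union> h z2" by blast
    have W3: "h z1 \<union> h z2 \<in> car ?W" unfolding carW by (metis z' image_eqI)
    show "\<exists>D\<in>cod ?W ` car ?W. \<forall>x\<in>cod X ` car X. M x D \<longleftrightarrow> M x B \<or> M x C"
    proof (intro bexI ballI)
      fix y assume "y \<in> cod X ` car X"
      then obtain y' where "y' \<in> car X" "y = cod X y'" by blast
      then show "M y (cod ?W (h z')) \<longleftrightarrow> M y B \<or> M y C"
        using M[OF _ W3] M[of _ "h z1"] M[of _ "h z2"] z' ST by (simp add: carW)
    qed (use z' carW in blast)
  next
    fix U assume U: "definable U \<and> U \<subseteq> cod ?W ` car ?W \<and>
       (\<forall>Z\<in>cod ?W ` car ?W. (\<forall>x\<in>cod X ` car X. \<not> M x Z) \<longrightarrow> Z \<in> U) \<and>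
       (\<forall>B\<in>U. \<forall>a\<in>cod X ` car X. \<forall>C\<in>cod ?W ` car ?W. (\<forall>x\<in>cod X ` car X. M x C \<longleftrightarrow> M x B \<or> x = a) \<longrightarrow> C \<in> U)"
    from U have U1: "definable U" by (elim conjE)
    from U have U2: "U \<subseteq> cod ?W ` car ?W" by (elim conjE)
    from U have U3: "\<forall>Z\<in>cod ?W ` car ?W. (\<forall>x\<in>cod X ` car X. \<not> M x Z) \<longrightarrow> Z \<in> U" by (elim conjE)
    from U have U4: "\<forall>B\<in>U. \<forall>a\<in>cod X ` car X. \<forall>C\<in>cod ?W ` car ?W.
         (\<forall>x\<in>cod X ` car X. M x C \<longleftrightarrow> M x B \<or> x = a) \<longrightarrow> C \<in> U" by (elim conjE)
    have "cod ?W ` {S \<in> car ?W. cod ?W S \<in> U} = U" using U2 by blast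
    then have "dp ?W (\<lambda>S. cod ?W S \<in> U)" unfolding dp_def using U1 W by simp
    then have dpU: "dp Z (\<lambda>z. cod ?W (h z) \<in> U)" by (rule dp_comp[OF _ hW])
    have "cod ?W (h z) \<in> U" if "z \<in> car Z" for z
    proof (rule ind[of "\<lambda>S. cod ?W S \<in> U", OF dpU _ _ that])
      obtain z0 where z0: "z0 \<in> car Z" "h z0 = {}" using emp by blast
      then have e: "{} \<in> car ?W" unfolding carW by (metis image_eqI)
      then have "\<forall>x\<in>cod X ` car X. \<not> M x (cod ?W {})"
        unfolding ball_simps(9) using M by blast
      then show "cod ?W {} \<in> U" using U3 e by blast
    next
      fix z x assume zx: "z \<in> car Z" "x \<in> car X" "cod ?W (h z) \<in> U"
      obtain z' where z': "z' \<in> car Z" "h z' = insert x (h z)" using ins[OF zx(1,2)] by blast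
      have w: "h z \<in> car ?W" "insert x (h z) \<in> car ?W" using zx z' unfolding carW by (metis image_eqI)+
      have "\<forall>y\<in>cod X ` car X. M y (cod ?W (insert x (h z))) \<longleftrightarrow> M y (cod ?W (h z)) \<or> y = cod X x"
      proof
        fix y assume "y \<in> cod X ` car X"
        then obtain y' where "y' \<in> car X" "y = cod X y'" by blast
        then show "M y (cod ?W (insert x (h z))) \<longleftrightarrow> M y (cod ?W (h z)) \<or> y = cod X x"
          using M[OF _ w(1)] M[OF _ w(2)] zx(2) inj_onD[OF injX] by (metis insert_iff)
      qed
      then show "cod ?W (insert x (h z)) \<in> U"
        using U4 zx(3) imageI[OF zx(2), of "cod X"] imageI[OF w(2), of "cod ?W"] by (metis (no_types))
    qed
    then show "U = cod ?W ` car ?W" using U2 unfolding carW by blast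
  qed
  then show hpX: "hp X" unfolding hp_def using X by blast
  show "HFs X = h ` car Z"
  proof
    show "HFs X \<subseteq> h ` car Z"
    proof
      fix S assume "S \<in> HFs X"
      then show "S \<in> h ` car Z"
      proof (rule HFs_induct[OF hpX])
        have "dp (Fin X) (\<lambda>S. \<exists>z\<in>car Z. \<forall>x\<in>car X. x \<in> S \<longleftrightarrow> x \<in> h z)"
          by (rule dp_bex dp_ball dp_iff memI dp_inI[OF hpX] dfn Z X cset_Fin[OF hpX])+
        then show "dp (Fin X) (\<lambda>S. S \<in> h ` car Z)"
        proof (rule dp_congI)
          fix S assume "S \<in> car (Fin X)"
          then have "S = h z \<longleftrightarrow> (\<forall>x\<in>car X. x \<in> S \<longleftrightarrow> x \<in> h z)" if "z \<in> car Z" for z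
            using sub[OF that] HFs_sub[of S X] by auto
          then show "S \<in> h ` car Z \<longleftrightarrow> (\<exists>z\<in>car Z. \<forall>x\<in>car X. x \<in> S \<longleftrightarrow> x \<in> h z)" by blast
        qed
      next
        show "{} \<in> h ` car Z" using emp by (metis image_eqI)
      next
        fix x S assume x: "x \<in> car X" and "S \<in> h ` car Z"
        then obtain z where z: "z \<in> car Z" "S = h z" by blast
        show "insert x S \<in> h ` car Z" using ins[OF z(1) x] unfolding z(2) by force
      qed
    qed
    have "h z \<in> HFs X" if "z \<in> car Z" for z
    proof (rule ind[of "\<lambda>S. S \<in> HFs X"])
      show "dp Z (\<lambda>z. h z \<in> HFs X)" by (rule dp_HFs[OF hpX Z sub mem])
    qed (use HFs_empty[OF hpX] HFs_insert[OF hpX] that in auto)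
    then show "h ` car Z \<subseteq> HFs X" by blast
  qed
qed

subsection \<open>Hyperfinite sets of pairs and of hyperfinite sets\<close>

lemma HFs_D: "S \<in> HFs X \<Longrightarrow> x \<in> S \<Longrightarrow> x \<in> car X"
  using HFs_sub by blast

lemma HFs_sep:
  assumes X: "hp X" and S: "S \<in> HFs X" and P: "dp X P"
  shows "{x \<in> S. P x} \<in> HFs X"
  using S
proof (rule HFs_induct[OF X])
  note c = hp_cset[OF X] cset_Fin[OF X]
  show "dp (Fin X) (\<lambda>S. {x \<in> S. P x} \<in> HFs X)"
  proof (rule dp_HFs[OF X])
    have "dp (Fin X \<times>\<^sub>c X) (\<lambda>w. snd w \<in> fst w \<and> P (snd w))"
      by (rule dp_conj dp_inI[OF X] dp_comp[OF P] dfn c)+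
    then show "dp (Fin X \<times>\<^sub>c X) (\<lambda>w. snd w \<in> {x \<in> fst w. P x})" by simp
  qed (use c in \<open>auto dest: HFs_D\<close>)
  fix x S assume "x \<in> car X" "{x \<in> S. P x} \<in> HFs X"
  moreover have "{y \<in> insert x S. P y} = (if P x then insert x {y \<in> S. P y} else {y \<in> S. P y})" by auto
  ultimately show "{y \<in> insert x S. P y} \<in> HFs X"
    using HFs_insert[OF X, of x "{x \<in> S. P x}"] by simp
qed (simp add: HFs_empty[OF X])

lemma HFs_subset:
  assumes "hp X" "S \<in> HFs X" "T \<subseteq> S" "dp X (\<lambda>x. x \<in> T)"
  shows "T \<in> HFs X"
proof -
  have "T = {x \<in> S. x \<in> T}" using assms by blast
  then show ?thesis using HFs_sep[OF assms(1,2,4)] by simp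
qed

lemma dp_in_set: assumes "hp X" "S \<in> HFs X" shows "dp X (\<lambda>x. x \<in> S)"
  by (rule dp_inI[OF assms(1)]) (use assms(2) hp_cset[OF assms(1)] cset_Fin[OF assms(1)] in \<open>auto intro!: df_id df_const\<close>)

lemma HFs_subset': assumes "hp X" "S \<in> HFs X" "T \<in> HFs X" shows "S - T \<in> HFs X" "S \<inter> T \<in> HFs X"
  by (rule HFs_subset[OF assms(1,2)]; use assms in \<open>auto intro!: dp_conj dp_not dp_in_set\<close>)+

lemma HFs_image:
  assumes X: "hp X" and Y: "hp Y" and f: "df X Y f" and S: "S \<in> HFs X"
  shows "f ` S \<in> HFs Y"
  using S
proof (rule HFs_induct[OF X])
  note c = hp_cset[OF X] cset_Fin[OF X] hp_cset[OF Y] cset_Fin[OF Y]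
  show "dp (Fin X) (\<lambda>S. f ` S \<in> HFs Y)"
  proof (rule dp_HFs[OF Y])
    have "dp (Fin X \<times>\<^sub>c Y) (\<lambda>w. \<exists>x\<in>car X. x \<in> fst w \<and> snd w = f x)"
      by (rule dp_bex dp_conj dp_inI[OF X] dp_eq[where Y = Y] df_comp[OF f] dfn c)+
    then show "dp (Fin X \<times>\<^sub>c Y) (\<lambda>w. snd w \<in> f ` fst w)"
    proof (rule dp_congI)
      fix w assume "w \<in> car (Fin X \<times>\<^sub>c Y)"
      then have "fst w \<subseteq> car X" using HFs_sub[of "fst w" X] by auto
      then show "snd w \<in> f ` fst w \<longleftrightarrow> (\<exists>x\<in>car X. x \<in> fst w \<and> snd w = f x)" by blast
    qed
  qed (use c in \<open>auto intro!: df_mem[OF f] dest: HFs_D\<close>)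
  show "f ` {} \<in> HFs Y" using HFs_empty[OF Y] by simp
  fix x S assume "x \<in> car X" "f ` S \<in> HFs Y"
  then show "f ` insert x S \<in> HFs Y" using HFs_insert[OF Y] df_mem[OF f] by simp
qed

lemma HFs_Un:
  assumes X: "hp X" and S: "S \<in> HFs X" and T: "T \<in> HFs X"
  shows "S \<union> T \<in> HFs X"
  using T
proof (rule HFs_induct[OF X])
  note c = hp_cset[OF X] cset_Fin[OF X]
  show "dp (Fin X) (\<lambda>T. S \<union> T \<in> HFs X)"
  proof (rule dp_HFs[OF X])
    have "dp (Fin X \<times>\<^sub>c X) (\<lambda>w. snd w \<in> S \<or> snd w \<in> fst w)"
      by (rule dp_disj dp_inI[OF X] df_const[of _ "Fin X" S] dfn c | simp add: S c)+
    then show "dp (Fin X \<times>\<^sub>c X) (\<lambda>w. snd w \<in> S \<union> fst w)" by simp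
  qed (use c HFs_sub[of _ X] S in auto)
  fix x T assume "x \<in> car X" "S \<union> T \<in> HFs X"
  then show "S \<union> insert x T \<in> HFs X" using HFs_insert[OF X] by simp
qed (use S in simp)

text \<open>No power set of \<open>X \<times>\<^sub>c Y\<close> is presupposed: induction on
  \<open>A\<close> adds one row at a time. The slope argument in \<open>sepfam_prod\<close> builds
  its hyperfinite set of quotients with this lemma, before products are known to have power
  sets.\<close>

lemma HFs_image2:
  assumes X: "hp X" and Y: "hp Y" and Z: "hp Z" and f: "df (X \<times>\<^sub>c Y) Z f"
    and A: "A \<in> HFs X" and B: "B \<in> HFs Y"
  shows "f ` (A \<times> B) \<in> HFs Z"
  using A
proof (rule HFs_induct[OF X])
  note c = hp_cset[OF X] cset_Fin[OF X] hp_cset[OF Y] cset_Fin[OF Y] hp_cset[OF Z] cset_Fin[OF Z]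
  show "dp (Fin X) (\<lambda>A. f ` (A \<times> B) \<in> HFs Z)"
  proof (rule dp_HFs[OF Z])
    have "dp (Fin X \<times>\<^sub>c Z) (\<lambda>w. \<exists>x\<in>car X. \<exists>y\<in>car Y. x \<in> fst w \<and> y \<in> B \<and> snd w = f (x, y))"
      by (rule dp_bex dp_conj dp_inI[OF X] dp_inI[OF Y] dp_eq[where Y = Z] df_comp[OF f] df_const[of _ "Fin Y" B] dfn c | simp add: B c)+
    then show "dp (Fin X \<times>\<^sub>c Z) (\<lambda>w. snd w \<in> f ` (fst w \<times> B))"
      by (rule dp_congI) (use HFs_sub[of _ X] HFs_sub[OF B] in fastforce)
  qed (use c in \<open>auto intro!: df_mem[OF f] dest: HFs_D HFs_D[OF B]\<close>)
  show "f ` ({} \<times> B) \<in> HFs Z" using HFs_empty[OF Z] by simp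
  fix x S assume x: "x \<in> car X" and S: "f ` (S \<times> B) \<in> HFs Z"
  have "df Y Z (\<lambda>y. f (x, y))" by (rule df_comp[OF f] df_Pair df_const df_id c x)+
  then have "(\<lambda>y. f (x, y)) ` B \<in> HFs Z" using HFs_image[OF Y Z _ B] by simp
  moreover have "f ` (insert x S \<times> B) = f ` (S \<times> B) \<union> (\<lambda>y. f (x, y)) ` B" by auto
  ultimately show "f ` (insert x S \<times> B) \<in> HFs Z" using HFs_Un[OF Z S] by simp
qed

text \<open>The images under \<open>g\<close> of the sets \<open>S \<inter> A\<close>, for
  \<open>S\<close> in \<open>Fin X\<close>, form a family to which \<open>hpI\<close> applies. Power
  sets thus pass to definable subsets and to definable quotients.\<close>

lemma hp_sub_img:
  assumes X: "hp X" and A: "dp X (\<lambda>x. x \<in> A)" "A \<subseteq> car X" and g: "df (A, cod X) Y g" and surj: "g ` A = car Y"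
  shows "hp Y"
proof (rule hpI[where Z = "Fin X" and h = "\<lambda>S. g ` (S \<inter> A)"])
  note cA = dp_sub_iff(1)[OF A] and i = df_sub_incl[OF A]
  note c = hp_cset[OF X] cset_Fin[OF X] df_cset(2)[OF g] cA
  show "cset Y" "cset (Fin X)" by (rule c)+
  show "g ` (z \<inter> A) \<subseteq> car Y" for z using surj by blast
  have "dp (Fin X \<times>\<^sub>c Y) (\<lambda>w. \<exists>x\<in>car (A, cod X). x \<in> fst w \<and> snd w = g x)"
    by (rule dp_bex dp_conj dp_inI[OF X] dp_eq[where Y = Y] df_comp[OF g] df_comp[OF i] dfn c)+
  then show "dp (Fin X \<times>\<^sub>c Y) (\<lambda>w. snd w \<in> g ` (fst w \<inter> A))"
    by (rule dp_congI) auto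
  show "\<exists>z\<in>car (Fin X). g ` (z \<inter> A) = {}" using HFs_empty[OF X] by auto
  fix S y assume S: "S \<in> car (Fin X)" and "y \<in> car Y"
  then obtain x where x: "x \<in> A" "y = g x" using surj by blast
  then have "g ` (insert x S \<inter> A) = insert y (g ` (S \<inter> A))" by auto
  moreover have "insert x S \<in> car (Fin X)" using HFs_insert[OF X, of x S] x A S by auto
  ultimately show "\<exists>z'\<in>car (Fin X). g ` (z' \<inter> A) = insert y (g ` (S \<inter> A))" by blast
next
  fix Q S assume Q: "dp (Fin X) (\<lambda>z. Q (g ` (z \<inter> A)))" "Q {}"
    and st: "\<And>z x. z \<in> car (Fin X) \<Longrightarrow> x \<in> car Y \<Longrightarrow> Q (g ` (z \<inter> A)) \<Longrightarrow> Q (insert x (g ` (z \<inter> A)))"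
    and S: "S \<in> car (Fin X)"
  have "S \<in> HFs X" using S by simp
  then show "Q (g ` (S \<inter> A))"
  proof (rule HFs_induct[OF X, where P = "\<lambda>S. Q (g ` (S \<inter> A))"])
    fix x S assume "x \<in> car X" "S \<in> HFs X" "Q (g ` (S \<inter> A))"
    then show "Q (g ` (insert x S \<inter> A))"
      using st[of S "g x"] surj by (cases "x \<in> A") auto
  qed (use Q in auto)
qed

lemma hp_inj:
  assumes W: "hp W" and e: "df X W e" and inj: "inj_on e (car X)"
  shows "hp X"
proof (rule hp_sub_img[OF W, where A = "e ` car X" and g = "inv_into (car X) e"])
  note c = df_cset[OF e]
  have "dp W (\<lambda>w. \<exists>x\<in>car X. w = e x)"
    by (rule dp_bex dp_eq[where Y = W] df_comp[OF e] dfn c)+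
  then show A: "dp W (\<lambda>w. w \<in> e ` car X)" by (rule dp_congI) auto
  show sub: "e ` car X \<subseteq> car W" using df_mem[OF e] by blast
  note i = df_sub_incl[OF A sub]
  show "df (e ` car X, cod W) X (inv_into (car X) e)"
  proof (rule df_graphI[where R = "\<lambda>w x. w = e x"])
    show "dp ((e ` car X, cod W) \<times>\<^sub>c X) (\<lambda>z. fst z = e (snd z))"
      by (rule dp_eq[where Y = W] df_comp[OF e] df_comp[OF i] dfn c df_cset(1)[OF i])+
  qed (use c df_cset[OF i] inj in \<open>auto simp: inv_into_into f_inv_into_f\<close>)
  show "inv_into (car X) e ` e ` car X = car X" by (rule inv_into_image_cancel[OF inj order_refl])
qed

end

section \<open>The power set of K and of products with K\<close>

locale hyperfield = kfield mem for mem :: "'k::field \<Rightarrow> 'f \<Rightarrow> bool" +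
  assumes power_set_structure: "is_power_set_structure" and char_zero: "definable_char_zero"
begin

abbreviation K :: "('k, 'k, 'f) coded" where "K \<equiv> Kc"

definition fext :: "'f \<Rightarrow> 'k set" where "fext B = {x. mem x B}"

text \<open>\<open>FP\<close> may have picked another power set of K than the second sort with
  \<open>mem\<close>. The criterion, applied to \<open>fext\<close>, shows that both have the same
  extensions.\<close>

lemma hp_K: "hp K" and HFs_K: "HFs K = range fext"
proof -
  have M: "(\<exists>x' B'. (kel x :: ('k, 'f) imag) = kel x' \<and> (fel B :: ('k, 'f) imag) = fel B' \<and> mem x' B') = mem x B" for x B
    by (auto simp: kel_def fel_def)
  have kinj: "(kel x :: ('k, 'f) imag) = kel y \<longleftrightarrow> x = y" for x y by (auto simp: kel_def)
  have finj: "(fel x :: ('k, 'f) imag) = fel y \<longleftrightarrow> x = y" for x y by (auto simp: fel_def)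
  note F = fin_power_setD[OF power_set_structure[unfolded is_power_set_structure_def]]
  have emp: "\<exists>z. fext z = {}" using F(4) by (auto simp: fext_def M)
  have ins: "\<exists>z'. fext z' = insert x (fext z)" for z x
  proof -
    obtain B where "\<forall>y. mem y B \<longleftrightarrow> y = x" using F(5)[of "kel x"] by (auto simp: kinj finj M)
    moreover obtain D where "\<forall>y. mem y D \<longleftrightarrow> mem y B \<or> mem y z" using F(6)[of "fel B" "fel z"] by (auto simp: kinj finj M)
    ultimately have "fext D = insert x (fext z)" unfolding fext_def by auto
    then show ?thesis by auto
  qed
  have ind: "Q (fext z)" if Q: "dp Fc (\<lambda>z. Q (fext z))" "Q {}"
    and st: "\<And>z x. z \<in> car Fc \<Longrightarrow> x \<in> car K \<Longrightarrow> Q (fext z) \<Longrightarrow> Q (insert x (fext z))" for Q z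
  proof -
    have "fel ` {z. Q (fext z)} = (range fel :: ('k, 'f) imag set)"
    proof (rule F(7))
      show "definable (fel ` {z. Q (fext z)})" using Q(1) unfolding dp_def by simp
      show "fel ` {z. Q (fext z)} \<subseteq> range fel" by blast
    next
      fix Z :: "('k, 'f) imag"
      assume "Z \<in> range fel" and Z: "\<forall>x\<in>range kel. \<not> (\<exists>x' B. x = kel x' \<and> Z = fel B \<and> mem x' B)"
      then obtain B where B: "Z = fel B" by blast
      then have "fext B = {}" using Z by (auto simp: fext_def)
      then have "Q (fext B)" using Q(2) by simp
      then show "Z \<in> fel ` {z. Q (fext z)}" using B by blast
    next
      fix B C a :: "('k, 'f) imag"
      assume "B \<in> fel ` {z. Q (fext z)}" "a \<in> range kel" "C \<in> range fel"
        and e: "\<forall>x\<in>range kel. (\<exists>x' D. x = kel x' \<and> C = fel D \<and> mem x' D) =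
          ((\<exists>x' D. x = kel x' \<and> B = fel D \<and> mem x' D) \<or> x = a)"
      then obtain B' C' x where B': "B = fel B'" "C = fel C'" "a = kel x" and QB: "Q (fext B')" by blast
      have "fext C' = insert x (fext B')"
        using e unfolding B' fext_def by (auto simp: M kinj finj)
      then have "Q (fext C')" using st[of B' x] QB by simp
      then show "C \<in> fel ` {z. Q (fext z)}" using B' by blast
    qed
    then have "fel z \<in> (fel ` {z. Q (fext z)} :: ('k, 'f) imag set)" by simp
    then show "Q (fext z)" by (auto simp: fel_def)
  qed
  have mem: "dp (Fc \<times>\<^sub>c K) (\<lambda>w. snd w \<in> fext (fst w))"
    unfolding fext_def mem_Collect_eq by (rule dfn)+
  show "hp K"
  proof (rule hpI[where Z = Fc and h = fext])
    fix Q z assume Q: "dp Fc (\<lambda>z. Q (fext z))" "Q {}"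
      "\<And>z x. z \<in> car Fc \<Longrightarrow> x \<in> car K \<Longrightarrow> Q (fext z) \<Longrightarrow> Q (insert x (fext z))"
    show "Q (fext z)" by (rule ind[of Q z]) (use Q in blast)+
  qed (use mem emp ins in \<open>auto intro: cset_Kc cset_Fc\<close>)
  have "HFs K = fext ` car Fc"
  proof (rule HFs_eqI[where Z = Fc and h = fext])
    fix Q z assume Q: "dp Fc (\<lambda>z. Q (fext z))" "Q {}"
      "\<And>z x. z \<in> car Fc \<Longrightarrow> x \<in> car K \<Longrightarrow> Q (fext z) \<Longrightarrow> Q (insert x (fext z))"
    show "Q (fext z)" by (rule ind[of Q z]) (use Q in blast)+
  qed (use mem emp ins in \<open>auto intro: cset_Kc cset_Fc\<close>)
  then show "HFs K = range fext" by simp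
qed

text \<open>A code whose extension is all of K would witness \<open>- 1 \<in> K0\<close>. That K is
  not hyperfinite supplies the fresh slopes and indices with which further power sets are
  built.\<close>

lemma UNIV_not_HFs: "UNIV \<notin> HFs K"
proof
  assume "UNIV \<in> HFs K"
  then obtain F where F: "fext F = UNIV" unfolding HFs_K by (metis rangeE)
  have "- 1 \<in> K0" unfolding K0_def using F by (auto simp: fext_def)
  then show False using char_zero unfolding definable_char_zero_def by simp
qed

lemma ex_new: "S \<in> HFs K \<Longrightarrow> \<exists>x. x \<notin> S"
  using UNIV_not_HFs by (metis UNIV_eq_I)

text \<open>A definable family of projections to the line, rich enough that each hyperfinite set is
  embedded by one of them. Hyperfinite subsets of \<open>X\<close> can then be handled through their
  images in K.\<close>

definition sepfam :: "('l, 'k, 'f) coded \<Rightarrow> ('a, 'k, 'f) coded \<Rightarrow> ('l \<Rightarrow> 'a \<Rightarrow> 'k) \<Rightarrow> bool" where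
  "sepfam L X h \<longleftrightarrow> df (L \<times>\<^sub>c X) K (\<lambda>z. h (fst z) (snd z)) \<and> (\<forall>S\<in>HFs X. \<exists>l\<in>car L. inj_on (h l) S)"

text \<open>Two points with distinct second entries collide under \<open>h l x + m * y\<close> only
  if \<open>m\<close> is a difference of values of \<open>h l\<close> divided by a difference of
  second entries. These quotients form a hyperfinite set, so some \<open>m\<close> avoids
  them.\<close>

lemma sepfam_prod:
  assumes X: "hp X" and L: "cset L" and h: "sepfam L X h" and A: "A \<in> HFs X" and B: "B \<in> HFs K"
  shows "\<exists>l\<in>car L. \<exists>m. inj_on (\<lambda>(x, y). h l x + m * y) (A \<times> B)"
proof -
  obtain l where l: "l \<in> car L" "inj_on (h l) A" using h A unfolding sepfam_def by blast
  note c = hp_cset[OF X] L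
  have hd: "df (L \<times>\<^sub>c X) K (\<lambda>z. h (fst z) (snd z))" using h by (simp add: sepfam_def)
  have 1: "(\<lambda>z. h l (snd z) - h l (fst z)) ` (A \<times> A) \<in> HFs K"
    by (rule HFs_image2[OF X X hp_K _ A A]) (rule dfn df_comp2[OF hd] df_const[OF _ L l(1)] c)+
  have 2: "(\<lambda>z. fst z - snd z) ` (B \<times> B) \<in> HFs K"
    by (rule HFs_image2[OF hp_K hp_K hp_K _ B B]) (rule dfn)+
  have 3: "(\<lambda>z. fst z / snd z) ` ((\<lambda>z. h l (snd z) - h l (fst z)) ` (A \<times> A) \<times> (\<lambda>z. fst z - snd z) ` (B \<times> B)) \<in> HFs K"
    by (rule HFs_image2[OF hp_K hp_K hp_K _ 1 2]) (rule dfn)+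
  obtain m where m: "m \<notin> (\<lambda>z. fst z / snd z) ` ((\<lambda>z. h l (snd z) - h l (fst z)) ` (A \<times> A) \<times> (\<lambda>z. fst z - snd z) ` (B \<times> B))"
    using ex_new[OF 3] by blast
  have "inj_on (\<lambda>(x, y). h l x + m * y) (A \<times> B)"
  proof (rule inj_onI)
    fix z z' assume "z \<in> A \<times> B" "z' \<in> A \<times> B" and e: "(\<lambda>(x, y). h l x + m * y) z = (\<lambda>(x, y). h l x + m * y) z'"
    then obtain x y x' y' where z: "z = (x, y)" "z' = (x', y')" "x \<in> A" "x' \<in> A" "y \<in> B" "y' \<in> B" by blast
    have e: "m * (y - y') = h l x' - h l x" using e z by (simp add: algebra_simps)
    have y: "y = y'"
    proof (rule ccontr)
      assume "y \<noteq> y'"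
      then have "m = (h l x' - h l x) / (y - y')" using e by (simp add: field_simps)
      moreover have "((\<lambda>z. h l (snd z) - h l (fst z)) (x, x'), (\<lambda>z. fst z - snd z) (y, y')) \<in> (\<lambda>z. h l (snd z) - h l (fst z)) ` (A \<times> A) \<times> (\<lambda>z. fst z - snd z) ` (B \<times> B)"
        using z by blast
      ultimately have "m \<in> (\<lambda>z. fst z / snd z) ` ((\<lambda>z. h l (snd z) - h l (fst z)) ` (A \<times> A) \<times> (\<lambda>z. fst z - snd z) ` (B \<times> B))"
        by (metis (no_types, lifting) fst_conv image_eqI snd_conv)
      then show False using m by blast
    qed
    then have "h l x = h l x'" using e by simp
    then show "z = z'" using l(2) z y by (auto dest: inj_onD)
  qed
  then show ?thesis using l by blast
qed

text \<open>
  A hyperfinite subset of \<open>X \<times> K\<close> is coded by a box \<open>A \<times> B\<close> containing it, a map \<open>h\<^sub>l(x) + m y\<close> that is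
  injective on the box, and the image \<open>C\<close> under this map.
\<close>

lemma
  assumes X: "hp X" and L: "cset L" and h: "sepfam L X h"
  shows hp_prod_K: "hp (X \<times>\<^sub>c K)"
    and sepfam_prod_K: "sepfam (L \<times>\<^sub>c K) (X \<times>\<^sub>c K) (\<lambda>p z. h (fst p) (fst z) + snd p * snd z)"
proof -
  note c = hp_cset[OF X] cset_Fin[OF X] L cset_Kc cset_Fin[OF hp_K]
  have hd: "df (L \<times>\<^sub>c X) K (\<lambda>z. h (fst z) (snd z))" using h by (simp add: sepfam_def)
  define v where "v p z = h (fst p) (fst z) + snd p * snd z" for p z
  have vd: "df ((L \<times>\<^sub>c K) \<times>\<^sub>c (X \<times>\<^sub>c K)) K (\<lambda>z. v (fst z) (snd z))"
    unfolding v_def by (rule dfn df_comp2[OF hd] c)+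
  \<comment> \<open>Data whose map is not injective on its box code the empty set. Every element of
    \<open>Z\<close> thus codes something, and such data need no induction.\<close>
  define H where "H w = {z \<in> fst (snd w) \<times> fst (snd (snd w)). v (fst w) z \<in> snd (snd (snd w)) \<and>
     inj_on (v (fst w)) (fst (snd w) \<times> fst (snd (snd w)))}" for w
  define Z where "Z = (L \<times>\<^sub>c K) \<times>\<^sub>c (Fin X \<times>\<^sub>c (Fin K \<times>\<^sub>c Fin K))"
  have cZ: "cset Z" unfolding Z_def by (simp add: c)
  have carZ: "w \<in> car Z \<longleftrightarrow> fst (fst w) \<in> car L \<and> fst (snd w) \<in> HFs X \<and> fst (snd (snd w)) \<in> HFs K \<and> snd (snd (snd w)) \<in> HFs K" for w
    unfolding Z_def by (cases w) auto
  have inj: "\<exists>p\<in>car L \<times> UNIV. inj_on (v p) (A \<times> B)" if AB: "A \<in> HFs X" "B \<in> HFs K" for A B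
  proof -
    obtain l m where "l \<in> car L" "inj_on (\<lambda>(x, y). h l x + m * y) (A \<times> B)"
      using sepfam_prod[OF X L h AB] by blast
    then show ?thesis by (intro bexI[of _ "(l, m)"]) (auto simp: v_def[abs_def] case_prod_beta')
  qed
  have ind: "Q (H w)" if Q: "dp Z (\<lambda>z. Q (H z))" "Q {}"
    and st: "\<And>z x. z \<in> car Z \<Longrightarrow> x \<in> car (X \<times>\<^sub>c K) \<Longrightarrow> Q (H z) \<Longrightarrow> Q (insert x (H z))" and w: "w \<in> car Z" for Q w
  proof -
    obtain p A B C where w': "w = (p, A, B, C)" by (metis prod.collapse)
    note W = w[unfolded w' carZ, simplified]
    show ?thesis
    proof (cases "inj_on (v p) (A \<times> B)")
      case False
      then show ?thesis unfolding H_def w' using Q(2) by simp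
    next
      case True
      \<comment> \<open>Box and projection stay fixed and only the image \<open>C\<close> is built
        up. By injectivity each new value in \<open>C\<close> adds at most one point of the
        box.\<close>
      have "Q (H (p, A, B, C))" if "C \<in> HFs K"
        using that
      proof (rule HFs_induct[OF hp_K, where P = "\<lambda>C. Q (H (p, A, B, C))"])
        have "df (Fin K) Z (\<lambda>C. (p, A, B, C))"
          unfolding Z_def by (rule df_Pair df_const df_id cset_cprod c | use W in \<open>force simp: mem_Times_iff\<close>)+
        from dp_comp[OF Q(1) this] show "dp (Fin K) (\<lambda>C. Q (H (p, A, B, C)))" .
        show "Q (H (p, A, B, {}))" unfolding H_def using Q(2) by simp
        fix x C assume C: "C \<in> HFs K" "Q (H (p, A, B, C))"
        show "Q (H (p, A, B, insert x C))"
        proof (cases "\<exists>z\<in>A \<times> B. v p z = x")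
          case False
          then have "H (p, A, B, insert x C) = H (p, A, B, C)" unfolding H_def by auto
          then show ?thesis using C by simp
        next
          case True': True
          then obtain z where z: "z \<in> A \<times> B" "v p z = x" by blast
          have "H (p, A, B, insert x C) = insert z (H (p, A, B, C))"
            unfolding H_def using True z by (auto dest: inj_onD)
          moreover have "(p, A, B, C) \<in> car Z" unfolding carZ using W C by simp
          moreover have "z \<in> car (X \<times>\<^sub>c K)" using z HFs_sub[of A X] W by auto
          ultimately show ?thesis using st C by simp
        qed
      qed
      then show ?thesis unfolding w' using W by simp
    qed
  qed
  have sub: "H z \<subseteq> car (X \<times>\<^sub>c K)" if "z \<in> car Z" for z
    using that HFs_sub[of "fst (snd z)" X] unfolding H_def carZ by auto
  have inj_box: "inj_on f (A \<times> B) \<longleftrightarrow> (\<forall>z\<in>car X \<times> UNIV. \<forall>z'\<in>car X \<times> UNIV.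
      fst z \<in> A \<and> snd z \<in> B \<and> fst z' \<in> A \<and> snd z' \<in> B \<and> f z = f z' \<longrightarrow> z = z')"
    if "A \<subseteq> car X" for f :: "'a \<times> 'k \<Rightarrow> 'k" and A B
  proof
    assume L: "inj_on f (A \<times> B)"
    show "\<forall>z\<in>car X \<times> UNIV. \<forall>z'\<in>car X \<times> UNIV.
      fst z \<in> A \<and> snd z \<in> B \<and> fst z' \<in> A \<and> snd z' \<in> B \<and> f z = f z' \<longrightarrow> z = z'"
      by (intro ballI impI, rule inj_onD[OF L]) (auto simp: mem_Times_iff)
  next
    assume R: "\<forall>z\<in>car X \<times> UNIV. \<forall>z'\<in>car X \<times> UNIV.
      fst z \<in> A \<and> snd z \<in> B \<and> fst z' \<in> A \<and> snd z' \<in> B \<and> f z = f z' \<longrightarrow> z = z'"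
    show "inj_on f (A \<times> B)"
      by (intro inj_onI, rule R[rule_format]) (use that in \<open>auto simp: mem_Times_iff\<close>)
  qed
  have mem: "dp (Z \<times>\<^sub>c (X \<times>\<^sub>c K)) (\<lambda>w. snd w \<in> H (fst w))"
  proof -
    have "dp (Z \<times>\<^sub>c (X \<times>\<^sub>c K)) (\<lambda>w. (fst (snd w) \<in> fst (snd (fst w)) \<and> snd (snd w) \<in> fst (snd (snd (fst w)))) \<and>
      v (fst (fst w)) (snd w) \<in> snd (snd (snd (fst w))) \<and>
      (\<forall>z\<in>car (X \<times>\<^sub>c K). \<forall>z'\<in>car (X \<times>\<^sub>c K). fst z \<in> fst (snd (fst w)) \<and> snd z \<in> fst (snd (snd (fst w))) \<and>
         fst z' \<in> fst (snd (fst w)) \<and> snd z' \<in> fst (snd (snd (fst w))) \<and> v (fst (fst w)) z = v (fst (fst w)) z' \<longrightarrow> z = z'))"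
      unfolding Z_def
      by (rule dp_ball dp_conj dp_imp dp_inI[OF X] dp_inI[OF hp_K] df_comp2[OF vd] dp_eq_K dp_eq[where Y = "X \<times>\<^sub>c K"] df_fst df_snd df_id cset_cprod c)+
    then show ?thesis
    proof (rule dp_congI)
      fix w assume w: "w \<in> car (Z \<times>\<^sub>c (X \<times>\<^sub>c K))"
      have "fst (snd (fst w)) \<subseteq> car X" using w carZ[of "fst w"] HFs_sub[of "fst (snd (fst w))" X] by auto
      then show "snd w \<in> H (fst w) \<longleftrightarrow> (fst (snd w) \<in> fst (snd (fst w)) \<and> snd (snd w) \<in> fst (snd (snd (fst w)))) \<and>
      v (fst (fst w)) (snd w) \<in> snd (snd (snd (fst w))) \<and>
      (\<forall>z\<in>car (X \<times>\<^sub>c K). \<forall>z'\<in>car (X \<times>\<^sub>c K). fst z \<in> fst (snd (fst w)) \<and> snd z \<in> fst (snd (snd (fst w))) \<and>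
         fst z' \<in> fst (snd (fst w)) \<and> snd z' \<in> fst (snd (snd (fst w))) \<and> v (fst (fst w)) z = v (fst (fst w)) z' \<longrightarrow> z = z')"
        unfolding H_def car_cprod car_Kc by (simp add: inj_box mem_Times_iff)
    qed
  qed
  have emp: "\<exists>z\<in>car Z. H z = {}"
  proof -
    obtain p where p: "p \<in> car L \<times> (UNIV :: 'k set)" using inj[OF HFs_empty[OF X] HFs_empty[OF hp_K]] by blast
    show ?thesis
      by (rule bexI[of _ "(p, {}, {}, {})"]) (use p HFs_empty[OF X] HFs_empty[OF hp_K] in \<open>auto simp: H_def carZ\<close>)
  qed
  have ins: "\<exists>z'\<in>car Z. H z' = insert x (H z)" if zx: "z \<in> car Z" "x \<in> car (X \<times>\<^sub>c K)" for z x
  proof -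
    obtain p A B C where z': "z = (p, A, B, C)" by (metis prod.collapse)
    obtain x1 x2 where x: "x = (x1, x2)" by fastforce
    note W = zx(1)[unfolded z' carZ, simplified]
    have A': "insert x1 A \<in> HFs X" and B': "insert x2 B \<in> HFs K"
      using W zx(2) x HFs_insert[OF X] HFs_insert[OF hp_K] by auto
    \<comment> \<open>The old projection may identify points of the enlarged box, so another one is
      chosen and the image is recomputed.\<close>
    obtain p' where p': "p' \<in> car L \<times> UNIV" "inj_on (v p') (insert x1 A \<times> insert x2 B)" using inj[OF A' B'] by blast
    have pL: "p \<in> car (L \<times>\<^sub>c K)" "p' \<in> car (L \<times>\<^sub>c K)" using W p' by (auto simp: mem_Times_iff)
    define T where "T = insert x (H z)"
    have TAB: "T \<subseteq> insert x1 A \<times> insert x2 B" unfolding T_def H_def z' x by auto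
    have img: "v p' ` T \<in> HFs K"
    proof (rule HFs_subset[OF hp_K])
      have "v p' ` (insert x1 A \<times> insert x2 B) \<in> HFs K"
        by (rule HFs_image2[OF X hp_K hp_K _ A' B'], rule df_comp2[OF vd], rule df_const)
          (rule c cset_cprod df_id pL)+
      then show "v p' ` (insert x1 A \<times> insert x2 B) \<in> HFs K" .
      show "v p' ` T \<subseteq> v p' ` (insert x1 A \<times> insert x2 B)" using TAB by blast
      have "dp K (\<lambda>y. \<exists>t\<in>car (X \<times>\<^sub>c K). (t = x \<or> t \<in> H z) \<and> y = v p' t)"
        by (rule dp_bex dp_conj dp_disj dp_eq_K df_comp2[OF vd] df_const[OF _ _ pL(2)] df_const[OF _ _ zx(2)] df_const[OF _ _ zx(1)]
            dp_comp2[where P = "\<lambda>w t. t \<in> H w", OF mem] dp_eq[where Y = "X \<times>\<^sub>c K"] df_fst df_snd df_id cset_cprod c cZ)+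
      then show "dp K (\<lambda>y. y \<in> v p' ` T)"
        by (rule dp_congI) (use sub[OF zx(1)] zx(2) in \<open>auto simp: T_def\<close>)
    qed
    have "z \<in> T" if z: "z \<in> insert x1 A \<times> insert x2 B" "v p' z \<in> v p' ` T" for z
    proof -
      obtain t where t: "t \<in> T" "v p' z = v p' t" using z(2) by blast
      then have "z = t" using inj_onD[OF p'(2) t(2) z(1)] TAB by blast
      then show ?thesis using t by simp
    qed
    then have "H (p', insert x1 A, insert x2 B, v p' ` T) = T"
      unfolding H_def fst_conv snd_conv using p'(2) TAB by blast
    moreover have "(p', insert x1 A, insert x2 B, v p' ` T) \<in> car Z"
      unfolding carZ using p' A' B' img by auto
    ultimately show ?thesis unfolding T_def by blast
  qed
  have cXK: "cset (X \<times>\<^sub>c K)" by (simp add: c)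
  show hpXK: "hp (X \<times>\<^sub>c K)"
  proof (rule hpI[where Z = Z and h = H])
    fix Q w assume Q: "dp Z (\<lambda>z. Q (H z))" "Q {}"
      "\<And>z x. z \<in> car Z \<Longrightarrow> x \<in> car (X \<times>\<^sub>c K) \<Longrightarrow> Q (H z) \<Longrightarrow> Q (insert x (H z))" "w \<in> car Z"
    show "Q (H w)" by (rule ind[of Q w]) (use Q in blast)+
  qed (rule cXK cZ sub mem emp ins, assumption?)+
  have HF: "HFs (X \<times>\<^sub>c K) = H ` car Z"
  proof (rule HFs_eqI[where Z = Z and h = H])
    fix Q w assume Q: "dp Z (\<lambda>z. Q (H z))" "Q {}"
      "\<And>z x. z \<in> car Z \<Longrightarrow> x \<in> car (X \<times>\<^sub>c K) \<Longrightarrow> Q (H z) \<Longrightarrow> Q (insert x (H z))" "w \<in> car Z"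
    show "Q (H w)" by (rule ind[of Q w]) (use Q in blast)+
  qed (rule cXK cZ sub mem emp ins, assumption?)+
  have "\<exists>p\<in>car (L \<times>\<^sub>c K). inj_on (v p) S" if "S \<in> HFs (X \<times>\<^sub>c K)" for S
  proof -
    obtain w where w: "w \<in> car Z" "S = H w" using \<open>S \<in> HFs (X \<times>\<^sub>c K)\<close> unfolding HF by blast
    obtain p where "p \<in> car L \<times> UNIV" "inj_on (v p) (fst (snd w) \<times> fst (snd (snd w)))"
      using inj w(1) unfolding carZ by blast
    moreover have "S \<subseteq> fst (snd w) \<times> fst (snd (snd w))" unfolding w(2) H_def by blast
    ultimately show ?thesis by (auto intro: inj_on_subset)
  qed
  then show "sepfam (L \<times>\<^sub>c K) (X \<times>\<^sub>c K) (\<lambda>p z. h (fst p) (fst z) + snd p * snd z)"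
    unfolding sepfam_def using vd unfolding v_def by blast
qed

text \<open>The identity of K separates points, and each application of \<open>hp_prod_K\<close> and
  \<open>sepfam_prod_K\<close> adds one dimension. Dimension three serves
  \<open>Fin (K \<times>\<^sub>c K)\<close>, where families of sets of pairs are indexed by a
  further coordinate.\<close>

lemma hp_KK: "hp (K \<times>\<^sub>c K)" and hp_KKK: "hp ((K \<times>\<^sub>c K) \<times>\<^sub>c K)"
proof -
  have 0: "sepfam K K (\<lambda>l x. x)" 
  proof -
    have "df (K \<times>\<^sub>c K) K (\<lambda>z. snd z)" by (rule df_snd df_id cset_cprod cset_Kc)+
    then show ?thesis unfolding sepfam_def by auto
  qed
  show 1: "hp (K \<times>\<^sub>c K)" by (rule hp_prod_K[OF hp_K cset_Kc 0])
  show "hp ((K \<times>\<^sub>c K) \<times>\<^sub>c K)"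
    by (rule hp_prod_K[OF 1 _ sepfam_prod_K[OF hp_K cset_Kc 0]]) (simp add: cset_Kc)
qed

text \<open>A hyperfinite family of hyperfinite subsets of \<open>X\<close> is coded as an indexed family \<open>(S\<^sub>i)\<^sub>i\<^sub>\<in>\<^sub>I\<close> with \<open>S \<subseteq> X \<times> K\<close>.\<close>

lemma hp_Fin_of_prod:
  assumes X: "hp X" and XK: "hp (X \<times>\<^sub>c K)"
  shows "hp (Fin X)"
proof -
  note c = hp_cset[OF X] cset_Fin[OF X] cset_Kc cset_Fin[OF hp_K] hp_cset[OF XK] cset_Fin[OF XK]
  define Z where "Z = Fin K \<times>\<^sub>c Fin (X \<times>\<^sub>c K)"
  define sl where "sl S i = {x \<in> car X. (x, i) \<in> S}" for S :: "('a \<times> 'k) set" and i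
  define h where "h w = sl (snd w) ` fst w" for w
  have cZ: "cset Z" unfolding Z_def by (simp add: c)
  have carZ: "w \<in> car Z \<longleftrightarrow> fst w \<in> HFs K \<and> snd w \<in> HFs (X \<times>\<^sub>c K)" for w
    unfolding Z_def by (cases w) auto
  have sl: "sl S i \<in> HFs X" if "S \<in> HFs (X \<times>\<^sub>c K)" for S i
  proof -
    have "{z \<in> S. snd z = i} \<in> HFs (X \<times>\<^sub>c K)"
      by (rule HFs_sep[OF XK that]) (rule dfn c)+
    then have "fst ` {z \<in> S. snd z = i} \<in> HFs X"
      by (rule HFs_image[OF XK X, rotated]) (rule df_fst df_id c)+
    moreover have "fst ` {z \<in> S. snd z = i} = sl S i" unfolding sl_def using HFs_sub[OF that] by force
    ultimately show ?thesis by simp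
  qed
  have sub: "h z \<subseteq> car (Fin X)" if "z \<in> car Z" for z
    using that sl unfolding h_def carZ by auto
  have mem: "dp (Z \<times>\<^sub>c Fin X) (\<lambda>w. snd w \<in> h (fst w))"
  proof -
    have "dp (Z \<times>\<^sub>c Fin X) (\<lambda>w. \<exists>i. i \<in> fst (fst w) \<and> (\<forall>x\<in>car X. x \<in> snd w \<longleftrightarrow> (x, i) \<in> snd (fst w)))"
      unfolding Z_def
      by (rule dp_ex_K dp_ball dp_conj dp_iff dp_inI[OF X] dp_inI[OF hp_K] dp_inI[OF XK] df_Pair df_fst df_snd df_id cset_cprod c)+
    then show ?thesis
    proof (rule dp_congI)
      fix w assume w: "w \<in> car (Z \<times>\<^sub>c Fin X)"
      then have "snd w \<subseteq> car X" using HFs_sub[of "snd w" X] by auto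
      then show "snd w \<in> h (fst w) \<longleftrightarrow> (\<exists>i. i \<in> fst (fst w) \<and> (\<forall>x\<in>car X. x \<in> snd w \<longleftrightarrow> (x, i) \<in> snd (fst w)))"
        unfolding h_def sl_def by auto
    qed
  qed
  have emp: "\<exists>z\<in>car Z. h z = {}"
    by (rule bexI[of _ "({}, {})"]) (use HFs_empty[OF XK] HFs_empty[OF hp_K] in \<open>auto simp: h_def carZ\<close>)
  have ins: "\<exists>z'\<in>car Z. h z' = insert T (h z)" if zx: "z \<in> car Z" "T \<in> car (Fin X)" for z T
  proof -
    obtain I S where z': "z = (I, S)" by fastforce
    note W = zx(1)[unfolded z' carZ, simplified]
    have "snd ` S \<in> HFs K" by (rule HFs_image[OF XK hp_K _ conjunct2[OF W]]) (rule df_snd df_id c)+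
    \<comment> \<open>The index is new both for \<open>I\<close> and for \<open>S\<close>: the slice
      at \<open>i\<close> will be exactly \<open>T\<close>, and the slices at indices in
      \<open>I\<close> stay as they were.\<close>
    then obtain i where i: "i \<notin> I \<union> snd ` S" using HFs_Un[OF hp_K, of I] ex_new W by blast
    have T: "T \<in> HFs X" "T \<subseteq> car X" using zx(2) HFs_sub[of T X] by auto
    have "df X (X \<times>\<^sub>c K) (\<lambda>x. (x, i))" by (rule dfn c)+
    then have "(\<lambda>x. (x, i)) ` T \<in> HFs (X \<times>\<^sub>c K)" by (rule HFs_image[OF X XK _ T(1)])
    then have S': "S \<union> (\<lambda>x. (x, i)) ` T \<in> HFs (X \<times>\<^sub>c K)" using HFs_Un[OF XK] W by blast
    have "sl (S \<union> (\<lambda>x. (x, i)) ` T) i = T" using i T(2) unfolding sl_def by force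
    moreover have "sl (S \<union> (\<lambda>x. (x, i)) ` T) j = sl S j" if "j \<in> I" for j using i that unfolding sl_def by auto
    ultimately have "h (insert i I, S \<union> (\<lambda>x. (x, i)) ` T) = insert T (h z)" unfolding h_def z' by simp
    moreover have "(insert i I, S \<union> (\<lambda>x. (x, i)) ` T) \<in> car Z" unfolding carZ using S' W HFs_insert[OF hp_K] by simp
    ultimately show ?thesis by blast
  qed
  have ind: "Q (h w)" if Q: "dp Z (\<lambda>z. Q (h z))" "Q {}"
    and st: "\<And>z x. z \<in> car Z \<Longrightarrow> x \<in> car (Fin X) \<Longrightarrow> Q (h z) \<Longrightarrow> Q (insert x (h z))" and w: "w \<in> car Z" for Q w
  proof -
    obtain I S where w': "w = (I, S)" by fastforce
    note W = w[unfolded w' carZ, simplified]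
    have "Q (h (I, S))"
      using conjunct1[OF W]
    proof (rule HFs_induct[OF hp_K, where P = "\<lambda>I. Q (h (I, S))"])
      have "df (Fin K) Z (\<lambda>I. (I, S))" unfolding Z_def by (rule df_Pair df_const df_id c | use W in force)+
      from dp_comp[OF Q(1) this] show "dp (Fin K) (\<lambda>I. Q (h (I, S)))" .
      show "Q (h ({}, S))" unfolding h_def using Q(2) by simp
      fix i I assume "I \<in> HFs K" "Q (h (I, S))"
      then have "Q (insert (sl S i) (h (I, S)))" using st[of "(I, S)" "sl S i"] sl W carZ by simp
      then show "Q (h (insert i I, S))" unfolding h_def by simp
    qed
    then show ?thesis unfolding w' .
  qed
  show ?thesis
  proof (rule hpI[where Z = Z and h = h])
    fix Q w assume Q: "dp Z (\<lambda>z. Q (h z))" "Q {}"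
      "\<And>z x. z \<in> car Z \<Longrightarrow> x \<in> car (Fin X) \<Longrightarrow> Q (h z) \<Longrightarrow> Q (insert x (h z))" "w \<in> car Z"
    show "Q (h w)" by (rule ind[of Q w]) (use Q in blast)+
  qed (rule c(2) cZ sub mem emp ins, assumption?)+
qed

end

subsection \<open>Every definable set has a definable finite power set\<close>

context kfield
begin

lemma hdp_all_less:
  fixes m :: nat
  assumes "\<And>i. i < m \<Longrightarrow> hdp a b (P i)"
  shows "hdp a b (\<lambda>xs Bs. \<forall>i<m. P i xs Bs)"
  using assms
proof (induction m)
  case 0
  then show ?case using hdp_True by simp
next
  case (Suc m)
  have "hdp a b (\<lambda>xs Bs. (\<forall>i<m. P i xs Bs) \<and> P m xs Bs)" by (rule hdp_conj) (use Suc in auto)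
  then show ?case by (rule hdp_eqI) (auto simp: less_Suc_eq)
qed

definition Tc :: "nat \<Rightarrow> nat \<Rightarrow> (('k, 'f) tup, 'k, 'f) coded" where
  "Tc a b = ({t. length (fst t) = a \<and> length (snd t) = b}, \<lambda>t. {t})"

lemma car_Tc: "car (Tc a b) = {t. length (fst t) = a \<and> length (snd t) = b}" and cod_Tc: "cod (Tc a b) t = {t}"
  by (simp_all add: Tc_def)

lemma arity_Tc: "arity (Tc a b) a b"
  unfolding arity_def
proof (intro conjI)
  show "hdp a b (\<lambda>xs Bs. \<exists>x\<in>car (Tc a b). (xs, Bs) \<in> cod (Tc a b) x)"
    using hdp_True by (rule hdp_eqI) (auto simp: car_Tc cod_Tc)
  have 1: "hdp (a + a) (b + b) (\<lambda>xs Bs. xs ! i = xs ! (a + i))" for i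
    by (rule hdp_fm[where \<phi> = "KEq (KVar i) (KVar (a + i))"]) simp
  have 2: "hdp (a + a) (b + b) (\<lambda>xs Bs. Bs ! i = Bs ! (b + i))" for i
    by (rule hdp_fm[where \<phi> = "FEq (FVar i) (FVar (b + i))"]) simp
  have "hdp (a + a) (b + b) (\<lambda>xs Bs. (\<forall>i<a. xs ! i = xs ! (a + i)) \<and> (\<forall>i<b. Bs ! i = Bs ! (b + i)))"
    by (intro hdp_conj hdp_all_less 1 2)
  then show "hdp (a + a) (b + b) (\<lambda>xs Bs. \<exists>x\<in>car (Tc a b). (take a xs, take b Bs) \<in> cod (Tc a b) x \<and> (drop a xs, drop b Bs) \<in> cod (Tc a b) x)"
    by (rule hdp_eqI) (auto simp: car_Tc cod_Tc list_eq_iff_nth_eq)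
qed (auto simp: car_Tc cod_Tc)

lemma Tc_SucE1:
  assumes "t \<in> car (Tc (Suc a) b)"
  obtains xs x Bs where "t = (xs @ [x], Bs)" "length xs = a" "length Bs = b"
proof -
  have "length (fst t) = Suc a" "length (snd t) = b" using assms by (auto simp: car_Tc)
  then show thesis using that[of "butlast (fst t)" "last (fst t)" "snd t"]
    by (metis append_butlast_last_id diff_Suc_1 length_0_conv length_butlast nat.distinct(1) prod.collapse)
qed

lemma Tc_SucE2:
  assumes "t \<in> car (Tc a (Suc b))"
  obtains xs C Bs where "t = (xs, Bs @ [C])" "length xs = a" "length Bs = b"
proof -
  have "length (snd t) = Suc b" "length (fst t) = a" using assms by (auto simp: car_Tc)
  then show thesis using that[of "fst t" "butlast (snd t)" "last (snd t)"]
    by (metis append_butlast_last_id diff_Suc_1 length_0_conv length_butlast nat.distinct(1) prod.collapse)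
qed

lemma cset_Tc: "cset (Tc a b)"
  using arity_Tc cset_iff_arity by blast

end

context hyperfield
begin

lemma fext_HFs: "fext B \<in> HFs K"
  by (simp add: HFs_K)

lemma K0_0: "0 \<in> K0" and K0_Suc: "x \<in> K0 \<Longrightarrow> x + 1 \<in> K0"
proof -
  obtain B where B: "fext B = {0}" using HFs_insert[OF hp_K _ HFs_empty[OF hp_K], of 0] unfolding HFs_K by auto
  show "0 \<in> K0" unfolding K0_def using B by (auto simp: fext_def)
  assume "x \<in> K0"
  then obtain F where F: "mem x F" "\<forall>z. mem z F \<longrightarrow> z \<noteq> 0 \<longrightarrow> mem (z - 1) F" unfolding K0_def by blast
  obtain G where G: "fext G = insert (x + 1) (fext F)" using HFs_insert[OF hp_K _ fext_HFs, of "x + 1" F] unfolding HFs_K by (metis UNIV_I car_Kc imageE)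
  have "mem z G \<longleftrightarrow> z = x + 1 \<or> mem z F" for z using G unfolding fext_def by auto
  then show "x + 1 \<in> K0" unfolding K0_def using F by (intro CollectI exI[of _ G]) auto
qed

lemma of_nat_K0: "of_nat m \<in> K0"
proof (induction m)
  case (Suc m)
  then show ?case using K0_Suc[of "of_nat m"] by (simp add: add.commute)
qed (simp add: K0_0)

text \<open>An equality between distinct numerals would make - 1 an \<open>of_nat\<close>, hence an
  element of \<open>K0\<close>. The numerals serve as labels of positions in a tuple.\<close>

lemma of_nat_eq_K: "(of_nat m :: 'k) = of_nat n \<longleftrightarrow> m = n"
proof -
  have "m = n" if e: "(of_nat m :: 'k) = of_nat n" and le: "m \<le> n" for m n
  proof (rule ccontr)
    assume "m \<noteq> n"
    then obtain d where d: "n = m + Suc d" using le by (metis add_Suc_right le_neq_implies_less less_imp_Suc_add)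
    then have "(of_nat (Suc d) :: 'k) = 0" using e by simp
    then have "of_nat d = (- 1 :: 'k)" by (simp add: eq_neg_iff_add_eq_0 add.commute)
    then show False using of_nat_K0[of d] char_zero unfolding definable_char_zero_def by simp
  qed
  then show ?thesis by (metis nle_le)
qed

text \<open>A tuple becomes a union of labelled pieces: {j} times {x} for a field entry x, and {j}
  times the extension of B for an entry B of the second sort. The last conjunct bounds the labels in
  use, so the label of the next entry is free and every piece can be recovered from the
  union.\<close>

lemma tuple_embedding:
  "\<exists>e. df (Tc a b) (Fin (K \<times>\<^sub>c K)) e \<and> inj_on e (car (Tc a b)) \<and>
     (\<forall>t\<in>car (Tc a b). \<forall>z\<in>e t. \<exists>j<a + b. fst z = of_nat j)"
proof (induction b)
  case 0
  show ?case
  proof (induction a)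
    case 0
    show ?case
      by (rule exI[of _ "\<lambda>_. {}"])
        (auto simp: car_Tc inj_on_def HFs_empty[OF hp_KK] intro!: df_const cset_Tc cset_Fin[OF hp_KK])
  next
    case (Suc a)
    then obtain e where e: "df (Tc a 0) (Fin (K \<times>\<^sub>c K)) e" "inj_on e (car (Tc a 0))"
      "\<forall>t\<in>car (Tc a 0). \<forall>z\<in>e t. \<exists>j<a + 0. fst z = of_nat j" by blast
    define \<delta> where "\<delta> t = ((butlast (fst t), snd t), last (fst t))" for t :: "('k, 'f) tup"
    have \<delta>: "df (Tc (Suc a) 0) (Tc a 0 \<times>\<^sub>c K) \<delta>"
    proof (rule df_recode[OF cset_Tc cset_cprod[OF cset_Tc cset_Kc]])
      fix t assume "t \<in> car (Tc (Suc a) 0)"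
      then show "\<delta> t \<in> car (Tc a 0 \<times>\<^sub>c K) \<and> cod (Tc a 0 \<times>\<^sub>c K) (\<delta> t) = cod (Tc (Suc a) 0) t"
        by (rule Tc_SucE1) (simp add: \<delta>_def cod_Tc car_Tc pr_def tcat_def kel_def)
    qed
    have \<delta>inj: "t = t'" if "t \<in> car (Tc (Suc a) 0)" "t' \<in> car (Tc (Suc a) 0)" "\<delta> t = \<delta> t'" for t t'
      by (rule Tc_SucE1[OF that(1)], rule Tc_SucE1[OF that(2)]) (use that(3) in \<open>simp add: \<delta>_def\<close>)
    define e' where "e' w = insert (of_nat a, snd w) (e (fst w))" for w
    note c = cset_Tc cset_Kc cset_Fin[OF hp_KK]
    have e'car: "e' w \<in> HFs (K \<times>\<^sub>c K)" if "w \<in> car (Tc a 0 \<times>\<^sub>c K)" for w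
      unfolding e'_def by (rule HFs_insert[OF hp_KK]) (use df_mem[OF e(1), of "fst w"] that in auto)
    have e': "df (Tc a 0 \<times>\<^sub>c K) (Fin (K \<times>\<^sub>c K)) e'"
    proof (rule df_Fin[OF hp_KK])
      have "dp ((Tc a 0 \<times>\<^sub>c K) \<times>\<^sub>c (K \<times>\<^sub>c K)) (\<lambda>w. snd w = (of_nat a, snd (fst w)) \<or> snd w \<in> e (fst (fst w)))"
        by (rule dp_disj dp_inI[OF hp_KK] dp_eq[where Y = "K \<times>\<^sub>c K"] df_Pair df_const_K df_comp[OF e(1)] df_fst df_snd df_id cset_cprod c)+
      then show "dp ((Tc a 0 \<times>\<^sub>c K) \<times>\<^sub>c (K \<times>\<^sub>c K)) (\<lambda>w. snd w \<in> e' (fst w))" by (simp add: e'_def)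
    qed (use e'car c in auto)
    have inj': "w = w'" if w: "w \<in> car (Tc a 0 \<times>\<^sub>c K)" "w' \<in> car (Tc a 0 \<times>\<^sub>c K)" "e' w = e' w'" for w w'
    proof -
      have no: "(of_nat a, y) \<notin> e (fst w)" if "w \<in> car (Tc a 0 \<times>\<^sub>c K)" for w y
        using e(3) that by (force simp: of_nat_eq_K)
      have "(of_nat a, snd w) \<in> e' w'" using w(3) unfolding e'_def by auto
      then have 1: "snd w = snd w'" using no[OF w(2)] unfolding e'_def by auto
      have "e (fst w) = e' w - {(of_nat a, snd w)}" "e (fst w') = e' w' - {(of_nat a, snd w')}"
        using no w unfolding e'_def by auto
      then have "e (fst w) = e (fst w')" using 1 w(3) by simp
      then have "fst w = fst w'" by (rule inj_onD[OF e(2)]) (use w in auto)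
      then show ?thesis using 1 by (simp add: prod_eq_iff)
    qed
    show ?case
    proof (intro exI[of _ "\<lambda>t. e' (\<delta> t)"] conjI)
      show "df (Tc (Suc a) 0) (Fin (K \<times>\<^sub>c K)) (\<lambda>t. e' (\<delta> t))" by (rule df_comp[OF e' \<delta>])
      show "inj_on (\<lambda>t. e' (\<delta> t)) (car (Tc (Suc a) 0))"
        by (rule inj_onI) (use inj' \<delta>inj df_mem[OF \<delta>] in blast)
      show "\<forall>t\<in>car (Tc (Suc a) 0). \<forall>z\<in>e' (\<delta> t). \<exists>j<Suc a + 0. fst z = of_nat j"
      proof (intro ballI)
        fix t z assume "t \<in> car (Tc (Suc a) 0)" and z: "z \<in> e' (\<delta> t)"
        then have "fst (\<delta> t) \<in> car (Tc a 0)" using df_mem[OF \<delta>] by (metis car_cprod mem_Times_iff)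
        then have "fst z = of_nat a \<or> (\<exists>j<a. fst z = of_nat j)" using e(3) z unfolding e'_def by auto
        then show "\<exists>j<Suc a + 0. fst z = of_nat j" using less_Suc_eq by auto
      qed
    qed
  qed
next
  case (Suc b)
  then obtain e where e: "df (Tc a b) (Fin (K \<times>\<^sub>c K)) e" "inj_on e (car (Tc a b))"
    "\<forall>t\<in>car (Tc a b). \<forall>z\<in>e t. \<exists>j<a + b. fst z = of_nat j" by blast
  define \<delta> where "\<delta> t = ((fst t, butlast (snd t)), last (snd t))" for t :: "('k, 'f) tup"
  have \<delta>: "df (Tc a (Suc b)) (Tc a b \<times>\<^sub>c Fc) \<delta>"
  proof (rule df_recode[OF cset_Tc cset_cprod[OF cset_Tc cset_Fc]])
    fix t assume "t \<in> car (Tc a (Suc b))"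
    then show "\<delta> t \<in> car (Tc a b \<times>\<^sub>c Fc) \<and> cod (Tc a b \<times>\<^sub>c Fc) (\<delta> t) = cod (Tc a (Suc b)) t"
      by (rule Tc_SucE2) (simp add: \<delta>_def cod_Tc car_Tc pr_def tcat_def fel_def)
  qed
  have \<delta>inj: "t = t'" if "t \<in> car (Tc a (Suc b))" "t' \<in> car (Tc a (Suc b))" "\<delta> t = \<delta> t'" for t t'
    by (rule Tc_SucE2[OF that(1)], rule Tc_SucE2[OF that(2)]) (use that(3) in \<open>simp add: \<delta>_def\<close>)
  define e' where "e' w = e (fst w) \<union> Pair (of_nat (a + b)) ` fext (snd w)" for w
  note c = cset_Tc cset_Kc cset_Fc cset_Fin[OF hp_KK]
  have e'car: "e' w \<in> HFs (K \<times>\<^sub>c K)" if "w \<in> car (Tc a b \<times>\<^sub>c Fc)" for w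
    unfolding e'_def
  proof (rule HFs_Un[OF hp_KK])
    show "e (fst w) \<in> HFs (K \<times>\<^sub>c K)" using df_mem[OF e(1), of "fst w"] that by auto
    show "Pair (of_nat (a + b)) ` fext (snd w) \<in> HFs (K \<times>\<^sub>c K)"
      by (rule HFs_image[OF hp_K hp_KK _ fext_HFs]) (rule dfn)+
  qed
  have e': "df (Tc a b \<times>\<^sub>c Fc) (Fin (K \<times>\<^sub>c K)) e'"
  proof (rule df_Fin[OF hp_KK])
    have "dp ((Tc a b \<times>\<^sub>c Fc) \<times>\<^sub>c (K \<times>\<^sub>c K)) (\<lambda>w. snd w \<in> e (fst (fst w)) \<or> fst (snd w) = of_nat (a + b) \<and> mem (snd (snd w)) (snd (fst w)))"
      by (rule dp_disj dp_conj dp_inI[OF hp_KK] dp_eq_K dp_memI df_Pair df_const_K df_comp[OF e(1)] df_fst df_snd df_id cset_cprod c)+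
    then show "dp ((Tc a b \<times>\<^sub>c Fc) \<times>\<^sub>c (K \<times>\<^sub>c K)) (\<lambda>w. snd w \<in> e' (fst w))"
      by (rule dp_congI) (auto simp: e'_def fext_def)
  qed (use e'car c HFs_sub in auto)
  have inj': "w = w'" if w: "w \<in> car (Tc a b \<times>\<^sub>c Fc)" "w' \<in> car (Tc a b \<times>\<^sub>c Fc)" "e' w = e' w'" for w w'
  proof -
    have no: "(of_nat (a + b), y) \<notin> e (fst w)" if "w \<in> car (Tc a b \<times>\<^sub>c Fc)" for w y
      using e(3) that by (force simp: of_nat_eq_K simp del: of_nat_add)
    have x: "fext (snd w) = {y. (of_nat (a + b), y) \<in> e' w}" "e (fst w) = e' w - {of_nat (a + b)} \<times> UNIV"
      if "w \<in> car (Tc a b \<times>\<^sub>c Fc)" for w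
      using no[OF that] unfolding e'_def by (auto simp del: of_nat_add)
    have "fext (snd w) = fext (snd w')" "e (fst w) = e (fst w')" using x[OF w(1)] x[OF w(2)] w(3) by simp_all
    moreover have "B = C" if "fext B = fext C" for B C
    proof -
      note F = fin_power_setD(3)[OF power_set_structure[unfolded is_power_set_structure_def], of "fel B" "fel C"]
      have "(fel B :: ('k, 'f) imag) = fel C"
        by (rule F) (use that in \<open>auto simp: kel_def fel_def fext_def\<close>)
      then show "B = C" by (simp add: fel_def)
    qed
    ultimately have "snd w = snd w'" "fst w = fst w'" using w e(2) by (auto dest: inj_onD)
    then show ?thesis by (simp add: prod_eq_iff)
  qed
  show ?case
  proof (intro exI[of _ "\<lambda>t. e' (\<delta> t)"] conjI)
    show "df (Tc a (Suc b)) (Fin (K \<times>\<^sub>c K)) (\<lambda>t. e' (\<delta> t))" by (rule df_comp[OF e' \<delta>])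
    show "inj_on (\<lambda>t. e' (\<delta> t)) (car (Tc a (Suc b)))"
      by (rule inj_onI) (use inj' \<delta>inj df_mem[OF \<delta>] in blast)
    show "\<forall>t\<in>car (Tc a (Suc b)). \<forall>z\<in>e' (\<delta> t). \<exists>j<a + Suc b. fst z = of_nat j"
    proof (intro ballI)
      fix t z assume "t \<in> car (Tc a (Suc b))" and z: "z \<in> e' (\<delta> t)"
      then have "fst (\<delta> t) \<in> car (Tc a b)" using df_mem[OF \<delta>] by (metis car_cprod mem_Times_iff)
      then have "fst z = of_nat (a + b) \<or> (\<exists>j<a + b. fst z = of_nat j)" using e(3) z unfolding e'_def by auto
      then show "\<exists>j<a + Suc b. fst z = of_nat j" by (metis add_Suc_right less_Suc_eq)
    qed
  qed
qed

text \<open>Tuples inherit a power set from \<open>Fin (K \<times>\<^sub>c K)\<close> by the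
  embedding, and a coded set is the image of a definable set of tuples under the map that sends a
  tuple to its class.\<close>

theorem hp_cset_iff: "hp X \<longleftrightarrow> cset X"
proof
  assume X: "cset X"
  then obtain a b where A: "arity X a b" using cset_iff_arity by blast
  note A' = arityD[OF A]
  obtain e where e: "df (Tc a b) (Fin (K \<times>\<^sub>c K)) e" "inj_on e (car (Tc a b))"
    using tuple_embedding by blast
  have hpT: "hp (Tc a b)" by (rule hp_inj[OF hp_Fin_of_prod[OF hp_KK hp_KKK] e])
  define S where "S = {t. \<exists>x\<in>car X. t \<in> cod X x}"
  define g where "g t = (THE x. x \<in> car X \<and> t \<in> cod X x)" for t
  have g: "g t = x" if "x \<in> car X" "t \<in> cod X x" for t x
    unfolding g_def using that A'(2) by (intro the_equality) blast+
  have lenS: "length (fst t) = a \<and> length (snd t) = b" if "t \<in> cod X x" "x \<in> car X" for t x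
    using A'(3)[of x "fst t" "snd t"] that by simp
  have S: "dp (Tc a b) (\<lambda>t. t \<in> S)" unfolding dp_iff_hdp[OF arity_Tc]
    by (rule hdp_eqI[OF A'(4)]) (auto simp: S_def car_Tc cod_Tc)
  have Ssub: "S \<subseteq> car (Tc a b)" using lenS by (auto simp: S_def car_Tc)
  have R: "dp (Tc a b \<times>\<^sub>c X) (\<lambda>z. fst z \<in> cod X (snd z))" unfolding dp_cprod_iff_hdp[OF arity_Tc A]
    by (rule hdp_eqI[OF A'(5)]) (auto simp: car_Tc cod_Tc, force)
  note i = df_sub_incl[OF S Ssub]
  show "hp X"
  proof (rule hp_sub_img[OF hpT S Ssub])
    show "df (S, cod (Tc a b)) X g"
    proof (rule df_graphI[where R = "\<lambda>t x. t \<in> cod X x"])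
      show "dp ((S, cod (Tc a b)) \<times>\<^sub>c X) (\<lambda>z. fst z \<in> cod X (snd z))"
        by (rule dp_comp2[OF R] df_comp[OF i] df_fst df_snd df_id cset_cprod df_cset(1)[OF i] X)+
    qed (use X df_cset(1)[OF i] g in \<open>auto simp: S_def\<close>)
    show "g ` S = car X"
    proof
      show "g ` S \<subseteq> car X" using g by (auto simp: S_def)
      show "car X \<subseteq> g ` S"
      proof
        fix x assume x: "x \<in> car X"
        then obtain t where "t \<in> cod X x" using A'(1) by blast
        then show "x \<in> g ` S" using g[OF x] x unfolding S_def by (metis (mono_tags, lifting) CollectI image_eqI)
      qed
    qed
  qed
qed (rule hp_cset)

lemma cset_FinI [simp, dfn]: "cset X \<Longrightarrow> cset (Fin X)"
  using cset_Fin hp_cset_iff by blast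

lemma dp_in: "cset X \<Longrightarrow> df W X f \<Longrightarrow> df W (Fin X) S \<Longrightarrow> dp W (\<lambda>w. f w \<in> S w)"
  using dp_inI hp_cset_iff by blast

lemma dp_in_K [dfn]: "df W K f \<Longrightarrow> df W (Fin K) S \<Longrightarrow> dp W (\<lambda>w. f w \<in> S w)"
  by (rule dp_in[OF cset_Kc])

lemmas HFs_empty' = HFs_empty[unfolded hp_cset_iff] and HFs_insert' = HFs_insert[unfolded hp_cset_iff]
  and HFs_induct' = HFs_induct[unfolded hp_cset_iff] and dp_HFs' = dp_HFs[unfolded hp_cset_iff]
  and df_Fin' = df_Fin[unfolded hp_cset_iff] and HFs_sep' = HFs_sep[unfolded hp_cset_iff]
  and HFs_subset'' = HFs_subset[unfolded hp_cset_iff] and HFs_image' = HFs_image[unfolded hp_cset_iff]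
  and HFs_Un' = HFs_Un[unfolded hp_cset_iff] and HFs_diff' = HFs_subset'(1)[unfolded hp_cset_iff]
  and dp_in_set' = dp_in_set[unfolded hp_cset_iff]

text \<open>Hyperfiniteness depends neither on the ambient set nor on its codes. The definitions of
  sequences and polynomials measure it in products that vary with \<open>n\<close> and
  \<open>R\<close>; this moves them all to \<open>K \<times>\<^sub>c K\<close> and
  \<open>Sc \<times>\<^sub>c K\<close>.\<close>

lemma HFs_recode:
  assumes i: "df X Y (\<lambda>x. x)"
  shows "HFs X = {S \<in> HFs Y. S \<subseteq> car X}"
proof -
  note c = df_cset[OF i]
  have "S \<in> HFs Y \<and> S \<subseteq> car X" if "S \<in> HFs X" for S
    using HFs_image'[OF c i that] HFs_sub[OF that] by simp
  moreover have "S \<inter> car X \<in> HFs X" if "S \<in> HFs Y" for S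
    using that
  proof (rule HFs_induct'[OF c(2)])
    show "dp (Fin Y) (\<lambda>S. S \<inter> car X \<in> HFs X)"
    proof (rule dp_HFs'[OF c(1)])
      have "dp (Fin Y \<times>\<^sub>c X) (\<lambda>w. snd w \<in> fst w)"
        by (rule dp_in[OF c(2)] df_comp[OF i] df_snd df_fst df_id cset_cprod cset_FinI c)+
      then show "dp (Fin Y \<times>\<^sub>c X) (\<lambda>w. snd w \<in> fst w \<inter> car X)" by (rule dp_congI) auto
    qed (use c in auto)
    fix x S assume "S \<inter> car X \<in> HFs X"
    then show "insert x S \<inter> car X \<in> HFs X" using HFs_insert'[OF c(1)] by (cases "x \<in> car X") auto
  qed (simp add: HFs_empty'[OF c(1)])
  ultimately show ?thesis by (metis (no_types, lifting) Collect_cong Collect_mem_eq inf.absorb1)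
qed

section \<open>Non-standard natural numbers\<close>

lemma dp_K0 [dfn]: "df W K f \<Longrightarrow> dp W (\<lambda>w. f w \<in> K0)"
proof -
  have "dp K (\<lambda>x. \<exists>F. mem x F \<and> (\<forall>z. mem z F \<longrightarrow> \<not> z = 0 \<longrightarrow> mem (z - 1) F))" by (rule dfn)+
  then have "dp K (\<lambda>x. x \<in> K0)" unfolding K0_def by simp
  then show "df W K f \<Longrightarrow> dp W (\<lambda>w. f w \<in> K0)" by (rule dp_comp)
qed

lemma K0_I: "F \<in> HFs K \<Longrightarrow> x \<in> F \<Longrightarrow> (\<And>z. z \<in> F \<Longrightarrow> z \<noteq> 0 \<Longrightarrow> z - 1 \<in> F) \<Longrightarrow> x \<in> K0"
  unfolding HFs_K K0_def fext_def by auto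

lemma K0_E:
  assumes "x \<in> K0"
  obtains F where "F \<in> HFs K" "x \<in> F" "\<And>z. z \<in> F \<Longrightarrow> z \<noteq> 0 \<Longrightarrow> z - 1 \<in> F" "F \<subseteq> K0"
proof -
  obtain B where B: "mem x B" "\<forall>z. mem z B \<longrightarrow> z \<noteq> 0 \<longrightarrow> mem (z - 1) B" using assms unfolding K0_def by blast
  then have "fext B \<subseteq> K0" unfolding K0_def fext_def by blast
  then show thesis using that[of "fext B"] B fext_HFs unfolding fext_def by blast
qed

lemma neg_1_not_K0: "- 1 \<notin> K0"
  using char_zero by (simp add: definable_char_zero_def)

text \<open>The failures of \<open>P\<close> inside a witness \<open>F\<close> for \<open>k\<close>
  are closed under predecessor without exception, since 0 is not among them. Translated by - k they
  contain 0 and therefore - 1, so they would witness \<open>- 1 \<in> K0\<close>.\<close>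

lemma N_induct [consumes 1]:
  assumes k: "k \<in> NN" and P: "dp K P" and 0: "P 0" and Suc: "\<And>i. i \<in> NN \<Longrightarrow> P i \<Longrightarrow> P (i + 1)"
  shows "P k"
proof (rule ccontr)
  assume nP: "\<not> P k"
  obtain F where F: "F \<in> HFs K" "k \<in> F" "\<And>z. z \<in> F \<Longrightarrow> z \<noteq> 0 \<Longrightarrow> z - 1 \<in> F" "F \<subseteq> K0" using K0_E[OF k] by blast
  have F1: "{z \<in> F. \<not> P z} \<in> HFs K" by (rule HFs_sep'[OF cset_Kc F(1) dp_not[OF P]])
  have pred: "z - 1 \<in> {z \<in> F. \<not> P z}" if "z \<in> {z \<in> F. \<not> P z}" for z
  proof -
    have "z \<noteq> 0" using that 0 by auto
    then have "z - 1 \<in> F" using F(3) that by blast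
    then show ?thesis using Suc[of "z - 1"] that F(4) by auto
  qed
  have "- 1 \<in> K0"
  proof (rule K0_I)
    show F2: "(\<lambda>z. z - k) ` {z \<in> F. \<not> P z} \<in> HFs K"
      by (rule HFs_image'[OF cset_Kc cset_Kc _ F1]) (rule dfn)+
    have st: "y - 1 \<in> (\<lambda>z. z - k) ` {z \<in> F. \<not> P z}" if y: "y \<in> (\<lambda>z. z - k) ` {z \<in> F. \<not> P z}" for y
    proof -
      obtain z where z: "z \<in> {z \<in> F. \<not> P z}" "y = z - k" using y by blast
      then show ?thesis using pred[OF z(1)] by (intro image_eqI[of _ _ "z - 1"]) auto
    qed
    show "z - 1 \<in> (\<lambda>z. z - k) ` {z \<in> F. \<not> P z}" if "z \<in> (\<lambda>z. z - k) ` {z \<in> F. \<not> P z}" for z using st that .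
    have "0 \<in> (\<lambda>z. z - k) ` {z \<in> F. \<not> P z}" using F(2) nP by force
    from st[OF this] show "- 1 \<in> (\<lambda>z. z - k) ` {z \<in> F. \<not> P z}" by simp
  qed
  then show False using neg_1_not_K0 by simp
qed

lemmas N_0 = K0_0 and N_Suc = K0_Suc

lemma N_1: "1 \<in> NN" using K0_Suc[OF K0_0] by simp

lemma N_add: "x \<in> NN \<Longrightarrow> y \<in> NN \<Longrightarrow> x + y \<in> NN"
proof -
  assume x: "x \<in> NN" and "y \<in> NN"
  from this(2) show "x + y \<in> NN"
  proof (rule N_induct)
    show "dp K (\<lambda>y. x + y \<in> NN)" by (rule dfn)+
    fix i assume "x + i \<in> NN" then show "x + (i + 1) \<in> NN" using N_Suc[of "x + i"] by (simp add: add.assoc)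
  qed (use x in simp)
qed

lemma N_mult: "x \<in> NN \<Longrightarrow> y \<in> NN \<Longrightarrow> x * y \<in> NN"
proof -
  assume x: "x \<in> NN" and "y \<in> NN"
  from this(2) show "x * y \<in> NN"
  proof (rule N_induct)
    show "dp K (\<lambda>y. x * y \<in> NN)" by (rule dfn)+
    fix i assume "x * i \<in> NN" then show "x * (i + 1) \<in> NN" using N_add x by (simp add: distrib_left)
  qed (use N_0 in simp)
qed

lemma N_pred: assumes "x \<in> NN" "x \<noteq> 0" shows "x - 1 \<in> NN"
proof -
  obtain F where F: "F \<in> HFs K" "x \<in> F" "\<And>z. z \<in> F \<Longrightarrow> z \<noteq> 0 \<Longrightarrow> z - 1 \<in> F" "F \<subseteq> K0" using K0_E[OF assms(1)] by blast
  then show ?thesis using assms(2) by blast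
qed

lemma N_Suc_neq_0: "x \<in> NN \<Longrightarrow> x + 1 \<noteq> 0"
  using neg_1_not_K0 by (metis add_eq_0_iff2)

lemma N_neg: assumes "x \<in> NN" "- x \<in> NN" shows "x = 0"
proof (rule ccontr)
  assume "x \<noteq> 0"
  then have "(x - 1) + (- x) \<in> NN" using N_pred N_add assms by blast
  then show False using neg_1_not_K0 by simp
qed

lemma nle_refl: "nle x x" by (simp add: nle_def N_0)

lemma nle_trans: "nle x y \<Longrightarrow> nle y z \<Longrightarrow> nle x z"
  unfolding nle_def using N_add[of "z - y" "y - x"] by simp

lemma nle_antisym: "nle x y \<Longrightarrow> nle y x \<Longrightarrow> x = y"
  unfolding nle_def using N_neg[of "y - x"] by simp

lemma nle_0: "x \<in> NN \<Longrightarrow> nle 0 x" by (simp add: nle_def)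

lemma nle_SucI: "nle x y \<Longrightarrow> nle x (y + 1)"
  unfolding nle_def using N_Suc[of "y - x"] by (simp add: algebra_simps)

lemma nle_Suc_iff: "nle x (y + 1) \<longleftrightarrow> nle x y \<or> x = y + 1"
  unfolding nle_def using N_pred[of "y + 1 - x"] N_Suc[of "y - x"] N_0 by (auto simp: algebra_simps)

lemma nle_0_iff: "x \<in> NN \<Longrightarrow> nle x 0 \<longleftrightarrow> x = 0"
  using nle_antisym nle_0 nle_refl by blast

lemma nle_linear: "x \<in> NN \<Longrightarrow> y \<in> NN \<Longrightarrow> nle x y \<or> nle y x"
proof -
  assume x: "x \<in> NN" and "y \<in> NN"
  from this(2) show ?thesis
  proof (rule N_induct)
    show "dp K (\<lambda>y. nle x y \<or> nle y x)" unfolding nle_def by (rule dfn)+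
    show "nle x 0 \<or> nle 0 x" using nle_0[OF x] by simp
    fix i assume i: "i \<in> NN" "nle x i \<or> nle i x"
    show "nle x (i + 1) \<or> nle (i + 1) x"
    proof (cases "nle x i")
      case False
      then have "x - i \<in> NN" "x - i \<noteq> 0" using i nle_refl[of x] unfolding nle_def by auto
      from N_pred[OF this] show ?thesis unfolding nle_def by (simp add: algebra_simps)
    qed (simp add: nle_SucI)
  qed
qed

lemma dp_nle [dfn]: "df W K f \<Longrightarrow> df W K g \<Longrightarrow> dp W (\<lambda>w. nle (f w) (g w))"
  unfolding nle_def by (rule dp_K0 df_minus | assumption)+

lemma below_iff: "i \<in> below n \<longleftrightarrow> i \<in> NN \<and> nle i n \<and> i \<noteq> n"
  by (simp add: below_def)

lemma dp_below [dfn]: "df W K f \<Longrightarrow> df W K g \<Longrightarrow> dp W (\<lambda>w. f w \<in> below (g w))"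
  unfolding below_iff by (rule dp_conj dp_not dp_nle dp_K0 dp_eq_K | assumption)+

lemma below_0: "below 0 = {}"
  using nle_0_iff by (auto simp: below_iff)

lemma below_Suc: "n \<in> NN \<Longrightarrow> below (n + 1) = insert n (below n)"
proof -
  assume n: "n \<in> NN"
  have "\<not> nle (n + 1) n" using neg_1_not_K0 by (simp add: nle_def)
  then show ?thesis unfolding set_eq_iff insert_iff below_iff using nle_Suc_iff nle_refl n by auto
qed

lemma below_HFs: "n \<in> NN \<Longrightarrow> below n \<in> HFs K"
proof (erule N_induct)
  show "dp K (\<lambda>n. below n \<in> HFs K)"
    by (rule dp_HFs'[OF cset_Kc cset_Kc]) (simp | rule dfn)+
qed (use below_0 below_Suc HFs_empty'[OF cset_Kc] HFs_insert'[OF cset_Kc] in auto)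

lemma below_mono: "nle m n \<Longrightarrow> below m \<subseteq> below n"
  unfolding below_iff subset_iff by (metis nle_antisym nle_trans)

lemma N_least:
  assumes P: "dp K P" and k: "k \<in> NN" "P k"
  shows "\<exists>m\<in>NN. P m \<and> (\<forall>j\<in>NN. P j \<longrightarrow> nle m j)"
proof (rule ccontr)
  assume no: "\<not> (\<exists>m\<in>NN. P m \<and> (\<forall>j\<in>NN. P j \<longrightarrow> nle m j))"
  have "\<forall>j. j \<in> NN \<longrightarrow> nle j k \<longrightarrow> \<not> P j"
    using k(1)
  proof (rule N_induct)
    show "dp K (\<lambda>k. \<forall>j. j \<in> NN \<longrightarrow> nle j k \<longrightarrow> \<not> P j)" by (rule dfn dp_comp[OF P])+
    show "\<forall>j. j \<in> NN \<longrightarrow> nle j 0 \<longrightarrow> \<not> P j" using no nle_0 N_0 nle_0_iff by metis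
    fix i assume i: "i \<in> NN" "\<forall>j. j \<in> NN \<longrightarrow> nle j i \<longrightarrow> \<not> P j"
    have "\<not> P (i + 1)"
    proof
      assume "P (i + 1)"
      moreover have "nle (i + 1) j" if "j \<in> NN" "P j" for j
        using nle_linear[OF N_Suc[OF i(1)] that(1)] nle_Suc_iff i(2) that nle_refl by metis
      ultimately show False using no N_Suc[OF i(1)] by blast
    qed
    then show "\<forall>j. j \<in> NN \<longrightarrow> nle j (i + 1) \<longrightarrow> \<not> P j" using i(2) nle_Suc_iff by metis
  qed
  then show False using k nle_refl by blast
qed

section \<open>Hyperfinitely supported functions\<close>

definition supp :: "('a \<Rightarrow> 'k) \<Rightarrow> 'a set" where "supp f = {x. f x \<noteq> 0}"
definition gr :: "('a \<Rightarrow> 'k) \<Rightarrow> ('a \<times> 'k) set" where "gr f = (\<lambda>x. (x, f x)) ` supp f"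

text \<open>A function of this kind vanishes off the carrier and is coded by its graph over the
  support alone. One code therefore serves a sequence or polynomial, however many places or
  variables are allowed for it.\<close>

definition FSs :: "('a, 'k, 'f) coded \<Rightarrow> ('a \<Rightarrow> 'k) set" where
  "FSs X = {f. gr f \<in> HFs (X \<times>\<^sub>c K)}"

definition FSup :: "('a, 'k, 'f) coded \<Rightarrow> ('a \<Rightarrow> 'k, 'k, 'f) coded" where
  "FSup X = (FSs X, \<lambda>f. cod (Fin (X \<times>\<^sub>c K)) (gr f))"

text \<open>Application as a constant, so that the definability rules can be applied by first-order matching.\<close>

definition ap :: "('a \<Rightarrow> 'k) \<Rightarrow> 'a \<Rightarrow> 'k" where "ap f x = f x"

lemma car_FSup [simp]: "car (FSup X) = FSs X"
  by (simp add: FSup_def)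

lemma mem_gr: "(x, v) \<in> gr f \<longleftrightarrow> v \<noteq> 0 \<and> f x = v"
  by (auto simp: gr_def supp_def)

lemma gr_inj: "gr f = gr g \<Longrightarrow> f = g"
  unfolding set_eq_iff split_paired_All mem_gr by (metis ext)

lemma FSs_off: "f \<in> FSs X \<Longrightarrow> x \<notin> car X \<Longrightarrow> f x = 0"
  unfolding FSs_def using HFs_sub[of "gr f" "X \<times>\<^sub>c K"] mem_gr[of x "f x" f] by auto

lemma FSs_eqI: "f \<in> FSs X \<Longrightarrow> g \<in> FSs X \<Longrightarrow> (\<And>x. x \<in> car X \<Longrightarrow> f x = g x) \<Longrightarrow> f = g"
  using FSs_off by (metis ext)

lemma cset_FSup [simp, dfn]: assumes "cset X" shows "cset (FSup X)"
proof -
  let ?Y = "X \<times>\<^sub>c K"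
  have cY: "cset (Fin ?Y)" by (simp add: assms cset_Kc)
  define A where "A = {T \<in> HFs ?Y. (\<forall>x\<in>car X. \<forall>v v'. (x, v) \<in> T \<and> (x, v') \<in> T \<longrightarrow> v = v') \<and> (\<forall>x\<in>car X. (x, 0) \<notin> T)}"
  have gr: "gr ` FSs X = A"
  proof
    show "gr ` FSs X \<subseteq> A" unfolding A_def FSs_def by (auto simp: mem_gr)
    show "A \<subseteq> gr ` FSs X"
    proof
      fix T assume T: "T \<in> A"
      define f where "f x = (if \<exists>v. (x, v) \<in> T then THE v. (x, v) \<in> T else 0)" for x
      have T1: "\<forall>x\<in>car X. \<forall>v v'. (x, v) \<in> T \<and> (x, v') \<in> T \<longrightarrow> v = v'" and T0: "\<forall>x\<in>car X. (x, 0) \<notin> T"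
        and TH: "T \<in> HFs ?Y" using T unfolding A_def by simp_all
      have Tcar: "x \<in> car X" if "(x, v) \<in> T" for x v using HFs_sub[OF TH] that by auto
      have f: "f x = v" if xv: "(x, v) \<in> T" for x v
      proof -
        have "(THE v. (x, v) \<in> T) = v" by (rule the_equality) (use T1 Tcar[OF xv] xv in blast)+
        then show ?thesis using xv unfolding f_def by auto
      qed
      have "(x, v) \<in> gr f \<longleftrightarrow> (x, v) \<in> T" for x v
      proof
        assume "(x, v) \<in> gr f"
        then have "v \<noteq> 0" "f x = v" by (auto simp: mem_gr)
        then obtain v' where "(x, v') \<in> T" unfolding f_def by (auto split: if_splits)
        then show "(x, v) \<in> T" using f \<open>f x = v\<close> by auto
      next
        assume xv: "(x, v) \<in> T"
        then have "v \<noteq> 0" using T0 Tcar by blast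
        then show "(x, v) \<in> gr f" using f[OF xv] by (simp add: mem_gr)
      qed
      then have "gr f = T" by auto
      then show "T \<in> gr ` FSs X" using T unfolding FSs_def A_def by blast
    qed
  qed
  have "dp (Fin ?Y) (\<lambda>T. (\<forall>x\<in>car X. \<forall>v v'. (x, v) \<in> T \<and> (x, v') \<in> T \<longrightarrow> v = v') \<and> (\<forall>x\<in>car X. (x, 0) \<notin> T))"
    by (rule dp_conj dp_ball dp_all_K dp_imp dp_not dp_in[of ?Y] dp_eq_K df_Pair df_const_K df_fst df_snd df_id cset_cprod cset_FinI assms cset_Kc)+
  then have "dp (Fin ?Y) (\<lambda>T. T \<in> A)" by (rule dp_congI) (auto simp: A_def)
  from dp_sub_iff(1)[OF this] have A: "cset (A, cod (Fin ?Y))" by (auto simp: A_def)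
  have "inj_on (cod (FSup X)) (FSs X)"
  proof (rule inj_onI)
    fix f g assume fg: "f \<in> FSs X" "g \<in> FSs X" "cod (FSup X) f = cod (FSup X) g"
    then have "cod (Fin ?Y) (gr f) = cod (Fin ?Y) (gr g)" by (simp add: FSup_def)
    moreover have "gr f \<in> A" "gr g \<in> A" using fg gr by auto
    ultimately have "gr f = gr g" using A unfolding cset_def by (auto dest: inj_onD)
    then show "f = g" by (rule gr_inj)
  qed
  moreover have "cod (FSup X) ` FSs X = cod (Fin ?Y) ` A"
    unfolding gr[symmetric] image_image by (simp add: FSup_def)
  ultimately show ?thesis using A unfolding cset_def by simp
qed

lemma df_gr: assumes "cset X" shows "df (FSup X) (Fin (X \<times>\<^sub>c K)) gr"
proof (rule df_recode[OF cset_FSup[OF assms]])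
  fix f assume "f \<in> car (FSup X)"
  then show "gr f \<in> car (Fin (X \<times>\<^sub>c K)) \<and> cod (Fin (X \<times>\<^sub>c K)) (gr f) = cod (FSup X) f"
    by (simp add: FSs_def) (simp add: FSup_def)
qed (simp add: assms cset_Kc)

lemma FSup_app: assumes X: "cset X" shows "df (FSup X \<times>\<^sub>c X) K (\<lambda>z. ap (fst z) (snd z))"
proof (rule df_graphI[where R = "\<lambda>z v. (snd z, v) \<in> gr (fst z) \<or> (v = 0 \<and> (\<forall>u. (snd z, u) \<notin> gr (fst z)))"])
  show "dp ((FSup X \<times>\<^sub>c X) \<times>\<^sub>c K) (\<lambda>z. (snd (fst z), snd z) \<in> gr (fst (fst z)) \<or> (snd z = 0 \<and> (\<forall>u. (snd (fst z), u) \<notin> gr (fst (fst z)))))"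
    by (rule dp_disj dp_conj dp_not dp_all_K dp_in[of "X \<times>\<^sub>c K"] df_comp[OF df_gr[OF X]] dp_eq_K df_const_K df_Pair df_fst df_snd df_id cset_cprod X cset_Kc cset_FSup)+
qed (auto simp: X cset_Kc ap_def mem_gr)

lemma df_ap: "df W (FSup X) f \<Longrightarrow> df W X x \<Longrightarrow> df W K (\<lambda>w. ap (f w) (x w))"
  by (rule df_comp2[OF FSup_app]) (auto dest: df_cset)

lemma FSs_iff: assumes X: "cset X" shows "f \<in> FSs X \<longleftrightarrow> supp f \<in> HFs X \<and> df X K f"
proof
  assume f: "f \<in> FSs X"
  have "fst ` gr f \<in> HFs X"
    by (rule HFs_image'[of "X \<times>\<^sub>c K"]) (use f X in \<open>auto simp: FSs_def cset_Kc intro!: df_fst df_id\<close>)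
  moreover have "fst ` gr f = supp f" by (auto simp: gr_def image_image)
  moreover have "df X K (\<lambda>x. ap f x)" by (rule df_ap[of _ X, OF df_const[OF X cset_FSup[OF X]] df_id[OF X]]) (use f in simp)
  ultimately show "supp f \<in> HFs X \<and> df X K f" by (simp add: ap_def)
next
  assume f: "supp f \<in> HFs X \<and> df X K f"
  have "(\<lambda>x. (x, f x)) ` supp f \<in> HFs (X \<times>\<^sub>c K)"
    by (rule HFs_image'[OF X _ _ conjunct1[OF f]]) (use f X in \<open>auto simp: cset_Kc intro!: df_Pair df_id\<close>)
  then show "f \<in> FSs X" by (simp add: FSs_def gr_def)
qed

lemma FSs_I: assumes "cset X" "S \<in> HFs X" "supp f \<subseteq> S" "df X K f" shows "f \<in> FSs X"
proof -
  have "dp X (\<lambda>x. \<not> f x = 0)" by (rule dp_not dp_eq_K assms df_const_K)+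
  then have "dp X (\<lambda>x. x \<in> supp f)" by (simp add: supp_def)
  then show ?thesis using HFs_subset''[OF assms(1-3)] assms(4) FSs_iff[OF assms(1)] by blast
qed

text \<open>Functions in \<open>FSs X\<close> are equal once they agree on the carrier, so the graph
  of \<open>h\<close> is given by a quantifier over \<open>X\<close>.\<close>

lemma df_FSup:
  assumes W: "cset W" and X: "cset X" and car: "\<And>w. w \<in> car W \<Longrightarrow> h w \<in> FSs X"
    and h: "df (W \<times>\<^sub>c X) K (\<lambda>z. h (fst z) (snd z))"
  shows "df W (FSup X) h"
proof (rule df_graphI[where R = "\<lambda>w f. \<forall>x\<in>car X. ap f x = h w x"])
  show "dp (W \<times>\<^sub>c FSup X) (\<lambda>z. \<forall>x\<in>car X. ap (snd z) x = h (fst z) x)"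
    by (rule dp_ball dp_eq_K df_ap[of _ X] df_comp2[OF h] df_fst df_snd df_id cset_cprod W X cset_FSup)+
qed (use W X car FSs_eqI[of _ X] in \<open>auto simp: ap_def\<close>)

lemma df_supp: "df W (FSup X) f \<Longrightarrow> cset X \<Longrightarrow> df W (Fin X) (\<lambda>w. supp (f w))"
proof -
  assume X: "cset X" and f: "df W (FSup X) f"
  have "df (FSup X) (Fin X) supp"
  proof (rule df_Fin'[OF X])
    have "dp (FSup X \<times>\<^sub>c X) (\<lambda>w. \<not> ap (fst w) (snd w) = 0)"
      by (rule dp_not dp_eq_K df_ap[of _ X] df_const_K df_fst df_snd df_id cset_cprod X cset_FSup)+
    then show "dp (FSup X \<times>\<^sub>c X) (\<lambda>w. snd w \<in> supp (fst w))" by (simp add: supp_def ap_def)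
  qed (use X FSs_iff[OF X] HFs_sub[of _ X] in auto)
  from df_comp[OF this f] show ?thesis .
qed

lemma FSs_0: "cset X \<Longrightarrow> (\<lambda>_. 0) \<in> FSs X"
  by (rule FSs_I[of _ "{}"]) (auto simp: supp_def HFs_empty' df_const_K)

lemma FSs_upd: assumes X: "cset X" and "f \<in> FSs X" "x \<in> car X" shows "f(x := c) \<in> FSs X"
proof (rule FSs_I[OF X])
  have f: "supp f \<in> HFs X" "df X K f" using assms FSs_iff[OF X] by auto
  show "insert x (supp f) \<in> HFs X" by (rule HFs_insert'[OF X assms(3) f(1)])
  show "supp (f(x := c)) \<subseteq> insert x (supp f)" by (auto simp: supp_def)
  have "df X K (\<lambda>y. if y = x then c else f y)"
    by (rule df_If dp_eq[where Y = X] df_id df_const[OF X X assms(3)] df_const_K f X)+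
  then show "df X K (f(x := c))" by (simp add: fun_upd_def)
qed

lemma FSs_add: assumes X: "cset X" and "f \<in> FSs X" "g \<in> FSs X" shows "(\<lambda>x. f x + g x) \<in> FSs X"
proof (rule FSs_I[OF X])
  show "supp f \<union> supp g \<in> HFs X" by (rule HFs_Un'[OF X]) (use assms FSs_iff[OF X] in auto)
  show "df X K (\<lambda>x. f x + g x)" by (rule df_plus) (use assms FSs_iff[OF X] in auto)
qed (auto simp: supp_def)

lemma FSs_cmult: assumes X: "cset X" and "f \<in> FSs X" shows "(\<lambda>x. c * f x) \<in> FSs X"
proof (rule FSs_I[OF X])
  show "supp f \<in> HFs X" using assms FSs_iff[OF X] by auto
  show "df X K (\<lambda>x. c * f x)" by (rule df_times df_const_K X)+ (use assms FSs_iff[OF X] in auto)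
qed (auto simp: supp_def)

text \<open>Induction runs over hyperfinite sets \<open>S\<close> that contain the support, with
  \<open>f\<close> quantified inside so that the statement about \<open>S\<close> is definable. In
  the step the value at the new point is reset to 0 and then restored.\<close>

lemma FSup_induct:
  assumes f: "f \<in> FSs X" and X: "cset X" and Q: "dp (FSup X) Q" and 0: "Q (\<lambda>_. 0)"
    and upd: "\<And>f x c. f \<in> FSs X \<Longrightarrow> x \<in> car X \<Longrightarrow> f x = 0 \<Longrightarrow> c \<noteq> 0 \<Longrightarrow> Q f \<Longrightarrow> Q (f(x := c))"
  shows "Q f"
proof -
  have "\<forall>f\<in>FSs X. supp f \<subseteq> S \<longrightarrow> Q f" if "S \<in> HFs X" for S
    using that
  proof (rule HFs_induct'[OF X])
    have "dp (Fin X) (\<lambda>S. \<forall>f\<in>car (FSup X). (\<forall>x\<in>car X. x \<in> supp f \<longrightarrow> x \<in> S) \<longrightarrow> Q f)"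
      by (rule dp_ball dp_imp dp_in[OF X] df_supp dp_comp[OF Q] df_fst df_snd df_id cset_cprod X cset_FSup cset_FinI)+
    then show "dp (Fin X) (\<lambda>S. \<forall>f\<in>FSs X. supp f \<subseteq> S \<longrightarrow> Q f)"
    proof (rule dp_congI, unfold car_FSup, intro ball_cong refl imp_cong)
      fix S f assume "f \<in> FSs X"
      then have "supp f \<subseteq> car X" using FSs_iff[OF X] HFs_sub by blast
      then show "supp f \<subseteq> S \<longleftrightarrow> (\<forall>x\<in>car X. x \<in> supp f \<longrightarrow> x \<in> S)" by blast
    qed
    have "f = (\<lambda>_. 0)" if "supp f \<subseteq> {}" for f :: "'a \<Rightarrow> 'k" using that by (auto simp: supp_def)
    then show "\<forall>f\<in>FSs X. supp f \<subseteq> {} \<longrightarrow> Q f" using 0 by blast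
    fix a S assume a: "a \<in> car X" and IH: "\<forall>f\<in>FSs X. supp f \<subseteq> S \<longrightarrow> Q f"
    show "\<forall>f\<in>FSs X. supp f \<subseteq> insert a S \<longrightarrow> Q f"
    proof (intro ballI impI)
      fix f assume f: "f \<in> FSs X" "supp f \<subseteq> insert a S"
      have f0: "f(a := 0) \<in> FSs X" "supp (f(a := 0)) \<subseteq> S"
        using FSs_upd[OF X f(1) a] f(2) by (auto simp: supp_def split: if_splits)
      then have Q0: "Q (f(a := 0))" using IH by blast
      show "Q f"
      proof (cases "f a = 0")
        case True
        then have "f(a := 0) = f" by auto
        then show ?thesis using Q0 by simp
      next
        case False
        then show ?thesis using upd[OF f0(1) a _ False Q0] by simp
      qed
    qed
  qed
  then show ?thesis using f FSs_iff[OF X] by blast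
qed

section \<open>Recursion and hyperfinite sums\<close>

lemma FSs_df: "cset X \<Longrightarrow> f \<in> FSs X \<Longrightarrow> df X K f"
  using FSs_iff[of X f] by blast

text \<open>\<open>nrec\<close> asks for a definable function, over which no formula can quantify. A
  hyperfinite table of the values up to \<open>k\<close> expresses the same computation, uniformly
  in any parameters inside \<open>c\<close> and \<open>s\<close>.\<close>

definition nR :: "'k \<Rightarrow> ('k \<Rightarrow> 'k \<Rightarrow> 'k) \<Rightarrow> 'k \<Rightarrow> 'k \<Rightarrow> bool" where
  "nR c s k v \<longleftrightarrow> (\<exists>H\<in>FSs K. H 0 = c \<and> (\<forall>i. i \<in> below k \<longrightarrow> H (i + 1) = s i (H i)) \<and> v = H k)"

lemma dp_nR:
  assumes s: "df (W \<times>\<^sub>c (K \<times>\<^sub>c K)) K (\<lambda>z. s (fst z) (fst (snd z)) (snd (snd z)))"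
    and c: "df W K c" and k: "df W K k" and v: "df W K v"
  shows "dp W (\<lambda>w. nR (c w) (s w) (k w) (v w))"
proof -
  have "dp W (\<lambda>w. \<exists>H\<in>car (FSup K). ap H 0 = c w \<and> (\<forall>i. i \<in> below (k w) \<longrightarrow> ap H (i + 1) = s w i (ap H i)) \<and> v w = ap H (k w))"
    by (rule dp_bex dp_all_K dp_conj dp_imp dp_below dp_eq_K df_comp3[OF s] df_ap[of _ K] df_plus df_const_K df_comp[OF c] df_comp[OF k] df_comp[OF v]
      df_fst df_snd df_id cset_cprod cset_FSup cset_Kc df_cset(1)[OF c])+
  then show ?thesis by (simp add: nR_def ap_def)
qed

context
  fixes c :: 'k and s :: "'k \<Rightarrow> 'k \<Rightarrow> 'k"
  assumes s: "df (K \<times>\<^sub>c K) K (\<lambda>z. s (fst z) (snd z))"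
begin

lemma nR_dp: "df W K k \<Longrightarrow> df W K v \<Longrightarrow> dp W (\<lambda>w. nR c s (k w) (v w))"
proof (rule dp_nR)
  assume "df W K k"
  then have W: "cset W" by (rule df_cset)
  then show "df W K (\<lambda>_. c)" by (rule df_const_K)
  show "df (W \<times>\<^sub>c (K \<times>\<^sub>c K)) K (\<lambda>z. s (fst (snd z)) (snd (snd z)))"
    by (rule df_comp2[OF s] df_fst df_snd df_id cset_cprod cset_Kc W)+
qed

lemma nR_Suc: "k \<in> NN \<Longrightarrow> nR c s k v \<Longrightarrow> nR c s (k + 1) (s k v)"
proof -
  assume k: "k \<in> NN" and "nR c s k v"
  then obtain H where H: "H \<in> FSs K" "H 0 = c" "\<And>i. i \<in> below k \<Longrightarrow> H (i + 1) = s i (H i)" "v = H k"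
    unfolding nR_def by blast
  let ?H = "H(k + 1 := s k (H k))"
  have "?H (i + 1) = s i (?H i)" if "i \<in> below (k + 1)" for i
  proof -
    have "i \<noteq> k + 1" using that by (simp add: below_iff)
    then show ?thesis using that H(3)[of i] by (auto simp: below_Suc[OF k] below_iff)
  qed
  moreover have "?H 0 = c" using H(2) N_Suc_neq_0[OF k] by auto
  moreover have "?H \<in> FSs K" by (rule FSs_upd[OF cset_Kc H(1)]) simp
  ultimately show ?thesis unfolding nR_def by (intro bexI[of _ ?H]) (simp_all add: H(4))
qed

lemma nR_0: "nR c s 0 c"
  unfolding nR_def by (rule bexI[OF _ FSs_upd[OF cset_Kc FSs_0[OF cset_Kc], of 0 c]]) (auto simp: below_0)

lemma nR_ex: "k \<in> NN \<Longrightarrow> \<exists>v. nR c s k v"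
proof (erule N_induct)
  show "dp K (\<lambda>k. \<exists>v. nR c s k v)" by (rule dp_ex_K nR_dp df_fst df_snd df_id cset_Kc cset_cprod)+
qed (use nR_0 nR_Suc in blast)+

lemma nR_uniq: assumes k: "k \<in> NN" and v: "nR c s k v" "nR c s k v'" shows "v = v'"
proof -
  obtain H where H: "H \<in> FSs K" "H 0 = c" "\<And>i. i \<in> below k \<Longrightarrow> H (i + 1) = s i (H i)" "v = H k"
    using v unfolding nR_def by blast
  obtain H' where H': "H' \<in> FSs K" "H' 0 = c" "\<And>i. i \<in> below k \<Longrightarrow> H' (i + 1) = s i (H' i)" "v' = H' k"
    using v unfolding nR_def by blast
  have "nle k k \<longrightarrow> H k = H' k"
    using k
  proof (rule N_induct[where P = "\<lambda>j. nle j k \<longrightarrow> H j = H' j"])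
    show "dp K (\<lambda>j. nle j k \<longrightarrow> H j = H' j)"
      by (rule dp_imp dp_nle dp_eq_K df_id df_const_K cset_Kc FSs_df H H')+
    fix i assume i: "i \<in> NN" "nle i k \<longrightarrow> H i = H' i"
    show "nle (i + 1) k \<longrightarrow> H (i + 1) = H' (i + 1)"
    proof
      assume le: "nle (i + 1) k"
      then have "i \<in> below k" using i(1) nle_trans[OF nle_SucI[OF nle_refl] le] neg_1_not_K0
        unfolding below_iff nle_def by auto
      then show "H (i + 1) = H' (i + 1)" using H(3) H'(3) i by (simp add: below_iff)
    qed
  qed (use H H' in simp)
  then show ?thesis using H H' nle_refl by simp
qed

text \<open>The values picked out by the tables form a definable function on NN. It satisfies the
  recursion and is unique by induction, so it is the function that the description in
  \<open>nrec\<close> asks for.\<close>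

lemma nrec_ex:
  "\<exists>g. df K K g \<and> g 0 = c \<and> (\<forall>i\<in>NN. g (i + 1) = s i (g i)) \<and> (\<forall>k\<in>NN. nrec c s k = g k \<and> nR c s k (g k)) \<and>
     (\<forall>k. k \<notin> NN \<longrightarrow> nrec c s k = (THE v. True))"
proof -
  define g where "g k = (if k \<in> NN then THE v. nR c s k v else 0)" for k
  have g: "nR c s k (g k)" if "k \<in> NN" for k
    unfolding g_def using theI'[of "nR c s k"] nR_ex[OF that] nR_uniq[OF that] that by auto
  have gd: "df K K g"
  proof (rule df_graphI[where R = "\<lambda>k v. (k \<in> NN \<and> nR c s k v) \<or> (k \<notin> NN \<and> v = 0)"])
    show "dp (K \<times>\<^sub>c K) (\<lambda>z. (fst z \<in> NN \<and> nR c s (fst z) (snd z)) \<or> (fst z \<notin> NN \<and> snd z = 0))"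
      by (rule dp_disj dp_conj dp_not dp_K0 nR_dp dp_eq_K df_fst df_snd df_id df_const_K cset_Kc cset_cprod)+
    fix k v show "v = g k \<longleftrightarrow> (k \<in> NN \<and> nR c s k v) \<or> (k \<notin> NN \<and> v = 0)"
      using g nR_uniq by (cases "k \<in> NN") (auto simp: g_def)
  qed (simp_all add: cset_Kc)
  have g0: "g 0 = c" using nR_uniq[OF N_0 g[OF N_0] nR_0] .
  have gS: "g (i + 1) = s i (g i)" if "i \<in> NN" for i
    using nR_uniq[OF N_Suc[OF that] g[OF N_Suc[OF that]] nR_Suc[OF that g[OF that]]] .
  have N: "dp K (\<lambda>x. x \<in> NN)" by (rule dfn)+
  have Nc: "cset (NN, kel)" using dp_sub_iff(1)[OF N] by simp
  have map: "definable_map kel kel NN h \<longleftrightarrow> df (NN, kel) K h" for h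
    using definable_map_iff_df[OF Nc, of UNIV kel h] cset_Kc by (simp add: Kc_def)
  have gN: "df (NN, kel) K g" using df_sub_dom[OF gd N] by simp
  have uni: "h k = g k" if h: "df (NN, kel) K h" "h 0 = c" "\<forall>i\<in>NN. h (i + 1) = s i (h i)" and "k \<in> NN" for h k
  proof -
    \<comment> \<open>\<open>h\<close> is known to be definable on NN only; carrying membership in
      NN along yields a definable statement on K.\<close>
    have "k \<in> NN \<and> h k = g k"
      using \<open>k \<in> NN\<close>
    proof (rule N_induct)
      have "dp (NN, cod K) (\<lambda>k. h k = g k)" using dp_eq_K[OF h(1) gN] by simp
      then show "dp K (\<lambda>k. k \<in> NN \<and> h k = g k)" using dp_sub_iff(2)[OF N] by simp
    qed (use h g0 gS N_0 N_Suc in auto)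
    then show ?thesis ..
  qed
  have "nrec c s k = g k" if "k \<in> NN" for k
    unfolding nrec_def map
  proof (rule the_equality)
    show "\<exists>h. df (NN, kel) K h \<and> h 0 = c \<and> (\<forall>i\<in>NN. h (i + 1) = s i (h i)) \<and> g k = h k"
      using gN g0 gS by blast
  qed (use uni that in metis)
  \<comment> \<open>A solution is unconstrained outside NN and can take any value at
    \<open>k\<close>. The description then describes every \<open>v\<close>, and \<open>nrec\<close>
    has a default value that depends on neither \<open>c\<close> nor \<open>s\<close> nor
    \<open>k\<close>; this keeps it definable on all of K.\<close>
  moreover have "nrec c s k = (THE v. True)" if "k \<notin> NN" for k
  proof -
    have "\<exists>h. df (NN, kel) K h \<and> h 0 = c \<and> (\<forall>i\<in>NN. h (i + 1) = s i (h i)) \<and> v = h k" for v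
    proof (intro exI conjI)
      show "df (NN, kel) K (g(k := v))" by (rule df_cong[OF gN]) (use that in auto)
      show "(g(k := v)) 0 = c" using g0 that N_0 by auto
      show "\<forall>i\<in>NN. (g(k := v)) (i + 1) = s i ((g(k := v)) i)" using gS that N_Suc by auto
    qed simp
    then show ?thesis unfolding nrec_def map by simp
  qed
  ultimately show ?thesis using gd g0 gS g by blast
qed

lemma nrec_0: "nrec c s 0 = c" and nrec_Suc: "k \<in> NN \<Longrightarrow> nrec c s (k + 1) = s k (nrec c s k)"
  and nR_nrec: "k \<in> NN \<Longrightarrow> nR c s k v \<longleftrightarrow> v = nrec c s k" and nrec_off: "k \<notin> NN \<Longrightarrow> nrec c s k = (THE v. True)"
  using nrec_ex N_0 N_Suc nR_uniq by metis+

end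

lemma df_fix:
  assumes "df (W \<times>\<^sub>c X) Y (\<lambda>z. h (fst z) (snd z))" "w \<in> car W" "cset W" "cset X"
  shows "df X Y (h w)"
  using df_comp2[OF assms(1) df_const[OF assms(4,3,2)] df_id[OF assms(4)]] .

lemma df_nrec:
  assumes s: "df (W \<times>\<^sub>c (K \<times>\<^sub>c K)) K (\<lambda>z. s (fst z) (fst (snd z)) (snd (snd z)))"
    and c: "df W K c" and k: "df W K k"
  shows "df W K (\<lambda>w. nrec (c w) (s w) (k w))"
proof (rule df_graphI[where R = "\<lambda>w v. (k w \<in> NN \<and> nR (c w) (s w) (k w) v) \<or> (k w \<notin> NN \<and> v = (THE v. True))"])
  note W = df_cset(1)[OF c]
  show "dp (W \<times>\<^sub>c K) (\<lambda>z. (k (fst z) \<in> NN \<and> nR (c (fst z)) (s (fst z)) (k (fst z)) (snd z)) \<or> (k (fst z) \<notin> NN \<and> snd z = (THE v. True)))"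
    by (rule dp_disj dp_conj dp_not dp_K0 dp_nR df_comp3[OF s] dp_eq_K df_comp[OF c] df_comp[OF k] df_fst df_snd df_id df_const_K cset_Kc cset_cprod W)+
  fix w v assume w: "w \<in> car W"
  have "df (K \<times>\<^sub>c K) K (\<lambda>z. s w (fst z) (snd z))"
    by (rule df_comp3[OF s] df_const[OF _ W w] df_fst df_snd df_id cset_Kc cset_cprod)+
  from nR_nrec[OF this] nrec_off[OF this]
  show "v = nrec (c w) (s w) (k w) \<longleftrightarrow> (k w \<in> NN \<and> nR (c w) (s w) (k w) v) \<or> (k w \<notin> NN \<and> v = (THE v. True))"
    by (cases "k w \<in> NN") auto
qed (simp_all add: cset_Kc df_cset(1)[OF c])

lemma df_insert: "df W X x \<Longrightarrow> df W (Fin X) T \<Longrightarrow> df W (Fin X) (\<lambda>w. insert (x w) (T w))"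
proof -
  assume x: "df W X x" and T: "df W (Fin X) T"
  note c = df_cset[OF x]
  show ?thesis
  proof (rule df_Fin'[OF c(2) c(1)])
    have "dp (W \<times>\<^sub>c X) (\<lambda>z. snd z = x (fst z) \<or> snd z \<in> T (fst z))"
      by (rule dp_disj dp_eq[where Y = X] dp_in[OF c(2)] df_comp[OF x] df_comp[OF T] df_fst df_snd df_id cset_cprod c)+
    then show "dp (W \<times>\<^sub>c X) (\<lambda>z. snd z \<in> insert (x (fst z)) (T (fst z)))" by simp
    show H: "insert (x w) (T w) \<in> HFs X" if "w \<in> car W" for w
      using HFs_insert'[OF c(2)] df_mem[OF x that] df_mem[OF T that] by simp
    then show "insert (x w) (T w) \<subseteq> car X" if "w \<in> car W" for w using HFs_sub that by blast
  qed
qed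

lemma df_remove: "df W X x \<Longrightarrow> df W (Fin X) T \<Longrightarrow> df W (Fin X) (\<lambda>w. T w - {x w})"
proof -
  assume x: "df W X x" and T: "df W (Fin X) T"
  note c = df_cset[OF x]
  show ?thesis
  proof (rule df_Fin'[OF c(2) c(1)])
    have "dp (W \<times>\<^sub>c X) (\<lambda>z. snd z \<in> T (fst z) \<and> \<not> snd z = x (fst z))"
      by (rule dp_conj dp_not dp_eq[where Y = X] dp_in[OF c(2)] df_comp[OF x] df_comp[OF T] df_fst df_snd df_id cset_cprod c)+
    then show "dp (W \<times>\<^sub>c X) (\<lambda>z. snd z \<in> T (fst z) - {x (fst z)})" by simp
    show H: "T w - {x w} \<in> HFs X" if "w \<in> car W" for w
      using HFs_diff'[OF c(2), of "T w" "{x w}"] HFs_insert'[OF c(2) _ HFs_empty'[OF c(2)]] df_mem[OF x that] df_mem[OF T that] by simp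
    then show "T w - {x w} \<subseteq> car X" if "w \<in> car W" for w using HFs_sub that by blast
  qed
qed

lemma dp_subset: "cset X \<Longrightarrow> df W (Fin X) S \<Longrightarrow> df W (Fin X) T \<Longrightarrow> dp W (\<lambda>w. S w \<subseteq> T w)"
proof -
  assume X: "cset X" and S: "df W (Fin X) S" and T: "df W (Fin X) T"
  have "dp W (\<lambda>w. \<forall>x\<in>car X. x \<in> S w \<longrightarrow> x \<in> T w)"
    by (rule dp_ball dp_imp dp_in[OF X] df_comp[OF S] df_comp[OF T] df_fst df_snd df_id X df_cset(1)[OF S] cset_cprod)+
  then show ?thesis
  proof (rule dp_congI)
    fix w assume "w \<in> car W"
    then have "S w \<subseteq> car X" using df_mem[OF S] HFs_sub by fastforce
    then show "S w \<subseteq> T w \<longleftrightarrow> (\<forall>x\<in>car X. x \<in> S w \<longrightarrow> x \<in> T w)" by blast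
  qed
qed

text \<open>The internal subsets of \<open>insert a S\<close> are those of \<open>S\<close> together
  with the same sets enlarged by \<open>a\<close>. The result bounds the support of a table of
  partial sums.\<close>

lemma HFs_Pow: assumes X: "cset X" and S: "S \<in> HFs X" shows "{T \<in> HFs X. T \<subseteq> S} \<in> HFs (Fin X)"
  using S
proof (rule HFs_induct'[OF X])
  note c = X cset_FinI[OF X] cset_FinI[OF cset_FinI[OF X]]
  show "dp (Fin X) (\<lambda>S. {T \<in> HFs X. T \<subseteq> S} \<in> HFs (Fin X))"
  proof (rule dp_HFs'[OF c(2,2)])
    have "dp (Fin X \<times>\<^sub>c Fin X) (\<lambda>w. snd w \<subseteq> fst w)" by (rule dp_subset df_fst df_snd df_id cset_cprod c)+
    then show "dp (Fin X \<times>\<^sub>c Fin X) (\<lambda>w. snd w \<in> {T \<in> HFs X. T \<subseteq> fst w})" by (rule dp_congI) auto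
  qed auto
  have "{T \<in> HFs X. T \<subseteq> {}} = {{}}" using HFs_empty'[OF X] by auto
  then show "{T \<in> HFs X. T \<subseteq> {}} \<in> HFs (Fin X)"
    using HFs_insert'[OF c(2) _ HFs_empty'[OF c(2)], of "{}"] HFs_empty'[OF X] by simp
  fix a S assume a: "a \<in> car X" and IH: "{T \<in> HFs X. T \<subseteq> S} \<in> HFs (Fin X)"
  have "df (Fin X) (Fin X) (insert a)" by (rule df_insert df_const df_id a c)+
  then have "insert a ` {T \<in> HFs X. T \<subseteq> S} \<in> HFs (Fin X)" using HFs_image'[OF c(2,2) _ IH] by simp
  moreover have "{T \<in> HFs X. T \<subseteq> insert a S} = {T \<in> HFs X. T \<subseteq> S} \<union> insert a ` {T \<in> HFs X. T \<subseteq> S}"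
  proof -
    have "T \<in> insert a ` {T \<in> HFs X. T \<subseteq> S}" if "T \<in> HFs X" "T \<subseteq> insert a S" "a \<in> T" for T
    proof (rule image_eqI)
      show "T = insert a (T - {a})" using that by blast
      show "T - {a} \<in> {T \<in> HFs X. T \<subseteq> S}"
        using HFs_diff'[OF X that(1), of "{a}"] HFs_insert'[OF X a HFs_empty'[OF X]] that by auto
    qed
    then show ?thesis using HFs_insert'[OF X a] by blast
  qed
  ultimately show "{T \<in> HFs X. T \<subseteq> insert a S} \<in> HFs (Fin X)" using HFs_Un'[OF c(2) IH] by simp
qed

text \<open>A hyperfinite sum over \<open>S\<close> is the value at \<open>S\<close> of a table \<open>H\<close> of all partial sums.\<close>

definition hR :: "('a, 'k, 'f) coded \<Rightarrow> ('a \<Rightarrow> 'k) \<Rightarrow> 'a set \<Rightarrow> 'k \<Rightarrow> bool" where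
  "hR X g S v \<longleftrightarrow> (\<exists>H\<in>FSs (Fin X). H {} = 0 \<and>
     (\<forall>T\<in>HFs X. \<forall>x\<in>car X. T \<subseteq> S \<longrightarrow> x \<in> S \<longrightarrow> x \<notin> T \<longrightarrow> H (insert x T) = H T + g x) \<and> v = H S)"

definition hsum :: "('a, 'k, 'f) coded \<Rightarrow> ('a \<Rightarrow> 'k) \<Rightarrow> 'a set \<Rightarrow> 'k" where
  "hsum X g S = (THE v. hR X g S v)"

lemma dp_hR:
  assumes X: "cset X" and g: "df (W \<times>\<^sub>c X) K (\<lambda>z. g (fst z) (snd z))"
    and S: "df W (Fin X) S" and v: "df W K v"
  shows "dp W (\<lambda>w. hR X (g w) (S w) (v w))"
proof -
  note c = X df_cset(1)[OF S] cset_FinI[OF X]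
  have "dp W (\<lambda>w. \<exists>H\<in>car (FSup (Fin X)). ap H {} = 0 \<and>
     (\<forall>T\<in>car (Fin X). \<forall>x\<in>car X. T \<subseteq> S w \<longrightarrow> x \<in> S w \<longrightarrow> x \<notin> T \<longrightarrow> ap H (insert x T) = ap H T + g w x) \<and> v w = ap H (S w))"
    by (rule dp_bex dp_ball dp_imp dp_conj dp_not dp_in[OF X] dp_subset[OF X] df_ap[of _ "Fin X"] dp_eq_K df_insert df_plus
      df_comp2[OF g] df_comp[OF S] df_comp[OF v] df_const_K df_const[of _ "Fin X" "{}"] df_fst df_snd df_id cset_cprod cset_FSup cset_Kc c
      | simp only: car_Fin HFs_empty'[OF X])+
  then show ?thesis by (simp add: hR_def ap_def)
qed

lemma hR_cong1: assumes "\<And>x. x \<in> S \<Longrightarrow> g x = g' x" and "hR X g S v" shows "hR X g' S v"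
proof -
  obtain H where H: "H \<in> FSs (Fin X)" "H {} = 0 \<and>
     (\<forall>T\<in>HFs X. \<forall>x\<in>car X. T \<subseteq> S \<longrightarrow> x \<in> S \<longrightarrow> x \<notin> T \<longrightarrow> H (insert x T) = H T + g x) \<and> v = H S"
    using assms(2) unfolding hR_def by blast
  show ?thesis unfolding hR_def by (rule bexI[OF _ H(1)]) (use H(2) assms(1) in simp)
qed

lemma hsum_cong: assumes "\<And>x. x \<in> S \<Longrightarrow> g x = g' x" shows "hsum X g S = hsum X g' S"
proof -
  have "hR X g S v = hR X g' S v" for v
    using hR_cong1[of S g g' X v] hR_cong1[of S g' g X v] assms by auto
  then have "hR X g S = hR X g' S" by (simp add: fun_eq_iff)
  then show ?thesis unfolding hsum_def by simp
qed

context
  fixes X :: "('a, 'k, 'f) coded" and g :: "'a \<Rightarrow> 'k"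
  assumes X: "cset X" and g: "df X K g"
begin

text \<open>No enumeration of the index set occurs: a table is consistent along every way of adding
  points. Consistency of the enlarged table is checked for \<open>a\<close> being added now, earlier
  or later.\<close>

lemma hR_insert:
  assumes S: "S \<in> HFs X" and a: "a \<in> car X" and R: "hR X g S v"
  shows "\<exists>v. hR X g (insert a S) v"
proof (cases "a \<in> S")
  case True
  then show ?thesis using R by (auto simp: insert_absorb)
next
  case False
  obtain H where H: "H \<in> FSs (Fin X)" "H {} = 0"
    "\<And>T x. T \<in> HFs X \<Longrightarrow> x \<in> car X \<Longrightarrow> T \<subseteq> S \<Longrightarrow> x \<in> S \<Longrightarrow> x \<notin> T \<Longrightarrow> H (insert x T) = H T + g x"
    using R unfolding hR_def by blast
  have aS: "insert a S \<in> HFs X" by (rule HFs_insert'[OF X a S])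
  define P where "P = {T \<in> HFs X. T \<subseteq> insert a S}"
  \<comment> \<open>The table for \<open>S\<close> is doubled: a subset containing \<open>a\<close>
    receives the value of the subset without \<open>a\<close>, plus \<open>g a\<close>. Outside the
    internal power set \<open>P\<close> it is 0, which keeps the support hyperfinite.\<close>
  define H' where "H' T = (if T \<in> P then if a \<in> T then H (T - {a}) + g a else H T else 0)" for T
  note c = X cset_FinI[OF X]
  have P: "P \<in> HFs (Fin X)" unfolding P_def by (rule HFs_Pow[OF X aS])
  have "df (Fin X) K H'"
    unfolding H'_def
    by (rule df_If dp_in[OF c(2)] dp_in[OF c(1)] df_const[OF _ _ a] df_const[of _ "Fin (Fin X)" P] df_plus df_comp[OF FSs_df[OF c(2) H(1)]] df_const_K df_remove df_id cset_FinI c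
      | simp only: car_Fin P)+
  then have m1: "H' \<in> FSs (Fin X)"
    by (rule FSs_I[OF c(2) P, rotated]) (auto simp: supp_def H'_def)
  have m2: "H' {} = 0" using H(2) by (simp add: H'_def)
  have m3: "H' (insert x T) = H' T + g x"
    if T: "T \<in> HFs X" "T \<subseteq> insert a S" and x: "x \<in> car X" "x \<in> insert a S" "x \<notin> T" for T x
  proof -
    have TP: "T \<in> P" "insert x T \<in> P" using T x HFs_insert'[OF X x(1)] unfolding P_def by auto
    have Ta: "T - {a} \<in> HFs X" using HFs_diff'[OF X T(1)] HFs_insert'[OF X a HFs_empty'[OF X]] by blast
    show ?thesis
    proof (cases "x = a")
      case True
      then have "insert x T - {a} = T" using x by auto
      then show ?thesis using True x TP by (simp add: H'_def)
    next
      case xa: False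
      show ?thesis
      proof (cases "a \<in> T")
        case True
        have "insert x T - {a} = insert x (T - {a})" using xa by auto
        moreover have "H (insert x (T - {a})) = H (T - {a}) + g x"
          using H(3)[OF Ta x(1)] T x xa by auto
        ultimately show ?thesis using True TP by (simp add: H'_def)
      next
        case False
        then have "H (insert x T) = H T + g x" using H(3)[OF T(1) x(1)] T x xa by auto
        then show ?thesis using False xa TP by (simp add: H'_def)
      qed
    qed
  qed
  have "hR X g (insert a S) (H' (insert a S))"
    unfolding hR_def by (rule bexI[OF _ m1]) (intro conjI m2 ballI impI refl, rule m3)
  then show ?thesis ..
qed

lemma hR_empty: "hR X g {} 0"
  unfolding hR_def by (rule bexI[OF _ FSs_0[OF cset_FinI[OF X]]]) auto

lemma hR_ex: "S \<in> HFs X \<Longrightarrow> \<exists>v. hR X g S v"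
proof (erule HFs_induct'[OF X])
  show "dp (Fin X) (\<lambda>S. \<exists>v. hR X g S v)"
    by (rule dp_ex_K dp_hR df_comp[OF g] df_fst df_snd df_id cset_cprod cset_FinI X cset_Kc)+
qed (use hR_empty hR_insert in blast)+

lemma hR_uniq: assumes S: "S \<in> HFs X" and v: "hR X g S v" "hR X g S v'" shows "v = v'"
proof -
  obtain H where H: "H \<in> FSs (Fin X)" "H {} = 0" "v = H S"
    "\<And>T x. T \<in> HFs X \<Longrightarrow> x \<in> car X \<Longrightarrow> T \<subseteq> S \<Longrightarrow> x \<in> S \<Longrightarrow> x \<notin> T \<Longrightarrow> H (insert x T) = H T + g x"
    using v unfolding hR_def by blast
  obtain H' where H': "H' \<in> FSs (Fin X)" "H' {} = 0" "v' = H' S"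
    "\<And>T x. T \<in> HFs X \<Longrightarrow> x \<in> car X \<Longrightarrow> T \<subseteq> S \<Longrightarrow> x \<in> S \<Longrightarrow> x \<notin> T \<Longrightarrow> H' (insert x T) = H' T + g x"
    using v unfolding hR_def by blast
  have "S \<subseteq> S \<longrightarrow> H S = H' S"
    using S
  proof (rule HFs_induct'[OF X, where P = "\<lambda>T. T \<subseteq> S \<longrightarrow> H T = H' T"])
    show "dp (Fin X) (\<lambda>T. T \<subseteq> S \<longrightarrow> H T = H' T)"
      by (rule dp_imp dp_subset[OF X] dp_eq_K df_id df_const[of _ "Fin X" S] cset_FinI X FSs_df H H' | simp only: car_Fin S)+
    fix x T assume a: "x \<in> car X" "T \<in> HFs X" "T \<subseteq> S \<longrightarrow> H T = H' T"
    show "insert x T \<subseteq> S \<longrightarrow> H (insert x T) = H' (insert x T)"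
      using a H(4)[OF a(2,1)] H'(4)[OF a(2,1)] by (cases "x \<in> T") (auto simp: insert_absorb)
  qed (use H H' in simp)
  then show ?thesis using H H' by simp
qed

lemma hR_hsum: "S \<in> HFs X \<Longrightarrow> hR X g S v \<longleftrightarrow> v = hsum X g S"
  unfolding hsum_def using theI'[of "hR X g S"] hR_ex hR_uniq by metis

lemma hsum_empty: "hsum X g {} = 0"
  using hR_hsum[OF HFs_empty'[OF X]] hR_empty by metis

lemma hsum_insert: assumes S: "S \<in> HFs X" and a: "a \<in> car X" "a \<notin> S"
  shows "hsum X g (insert a S) = hsum X g S + g a"
proof -
  have aS: "insert a S \<in> HFs X" by (rule HFs_insert'[OF X a(1) S])
  obtain H where H: "H \<in> FSs (Fin X)" "H {} = 0" "hsum X g (insert a S) = H (insert a S)"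
    "\<And>T x. T \<in> HFs X \<Longrightarrow> x \<in> car X \<Longrightarrow> T \<subseteq> insert a S \<Longrightarrow> x \<in> insert a S \<Longrightarrow> x \<notin> T \<Longrightarrow> H (insert x T) = H T + g x"
    using hR_hsum[OF aS, of "hsum X g (insert a S)"] unfolding hR_def by blast
  have "hR X g S (H S)" unfolding hR_def by (rule bexI[OF _ H(1)]) (use H in auto)
  then have "H S = hsum X g S" using hR_hsum[OF S] by simp
  then show ?thesis using H(3) H(4)[OF S a(1)] a by auto
qed

end

lemma df_hsum:
  assumes X: "cset X" and g: "df (W \<times>\<^sub>c X) K (\<lambda>z. g (fst z) (snd z))" and S: "df W (Fin X) S"
  shows "df W K (\<lambda>w. hsum X (g w) (S w))"
proof (rule df_graphI[where R = "\<lambda>w v. hR X (g w) (S w) v"])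
  note c = X df_cset(1)[OF S] cset_Kc
  show "dp (W \<times>\<^sub>c K) (\<lambda>z. hR X (g (fst z)) (S (fst z)) (snd z))"
    by (rule dp_hR[OF X] df_comp2[OF g] df_comp[OF S] df_fst df_snd df_id cset_cprod c)+
  fix w v assume w: "w \<in> car W"
  then show "v = hsum X (g w) (S w) \<longleftrightarrow> hR X (g w) (S w) v"
    using hR_hsum[OF X df_fix[OF g w c(2,1)], of "S w" v] df_mem[OF S w] by auto
qed (simp_all add: cset_Kc df_cset(1)[OF S])

lemma hsum_in:
  assumes X: "cset X" and g: "df X K g" and R: "dp K (\<lambda>x. x \<in> R)" "0 \<in> R" "\<And>x y. x \<in> R \<Longrightarrow> y \<in> R \<Longrightarrow> x + y \<in> R"
    and S: "S \<in> HFs X" "\<And>x. x \<in> S \<Longrightarrow> g x \<in> R"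
  shows "hsum X g S \<in> R"
proof -
  have "S \<subseteq> S \<longrightarrow> hsum X g S \<in> R"
    using S(1)
  proof (rule HFs_induct'[OF X, where P = "\<lambda>T. T \<subseteq> S \<longrightarrow> hsum X g T \<in> R"])
    show "dp (Fin X) (\<lambda>T. T \<subseteq> S \<longrightarrow> hsum X g T \<in> R)"
      by (rule dp_imp dp_subset[OF X] dp_comp[OF R(1)] df_hsum df_comp[OF g] df_snd df_id df_const[of _ "Fin X" S] cset_FinI X cset_cprod
        | simp only: car_Fin S)+
    fix x T assume a: "x \<in> car X" "T \<in> HFs X" "T \<subseteq> S \<longrightarrow> hsum X g T \<in> R"
    then show "insert x T \<subseteq> S \<longrightarrow> hsum X g (insert x T) \<in> R"
      using S(2)[of x] R(3) hsum_insert[OF X g a(2,1)] by (cases "x \<in> T") (auto simp: insert_absorb)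
  qed (use hsum_empty[OF X g] R in simp)
  then show ?thesis by simp
qed

text \<open>Evaluation (\<open>E\<close>, with the values of monomials as weights) and each
  coefficient of a product (\<open>pm\<close>, with shifted coefficients as weights) are of this
  form.\<close>

definition lin :: "('a, 'k, 'f) coded \<Rightarrow> ('a \<Rightarrow> 'k) \<Rightarrow> ('a \<Rightarrow> 'k) \<Rightarrow> 'k" where
  "lin X g p = hsum X (\<lambda>x. p x * g x) (supp p)"

lemma lin_cong: "(\<And>x. p x \<noteq> 0 \<Longrightarrow> g x = g' x) \<Longrightarrow> lin X g p = lin X g' p"
  unfolding lin_def by (rule hsum_cong) (simp add: supp_def)

lemma df_lin:
  assumes X: "cset X" and g: "df (W \<times>\<^sub>c X) K (\<lambda>z. g (fst z) (snd z))" and p: "df W (FSup X) p"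
  shows "df W K (\<lambda>w. lin X (g w) (p w))"
proof -
  have "df W K (\<lambda>w. hsum X (\<lambda>x. ap (p w) x * g w x) (supp (p w)))"
    by (rule df_hsum[OF X] df_supp df_times df_ap[of _ X] df_comp2[OF g] df_comp[OF p] df_fst df_snd df_id cset_cprod X df_cset(1)[OF p] p)+
  then show ?thesis by (simp add: lin_def ap_def)
qed

context
  fixes X :: "('a, 'k, 'f) coded" and g :: "'a \<Rightarrow> 'k"
  assumes X: "cset X" and g: "df X K g"
begin

lemma df_lin_g: assumes p: "df W (FSup X) p" shows "df W K (\<lambda>w. lin X g (p w))"
  by (rule df_lin[OF X _ p]) (rule df_comp[OF g] df_snd df_id cset_cprod X df_cset(1)[OF p])+

lemma lin_0: "lin X g (\<lambda>_. 0) = 0"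
  unfolding lin_def supp_def using hsum_empty[OF X df_const_K[OF X], of 0] by simp

lemma lin_upd: assumes p: "p \<in> FSs X" and x: "x \<in> car X"
  shows "lin X g (p(x := c)) = lin X g p + (c - p x) * g x"
proof -
  \<comment> \<open>The case of a vanishing old value suffices: both \<open>p\<close> and
    \<open>p(x := c)\<close> arise in this way from \<open>p(x := 0)\<close>.\<close>
  have zero: "lin X g (p(x := c)) = lin X g p + c * g x" if p: "p \<in> FSs X" "p x = 0" for p c
  proof (cases "c = 0")
    case True
    then have "p(x := c) = p" using p by auto
    then show ?thesis using True by simp
  next
    case False
    let ?q = "p(x := c)"
    have "supp ?q = insert x (supp p)" using False by (auto simp: supp_def)
    then have "lin X g ?q = hsum X (\<lambda>y. ?q y * g y) (insert x (supp p))" by (simp add: lin_def)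
    also have "\<dots> = hsum X (\<lambda>y. ?q y * g y) (supp p) + ?q x * g x"
      by (rule hsum_insert[OF X df_times[OF FSs_df[OF X FSs_upd[OF X p(1) x]] g]])
        (use p x FSs_iff[OF X] in \<open>auto simp: supp_def\<close>)
    also have "hsum X (\<lambda>y. ?q y * g y) (supp p) = lin X g p"
      unfolding lin_def by (rule hsum_cong) (use p in \<open>auto simp: supp_def\<close>)
    finally show ?thesis by (simp only: fun_upd_same)
  qed
  let ?p = "p(x := 0)"
  have "?p \<in> FSs X" by (rule FSs_upd[OF X p x])
  from zero[OF this, of c] zero[OF this, of "p x"]
  have "lin X g (p(x := c)) = lin X g ?p + c * g x" "lin X g p = lin X g ?p + p x * g x" by simp_all
  then show ?thesis by (simp add: algebra_simps)
qed

lemma lin_add: assumes p: "p \<in> FSs X" and q: "q \<in> FSs X"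
  shows "lin X g (\<lambda>x. p x + q x) = lin X g p + lin X g q"
  using q
proof (rule FSup_induct[OF _ X])
  have "df (FSup X) (FSup X) (\<lambda>q x. ap p x + ap q x)"
    by (rule df_FSup[OF _ X _], simp add: X, use FSs_add[OF X p] in \<open>simp add: ap_def\<close>)
      (rule df_plus df_ap[of _ X] df_const df_fst df_snd df_id cset_cprod X cset_FSup | simp only: car_FSup p)+
  then have "df (FSup X) (FSup X) (\<lambda>q x. p x + q x)" by (simp add: ap_def)
  then show "dp (FSup X) (\<lambda>q. lin X g (\<lambda>x. p x + q x) = lin X g p + lin X g q)"
    by (intro dp_eq_K df_plus df_lin_g df_const_K df_id cset_FSup X)
  fix q x and c :: 'k assume a: "q \<in> FSs X" "x \<in> car X" "q x = 0" "c \<noteq> 0" "lin X g (\<lambda>x. p x + q x) = lin X g p + lin X g q"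
  have "(\<lambda>y. p y + (q(x := c)) y) = (\<lambda>y. p y + q y)(x := p x + c)" by auto
  then show "lin X g (\<lambda>y. p y + (q(x := c)) y) = lin X g p + lin X g (q(x := c))"
    using lin_upd[OF FSs_add[OF X p a(1)] a(2), of "p x + c"] lin_upd[OF a(1,2), of c] a(3,5) by simp
qed (simp add: lin_0)

lemma lin_in:
  assumes R: "dp K (\<lambda>x. x \<in> R)" "0 \<in> R" "\<And>x y. x \<in> R \<Longrightarrow> y \<in> R \<Longrightarrow> x + y \<in> R"
    and p: "p \<in> FSs X" "\<And>x. p x \<noteq> 0 \<Longrightarrow> p x * g x \<in> R"
  shows "lin X g p \<in> R"
  unfolding lin_def
  by (rule hsum_in[OF X _ R]) (use df_times[OF FSs_df[OF X p(1)] g] FSs_iff[OF X] p in \<open>auto simp: supp_def\<close>)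

end

lemma lin_cmult_g: assumes X: "cset X" and g: "df X K g" and p: "p \<in> FSs X"
  shows "lin X (\<lambda>x. c * g x) p = c * lin X g p"
  using p
proof (rule FSup_induct[OF _ X])
  have cg: "df X K (\<lambda>x. c * g x)" by (rule df_times df_const_K X g)+
  show "dp (FSup X) (\<lambda>p. lin X (\<lambda>x. c * g x) p = c * lin X g p)"
    by (intro dp_eq_K df_times df_lin_g df_const_K df_id cset_FSup X g cg)
  show "lin X (\<lambda>x. c * g x) (\<lambda>_. 0) = c * lin X g (\<lambda>_. 0)" by (simp add: lin_0[OF X g] lin_0[OF X cg])
  fix q x and d :: 'k assume a: "q \<in> FSs X" "x \<in> car X" "q x = 0" "lin X (\<lambda>x. c * g x) q = c * lin X g q"
  then show "lin X (\<lambda>x. c * g x) (q(x := d)) = c * lin X g (q(x := d))"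
    by (simp add: lin_upd[OF X cg] lin_upd[OF X g] algebra_simps)
qed

section \<open>Non-standard monomials and polynomials\<close>

text \<open>
  Sequences and polynomials are treated as hyperfinitely supported functions. Their codes do not
  mention the number of variables, so that it can be quantified over.
\<close>

abbreviation Sc :: "('k \<Rightarrow> 'k, 'k, 'f) coded" where "Sc \<equiv> FSup K"
abbreviation Pc :: "(('k \<Rightarrow> 'k) \<Rightarrow> 'k, 'k, 'f) coded" where "Pc \<equiv> FSup Sc"

lemma cset_Sc [simp, dfn]: "cset Sc" and cset_Pc [simp, dfn]: "cset Pc"
  by (simp_all add: cset_Kc)

declare cset_Kc [simp]

lemmas df_apS = df_ap[of _ K] and df_apP = df_ap[of _ Sc]

lemma S_df: "f \<in> FSs K \<Longrightarrow> df K K f"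
  by (rule FSs_df[OF cset_Kc])

lemma df_npow [dfn]: assumes "df W K x" "df W K k" shows "df W K (\<lambda>w. npow (x w) (k w))"
  unfolding npow_def
  by (rule df_nrec df_times df_comp[OF assms(1)] df_const_K df_fst df_snd df_id cset_cprod cset_Kc df_cset(1)[OF assms(1)] assms)+

lemma npow_step: "df (K \<times>\<^sub>c K) K (\<lambda>z. snd z * x)"
  by (rule dfn)+

lemma npow_0: "npow x 0 = 1"
  unfolding npow_def by (rule nrec_0[OF npow_step])

lemma npow_Suc: "k \<in> NN \<Longrightarrow> npow x (k + 1) = npow x k * x"
  unfolding npow_def by (rule nrec_Suc[OF npow_step])

lemma npow_1: "npow x 1 = x"
  using npow_Suc[OF N_0] npow_0 by simp

lemma npow_add: assumes "a \<in> NN" "b \<in> NN" shows "npow x (a + b) = npow x a * npow x b"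
  using assms(2)
proof (rule N_induct)
  show "dp K (\<lambda>b. npow x (a + b) = npow x a * npow x b)" by (rule dfn)+
  fix i assume i: "i \<in> NN" "npow x (a + i) = npow x a * npow x i"
  then show "npow x (a + (i + 1)) = npow x a * npow x (i + 1)"
    using npow_Suc[OF N_add[OF assms(1) i(1)], of x] npow_Suc[OF i(1), of x] by (simp add: add.assoc)
qed (simp add: npow_0)

lemma df_mev: assumes n: "df W K n" and I: "df W Sc I" and f: "df W Sc f" shows "df W K (\<lambda>w. mev (n w) (I w) (f w))"
proof -
  have "df W K (\<lambda>w. nrec 1 (\<lambda>m v. v * npow (ap (f w) m) (ap (I w) m)) (n w))"
    by (rule df_nrec df_times df_npow df_apS df_comp[OF I] df_comp[OF f] df_const_K df_fst df_snd df_id cset_cprod cset_Kc df_cset(1)[OF n] n)+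
  then show ?thesis by (simp add: mev_def ap_def)
qed

lemma mev_step: "I \<in> FSs K \<Longrightarrow> f \<in> FSs K \<Longrightarrow> df (K \<times>\<^sub>c K) K (\<lambda>z. snd z * npow (f (fst z)) (I (fst z)))"
  by (rule df_times df_npow df_comp[OF S_df] df_fst df_snd df_id cset_cprod cset_Kc | assumption)+

context
  fixes I f assumes I: "I \<in> FSs K" and f: "f \<in> FSs K"
begin

lemma mev_0: "mev 0 I f = 1"
  unfolding mev_def by (rule nrec_0[OF mev_step[OF I f]])

lemma mev_Suc: "k \<in> NN \<Longrightarrow> mev (k + 1) I f = mev k I f * npow (f k) (I k)"
  unfolding mev_def by (rule nrec_Suc[OF mev_step[OF I f]])

lemma df_mev_n: assumes n: "df W K n" shows "df W K (\<lambda>w. mev (n w) I f)"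
  by (rule df_mev[OF n]) (use I f df_cset(1)[OF n] in \<open>auto intro: df_const\<close>)

end

lemma mev_cong:
  assumes I: "I \<in> FSs K" "I' \<in> FSs K" "f \<in> FSs K" "f' \<in> FSs K" and n: "n \<in> NN"
    and eq: "\<And>m. m \<in> below n \<Longrightarrow> npow (f m) (I m) = npow (f' m) (I' m)"
  shows "mev n I f = mev n I' f'"
proof -
  have "nle n n \<longrightarrow> mev n I f = mev n I' f'"
    using n
  proof (rule N_induct[where P = "\<lambda>k. nle k n \<longrightarrow> mev k I f = mev k I' f'"])
    show "dp K (\<lambda>k. nle k n \<longrightarrow> mev k I f = mev k I' f')"
      by (rule dp_imp dp_nle dp_eq_K df_mev_n I df_id df_const_K cset_Kc)+
    fix i assume i: "i \<in> NN" "nle i n \<longrightarrow> mev i I f = mev i I' f'"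
    show "nle (i + 1) n \<longrightarrow> mev (i + 1) I f = mev (i + 1) I' f'"
    proof
      assume le: "nle (i + 1) n"
      then have "i \<in> below n" using i(1) nle_trans[OF nle_SucI[OF nle_refl] le] neg_1_not_K0
        unfolding below_iff nle_def by auto
      then show "mev (i + 1) I f = mev (i + 1) I' f'" using i I eq[of i] by (simp add: mev_Suc below_iff)
    qed
  qed (simp add: mev_0 I)
  then show ?thesis using nle_refl by simp
qed

lemma S_zero: "(\<lambda>_. 0) \<in> FSs K" and S_add: "I \<in> FSs K \<Longrightarrow> J \<in> FSs K \<Longrightarrow> (\<lambda>k. I k + J k) \<in> FSs K"
  and S_diff: "I \<in> FSs K \<Longrightarrow> J \<in> FSs K \<Longrightarrow> (\<lambda>k. I k - J k) \<in> FSs K"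
  and S_upd: "I \<in> FSs K \<Longrightarrow> I(k := v) \<in> FSs K"
  using FSs_0[OF cset_Kc] FSs_add[OF cset_Kc, of I J] FSs_add[OF cset_Kc, of I "\<lambda>k. - J k"] FSs_cmult[OF cset_Kc, of J "- 1"]
    FSs_upd[OF cset_Kc, of I k v] by simp_all

lemma mev_zero: assumes f: "f \<in> FSs K" and n: "n \<in> NN" shows "mev n (\<lambda>_. 0) f = 1"
  using n
proof (rule N_induct)
  show "dp K (\<lambda>n. mev n (\<lambda>_. 0) f = 1)" by (rule dp_eq_K df_mev_n S_zero f df_id df_const_K cset_Kc)+
qed (simp_all add: mev_0 mev_Suc S_zero f npow_0)

lemma mev_add:
  assumes I: "I \<in> FSs K" "J \<in> FSs K" "\<And>k. I k \<in> NN" "\<And>k. J k \<in> NN" and f: "f \<in> FSs K" and n: "n \<in> NN"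
  shows "mev n (\<lambda>k. I k + J k) f = mev n I f * mev n J f"
  using n
proof (rule N_induct)
  note s = S_add[OF I(1,2)]
  show "dp K (\<lambda>n. mev n (\<lambda>k. I k + J k) f = mev n I f * mev n J f)"
    by (rule dp_eq_K df_times df_mev_n s I f df_id cset_Kc)+
qed (simp_all add: mev_0 mev_Suc S_add I f npow_add)

lemma mev_ext:
  assumes I: "I \<in> FSs K" and f: "f \<in> FSs K" and r: "r \<in> NN" "nle r n" and off: "\<And>m. m \<notin> below r \<Longrightarrow> I m = 0"
  shows "mev n I f = mev r I f"
proof -
  have "mev (r + d) I f = mev r I f" if "d \<in> NN" for d
    using that
  proof (rule N_induct)
    show "dp K (\<lambda>d. mev (r + d) I f = mev r I f)" by (rule dp_eq_K df_mev_n I f df_plus df_id df_const_K cset_Kc)+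
    fix i assume i: "i \<in> NN" "mev (r + i) I f = mev r I f"
    have "\<not> nle (r + i) r \<or> r + i = r" using nle_antisym[of r "r + i"] i(1) by (auto simp: nle_def)
    then have "I (r + i) = 0" using off[of "r + i"] by (auto simp: below_iff)
    then show "mev (r + (i + 1)) I f = mev r I f"
      using i mev_Suc[OF I f N_add[OF r(1) i(1)]] by (simp add: npow_0 add.assoc)
  qed simp
  from this[of "n - r"] show ?thesis using r(2) by (simp add: nle_def)
qed

lemma mev_single:
  assumes f: "f \<in> FSs K" and n: "r \<in> below n" "n \<in> NN"
  shows "mev n ((\<lambda>_. 0)(r := k)) f = npow (f r) k"
proof -
  let ?I = "(\<lambda>_. 0)(r := k) :: 'k \<Rightarrow> 'k"
  have I: "?I \<in> FSs K" by (rule S_upd[OF S_zero])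
  have r: "r \<in> NN" "nle (r + 1) n"
  proof -
    show r: "r \<in> NN" using n by (simp add: below_iff)
    have "n - r \<in> NN" "n - r \<noteq> 0" using n by (auto simp: below_iff nle_def)
    from N_pred[OF this] show "nle (r + 1) n" by (simp add: nle_def algebra_simps)
  qed
  have "mev n ?I f = mev (r + 1) ?I f"
    by (rule mev_ext[OF I f N_Suc[OF r(1)] r(2)]) (auto simp: below_Suc[OF r(1)])
  also have "\<dots> = mev r ?I f * npow (f r) k" using mev_Suc[OF I f r(1)] by simp
  also have "mev r ?I f = mev r (\<lambda>_. 0) f"
    by (rule mev_cong[OF I S_zero f f r(1)]) (auto simp: below_iff)
  also have "\<dots> = 1" by (rule mev_zero[OF f r(1)])
  finally show ?thesis by (simp only: mult_1)
qed

text \<open>Agrees with \<open>ev\<close> on polynomials (\<open>ev_eq\<close>), but is definable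
  jointly in \<open>n\<close>, \<open>p\<close> and \<open>f\<close> (\<open>df_E\<close>), so that
  it can occur in induction statements.\<close>

definition E :: "'k \<Rightarrow> (('k \<Rightarrow> 'k) \<Rightarrow> 'k) \<Rightarrow> ('k \<Rightarrow> 'k) \<Rightarrow> 'k" where
  "E n p f = lin Sc (\<lambda>I. mev n I f) p"

lemma mev_df: "f \<in> FSs K \<Longrightarrow> df Sc K (\<lambda>I. mev n I f)"
  by (rule df_mev) (auto intro: df_const_K df_id df_const)

lemma df_E: assumes n: "df W K n" and p: "df W Pc p" and f: "df W Sc f" shows "df W K (\<lambda>w. E (n w) (p w) (f w))"
  unfolding E_def
  by (rule df_lin df_mev df_comp[OF n] df_comp[OF f] df_fst df_snd df_id cset_cprod cset_Sc df_cset(1)[OF n] p)+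

lemma E_0: "f \<in> FSs K \<Longrightarrow> E n (\<lambda>_. 0) f = 0"
  unfolding E_def by (rule lin_0[OF cset_Sc mev_df])

lemma E_upd: "f \<in> FSs K \<Longrightarrow> p \<in> FSs Sc \<Longrightarrow> I \<in> FSs K \<Longrightarrow> E n (p(I := c)) f = E n p f + (c - p I) * mev n I f"
  unfolding E_def using lin_upd[OF cset_Sc mev_df] by simp

lemma E_add: "f \<in> FSs K \<Longrightarrow> p \<in> FSs Sc \<Longrightarrow> q \<in> FSs Sc \<Longrightarrow> E n (\<lambda>I. p I + q I) f = E n p f + E n q f"
  unfolding E_def using lin_add[OF cset_Sc mev_df] by simp

lemma E_cmult: assumes f: "f \<in> FSs K" and p: "p \<in> FSs Sc" shows "E n (\<lambda>I. c * p I) f = c * E n p f"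
  using p
proof (rule FSup_induct[OF _ cset_Sc])
  have "df Pc Pc (\<lambda>p I. c * p I)"
  proof (rule df_FSup[OF cset_Pc cset_Sc])
    have "df (Pc \<times>\<^sub>c Sc) K (\<lambda>z. c * ap (fst z) (snd z))"
      by (rule df_times df_const_K df_apP df_fst df_snd df_id cset_cprod cset_Sc cset_Pc)+
    then show "df (Pc \<times>\<^sub>c Sc) K (\<lambda>z. c * fst z (snd z))" by (simp add: ap_def)
  qed (simp add: FSs_cmult)
  then show "dp Pc (\<lambda>p. E n (\<lambda>I. c * p I) f = c * E n p f)"
    by (intro dp_eq_K df_times df_E df_const_K df_id cset_Pc df_const[OF cset_Pc cset_Sc]) (simp_all add: f)
  fix q I and d :: 'k assume a: "q \<in> FSs Sc" "I \<in> car Sc" "q I = 0" "E n (\<lambda>I. c * q I) f = c * E n q f"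
  have "(\<lambda>J. c * (q(I := d)) J) = (\<lambda>J. c * q J)(I := c * d)" by auto
  then show "E n (\<lambda>J. c * (q(I := d)) J) f = c * E n (q(I := d)) f"
    using a E_upd[OF f FSs_cmult[OF cset_Sc a(1)], of I n c "c * d"] E_upd[OF f a(1), of I n d] by (simp add: algebra_simps)
qed (simp add: E_0 f)

lemma E_cong: "(\<And>I. p I \<noteq> 0 \<Longrightarrow> mev n I f = mev n' I f') \<Longrightarrow> E n p f = E n' p f'"
  unfolding E_def by (rule lin_cong)

subsection \<open>Products\<close>

definition mono :: "'k \<Rightarrow> ('k \<Rightarrow> 'k) \<Rightarrow> ('k \<Rightarrow> 'k) \<Rightarrow> 'k" where
  "mono c I = (\<lambda>_. 0)(I := c)"

text \<open>The convolution of coefficients. The difference of exponents is taken in K; where it has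
  an entry outside NN, a \<open>q\<close> with natural exponents is 0. Unlike in
  \<open>pmul\<close>, neither \<open>n\<close> nor \<open>R\<close> occurs.\<close>

definition pm :: "(('k \<Rightarrow> 'k) \<Rightarrow> 'k) \<Rightarrow> (('k \<Rightarrow> 'k) \<Rightarrow> 'k) \<Rightarrow> ('k \<Rightarrow> 'k) \<Rightarrow> 'k" where
  "pm p q L = lin Sc (\<lambda>I. q (\<lambda>k. L k - I k)) p"

lemma P_zero: "(\<lambda>_. 0) \<in> FSs Sc" by (rule FSs_0[OF cset_Sc])

lemma P_upd: "p \<in> FSs Sc \<Longrightarrow> I \<in> FSs K \<Longrightarrow> p(I := c) \<in> FSs Sc"
  by (rule FSs_upd[OF cset_Sc]) simp_all

lemma P_mono: "I \<in> FSs K \<Longrightarrow> mono c I \<in> FSs Sc"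
  unfolding mono_def by (rule P_upd[OF P_zero])

lemma P_add: "p \<in> FSs Sc \<Longrightarrow> q \<in> FSs Sc \<Longrightarrow> (\<lambda>I. p I + q I) \<in> FSs Sc"
  by (rule FSs_add[OF cset_Sc])

lemma P_off: "p \<in> FSs Sc \<Longrightarrow> I \<notin> FSs K \<Longrightarrow> p I = 0"
  using FSs_off[of p Sc I] by simp

lemma E_mono: "f \<in> FSs K \<Longrightarrow> I \<in> FSs K \<Longrightarrow> E n (mono c I) f = c * mev n I f"
  unfolding mono_def using E_upd[OF _ P_zero] E_0 by simp

lemma df_Sdiff: assumes "df W Sc I" "df W Sc J" shows "df W Sc (\<lambda>w k. I w k - J w k)"
proof (rule df_FSup)
  show "cset W" "cset K" using df_cset[OF assms(1)] by simp_all
  show "(\<lambda>k. I w k - J w k) \<in> FSs K" if "w \<in> car W" for w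
    using S_diff df_mem[OF assms(1) that] df_mem[OF assms(2) that] by simp
  have "df (W \<times>\<^sub>c K) K (\<lambda>z. ap (I (fst z)) (snd z) - ap (J (fst z)) (snd z))"
    by (rule df_minus df_apS df_comp[OF assms(1)] df_comp[OF assms(2)] df_fst df_snd df_id cset_cprod cset_Kc df_cset(1)[OF assms(1)])+
  then show "df (W \<times>\<^sub>c K) K (\<lambda>z. I (fst z) (snd z) - J (fst z) (snd z))" by (simp add: ap_def)
qed

lemma df_pm_coef:
  assumes p: "df W Pc p" and q: "df W Pc q" and L: "df W Sc L"
  shows "df W K (\<lambda>w. pm (p w) (q w) (L w))"
proof -
  have "df W K (\<lambda>w. lin Sc (\<lambda>I. ap (q w) (\<lambda>k. L w k - I k)) (p w))"
    by (rule df_lin df_apP df_Sdiff df_comp[OF q] df_comp[OF L] df_fst df_snd df_id cset_cprod cset_Sc df_cset(1)[OF p] p)+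
  then show ?thesis by (simp add: pm_def ap_def)
qed

lemma pm_g: assumes "q \<in> FSs Sc" "L \<in> FSs K" shows "df Sc K (\<lambda>I. q (\<lambda>k. L k - I k))"
  by (rule df_comp[OF FSs_df[OF cset_Sc assms(1)] df_Sdiff]) (use assms in \<open>auto intro: df_const df_id\<close>)

lemma lin_zero: assumes "p \<in> FSs Sc" "\<And>I. p I \<noteq> 0 \<Longrightarrow> g I = 0" shows "lin Sc g p = 0"
proof -
  have "lin Sc g p = lin Sc (\<lambda>_. 0) p" by (rule lin_cong) (use assms in simp)
  also have "\<dots> = 0" using lin_cmult_g[OF cset_Sc df_const_K[OF cset_Sc] assms(1), of 0 0] by simp
  finally show ?thesis .
qed

lemma pm_supp: assumes p: "p \<in> FSs Sc" and "pm p q L \<noteq> 0"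
  obtains I J where "p I \<noteq> 0" "q J \<noteq> 0" "L = (\<lambda>k. I k + J k)"
proof -
  obtain I where "p I \<noteq> 0" "q (\<lambda>k. L k - I k) \<noteq> 0"
    using lin_zero[OF p, of "\<lambda>I. q (\<lambda>k. L k - I k)"] assms(2) unfolding pm_def by blast
  then show thesis using that[of I "\<lambda>k. L k - I k"] by simp
qed

lemma pm_off: assumes "p \<in> FSs Sc" "q \<in> FSs Sc" "L \<notin> FSs K" shows "pm p q L = 0"
proof (rule ccontr)
  assume "pm p q L \<noteq> 0"
  then obtain I J where "p I \<noteq> 0" "q J \<noteq> 0" "L = (\<lambda>k. I k + J k)" using pm_supp[OF assms(1)] by blast
  then show False using P_off assms S_add by blast
qed

lemma pm_upd:
  assumes p: "p \<in> FSs Sc" and q: "q \<in> FSs Sc" and I: "I \<in> FSs K"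
  shows "pm (p(I := c)) q = (\<lambda>L. pm p q L + (c - p I) * mshift I q L)"
proof
  fix L
  show "pm (p(I := c)) q L = pm p q L + (c - p I) * mshift I q L"
  proof (cases "L \<in> FSs K")
    case True
    then show ?thesis unfolding pm_def mshift_def using lin_upd[OF cset_Sc pm_g[OF q True] p] I by simp
  next
    case False
    have "(\<lambda>k. L k - I k) \<notin> FSs K"
    proof
      assume "(\<lambda>k. L k - I k) \<in> FSs K"
      from S_add[OF this I] show False using False by simp
    qed
    then show ?thesis using pm_off False p q P_upd[OF p I] P_off[OF q] by (simp add: mshift_def)
  qed
qed

lemma pm_0: "q \<in> FSs Sc \<Longrightarrow> pm (\<lambda>_. 0) q = (\<lambda>_. 0)"
  unfolding pm_def by (rule HOL.ext, rule lin_zero[OF P_zero]) simp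

lemma pm_mono: "q \<in> FSs Sc \<Longrightarrow> I \<in> FSs K \<Longrightarrow> pm (mono c I) q = (\<lambda>L. c * mshift I q L)"
  unfolding mono_def by (simp add: pm_upd[OF P_zero] pm_0)

lemma mshift_upd: "mshift I (q(J := d)) = (mshift I q)((\<lambda>k. I k + J k) := d)"
proof
  fix L
  have "(\<lambda>k. L k - I k) = J \<longleftrightarrow> L = (\<lambda>k. I k + J k)" by (auto simp: fun_eq_iff algebra_simps)
  then show "mshift I (q(J := d)) L = ((mshift I q)((\<lambda>k. I k + J k) := d)) L" by (simp add: mshift_def)
qed

lemma P_mshift: assumes q: "q \<in> FSs Sc" and I: "I \<in> FSs K" shows "mshift I q \<in> FSs Sc"
  unfolding mshift_def
proof (rule FSs_I[OF cset_Sc])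
  \<comment> \<open>Addition of \<open>I\<close> is written as a difference so that
    \<open>df_Sdiff\<close> applies.\<close>
  have "df Sc Sc (\<lambda>J k. J k - (0 - I k))"
    by (rule df_Sdiff df_id df_const cset_Sc)+ (use S_diff[OF S_zero I] in simp)
  then show "(\<lambda>J k. J k - (0 - I k)) ` supp q \<in> HFs Sc"
    by (rule HFs_image'[OF cset_Sc cset_Sc]) (use q FSs_iff[OF cset_Sc] in blast)
  show "supp (\<lambda>L. q (\<lambda>k. L k - I k)) \<subseteq> (\<lambda>J k. J k - (0 - I k)) ` supp q"
  proof
    fix L assume "L \<in> supp (\<lambda>L. q (\<lambda>k. L k - I k))"
    then show "L \<in> (\<lambda>J k. J k - (0 - I k)) ` supp q"
      by (intro image_eqI[of _ _ "\<lambda>k. L k - I k"]) (simp_all add: supp_def)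
  qed
  show "df Sc K (\<lambda>L. q (\<lambda>k. L k - I k))"
    by (rule df_comp[OF FSs_df[OF cset_Sc q] df_Sdiff]) (use I in \<open>auto intro: df_const df_id\<close>)
qed

lemma P_pm: assumes p: "p \<in> FSs Sc" and q: "q \<in> FSs Sc" shows "pm p q \<in> FSs Sc"
  using p
proof (rule FSup_induct[OF _ cset_Sc])
  \<comment> \<open>The coefficients of the product are definable before the product is known to be
    a polynomial. Membership in \<open>FSs Sc\<close> is therefore expressed by a polynomial
    \<open>h\<close> with the same coefficients.\<close>
  have "dp Pc (\<lambda>p. \<exists>h\<in>car Pc. \<forall>L\<in>car Sc. ap h L = pm p q L)"
    by (rule dp_bex dp_ball dp_eq_K df_apP df_pm_coef df_const[of _ Pc q] df_fst df_snd df_id cset_cprod cset_Sc cset_Pc | simp only: car_FSup q)+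
  then show "dp Pc (\<lambda>p. pm p q \<in> FSs Sc)"
  proof (rule dp_congI)
    fix p assume p: "p \<in> car Pc"
    have "pm p q = h" if "h \<in> FSs Sc" "\<forall>L\<in>FSs K. h L = pm p q L" for h
    proof
      fix L show "pm p q L = h L" using pm_off[of p q L] p q P_off[OF that(1)] that(2) by (cases "L \<in> FSs K") auto
    qed
    then show "pm p q \<in> FSs Sc \<longleftrightarrow> (\<exists>h\<in>car Pc. \<forall>L\<in>car Sc. ap h L = pm p q L)" unfolding ap_def car_FSup by metis
  qed
  show "pm (\<lambda>_. 0) q \<in> FSs Sc" using pm_0[OF q] P_zero by simp
  fix p I and c :: 'k assume a: "p \<in> FSs Sc" "I \<in> car Sc" "pm p q \<in> FSs Sc"
  then show "pm (p(I := c)) q \<in> FSs Sc"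
    using pm_upd[OF a(1) q, of I c] P_add[OF a(3) FSs_cmult[OF cset_Sc P_mshift[OF q]]] by simp
qed

lemma df_pm: assumes p: "df W Pc p" and q: "df W Pc q" shows "df W Pc (\<lambda>w. pm (p w) (q w))"
proof (rule df_FSup)
  show "cset W" "cset Sc" using df_cset[OF p] by simp_all
  show "pm (p w) (q w) \<in> FSs Sc" if "w \<in> car W" for w
    using P_pm df_mem[OF p that] df_mem[OF q that] by simp
  show "df (W \<times>\<^sub>c Sc) K (\<lambda>z. pm (p (fst z)) (q (fst z)) (snd z))"
    by (rule df_pm_coef df_comp[OF p] df_comp[OF q] df_fst df_snd df_id cset_cprod cset_Sc df_cset(1)[OF p])+
qed

lemma df_Padd: assumes p: "df W Pc p" and q: "df W Pc q" shows "df W Pc (\<lambda>w I. p w I + q w I)"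
proof (rule df_FSup)
  show "cset W" "cset Sc" using df_cset[OF p] by simp_all
  show "(\<lambda>I. p w I + q w I) \<in> FSs Sc" if "w \<in> car W" for w
    using P_add df_mem[OF p that] df_mem[OF q that] by simp
  have "df (W \<times>\<^sub>c Sc) K (\<lambda>z. ap (p (fst z)) (snd z) + ap (q (fst z)) (snd z))"
    by (rule df_plus df_apP df_comp[OF p] df_comp[OF q] df_fst df_snd df_id cset_cprod cset_Sc df_cset(1)[OF p])+
  then show "df (W \<times>\<^sub>c Sc) K (\<lambda>z. p (fst z) (snd z) + q (fst z) (snd z))" by (simp add: ap_def)
qed

text \<open>The power law \<open>npow_add\<close> is available on NN only, so multiplicativity of
  evaluation is stated for natural exponents. The coefficients and the number of variables are left
  free.\<close>

definition PN :: "(('k \<Rightarrow> 'k) \<Rightarrow> 'k) set" where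
  "PN = {p \<in> FSs Sc. \<forall>I. p I \<noteq> 0 \<longrightarrow> (\<forall>k. I k \<in> NN)}"

lemma PN_iff: "p \<in> PN \<longleftrightarrow> p \<in> FSs Sc \<and> (\<forall>I\<in>car Sc. ap p I \<noteq> 0 \<longrightarrow> (\<forall>k. ap I k \<in> NN))"
  unfolding PN_def ap_def car_FSup using P_off by blast

lemma dp_PN: "dp Pc (\<lambda>p. p \<in> PN)"
proof -
  have "dp Pc (\<lambda>p. \<forall>I\<in>car Sc. \<not> ap p I = 0 \<longrightarrow> (\<forall>k. ap I k \<in> NN))"
    by (rule dp_ball dp_imp dp_not dp_all_K dp_K0 dp_eq_K df_apP df_apS df_const_K df_fst df_snd df_id cset_cprod cset_Sc cset_Kc cset_Pc)+
  then show ?thesis by (rule dp_congI) (auto simp: PN_iff)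
qed

lemma PN_upd_D: "q(I := c) \<in> PN \<Longrightarrow> q \<in> FSs Sc \<Longrightarrow> q I = 0 \<Longrightarrow> c \<noteq> 0 \<Longrightarrow> q \<in> PN \<and> (\<forall>k. I k \<in> NN)"
  unfolding PN_def by (auto split: if_splits)

lemma E_mshift:
  assumes q: "q \<in> PN" and I: "I \<in> FSs K" "\<And>k. I k \<in> NN" and f: "f \<in> FSs K" and n: "n \<in> NN"
  shows "E n (mshift I q) f = mev n I f * E n q f"
proof -
  have q': "q \<in> FSs Sc" using q by (simp add: PN_def)
  have "df Pc Pc (\<lambda>q. mshift I q)"
  proof (rule df_FSup[OF cset_Pc cset_Sc])
    have "df (Pc \<times>\<^sub>c Sc) K (\<lambda>z. ap (fst z) (\<lambda>k. snd z k - I k))"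
      by (rule df_apP df_Sdiff df_const[of _ Sc I] df_fst df_snd df_id cset_cprod cset_Sc cset_Pc | simp only: car_FSup I)+
    then show "df (Pc \<times>\<^sub>c Sc) K (\<lambda>z. mshift I (fst z) (snd z))" by (simp add: ap_def mshift_def)
  qed (use P_mshift I in simp)
  then have D: "dp Pc (\<lambda>q. q \<in> PN \<longrightarrow> E n (mshift I q) f = mev n I f * E n q f)"
    by (intro dp_imp dp_PN dp_eq_K df_times df_E df_const_K df_id cset_Pc df_const[OF cset_Pc cset_Sc]) (simp_all add: f)
  have "q \<in> PN \<longrightarrow> E n (mshift I q) f = mev n I f * E n q f"
  proof (rule FSup_induct[OF q' cset_Sc D])
    show "(\<lambda>_. 0) \<in> PN \<longrightarrow> E n (mshift I (\<lambda>_. 0)) f = mev n I f * E n (\<lambda>_. 0) f" by (simp add: mshift_def E_0 f)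
    fix q J and c :: 'k assume a: "q \<in> FSs Sc" "J \<in> car Sc" "q J = 0" "c \<noteq> 0" "q \<in> PN \<longrightarrow> E n (mshift I q) f = mev n I f * E n q f"
    have J: "J \<in> FSs K" using a(2) by simp
    show "q(J := c) \<in> PN \<longrightarrow> E n (mshift I (q(J := c))) f = mev n I f * E n (q(J := c)) f"
    proof
      assume "q(J := c) \<in> PN"
      then have q: "q \<in> PN" "\<And>k. J k \<in> NN" using PN_upd_D a by blast+
      have "mshift I q (\<lambda>k. I k + J k) = 0" using a(3) by (simp add: mshift_def)
      then show "E n (mshift I (q(J := c))) f = mev n I f * E n (q(J := c)) f"
        using a(3,5) q(1) E_upd[OF f P_mshift[OF a(1) I(1)] S_add[OF I(1) J], of n c] E_upd[OF f a(1) J, of n c]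
          mev_add[OF I(1) J I(2) q(2) f n] by (simp add: mshift_upd algebra_simps)
    qed
  qed
  then show ?thesis using q by blast
qed

text \<open>Induction on \<open>p\<close>: a new monomial with exponent \<open>I\<close> adds a
  multiple of \<open>q\<close> shifted by \<open>I\<close>, whose value \<open>E_mshift\<close>
  computes.\<close>

lemma E_pm:
  assumes p: "p \<in> PN" and q: "q \<in> PN" and f: "f \<in> FSs K" and n: "n \<in> NN"
  shows "E n (pm p q) f = E n p f * E n q f"
proof -
  have p': "p \<in> FSs Sc" and q': "q \<in> FSs Sc" using p q by (simp_all add: PN_def)
  have D: "dp Pc (\<lambda>p. p \<in> PN \<longrightarrow> E n (pm p q) f = E n p f * E n q f)"
    by (intro dp_imp dp_PN dp_eq_K df_times df_E df_pm df_const_K df_id cset_Pc df_const[OF cset_Pc cset_Sc] df_const[OF cset_Pc cset_Pc])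
      (simp_all add: f q')
  have "p \<in> PN \<longrightarrow> E n (pm p q) f = E n p f * E n q f"
  proof (rule FSup_induct[OF p' cset_Sc D])
    show "(\<lambda>_. 0) \<in> PN \<longrightarrow> E n (pm (\<lambda>_. 0) q) f = E n (\<lambda>_. 0) f * E n q f" by (simp add: pm_0[OF q'] E_0 f)
    fix p I and c :: 'k assume a: "p \<in> FSs Sc" "I \<in> car Sc" "p I = 0" "c \<noteq> 0" "p \<in> PN \<longrightarrow> E n (pm p q) f = E n p f * E n q f"
    have I: "I \<in> FSs K" using a(2) by simp
    show "p(I := c) \<in> PN \<longrightarrow> E n (pm (p(I := c)) q) f = E n (p(I := c)) f * E n q f"
    proof
      assume "p(I := c) \<in> PN"
      then have p: "p \<in> PN" "\<And>k. I k \<in> NN" using PN_upd_D a by blast+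
      show "E n (pm (p(I := c)) q) f = E n (p(I := c)) f * E n q f"
        using a(3,5) p(1) pm_upd[OF a(1) q' I, of c] E_upd[OF f a(1) I, of n c] E_mshift[OF q I p(2) f n]
          E_add[OF f P_pm[OF a(1) q'] FSs_cmult[OF cset_Sc P_mshift[OF q' I], of c], of n] E_cmult[OF f P_mshift[OF q' I], of n c]
        by (simp add: algebra_simps)
    qed
  qed
  then show ?thesis using p by blast
qed

end

section \<open>Codes of sequences and polynomials\<close>

lemma prods_cod: "prods (cod X ` car X) (cod Y ` car Y) = cod (X \<times>\<^sub>c Y) ` car (X \<times>\<^sub>c Y)"
proof (rule Set.set_eqI)
  fix t
  have "t \<in> prods (cod X ` car X) (cod Y ` car Y) \<longleftrightarrow> (\<exists>x\<in>car X. \<exists>y\<in>car Y. t = pr (cod X x) (cod Y y))"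
    unfolding prods_def mem_Collect_eq image_iff by metis
  also have "\<dots> \<longleftrightarrow> t \<in> cod (X \<times>\<^sub>c Y) ` car (X \<times>\<^sub>c Y)"
    unfolding image_iff car_cprod split_paired_Bex_Sigma cod_cprod ..
  finally show "t \<in> prods (cod X ` car X) (cod Y ` car Y) \<longleftrightarrow> t \<in> cod (X \<times>\<^sub>c Y) ` car (X \<times>\<^sub>c Y)" .
qed

context hyperfield
begin

lemma HF_sub: "S \<in> HF X \<Longrightarrow> S \<subseteq> X"
  by (auto simp: HF_def ext_def)

lemma HFs_iff_HF:
  assumes "inj_on (cod X) (car X \<union> S)"
  shows "S \<in> HFs X \<longleftrightarrow> cod X ` S \<in> HF (cod X ` car X)"
proof
  assume H: "cod X ` S \<in> HF (cod X ` car X)"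
  have "S \<subseteq> car X"
  proof
    fix x assume x: "x \<in> S"
    then have "cod X x \<in> cod X ` car X" using HF_sub[OF H] by blast
    then obtain y where "y \<in> car X" "cod X x = cod X y" by blast
    then show "x \<in> car X" using inj_onD[OF assms, of x y] x by simp
  qed
  then show "S \<in> HFs X" using H by (simp add: HFs_def)
qed (simp add: HFs_def)

lemma cod_Fin: "cod (Fin X) S = hcode (cod X ` car X) (cod X ` S)"
  by (simp add: Fin_def)

lemma df_Fin_incl: assumes i: "df X Y (\<lambda>x. x)" shows "df (Fin X) (Fin Y) (\<lambda>S. S)"
proof (rule df_Fin')
  note c = df_cset[OF i]
  show "cset Y" "cset (Fin X)" using c by simp_all
  have "dp (Fin X \<times>\<^sub>c Y) (\<lambda>w. \<exists>x\<in>car X. x \<in> fst w \<and> snd w = x)"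
    by (rule dp_bex dp_conj dp_in[OF c(1)] dp_eq[where Y = Y] df_comp[OF i] df_fst df_snd df_id cset_cprod cset_FinI c)+
  then show "dp (Fin X \<times>\<^sub>c Y) (\<lambda>w. snd w \<in> fst w)" by (rule dp_congI) (auto dest: HFs_D)
qed (use HFs_recode[OF i] HFs_sub[of _ Y] in auto)

text \<open>The codes in the definitions are codes of graphs. If taking the graph, \<open>G\<close>,
  is injective with definable image, then the objects form a coded set, and \<open>G\<close> is
  definable because it leaves codes unchanged.\<close>

lemma transport:
  assumes Y: "cset Y" and G: "inj_on G A" "G ` A \<subseteq> car Y" and P: "dp Y (\<lambda>y. y \<in> G ` A)" and c: "\<And>a. a \<in> A \<Longrightarrow> c a = cod Y (G a)"
  shows "cset (A, c)" and "df (A, c) Y G"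
proof -
  have S: "cset (G ` A, cod Y)" by (rule dp_sub_iff(1)[OF P G(2)])
  have "c ` A = cod Y ` G ` A" unfolding image_image by (rule image_cong) (simp_all add: c)
  moreover have "inj_on c A"
  proof (rule inj_onI)
    fix a b assume ab: "a \<in> A" "b \<in> A" "c a = c b"
    then have "cod Y (G a) = cod Y (G b)" by (simp add: c)
    moreover have "inj_on (cod Y) (G ` A)" using S by (simp add: cset_def)
    ultimately have "G a = G b" using ab by (auto dest: inj_onD)
    then show "a = b" using G(1) ab by (auto dest: inj_onD)
  qed
  ultimately show C: "cset (A, c)" using S by (simp add: cset_def)
  show "df (A, c) Y G" by (rule df_recode[OF C Y]) (use G c in auto)
qed

lemma dp_sub_K: "dp K (\<lambda>x. x \<in> X) \<Longrightarrow> cset (X, kel) \<and> df (X, kel) K (\<lambda>x. x)"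
  using dp_sub_iff(1)[of K X] df_sub_incl[of K X] by simp

lemma dp_below_K: "dp K (\<lambda>i. i \<in> below n)" and dp_NN_K: "dp K (\<lambda>i. i \<in> NN)"
  by (rule dfn)+

lemma inj_KK: "inj (cod (K \<times>\<^sub>c K))"
  by (auto simp: inj_on_def pr_def tcat_def kel_def)

definition graph :: "'k \<Rightarrow> ('k \<Rightarrow> 'k) \<Rightarrow> ('k \<times> 'k) set" where
  "graph n f = (\<lambda>i. (i, f i)) ` below n"

text \<open>Sequences are defined through the graph over (n), and \<open>FSs\<close> through the
  graph over the support. As (n) is hyperfinite, both amount to definability of the
  function.\<close>

lemma seqs_iff:
  assumes n: "n \<in> NN" and X: "dp K (\<lambda>x. x \<in> X)"
  shows "f \<in> seqs X n \<longleftrightarrow> f \<in> FSs K \<and> (\<forall>i. i \<notin> below n \<longrightarrow> f i = 0) \<and> (\<forall>i\<in>below n. f i \<in> X)"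
    and "f \<in> seqs X n \<Longrightarrow> graph n f \<in> HFs ((below n, kel) \<times>\<^sub>c (X, kel))"
proof -
  let ?Y = "(below n, kel) \<times>\<^sub>c (X, kel) :: ('k \<times> 'k, 'k, 'f) coded"
  note b = dp_sub_K[OF dp_below_K[of n]] and x = dp_sub_K[OF X]
  have Y: "cset ?Y" using b x by simp
  have i: "df ?Y (K \<times>\<^sub>c K) (\<lambda>z. z)" by (rule df_recode[OF Y]) auto
  have sg: "seq_graph n f = cod ?Y ` graph n f" for f
    by (auto simp: seq_graph_def graph_def image_image)
  have pr: "prods (kel ` below n) (kel ` X) = cod ?Y ` car ?Y"
    using prods_cod[of "(below n, kel)" "(X, kel)"] by simp
  have inj: "inj_on (cod ?Y) A" for A
    using inj_KK by (auto simp: inj_on_def)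
  have G: "seq_graph n f \<in> HF (prods (kel ` below n) (kel ` X)) \<longleftrightarrow> graph n f \<in> HFs ?Y" for f
    unfolding sg pr using HFs_iff_HF[OF inj] by blast
  show "f \<in> seqs X n \<Longrightarrow> graph n f \<in> HFs ?Y" unfolding seqs_def G by simp
  have R: "graph n f \<in> HFs ?Y \<longleftrightarrow> graph n f \<in> HFs (K \<times>\<^sub>c K) \<and> (\<forall>i\<in>below n. f i \<in> X)"
    unfolding HFs_recode[OF i] by (auto simp: graph_def)
  have "f \<in> FSs K \<longleftrightarrow> graph n f \<in> HFs (K \<times>\<^sub>c K)" if off: "\<forall>i. i \<notin> below n \<longrightarrow> f i = 0"
  proof
    assume "f \<in> FSs K"
    then have "df K (K \<times>\<^sub>c K) (\<lambda>i. (i, f i))" by (intro df_Pair df_id S_df) (simp_all add: cset_Kc)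
    from HFs_image'[OF cset_Kc _ this below_HFs[OF n]] show "graph n f \<in> HFs (K \<times>\<^sub>c K)"
      by (simp add: graph_def)
  next
    assume g: "graph n f \<in> HFs (K \<times>\<^sub>c K)"
    have mem: "(i, v) \<in> graph n f \<longleftrightarrow> i \<in> below n \<and> v = f i" for i v by (auto simp: graph_def)
    have "df K K f"
    proof (rule df_graphI[where R = "\<lambda>i v. (i, v) \<in> graph n f \<or> (i \<notin> below n \<and> v = 0)"])
      show "dp (K \<times>\<^sub>c K) (\<lambda>z. (fst z, snd z) \<in> graph n f \<or> (fst z \<notin> below n \<and> snd z = 0))"
        by (rule dp_disj dp_conj dp_not dp_below dp_in[of "K \<times>\<^sub>c K"] dp_eq_K df_Pair df_const[of _ "Fin (K \<times>\<^sub>c K)" "graph n f"] df_const_K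
            df_fst df_snd df_id cset_cprod cset_Kc cset_FinI | simp only: car_Fin g)+
    qed (use off mem in auto)
    then show "f \<in> FSs K" by (rule FSs_I[OF cset_Kc below_HFs[OF n], rotated]) (use off in \<open>auto simp: supp_def\<close>)
  qed
  then show "f \<in> seqs X n \<longleftrightarrow> f \<in> FSs K \<and> (\<forall>i. i \<notin> below n \<longrightarrow> f i = 0) \<and> (\<forall>i\<in>below n. f i \<in> X)"
    unfolding seqs_def G R mem_Collect_eq by blast
qed

lemma seqs_UNIV: "n \<in> NN \<Longrightarrow> f \<in> seqs UNIV n \<longleftrightarrow> f \<in> FSs K \<and> (\<forall>i. i \<notin> below n \<longrightarrow> f i = 0)"
  using seqs_iff(1)[of n UNIV] by (simp add: dp_const)

lemma monoms_iff: "n \<in> NN \<Longrightarrow> I \<in> monoms n \<longleftrightarrow> I \<in> FSs K \<and> (\<forall>i. i \<notin> below n \<longrightarrow> I i = 0) \<and> (\<forall>i. I i \<in> NN)"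
  using seqs_iff(1)[OF _ dp_NN_K, of n I] N_0 by metis

section \<open>Monomials and polynomials with the codes of their definitions\<close>

definition MC :: "'k \<Rightarrow> ('k \<Rightarrow> 'k, 'k, 'f) coded" where "MC n = (monoms n, mcode n)"
definition PCo :: "'k set \<Rightarrow> 'k \<Rightarrow> (('k \<Rightarrow> 'k) \<Rightarrow> 'k, 'k, 'f) coded" where "PCo R n = (polys R n, pcode R n)"

lemma car_MC [simp]: "car (MC n) = monoms n" and cod_MC: "cod (MC n) = mcode n"
  and car_PCo [simp]: "car (PCo R n) = polys R n" and cod_PCo: "cod (PCo R n) = pcode R n"
  by (simp_all add: MC_def PCo_def)

text \<open>The codes \<open>mcode\<close> mention \<open>n\<close>. Once the identity from
  \<open>MC n\<close> to \<open>Sc\<close> is known to be definable, they can be exchanged for codes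
  that do not.\<close>

lemma cset_MC: assumes n: "n \<in> NN" shows "cset (MC n)" and df_MC: "df (MC n) Sc (\<lambda>I. I)"
proof -
  let ?Y = "(below n, kel) \<times>\<^sub>c (NN, kel) :: ('k \<times> 'k, 'k, 'f) coded"
  note b = dp_sub_K[OF dp_below_K[of n]] and x = dp_sub_K[OF dp_NN_K]
  have Y: "cset ?Y" using b x by simp
  have i: "df ?Y (K \<times>\<^sub>c K) (\<lambda>z. z)" by (rule df_recode[OF Y]) auto
  note Fi = df_Fin_incl[OF i]
  have pr: "prods (kel ` below n) (kel ` NN) = cod ?Y ` car ?Y"
    using prods_cod[of "(below n, kel)" "(NN, kel)"] by simp
  have mem: "(i, v) \<in> graph n f \<longleftrightarrow> i \<in> below n \<and> f i = v" for i v f by (auto simp: graph_def)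
  have G1: "inj_on (graph n) (monoms n)"
  proof (rule inj_onI, rule HOL.ext)
    fix I J i assume "I \<in> monoms n" "J \<in> monoms n" "graph n I = graph n J"
    then show "I i = J i" using mem[of i "I i" I] mem[of i "I i" J] monoms_iff[OF n] by (cases "i \<in> below n") auto
  qed
  have G2: "graph n ` monoms n \<subseteq> car (Fin ?Y)" using seqs_iff(2)[OF n dp_NN_K] by auto
  have P: "dp (Fin ?Y) (\<lambda>T. T \<in> graph n ` monoms n)"
  proof -
    have "dp (Fin ?Y) (\<lambda>T. \<exists>I\<in>car Sc. (\<forall>i. i \<notin> below n \<longrightarrow> ap I i = 0) \<and> (\<forall>i v. (i, v) \<in> T \<longleftrightarrow> i \<in> below n \<and> ap I i = v))"
      by (rule dp_bex dp_all_K dp_conj dp_iff dp_imp dp_not dp_below dp_in[of "K \<times>\<^sub>c K"] df_comp[OF Fi] dp_eq_K df_apS df_Pair df_const_K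
          df_fst df_snd df_id cset_cprod cset_Sc cset_Kc cset_FinI Y b[THEN conjunct1] x[THEN conjunct1])+
    then show ?thesis
    proof (rule dp_congI)
      fix T assume T: "T \<in> car (Fin ?Y)"
      then have T': "T \<subseteq> below n \<times> NN" using HFs_sub[of T ?Y] by simp
      show "T \<in> graph n ` monoms n \<longleftrightarrow> (\<exists>I\<in>car Sc. (\<forall>i. i \<notin> below n \<longrightarrow> ap I i = 0) \<and> (\<forall>i v. (i, v) \<in> T \<longleftrightarrow> i \<in> below n \<and> ap I i = v))"
      proof
        assume "T \<in> graph n ` monoms n"
        then obtain I where I: "I \<in> monoms n" "T = graph n I" by blast
        show "\<exists>I\<in>car Sc. (\<forall>i. i \<notin> below n \<longrightarrow> ap I i = 0) \<and> (\<forall>i v. (i, v) \<in> T \<longleftrightarrow> i \<in> below n \<and> ap I i = v)"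
          by (rule bexI[of _ I]) (use I monoms_iff[OF n] mem in \<open>auto simp: ap_def\<close>)
      next
        assume "\<exists>I\<in>car Sc. (\<forall>i. i \<notin> below n \<longrightarrow> ap I i = 0) \<and> (\<forall>i v. (i, v) \<in> T \<longleftrightarrow> i \<in> below n \<and> ap I i = v)"
        then obtain I where I: "I \<in> FSs K" "\<And>i. i \<notin> below n \<Longrightarrow> I i = 0" "\<And>i v. (i, v) \<in> T \<longleftrightarrow> i \<in> below n \<and> I i = v"
          unfolding ap_def by auto
        have "I i \<in> NN" for i using I(2)[of i] I(3)[of i "I i"] T' N_0 by (cases "i \<in> below n") auto
        then have "I \<in> monoms n" using I monoms_iff[OF n] by blast
        moreover have "T = graph n I" using I(3) mem by auto
        ultimately show "T \<in> graph n ` monoms n" by blast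
      qed
    qed
  qed
  have c: "mcode n I = cod (Fin ?Y) (graph n I)" for I
  proof -
    have "seq_graph n I = cod ?Y ` graph n I" by (auto simp: seq_graph_def graph_def image_image)
    then show ?thesis unfolding mcode_def cod_Fin pr by simp
  qed
  note t = transport[OF cset_FinI[OF Y] G1 G2 P c]
  show C: "cset (MC n)" using t(1) by (simp add: MC_def)
  have g: "df (MC n) (Fin (K \<times>\<^sub>c K)) (graph n)" using df_comp[OF Fi t(2)] by (simp add: MC_def)
  show "df (MC n) Sc (\<lambda>I. I)"
  proof (rule df_FSup[OF C cset_Kc])
    show "df (MC n \<times>\<^sub>c K) K (\<lambda>z. fst z (snd z))"
    proof (rule df_graphI[where R = "\<lambda>z v. (snd z, v) \<in> graph n (fst z) \<or> (snd z \<notin> below n \<and> v = 0)"])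
      show "dp ((MC n \<times>\<^sub>c K) \<times>\<^sub>c K) (\<lambda>z. (snd (fst z), snd z) \<in> graph n (fst (fst z)) \<or> (snd (fst z) \<notin> below n \<and> snd z = 0))"
        by (rule dp_disj dp_conj dp_not dp_below dp_in[of "K \<times>\<^sub>c K"] df_comp[OF g] dp_eq_K df_Pair df_const_K
          df_fst df_snd df_id cset_cprod cset_Kc cset_FinI C)+
    qed (use monoms_iff[OF n] C in \<open>auto simp: mem\<close>)
  qed (use monoms_iff[OF n] in simp)
qed

context
  fixes R :: "'k set" and n :: 'k
  assumes n: "n \<in> NN" and R: "dp K (\<lambda>x. x \<in> R)"
begin

definition MR :: "(('k \<Rightarrow> 'k) \<times> 'k, 'k, 'f) coded" where "MR = MC n \<times>\<^sub>c (R - {0}, kel)"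

lemma MR: "cset MR" "df MR (Sc \<times>\<^sub>c K) (\<lambda>z. z)" "car MR = monoms n \<times> (R - {0})"
proof -
  have R0: "dp K (\<lambda>x. x \<in> R - {0})"
    using dp_conj[OF R dp_not[OF dp_eq_K[OF df_id df_const_K]], of 0] by (simp add: cset_Kc)
  note r = dp_sub_K[OF R0]
  show "cset MR" using cset_MC[OF n] r by (simp add: MR_def)
  have "df MR (Sc \<times>\<^sub>c K) (\<lambda>z. (fst z, snd z))" unfolding MR_def
    by (rule df_Pair df_comp[OF df_MC[OF n]] df_comp[OF conjunct2[OF r]] df_fst df_snd df_id cset_cprod cset_MC[OF n] conjunct1[OF r])+
  then show "df MR (Sc \<times>\<^sub>c K) (\<lambda>z. z)" by simp
  show "car MR = monoms n \<times> (R - {0})" by (simp add: MR_def)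
qed

lemma polys_gr: assumes "pdom p \<subseteq> monoms n"
  shows "p \<in> polys R n \<longleftrightarrow> gr p \<in> HFs MR"
proof -
  have sg: "poly_graph n p = cod MR ` gr p" for p
    by (auto simp: poly_graph_def gr_def supp_def pdom_def image_image MR_def cod_MC)
  have pr: "prods (mcode n ` monoms n) (kel ` (R - {0})) = cod MR ` car MR"
    using prods_cod[of "MC n" "(R - {0}, kel)"] by (simp add: MR_def cod_MC)
  have "cset (MC n \<times>\<^sub>c K)" using cset_MC[OF n] by (simp add: cset_Kc)
  \<comment> \<open>The values of \<open>p\<close> are not yet known to lie in \<open>R\<close>, so
    injectivity of the codes is taken on a product with all of K, where \<open>gr p\<close>
    certainly lies.\<close>
  then have "inj_on (cod (MC n \<times>\<^sub>c K)) (monoms n \<times> UNIV)" by (simp add: cset_def)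
  moreover have "car MR \<union> gr p \<subseteq> monoms n \<times> UNIV" using assms by (auto simp: MR(3) gr_def supp_def pdom_def)
  ultimately have "inj_on (cod (MC n \<times>\<^sub>c K)) (car MR \<union> gr p)" by (rule inj_on_subset)
  moreover have "cod MR = cod (MC n \<times>\<^sub>c K)" by (auto simp: MR_def fun_eq_iff)
  ultimately have "inj_on (cod MR) (car MR \<union> gr p)" by simp
  from HFs_iff_HF[OF this] show ?thesis unfolding polys_def sg pr using assms by blast
qed

lemma polys_iff: "p \<in> polys R n \<longleftrightarrow> p \<in> FSs Sc \<and> (\<forall>I. p I \<noteq> 0 \<longrightarrow> I \<in> monoms n \<and> p I \<in> R)"
proof (cases "pdom p \<subseteq> monoms n")
  case True
  then show ?thesis unfolding polys_gr[OF True] HFs_recode[OF MR(2)] FSs_def MR(3)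
    by (auto simp: pdom_def gr_def supp_def)
next
  case False
  then have "p \<notin> polys R n" by (simp add: polys_def)
  moreover have "\<exists>I. p I \<noteq> 0 \<and> I \<notin> monoms n" using False unfolding pdom_def by blast
  ultimately show ?thesis by blast
qed

lemma polysD:
  assumes "p \<in> polys R n"
  shows "p \<in> FSs Sc" and "pdom p \<subseteq> monoms n" and "\<And>I. p I \<noteq> 0 \<Longrightarrow> I \<in> monoms n"
    and "\<And>I. I \<in> pdom p \<Longrightarrow> I \<in> FSs K" and "\<And>I. p I \<noteq> 0 \<Longrightarrow> p I \<in> R"
proof -
  note P = assms[unfolded polys_iff]
  from P show "p \<in> FSs Sc" ..
  from P show m: "\<And>I. p I \<noteq> 0 \<Longrightarrow> I \<in> monoms n" and "\<And>I. p I \<noteq> 0 \<Longrightarrow> p I \<in> R" by blast+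
  show "pdom p \<subseteq> monoms n" using m unfolding pdom_def by blast
  then show "\<And>I. I \<in> pdom p \<Longrightarrow> I \<in> FSs K" using monoms_iff[OF n] by blast
qed

lemma cset_PCo: "cset (PCo R n)" and df_PCo: "df (PCo R n) Pc (\<lambda>p. p)"
proof -
  note Fi = df_Fin_incl[OF MR(2)]
  have pd: "pdom p \<subseteq> monoms n" if "p \<in> polys R n" for p by (rule polysD(2)[OF that])
  have pr: "prods (mcode n ` monoms n) (kel ` (R - {0})) = cod MR ` car MR"
    using prods_cod[of "MC n" "(R - {0}, kel)"] by (simp add: MR_def cod_MC)
  have P: "dp (Fin MR) (\<lambda>T. T \<in> gr ` polys R n)"
  proof -
    have "dp (Fin MR) (\<lambda>T. \<exists>p\<in>car Pc. \<forall>I\<in>car Sc. \<forall>v. (I, v) \<in> T \<longleftrightarrow> \<not> v = 0 \<and> ap p I = v)"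
      by (rule dp_bex dp_ball dp_all_K dp_conj dp_iff dp_not dp_in[of "Sc \<times>\<^sub>c K"] df_comp[OF Fi] dp_eq_K df_apP df_Pair df_const_K
          df_fst df_snd df_id cset_cprod cset_Sc cset_Pc cset_Kc cset_FinI MR(1))+
    then show ?thesis
    proof (rule dp_congI)
      fix T assume T: "T \<in> car (Fin MR)"
      then have T': "T \<subseteq> monoms n \<times> (R - {0})" using HFs_sub[of T MR] by (simp add: MR(3))
      show "T \<in> gr ` polys R n \<longleftrightarrow> (\<exists>p\<in>car Pc. \<forall>I\<in>car Sc. \<forall>v. (I, v) \<in> T \<longleftrightarrow> \<not> v = 0 \<and> ap p I = v)"
      proof
        assume "T \<in> gr ` polys R n"
        then show "\<exists>p\<in>car Pc. \<forall>I\<in>car Sc. \<forall>v. (I, v) \<in> T \<longleftrightarrow> \<not> v = 0 \<and> ap p I = v"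
          using polysD(1) by (auto simp: mem_gr ap_def)
      next
        assume "\<exists>p\<in>car Pc. \<forall>I\<in>car Sc. \<forall>v. (I, v) \<in> T \<longleftrightarrow> \<not> v = 0 \<and> ap p I = v"
        then obtain p where p: "p \<in> FSs Sc" "\<And>I v. I \<in> FSs K \<Longrightarrow> (I, v) \<in> T \<longleftrightarrow> v \<noteq> 0 \<and> p I = v" unfolding ap_def by auto
        have "(I, v) \<in> T \<longleftrightarrow> (I, v) \<in> gr p" for I v
          using p(2)[of I v] P_off[OF p(1), of I] T' monoms_iff[OF n, of I] unfolding mem_gr by (cases "I \<in> FSs K") auto
        then have TT: "T = gr p" by auto
        have "I \<in> monoms n \<and> p I \<in> R" if "p I \<noteq> 0" for I
        proof -
          have "(I, p I) \<in> T" unfolding TT mem_gr using that by simp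
          then show ?thesis using T' by auto
        qed
        then have "p \<in> polys R n" using polys_iff p(1) by blast
        then show "T \<in> gr ` polys R n" using TT by blast
      qed
    qed
  qed
  have c: "pcode R n p = cod (Fin MR) (gr p)" for p
  proof -
    have "poly_graph n p = cod MR ` gr p"
      by (auto simp: poly_graph_def gr_def supp_def pdom_def image_image MR_def cod_MC)
    then show ?thesis unfolding pcode_def cod_Fin pr by simp
  qed
  have G2: "gr ` polys R n \<subseteq> car (Fin MR)" using polys_gr[OF pd] by auto
  have G1: "inj_on gr (polys R n)" using gr_inj by (auto simp: inj_on_def)
  note t = transport[OF cset_FinI[OF MR(1)] G1 G2 P c]
  show C: "cset (PCo R n)" using t(1) by (simp add: PCo_def)
  have g: "df (PCo R n) (Fin (Sc \<times>\<^sub>c K)) gr" using df_comp[OF Fi t(2)] by (simp add: PCo_def)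
  show "df (PCo R n) Pc (\<lambda>p. p)"
  proof (rule df_FSup[OF C cset_Sc])
    show "df (PCo R n \<times>\<^sub>c Sc) K (\<lambda>z. fst z (snd z))"
    proof (rule df_graphI[where R = "\<lambda>z v. (snd z, v) \<in> gr (fst z) \<or> (v = 0 \<and> (\<forall>u. (snd z, u) \<notin> gr (fst z)))"])
      show "dp ((PCo R n \<times>\<^sub>c Sc) \<times>\<^sub>c K) (\<lambda>z. (snd (fst z), snd z) \<in> gr (fst (fst z)) \<or> (snd z = 0 \<and> (\<forall>u. (snd (fst z), u) \<notin> gr (fst (fst z)))))"
        by (rule dp_disj dp_conj dp_not dp_all_K dp_in[of "Sc \<times>\<^sub>c K"] df_comp[OF g] dp_eq_K df_Pair df_const_K
          df_fst df_snd df_id cset_cprod cset_Kc cset_Sc cset_FinI C)+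
    qed (use C in \<open>auto simp: mem_gr cset_Kc\<close>)
  qed (use polysD(1) in simp)
qed

text \<open>The hypothesis on the ideal speaks about \<open>pcode\<close>; the definable identity
  from \<open>PCo R n\<close> turns it into definability inside \<open>Pc\<close>.\<close>

lemma definable_poly_set_dp: assumes "definable_poly_set R n P" shows "dp Pc (\<lambda>p. p \<in> P)"
proof -
  have P: "P \<subseteq> polys R n" "definable (pcode R n ` P)" using assms by (simp_all add: definable_poly_set_def)
  have "{p \<in> car (PCo R n). p \<in> P} = P" using P by auto
  then have PP: "dp (PCo R n) (\<lambda>p. p \<in> P)" unfolding dp_def using P cset_PCo by (simp add: cod_PCo)
  have "dp Pc (\<lambda>p. \<exists>q\<in>car (PCo R n). q \<in> P \<and> p = q)"
    by (rule dp_bex dp_conj dp_comp[OF PP] dp_eq[where Y = Pc] df_comp[OF df_PCo] df_fst df_snd df_id cset_cprod cset_Pc cset_PCo)+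
  then show ?thesis by (rule dp_congI) (use P in auto)
qed

definition rs :: "(('k \<Rightarrow> 'k) \<Rightarrow> 'k) \<Rightarrow> ('k \<Rightarrow> 'k) set \<Rightarrow> ('k \<Rightarrow> 'k) \<Rightarrow> 'k" where
  "rs p A = (\<lambda>I. if I \<in> A then p I else 0)"

context
  fixes p assumes p: "p \<in> polys R n"
begin

text \<open>Its hyperfinite subsets are \<open>hsubsets n p\<close> and their codes are
  \<open>scode n p\<close>, so the recursions in \<open>ev\<close> and \<open>pmul\<close> become
  recursions over \<open>Fin Dc\<close>.\<close>

definition Dc :: "('k \<Rightarrow> 'k, 'k, 'f) coded" where "Dc = (pdom p, mcode n)"

lemma Dc: "cset Dc" "df Dc Sc (\<lambda>I. I)" "car Dc = pdom p" "HFs Dc = {A \<in> HFs Sc. A \<subseteq> pdom p}" "pdom p \<in> HFs Dc"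
  "hsubsets n p = HFs Dc" "scode n p = cod (Fin Dc)"
proof -
  have pP: "p \<in> FSs Sc" and sub: "pdom p \<subseteq> monoms n" by (rule polysD[OF p])+
  have "dp (MC n) (\<lambda>I. \<not> p I = 0)"
    by (rule dp_not dp_eq_K df_comp[OF FSs_df[OF cset_Sc pP] df_MC[OF n]] df_const_K cset_MC[OF n])+
  then have D: "dp (MC n) (\<lambda>I. I \<in> pdom p)" by (simp add: pdom_def)
  then show "cset Dc" using dp_sub_iff(1)[OF D] sub by (simp add: Dc_def cod_MC)
  show i: "df Dc Sc (\<lambda>I. I)" using df_sub_dom[OF df_MC[OF n] D] sub by (simp add: Dc_def cod_MC)
  show c: "car Dc = pdom p" by (simp add: Dc_def)
  show H: "HFs Dc = {A \<in> HFs Sc. A \<subseteq> pdom p}" using HFs_recode[OF i] by (simp add: c)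
  show "pdom p \<in> HFs Dc" unfolding H using pP FSs_iff[OF cset_Sc] by (simp add: pdom_def supp_def)
  show "hsubsets n p = HFs Dc" by (simp add: hsubsets_def HFs_def Dc_def)
  show "scode n p = cod (Fin Dc)" by (rule HOL.ext) (simp add: scode_def cod_Fin Dc_def)
qed

lemma rs_FSs: "A \<in> HFs Dc \<Longrightarrow> rs p A \<in> FSs Sc"
proof -
  assume A: "A \<in> HFs Dc"
  have pP: "p \<in> FSs Sc" by (rule polysD[OF p])
  have A': "A \<in> HFs Sc" using A Dc(4) by blast
  show ?thesis unfolding rs_def
  proof (rule FSs_I[OF cset_Sc])
    show "supp p \<in> HFs Sc" using FSs_iff[OF cset_Sc] pP by blast
    show "df Sc K (\<lambda>I. if I \<in> A then p I else 0)"
      by (rule df_If dp_in_set'[OF cset_Sc] FSs_df[OF cset_Sc pP] df_const_K cset_Sc A')+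
  qed (auto simp: supp_def)
qed

lemma df_rs: "df (Fin Dc) Pc (rs p)"
proof (rule df_FSup)
  have pP: "p \<in> FSs Sc" by (rule polysD[OF p])
  show "df (Fin Dc \<times>\<^sub>c Sc) K (\<lambda>z. rs p (fst z) (snd z))" unfolding rs_def
    by (rule df_If dp_in[OF cset_Sc] df_comp[OF df_Fin_incl[OF Dc(2)]] df_comp[OF FSs_df[OF cset_Sc pP]] df_const_K
       df_fst df_snd df_id cset_cprod cset_Sc cset_FinI Dc(1))+
qed (use rs_FSs Dc(1) in simp_all)

lemma rs_empty: "rs p {} = (\<lambda>_. 0)" and rs_insert: "rs p (insert I A) = (rs p A)(I := p I)"
  and rs_pdom: "rs p (pdom p) = p"
  by (rule HOL.ext, simp add: rs_def pdom_def)+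

text \<open>The function demanded by \<open>ev\<close> sends \<open>A\<close> to the value of the
  restriction \<open>rs p A\<close>. Any other solution agrees with it by induction over the
  hyperfinite subsets of the domain.\<close>

lemma ev_eq: assumes f: "f \<in> FSs K" shows "ev n p f = E n p f"
proof -
  have cF: "cset (Fin Dc)" using Dc(1) by simp
  have map: "definable_map (scode n p) kel (hsubsets n p) G \<longleftrightarrow> df (Fin Dc) K G" for G
    using definable_map_iff_df[of "HFs Dc" "cod (Fin Dc)" UNIV kel G] cF cset_Kc
    by (simp add: Dc(6,7) Kc_def) (simp add: Fin_def)
  have E: "df (Fin Dc) K (\<lambda>A. E n (rs p A) f)"
    by (rule df_E df_rs df_const_K df_const cset_Sc cF)+ (simp add: f)
  have ins: "E n (rs p (insert I A)) f = E n (rs p A) f + p I * mev n I f" if "A \<in> HFs Dc" "I \<in> pdom p" "I \<notin> A" for A I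
  proof -
    have "I \<in> FSs K" by (rule polysD(4)[OF p that(2)])
    from E_upd[OF f rs_FSs[OF that(1)] this, of n "p I"] show ?thesis
      using that(3) by (simp add: rs_insert) (simp add: rs_def)
  qed
  show ?thesis unfolding ev_def map unfolding Dc(6)
  proof (rule the_equality)
    show "\<exists>G. df (Fin Dc) K G \<and> G {} = 0 \<and> (\<forall>A\<in>HFs Dc. \<forall>I\<in>pdom p - A. G (insert I A) = G A + p I * mev n I f) \<and> E n p f = G (pdom p)"
      by (rule exI[of _ "\<lambda>A. E n (rs p A) f"]) (use E ins in \<open>auto simp: rs_empty rs_pdom E_0[OF f]\<close>)
    fix v assume "\<exists>G. df (Fin Dc) K G \<and> G {} = 0 \<and> (\<forall>A\<in>HFs Dc. \<forall>I\<in>pdom p - A. G (insert I A) = G A + p I * mev n I f) \<and> v = G (pdom p)"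
    then obtain G where G: "df (Fin Dc) K G" "G {} = 0" "\<And>A I. A \<in> HFs Dc \<Longrightarrow> I \<in> pdom p \<Longrightarrow> I \<notin> A \<Longrightarrow> G (insert I A) = G A + p I * mev n I f"
      "v = G (pdom p)" by blast
    have "G (pdom p) = E n (rs p (pdom p)) f"
      using Dc(5)
    proof (rule HFs_induct'[OF Dc(1)])
      show "dp (Fin Dc) (\<lambda>A. G A = E n (rs p A) f)" by (rule dp_eq_K[OF G(1) E])
      show "G {} = E n (rs p {}) f" using G(2) by (simp add: rs_empty E_0[OF f])
      fix I A assume "I \<in> car Dc" "A \<in> HFs Dc" "G A = E n (rs p A) f"
      then show "G (insert I A) = E n (rs p (insert I A)) f"
        using G(3)[of A I] ins[of A I] Dc(3) by (cases "I \<in> A") (simp_all add: insert_absorb)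
    qed
    then show "v = E n p f" using G(4) by (simp add: rs_pdom)
  qed
qed

end

context
  assumes R0: "0 \<in> R" and Radd: "\<And>x y. x \<in> R \<Longrightarrow> y \<in> R \<Longrightarrow> x + y \<in> R" and Rmult: "\<And>x y. x \<in> R \<Longrightarrow> y \<in> R \<Longrightarrow> x * y \<in> R"
begin

lemma monoms_add: "I \<in> monoms n \<Longrightarrow> J \<in> monoms n \<Longrightarrow> (\<lambda>k. I k + J k) \<in> monoms n"
  using monoms_iff[OF n] S_add N_add by simp

lemma polys_coef: "p \<in> polys R n \<Longrightarrow> p I \<in> R"
  using polysD(5)[of p I] R0 by (cases "p I = 0") auto

lemma pm_polys: assumes p: "p \<in> polys R n" and q: "q \<in> polys R n" shows "pm p q \<in> polys R n"
  unfolding polys_iff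
proof (intro conjI allI impI)
  have p': "p \<in> FSs Sc" and q': "q \<in> FSs Sc" by (rule polysD[OF p] polysD[OF q])+
  show "pm p q \<in> FSs Sc" by (rule P_pm[OF p' q'])
  fix L assume L: "pm p q L \<noteq> 0"
  then obtain I J where "p I \<noteq> 0" "q J \<noteq> 0" "L = (\<lambda>k. I k + J k)" using pm_supp[OF p'] by blast
  then show "L \<in> monoms n" using monoms_add polysD(3)[OF p] polysD(3)[OF q] by blast
  then have LK: "L \<in> FSs K" using monoms_iff[OF n] by blast
  show "pm p q L \<in> R" unfolding pm_def
    by (rule lin_in[OF cset_Sc pm_g[OF q' LK] R R0 Radd p' Rmult[OF polys_coef[OF p] polys_coef[OF q]]])
qed

lemma polys_rs: assumes p: "p \<in> polys R n" and A: "A \<in> HFs (Dc p)" shows "rs p A \<in> polys R n"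
  unfolding polys_iff
  using rs_FSs[OF p A] polysD(3)[OF p] polysD(5)[OF p] by (simp add: rs_def)

text \<open>As for \<open>ev_eq\<close>, with \<open>pm (rs p A) q\<close> as the solution. Closure
  of \<open>polys R n\<close> under \<open>pm\<close> ensures that the partial products have codes
  in \<open>PCo R n\<close>.\<close>

lemma pmul_eq: assumes p: "p \<in> polys R n" and q: "q \<in> polys R n" shows "pmul R n p q = pm p q"
proof -
  note Dc = Dc[OF p]
  have cF: "cset (Fin (Dc p))" using Dc(1) by simp
  have p': "p \<in> FSs Sc" and q': "q \<in> FSs Sc" by (rule polysD[OF p] polysD[OF q])+
  have map: "G ` hsubsets n p \<subseteq> polys R n \<and> definable_map (scode n p) (pcode R n) (hsubsets n p) G \<longleftrightarrow> df (Fin (Dc p)) (PCo R n) G" for G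
  proof -
    have F: "Fin (Dc p) = (HFs (Dc p), cod (Fin (Dc p)))" unfolding Fin_def cod_pair ..
    have c1: "cset (HFs (Dc p), cod (Fin (Dc p)))" by (subst F[symmetric]) (rule cF)
    have c2: "cset (polys R n, pcode R n)" using cset_PCo by (simp only: PCo_def)
    have "definable_map (cod (Fin (Dc p))) (pcode R n) (HFs (Dc p)) G \<longleftrightarrow> df (Fin (Dc p)) (PCo R n) G" if "G ` HFs (Dc p) \<subseteq> polys R n"
      using definable_map_iff_df[OF c1 c2 that] by (simp only: F[symmetric] PCo_def[symmetric])
    moreover have "G ` HFs (Dc p) \<subseteq> polys R n" if "df (Fin (Dc p)) (PCo R n) G" using df_mem[OF that] by auto
    ultimately show ?thesis unfolding Dc(6,7) by blast
  qed
  have mem: "pm (rs p A) q \<in> polys R n" if "A \<in> HFs (Dc p)" for A using pm_polys[OF polys_rs[OF p that] q] .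
  have dP: "df (Fin (Dc p)) Pc (\<lambda>A. pm (rs p A) q)"
    by (rule df_pm df_rs[OF p] df_const cset_Pc cF)+ (simp add: q')
  have d: "df (Fin (Dc p)) (PCo R n) (\<lambda>A. pm (rs p A) q)"
  proof (rule df_graphI[where R = "\<lambda>A h. h = pm (rs p A) q"])
    show "dp (Fin (Dc p) \<times>\<^sub>c PCo R n) (\<lambda>z. snd z = pm (rs p (fst z)) q)"
      by (rule dp_eq[where Y = Pc] df_comp[OF df_PCo] df_comp[OF dP] df_fst df_snd df_id cset_cprod cF cset_PCo)+
  qed (use mem cF cset_PCo in auto)
  have ins: "pm (rs p (insert I A)) q = padd (pm (rs p A) q) (\<lambda>L. p I * mshift I q L)" if "A \<in> HFs (Dc p)" "I \<in> pdom p" "I \<notin> A" for A I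
  proof -
    have "I \<in> FSs K" by (rule polysD(4)[OF p that(2)])
    from pm_upd[OF rs_FSs[OF p that(1)] q' this, of "p I"] show ?thesis
      using that(3) by (simp add: rs_insert[OF p] padd_def) (simp add: rs_def)
  qed
  have e: "pmul R n p q = (THE s. \<exists>G. df (Fin (Dc p)) (PCo R n) G \<and> G {} = (\<lambda>_. 0) \<and>
     (\<forall>A\<in>HFs (Dc p). \<forall>I\<in>pdom p - A. G (insert I A) = padd (G A) (\<lambda>L. p I * mshift I q L)) \<and> s = G (pdom p))"
    unfolding pmul_def map[symmetric] Dc(6) conj_assoc ..
  show ?thesis unfolding e
  proof (rule the_equality)
    show "\<exists>G. df (Fin (Dc p)) (PCo R n) G \<and> G {} = (\<lambda>_. 0) \<and>
     (\<forall>A\<in>HFs (Dc p). \<forall>I\<in>pdom p - A. G (insert I A) = padd (G A) (\<lambda>L. p I * mshift I q L)) \<and> pm p q = G (pdom p)"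
      by (rule exI[of _ "\<lambda>A. pm (rs p A) q"]) (use d ins in \<open>auto simp: rs_empty[OF p] rs_pdom[OF p] pm_0[OF q']\<close>)
    fix s assume "\<exists>G. df (Fin (Dc p)) (PCo R n) G \<and> G {} = (\<lambda>_. 0) \<and>
     (\<forall>A\<in>HFs (Dc p). \<forall>I\<in>pdom p - A. G (insert I A) = padd (G A) (\<lambda>L. p I * mshift I q L)) \<and> s = G (pdom p)"
    then obtain G where G: "df (Fin (Dc p)) (PCo R n) G" "G {} = (\<lambda>_. 0)"
      "\<And>A I. A \<in> HFs (Dc p) \<Longrightarrow> I \<in> pdom p \<Longrightarrow> I \<notin> A \<Longrightarrow> G (insert I A) = padd (G A) (\<lambda>L. p I * mshift I q L)"
      "s = G (pdom p)" by blast
    have "G (pdom p) = pm (rs p (pdom p)) q"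
      using Dc(5)
    proof (rule HFs_induct'[OF Dc(1)])
      show "dp (Fin (Dc p)) (\<lambda>A. G A = pm (rs p A) q)" by (rule dp_eq[OF G(1) d])
      show "G {} = pm (rs p {}) q" using G(2) by (simp add: rs_empty[OF p] pm_0[OF q'])
      fix I A assume "I \<in> car (Dc p)" "A \<in> HFs (Dc p)" "G A = pm (rs p A) q"
      then show "G (insert I A) = pm (rs p (insert I A)) q"
        using G(3)[of A I] ins[of A I] Dc(3) by (cases "I \<in> A") (simp_all add: insert_absorb)
    qed
    then show "s = pm p q" using G(4) by (simp add: rs_pdom[OF p])
  qed
qed

end
end

section \<open>Definable subrings\<close>

definition def_subring :: "'k set \<Rightarrow> bool" where
  "def_subring R \<longleftrightarrow> dp K (\<lambda>x. x \<in> R) \<and> 0 \<in> R \<and> 1 \<in> R \<and> - 1 \<in> R \<and> (\<forall>x\<in>R. \<forall>y\<in>R. x + y \<in> R) \<and> (\<forall>x\<in>R. \<forall>y\<in>R. x * y \<in> R)"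

lemma def_subringD: assumes "def_subring R"
  shows "dp K (\<lambda>x. x \<in> R)" "0 \<in> R" "1 \<in> R" "- 1 \<in> R" "x \<in> R \<Longrightarrow> y \<in> R \<Longrightarrow> x + y \<in> R" "x \<in> R \<Longrightarrow> y \<in> R \<Longrightarrow> x * y \<in> R"
  using assms unfolding def_subring_def by blast+

lemma def_subring_UNIV: "def_subring UNIV"
  unfolding def_subring_def by (simp add: dp_const)

lemma dp_subring: "def_subring R \<Longrightarrow> df W K f \<Longrightarrow> dp W (\<lambda>w. f w \<in> R)"
  by (rule dp_comp[OF def_subringD(1)])

definition frac :: "'k set \<Rightarrow> 'k set" where "frac B = {a / b | a b. a \<in> B \<and> b \<in> B \<and> b \<noteq> 0}"

lemma fracI: "a \<in> B \<Longrightarrow> b \<in> B \<Longrightarrow> b \<noteq> 0 \<Longrightarrow> a / b \<in> frac B"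
  unfolding frac_def by blast

lemma fracE: assumes "x \<in> frac B" obtains a b where "x = a / b" "a \<in> B" "b \<in> B" "b \<noteq> 0"
  using assms unfolding frac_def by blast

lemma frac_inverse: "0 \<in> B \<Longrightarrow> x \<in> frac B \<Longrightarrow> x \<noteq> 0 \<Longrightarrow> 1 / x \<in> frac B"
  by (erule fracE) (use fracI in fastforce)

lemma frac_incl: "def_subring B \<Longrightarrow> B \<subseteq> frac B"
  using fracI[OF _ def_subringD(3)] by (metis div_by_1 subsetI zero_neq_one)

lemma def_subring_frac: assumes B: "def_subring B" shows "def_subring (frac B)"
  unfolding def_subring_def
proof (intro conjI ballI)
  note b = def_subringD[OF B]
  have "dp K (\<lambda>x. \<exists>a b. a \<in> B \<and> b \<in> B \<and> \<not> b = 0 \<and> x = a / b)"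
    by (rule dp_ex_K dp_conj dp_not dp_subring[OF B] dp_eq_K df_divide df_fst df_snd df_id df_const_K cset_cprod cset_Kc)+
  then show "dp K (\<lambda>x. x \<in> frac B)" by (rule dp_congI) (auto simp: frac_def)
  show "0 \<in> frac B" "1 \<in> frac B" "- 1 \<in> frac B" using frac_incl[OF B] b by auto
  fix x y assume "x \<in> frac B" "y \<in> frac B"
  then obtain a c a' c' where x: "x = a / c" "a \<in> B" "c \<in> B" "c \<noteq> 0" and y: "y = a' / c'" "a' \<in> B" "c' \<in> B" "c' \<noteq> 0"
    by (metis fracE)
  have "x + y = (a * c' + a' * c) / (c * c')" "x * y = (a * a') / (c * c')"
    unfolding x(1) y(1) using x(4) y(4) by (simp_all add: field_simps)
  moreover have "a * c' + a' * c \<in> B" "a * a' \<in> B" "c * c' \<in> B" "c * c' \<noteq> 0" using x y b(5,6) by auto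
  ultimately show "x + y \<in> frac B" "x * y \<in> frac B" using fracI by metis+
qed

lemma ZZ_iff: "x \<in> ZZ \<longleftrightarrow> (\<exists>a\<in>NN. \<exists>b\<in>NN. x = a - b)"
proof
  assume "x \<in> ZZ"
  then show "\<exists>a\<in>NN. \<exists>b\<in>NN. x = a - b" unfolding ZZ_def using N_0 by (metis Un_iff diff_0 diff_zero imageE)
next
  assume "\<exists>a\<in>NN. \<exists>b\<in>NN. x = a - b"
  then obtain a b where ab: "a \<in> NN" "b \<in> NN" "x = a - b" by blast
  then have "x \<in> NN \<or> - x \<in> NN" using nle_linear[OF ab(1,2)] by (auto simp: nle_def)
  then show "x \<in> ZZ" unfolding ZZ_def by (metis UnCI add.inverse_inverse image_eqI)
qed

lemma def_subring_ZZ: "def_subring ZZ"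
  unfolding def_subring_def
proof (intro conjI ballI)
  have "dp K (\<lambda>x. \<exists>a b. a \<in> NN \<and> b \<in> NN \<and> x = a - b)" by (rule dfn)+
  then show "dp K (\<lambda>x. x \<in> ZZ)" by (rule dp_congI) (auto simp: ZZ_iff)
  show "0 \<in> ZZ" "1 \<in> ZZ" "- 1 \<in> ZZ" unfolding ZZ_def using N_0 N_1 by auto
  fix x y assume "x \<in> ZZ" "y \<in> ZZ"
  then obtain a b c d where x: "a \<in> NN" "b \<in> NN" "x = a - b" and y: "c \<in> NN" "d \<in> NN" "y = c - d" unfolding ZZ_iff by blast
  have "x + y = (a + c) - (b + d)" "x * y = (a * c + b * d) - (a * d + b * c)"
    unfolding x(3) y(3) by (simp_all add: algebra_simps)
  then show "x + y \<in> ZZ" "x * y \<in> ZZ" unfolding ZZ_iff using x y N_add N_mult by metis+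
qed

lemma QQ_frac: "QQ = frac ZZ"
  by (simp add: QQ_def frac_def)

lemma def_subring_QQ: "def_subring QQ"
  unfolding QQ_frac by (rule def_subring_frac[OF def_subring_ZZ])

text \<open>\<open>polys R m\<close> freed of codes. It makes sense for every \<open>m\<close> and
  is definable jointly in \<open>m\<close> and \<open>p\<close> (\<open>dp_Pol\<close>), as
  induction on the number of variables requires.\<close>

definition Pol :: "'k set \<Rightarrow> 'k \<Rightarrow> (('k \<Rightarrow> 'k) \<Rightarrow> 'k) set" where
  "Pol R m = {p \<in> FSs Sc. \<forall>I. p I \<noteq> 0 \<longrightarrow> (\<forall>i. i \<notin> below m \<longrightarrow> I i = 0) \<and> (\<forall>i. I i \<in> NN) \<and> p I \<in> R}"

lemma polys_Pol: assumes "def_subring R" "m \<in> NN" shows "polys R m = Pol R m"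
proof -
  have "p \<in> polys R m \<longleftrightarrow> p \<in> Pol R m" for p
    unfolding polys_iff[OF assms(2) def_subringD(1)[OF assms(1)]] Pol_def mem_Collect_eq using monoms_iff[OF assms(2)] P_off by metis
  then show ?thesis by blast
qed

lemma PolD: assumes "p \<in> Pol R m"
  shows "p \<in> FSs Sc" "p I \<noteq> 0 \<Longrightarrow> i \<notin> below m \<Longrightarrow> I i = 0" "p I \<noteq> 0 \<Longrightarrow> I i \<in> NN" "p I \<noteq> 0 \<Longrightarrow> p I \<in> R"
    "p I \<noteq> 0 \<Longrightarrow> I \<in> FSs K"
  using assms P_off unfolding Pol_def by blast+

lemma PolI: "p \<in> FSs Sc \<Longrightarrow> (\<And>I i. p I \<noteq> 0 \<Longrightarrow> i \<notin> below m \<Longrightarrow> I i = 0) \<Longrightarrow> (\<And>I i. p I \<noteq> 0 \<Longrightarrow> I i \<in> NN) \<Longrightarrow>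
   (\<And>I. p I \<noteq> 0 \<Longrightarrow> p I \<in> R) \<Longrightarrow> p \<in> Pol R m"
  unfolding Pol_def by blast

lemma Pol_PN: "p \<in> Pol R m \<Longrightarrow> p \<in> PN"
  unfolding PN_def Pol_def by blast

lemma dp_Pol: assumes R: "def_subring R" and m: "df W K m" and p: "df W Pc p" shows "dp W (\<lambda>w. p w \<in> Pol R (m w))"
proof -
  note W = df_cset(1)[OF m]
  have "dp W (\<lambda>w. \<forall>I\<in>car Sc. \<not> ap (p w) I = 0 \<longrightarrow> (\<forall>i. i \<notin> below (m w) \<longrightarrow> ap I i = 0) \<and> (\<forall>i. ap I i \<in> NN) \<and> ap (p w) I \<in> R)"
    by (rule dp_ball dp_all_K dp_imp dp_conj dp_not dp_below dp_K0 dp_subring[OF R] dp_eq_K df_apP df_apS df_comp[OF m] df_comp[OF p]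
      df_fst df_snd df_id df_const_K cset_cprod cset_Kc cset_Sc W)+
  then show ?thesis
  proof (rule dp_congI)
    fix w assume w: "w \<in> car W"
    have pw: "p w \<in> FSs Sc" using df_mem[OF p w] by simp
    then show "p w \<in> Pol R (m w) \<longleftrightarrow> (\<forall>I\<in>car Sc. \<not> ap (p w) I = 0 \<longrightarrow> (\<forall>i. i \<notin> below (m w) \<longrightarrow> ap I i = 0) \<and> (\<forall>i. ap I i \<in> NN) \<and> ap (p w) I \<in> R)"
      unfolding Pol_def mem_Collect_eq ap_def car_FSup using P_off[OF pw] by blast
  qed
qed

lemma Pol_mono: "nle m n \<Longrightarrow> p \<in> Pol R m \<Longrightarrow> p \<in> Pol R n"
  unfolding Pol_def using below_mono by blast

lemma Pol_subset: "R \<subseteq> R' \<Longrightarrow> p \<in> Pol R m \<Longrightarrow> p \<in> Pol R' m"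
  unfolding Pol_def by blast

lemma Pol_0: "(\<lambda>_. 0) \<in> Pol R m"
  by (rule PolI) (simp_all add: P_zero)

lemma Pol_coef: "def_subring R \<Longrightarrow> p \<in> Pol R m \<Longrightarrow> p I \<in> R"
  using PolD(4)[of p R m I] def_subringD(2) by (cases "p I = 0") auto

lemma Pol_add: assumes R: "def_subring R" and p: "p \<in> Pol R m" and q: "q \<in> Pol R m" shows "(\<lambda>I. p I + q I) \<in> Pol R m"
proof (rule PolI)
  show "(\<lambda>I. p I + q I) \<in> FSs Sc" by (rule P_add[OF PolD(1)[OF p] PolD(1)[OF q]])
  fix I assume "p I + q I \<noteq> 0"
  then have "p I \<noteq> 0 \<or> q I \<noteq> 0" by auto
  then show "I i \<in> NN" "i \<notin> below m \<Longrightarrow> I i = 0" for i using PolD(2,3)[OF p, of I i] PolD(2,3)[OF q, of I i] by blast+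
  show "p I + q I \<in> R" by (rule def_subringD(5)[OF R Pol_coef[OF R p] Pol_coef[OF R q]])
qed

lemma Pol_pm: assumes R: "def_subring R" and p: "p \<in> Pol R m" and q: "q \<in> Pol R m" and m: "m \<in> NN" shows "pm p q \<in> Pol R m"
  using pm_polys[OF m def_subringD(1,2,5,6)[OF R], of p q] p q by (simp add: polys_Pol[OF R m])

lemma Pol_mono_term: assumes "I \<in> FSs K" "\<And>i. i \<notin> below m \<Longrightarrow> I i = 0" "\<And>i. I i \<in> NN" "c \<in> R" shows "mono c I \<in> Pol R m"
  by (rule PolI) (use assms P_mono in \<open>auto simp: mono_def split: if_splits\<close>)

lemma Pol_const: "c \<in> R \<Longrightarrow> mono c (\<lambda>_. 0) \<in> Pol R m"
  by (rule Pol_mono_term) (simp_all add: S_zero N_0)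

lemma E_const: "f \<in> FSs K \<Longrightarrow> n \<in> NN \<Longrightarrow> E n (mono c (\<lambda>_. 0)) f = c"
  by (simp add: E_mono S_zero mev_zero)

text \<open>Variables beyond the first \<open>m\<close> occur with exponent 0. All evaluations can
  therefore be made with one fixed number of variables.\<close>

lemma E_Pol_cong:
  assumes p: "p \<in> Pol R m" and m: "m \<in> NN" "nle m n" and f: "f \<in> FSs K" "f' \<in> FSs K" and eq: "\<And>i. i \<in> below m \<Longrightarrow> f i = f' i"
  shows "E n p f = E m p f'"
proof (rule E_cong)
  fix I assume I: "p I \<noteq> 0"
  have I1: "I \<in> FSs K" by (rule PolD(5)[OF p, OF I])
  have "mev n I f = mev m I f" by (rule mev_ext[OF I1 f(1) m]) (rule PolD(2)[OF p, OF I])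
  also have "\<dots> = mev m I f'" by (rule mev_cong[OF I1 I1 f m(1)]) (simp add: eq)
  finally show "mev n I f = mev m I f'" .
qed

subsection \<open>Rings generated by a hyperfinite set\<close>

lemma below_add:
  assumes "n \<in> NN" "m \<in> NN"
  shows "i \<in> below (n + m) \<longleftrightarrow> i \<in> below n \<or> i - n \<in> below m" and "i \<in> below n \<Longrightarrow> i - n \<notin> below m"
proof -
  have 1: "i \<in> below n \<or> i - n \<in> below m" if "i \<in> below (n + m)"
    using that nle_linear[of i n] assms unfolding below_iff nle_def by (auto simp: algebra_simps)
  have 2: "i \<in> below (n + m)" if "i \<in> below n"
    using that below_mono[of n "n + m"] assms by (auto simp: nle_def)
  have 3: "i \<in> below (n + m)" if "i - n \<in> below m"
    using that N_add[of "i - n" n] assms unfolding below_iff nle_def by (auto simp: algebra_simps)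
  show "i \<in> below (n + m) \<longleftrightarrow> i \<in> below n \<or> i - n \<in> below m" using 1 2 3 by blast
  show "i - n \<notin> below m" if "i \<in> below n"
    using that N_neg[of "i - n"] unfolding below_iff nle_def by auto
qed

lemma seq_append_FSs:
  assumes n: "n \<in> NN" and m: "m \<in> NN" and f: "f \<in> FSs K" and g: "g \<in> FSs K" "\<And>i. i \<notin> below m \<Longrightarrow> g i = 0"
  shows "seq_append n f g \<in> FSs K" and "i \<notin> below (n + m) \<Longrightarrow> seq_append n f g i = 0"
proof -
  show off: "seq_append n f g i = 0" if "i \<notin> below (n + m)" for i
    using that below_add[OF n m] g(2) by (simp add: seq_append_def)
  have "df K K (\<lambda>i. if i \<in> below n then f i else g (i - n))"
    by (rule df_If dp_below df_comp[OF S_df[OF f]] df_comp[OF S_df[OF g(1)]] df_minus df_id df_const_K cset_Kc)+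
  then have "df K K (seq_append n f g)" by (simp add: seq_append_def[abs_def])
  then show "seq_append n f g \<in> FSs K"
    by (rule FSs_I[OF cset_Kc below_HFs[OF N_add[OF n m]], rotated]) (use off in \<open>auto simp: supp_def\<close>)
qed

definition en :: "'f \<Rightarrow> 'k \<Rightarrow> ('k \<Rightarrow> 'k) \<Rightarrow> bool" where
  "en A n f \<longleftrightarrow> n \<in> NN \<and> f \<in> FSs K \<and> (\<forall>i. i \<notin> below n \<longrightarrow> f i = 0) \<and> f ` below n = fext A"

lemma QA_iff: "x \<in> QA A \<longleftrightarrow> (\<exists>n f p. en A n f \<and> p \<in> Pol QQ n \<and> x = E n p f)"
proof -
  have e: "x = ev n p f \<and> n \<in> NN \<and> f \<in> seqs UNIV n \<and> f ` below n = {x. mem x A} \<and> p \<in> polys QQ n \<longleftrightarrow>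
     en A n f \<and> p \<in> Pol QQ n \<and> x = E n p f" for n f p
  proof (cases "n \<in> NN")
    case True
    show ?thesis
      unfolding en_def seqs_UNIV[OF True] fext_def[symmetric] polys_Pol[OF def_subring_QQ True, symmetric]
      using ev_eq[OF True def_subringD(1)[OF def_subring_QQ]] by auto
  qed (simp add: en_def)
  show ?thesis unfolding QA_def mem_Collect_eq e by blast
qed

lemma ex_en: "\<exists>n f. en A n f"
proof -
  have "\<exists>n. n \<in> NN \<and> (\<exists>f\<in>FSs K. (\<forall>i. i \<notin> below n \<longrightarrow> f i = 0) \<and> f ` below n = S)" if "S \<in> HFs K" for S
    using that
  proof (rule HFs_induct'[OF cset_Kc])
    have "dp (Fin K) (\<lambda>S. \<exists>n. n \<in> NN \<and> (\<exists>f\<in>car Sc. (\<forall>i. i \<notin> below n \<longrightarrow> ap f i = 0) \<and> (\<forall>y. y \<in> S \<longleftrightarrow> (\<exists>i. i \<in> below n \<and> y = ap f i))))"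
      by (rule dp_ex_K dp_all_K dp_bex dp_conj dp_imp dp_iff dp_not dp_below dp_K0 dp_in_K dp_eq_K df_apS df_fst df_snd df_id df_const_K cset_cprod cset_Kc cset_Sc cset_FinI)+
    then show "dp (Fin K) (\<lambda>S. \<exists>n. n \<in> NN \<and> (\<exists>f\<in>FSs K. (\<forall>i. i \<notin> below n \<longrightarrow> f i = 0) \<and> f ` below n = S))"
    proof (rule dp_congI)
      have "f ` below n = S \<longleftrightarrow> (\<forall>y. y \<in> S \<longleftrightarrow> (\<exists>i. i \<in> below n \<and> y = f i))" for f :: "'k \<Rightarrow> 'k" and n S
        unfolding set_eq_iff image_iff Bex_def by blast
      then show "(\<exists>n. n \<in> NN \<and> (\<exists>f\<in>FSs K. (\<forall>i. i \<notin> below n \<longrightarrow> f i = 0) \<and> f ` below n = S)) \<longleftrightarrow>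
        (\<exists>n. n \<in> NN \<and> (\<exists>f\<in>car Sc. (\<forall>i. i \<notin> below n \<longrightarrow> ap f i = 0) \<and> (\<forall>y. y \<in> S \<longleftrightarrow> (\<exists>i. i \<in> below n \<and> y = ap f i))))" for S
        by (simp add: ap_def)
    qed
    show "\<exists>n. n \<in> NN \<and> (\<exists>f\<in>FSs K. (\<forall>i. i \<notin> below n \<longrightarrow> f i = 0) \<and> f ` below n = {})"
      by (rule exI[of _ 0]) (use N_0 S_zero below_0 in auto)
    fix a S assume "\<exists>n. n \<in> NN \<and> (\<exists>f\<in>FSs K. (\<forall>i. i \<notin> below n \<longrightarrow> f i = 0) \<and> f ` below n = S)"
    then obtain n f where f: "n \<in> NN" "f \<in> FSs K" "\<forall>i. i \<notin> below n \<longrightarrow> f i = 0" "f ` below n = S" by blast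
    have "n \<notin> below n" by (simp add: below_iff)
    then have "(f(n := a)) ` below (n + 1) = insert a S" using f(4) by (auto simp: below_Suc[OF f(1)])
    moreover have "\<forall>i. i \<notin> below (n + 1) \<longrightarrow> (f(n := a)) i = 0" using f(3) by (simp add: below_Suc[OF f(1)])
    ultimately show "\<exists>n. n \<in> NN \<and> (\<exists>f\<in>FSs K. (\<forall>i. i \<notin> below n \<longrightarrow> f i = 0) \<and> f ` below n = insert a S)"
      using N_Suc[OF f(1)] S_upd[OF f(2)] by blast
  qed
  then show ?thesis using fext_HFs[of A] unfolding en_def by blast
qed

lemma en_append:
  assumes f: "en A n f" and g: "en B m g" and C: "fext C = fext A \<union> fext B"
  shows "en C (n + m) (seq_append n f g)"
proof -
  note F = f[unfolded en_def] and G = g[unfolded en_def]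
  have s: "seq_append n f g \<in> FSs K" "\<And>i. i \<notin> below (n + m) \<Longrightarrow> seq_append n f g i = 0"
    using seq_append_FSs[of n m f g] F G by auto
  have nm: "n \<in> NN" "m \<in> NN" using F G by auto
  have "seq_append n f g ` below (n + m) = f ` below n \<union> g ` below m"
  proof
    show "seq_append n f g ` below (n + m) \<subseteq> f ` below n \<union> g ` below m"
      using below_add[OF nm] by (auto simp: seq_append_def)
    have "g j \<in> seq_append n f g ` below (n + m)" if "j \<in> below m" for j
      by (rule image_eqI[of _ _ "n + j"]) (use that below_add[OF nm, of "n + j"] in \<open>auto simp: seq_append_def\<close>)
    moreover have "f j \<in> seq_append n f g ` below (n + m)" if "j \<in> below n" for j
      by (rule image_eqI[of _ _ j]) (use that below_add[OF nm, of j] in \<open>auto simp: seq_append_def\<close>)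
    ultimately show "f ` below n \<union> g ` below m \<subseteq> seq_append n f g ` below (n + m)"
      by (intro Un_least image_subsetI)
  qed
  then show ?thesis using s nm F G C N_add unfolding en_def by auto
qed

lemma E_append_left:
  assumes f: "en A n f" and g: "en B m g" and p: "p \<in> Pol R n"
  shows "E (n + m) p (seq_append n f g) = E n p f"
proof (rule E_Pol_cong[OF p])
  note F = f[unfolded en_def] and G = g[unfolded en_def]
  show "n \<in> NN" "nle n (n + m)" "f \<in> FSs K" using F G by (auto simp: nle_def)
  show "seq_append n f g \<in> FSs K" using seq_append_FSs(1)[of n m f g] F G by auto
qed (simp add: seq_append_def)

lemma mev_shift:
  assumes n: "n \<in> NN" and m: "m \<in> NN" and J: "J \<in> FSs K" "\<And>i. i \<notin> below m \<Longrightarrow> J i = 0"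
    and f: "f \<in> FSs K" and g: "g \<in> FSs K" "\<And>i. i \<notin> below m \<Longrightarrow> g i = 0" and k: "k \<in> NN"
  shows "mev (n + k) (seq_append n (\<lambda>_. 0) J) (seq_append n f g) = mev k J g"
proof -
  have h: "seq_append n f g \<in> FSs K" by (rule seq_append_FSs(1)[OF n m f g])
  have L: "seq_append n (\<lambda>_. 0) J \<in> FSs K" by (rule seq_append_FSs(1)[OF n m S_zero J])
  show ?thesis
    using k
  proof (rule N_induct)
    show "dp K (\<lambda>k. mev (n + k) (seq_append n (\<lambda>_. 0) J) (seq_append n f g) = mev k J g)"
      by (rule dp_eq_K df_mev_n L h J(1) g(1) df_plus df_const_K df_id cset_Kc)+
    have "mev n (seq_append n (\<lambda>_. 0) J) (seq_append n f g) = mev n (\<lambda>_. 0) (seq_append n f g)"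
      by (rule mev_cong[OF L S_zero h h n]) (simp add: seq_append_def)
    then show "mev (n + 0) (seq_append n (\<lambda>_. 0) J) (seq_append n f g) = mev 0 J g"
      by (simp add: mev_zero[OF h n] mev_0[OF J(1) g(1)])
    fix i assume i: "i \<in> NN" "mev (n + i) (seq_append n (\<lambda>_. 0) J) (seq_append n f g) = mev i J g"
    have "n + i \<notin> below n" using i(1) N_neg[of i] by (auto simp: below_iff nle_def)
    then show "mev (n + (i + 1)) (seq_append n (\<lambda>_. 0) J) (seq_append n f g) = mev (i + 1) J g"
      using mev_Suc[OF L h N_add[OF n i(1)]] mev_Suc[OF J(1) g(1) i(1)] i(2) by (simp add: seq_append_def add.assoc)
  qed
qed

text \<open>A polynomial in the second block is rewritten with its exponents moved up by
  \<open>n\<close>. Only the existence of \<open>q'\<close> is carried through the induction, one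
  monomial at a time.\<close>

lemma E_append_right:
  assumes f: "en A n f" and g: "en B m g" and R: "def_subring R" and q: "q \<in> Pol R m"
  shows "\<exists>q'\<in>Pol R (n + m). E (n + m) q' (seq_append n f g) = E m q g"
proof -
  note F = f[unfolded en_def] and G = g[unfolded en_def]
  have nm: "n \<in> NN" "m \<in> NN" "n + m \<in> NN" and fg: "f \<in> FSs K" "g \<in> FSs K" "\<And>i. i \<notin> below m \<Longrightarrow> g i = 0" using F G N_add by auto
  have h: "seq_append n f g \<in> FSs K" by (rule seq_append_FSs(1)[OF nm(1,2) fg])
  have D: "dp Pc (\<lambda>q. q \<in> Pol R m \<longrightarrow> (\<exists>q'\<in>car Pc. q' \<in> Pol R (n + m) \<and> E (n + m) q' (seq_append n f g) = E m q g))"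
    by (rule dp_imp dp_bex dp_conj dp_Pol[OF R] dp_eq_K df_E df_const[OF _ cset_Sc] df_fst df_snd df_id df_const_K cset_cprod cset_Pc | simp only: car_FSup h fg(2))+
  have "q \<in> Pol R m \<longrightarrow> (\<exists>q'\<in>car Pc. q' \<in> Pol R (n + m) \<and> E (n + m) q' (seq_append n f g) = E m q g)"
  proof (rule FSup_induct[OF PolD(1)[OF q] cset_Sc D])
    show "(\<lambda>_. 0) \<in> Pol R m \<longrightarrow> (\<exists>q'\<in>car Pc. q' \<in> Pol R (n + m) \<and> E (n + m) q' (seq_append n f g) = E m (\<lambda>_. 0) g)"
      using Pol_0 P_zero E_0 h fg by fastforce
    fix q J and c :: 'k
    assume a: "q \<in> FSs Sc" "J \<in> car Sc" "q J = 0" "c \<noteq> 0" and IH: "q \<in> Pol R m \<longrightarrow> (\<exists>q'\<in>car Pc. q' \<in> Pol R (n + m) \<and> E (n + m) q' (seq_append n f g) = E m q g)"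
    show "q(J := c) \<in> Pol R m \<longrightarrow> (\<exists>q'\<in>car Pc. q' \<in> Pol R (n + m) \<and> E (n + m) q' (seq_append n f g) = E m (q(J := c)) g)"
    proof
      assume qc: "q(J := c) \<in> Pol R m"
      have J: "J \<in> FSs K" "\<And>i. i \<notin> below m \<Longrightarrow> J i = 0" "\<And>i. J i \<in> NN" "c \<in> R"
        using PolD(2-5)[OF qc, of J] a by auto
      have "q \<in> Pol R m"
      proof (rule PolI[OF a(1)])
        fix I i assume "q I \<noteq> 0"
        then have e: "(q(J := c)) I \<noteq> 0" "(q(J := c)) I = q I" using a(3) by auto
        show "I i \<in> NN" by (rule PolD(3)[OF qc, OF e(1)])
        show "i \<notin> below m \<Longrightarrow> I i = 0" by (rule PolD(2)[OF qc, OF e(1)])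
        show "q I \<in> R" using PolD(4)[OF qc, OF e(1)] unfolding e(2) .
      qed
      then obtain q' where q': "q' \<in> Pol R (n + m)" "E (n + m) q' (seq_append n f g) = E m q g" using IH by blast
      let ?L = "seq_append n (\<lambda>_. 0) J"
      have L: "?L \<in> FSs K" "\<And>i. i \<notin> below (n + m) \<Longrightarrow> ?L i = 0" using seq_append_FSs[OF nm(1,2) S_zero J(1,2)] by auto
      have "?L i \<in> NN" for i using J(3) N_0 by (simp add: seq_append_def)
      then have M: "mono c ?L \<in> Pol R (n + m)" by (intro Pol_mono_term L J(4))
      have "E (n + m) (\<lambda>I. q' I + mono c ?L I) (seq_append n f g) = E m q g + c * mev m J g"
        using E_add[OF h PolD(1)[OF q'(1)] PolD(1)[OF M]] q'(2) E_mono[OF h L(1)] mev_shift[OF nm(1,2) J(1,2) fg nm(2)] by simp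
      also have "\<dots> = E m (q(J := c)) g" using E_upd[OF fg(2) a(1) J(1), of m c] a(3) by simp
      finally show "\<exists>q'\<in>car Pc. q' \<in> Pol R (n + m) \<and> E (n + m) q' (seq_append n f g) = E m (q(J := c)) g"
        using Pol_add[OF R q'(1) M] PolD(1) by (intro bexI[of _ "\<lambda>I. q' I + mono c ?L I"]) auto
    qed
  qed
  then show ?thesis using q by blast
qed

text \<open>\<open>QA\<close> lets the enumeration vary with the element, while sums and products of
  polynomials require a common one. Concatenation provides it, since an enumeration may repeat
  elements.\<close>

lemma QA_common:
  assumes "x \<in> QA A" "y \<in> QA B" "fext C = fext A \<union> fext B"
  obtains n f p q where "en C n f" "p \<in> Pol QQ n" "q \<in> Pol QQ n" "x = E n p f" "y = E n q f"
proof -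
  obtain n f p where 1: "en A n f" "p \<in> Pol QQ n" "x = E n p f" using assms(1) unfolding QA_iff by blast
  obtain m g q where 2: "en B m g" "q \<in> Pol QQ m" "y = E m q g" using assms(2) unfolding QA_iff by blast
  obtain q' where q': "q' \<in> Pol QQ (n + m)" "E (n + m) q' (seq_append n f g) = y"
    using E_append_right[OF 1(1) 2(1) def_subring_QQ 2(2)] 2(3) by metis
  have le: "nle n (n + m)" using 2(1) by (simp add: nle_def en_def)
  have x: "x = E (n + m) p (seq_append n f g)" using E_append_left[OF 1(1) 2(1) 1(2)] 1(3) by simp
  show thesis by (rule that[OF en_append[OF 1(1) 2(1) assms(3)] Pol_mono[OF le 1(2)] q'(1) x q'(2)[symmetric]])
qed

lemma QA_const: "c \<in> QQ \<Longrightarrow> c \<in> QA A"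
  using ex_en[of A] E_const Pol_const unfolding QA_iff en_def by metis

lemma QA_mono: assumes "fext A \<subseteq> fext B" shows "QA A \<subseteq> QA B"
proof
  fix x assume x: "x \<in> QA A"
  have "fext B = fext A \<union> fext B" using assms by blast
  \<comment> \<open>The second element is 0 in \<open>QA B\<close>; it serves to bring in an
    enumeration of \<open>B\<close>.\<close>
  from QA_common[OF x QA_const[OF def_subringD(2)[OF def_subring_QQ]] this] show "x \<in> QA B" unfolding QA_iff by metis
qed

lemma QA_gen: assumes "x \<in> fext A" shows "x \<in> QA A"
proof -
  obtain n f where f: "en A n f" using ex_en by blast
  then obtain i where i: "i \<in> below n" "f i = x" using assms unfolding en_def by (metis imageE)
  have n: "n \<in> NN" "f \<in> FSs K" using f by (auto simp: en_def)
  let ?I = "(\<lambda>_. 0)(i := 1) :: 'k \<Rightarrow> 'k"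
  have I: "?I \<in> FSs K" by (rule S_upd[OF S_zero])
  have "mono 1 ?I \<in> Pol QQ n" by (rule Pol_mono_term[OF I]) (use i N_0 N_1 def_subringD(3)[OF def_subring_QQ] in auto)
  moreover have "x = E n (mono 1 ?I) f"
    unfolding E_mono[OF n(2) I] mev_single[OF n(2) i(1) n(1)] npow_1 i(2) by simp
  ultimately show ?thesis unfolding QA_iff using f by blast
qed

lemma def_subring_QA: "def_subring (QA A)"
  unfolding def_subring_def
proof (intro conjI ballI)
  have "dp K (\<lambda>x. \<exists>n. \<exists>f\<in>car Sc. \<exists>p\<in>car Pc. (n \<in> NN \<and> (\<forall>i. i \<notin> below n \<longrightarrow> ap f i = 0) \<and> (\<forall>y. mem y A \<longleftrightarrow> (\<exists>i. i \<in> below n \<and> y = ap f i)))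
     \<and> p \<in> Pol QQ n \<and> x = E n p f)"
    by (rule dp_ex_K dp_all_K dp_bex dp_conj dp_imp dp_iff dp_not dp_below dp_K0 dp_memI dp_Pol[OF def_subring_QQ] dp_eq_K df_E df_apS
       df_fst df_snd df_id df_const_K df_const_F cset_cprod cset_Kc cset_Sc cset_Pc)+
  then show "dp K (\<lambda>x. x \<in> QA A)"
  proof (rule dp_congI)
    fix x
    have img: "f ` below n = fext A \<longleftrightarrow> (\<forall>y. mem y A \<longleftrightarrow> (\<exists>i. i \<in> below n \<and> y = f i))" for n f
      unfolding fext_def set_eq_iff image_iff mem_Collect_eq Bex_def by blast
    have e: "en A n f \<longleftrightarrow> f \<in> FSs K \<and> (n \<in> NN \<and> (\<forall>i. i \<notin> below n \<longrightarrow> f i = 0) \<and> (\<forall>y. mem y A \<longleftrightarrow> (\<exists>i. i \<in> below n \<and> y = f i)))" for n f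
      unfolding en_def img by blast
    show "x \<in> QA A \<longleftrightarrow> (\<exists>n. \<exists>f\<in>car Sc. \<exists>p\<in>car Pc. (n \<in> NN \<and> (\<forall>i. i \<notin> below n \<longrightarrow> ap f i = 0) \<and> (\<forall>y. mem y A \<longleftrightarrow> (\<exists>i. i \<in> below n \<and> y = ap f i)))
     \<and> p \<in> Pol QQ n \<and> x = E n p f)" unfolding ap_def car_FSup
    proof
      assume "x \<in> QA A"
      then obtain n f p where *: "en A n f" "p \<in> Pol QQ n" "x = E n p f" unfolding QA_iff by blast
      show "\<exists>n. \<exists>f\<in>FSs K. \<exists>p\<in>FSs Sc. (n \<in> NN \<and> (\<forall>i. i \<notin> below n \<longrightarrow> f i = 0) \<and> (\<forall>y. mem y A \<longleftrightarrow> (\<exists>i. i \<in> below n \<and> y = f i)))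
        \<and> p \<in> Pol QQ n \<and> x = E n p f"
        using *(1)[unfolded e] *(2,3) PolD(1)[OF *(2)] by (intro exI[of _ n] bexI[of _ f] bexI[of _ p] conjI) simp_all
    next
      assume "\<exists>n. \<exists>f\<in>FSs K. \<exists>p\<in>FSs Sc. (n \<in> NN \<and> (\<forall>i. i \<notin> below n \<longrightarrow> f i = 0) \<and> (\<forall>y. mem y A \<longleftrightarrow> (\<exists>i. i \<in> below n \<and> y = f i)))
        \<and> p \<in> Pol QQ n \<and> x = E n p f"
      then obtain n f p where "f \<in> FSs K" "n \<in> NN \<and> (\<forall>i. i \<notin> below n \<longrightarrow> f i = 0) \<and> (\<forall>y. mem y A \<longleftrightarrow> (\<exists>i. i \<in> below n \<and> y = f i))"
        "p \<in> Pol QQ n" "x = E n p f" by blast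
      then show "x \<in> QA A" unfolding QA_iff e by blast
    qed
  qed
  show "0 \<in> QA A" "1 \<in> QA A" "- 1 \<in> QA A" using QA_const def_subringD[OF def_subring_QQ] by auto
  fix x y assume "x \<in> QA A" "y \<in> QA A"
  then obtain n f p q where *: "en A n f" "p \<in> Pol QQ n" "q \<in> Pol QQ n" "x = E n p f" "y = E n q f"
    using QA_common[of x A y A A] by blast
  then have n: "n \<in> NN" "f \<in> FSs K" by (auto simp: en_def)
  have "x + y = E n (\<lambda>I. p I + q I) f" using E_add[OF n(2) PolD(1)[OF *(2)] PolD(1)[OF *(3)]] * by simp
  then show "x + y \<in> QA A" unfolding QA_iff using *(1) Pol_add[OF def_subring_QQ *(2,3)] by blast
  have "x * y = E n (pm p q) f" using E_pm[OF Pol_PN[OF *(2)] Pol_PN[OF *(3)] n(2,1)] * by simp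
  then show "x * y \<in> QA A" unfolding QA_iff using *(1) Pol_pm[OF def_subring_QQ *(2,3) n(1)] by blast
qed

lemma QAfrac_eq: "QAfrac A = frac (QA A)"
  by (simp add: QAfrac_def frac_def)

lemma def_subring_QAfrac: "def_subring (QAfrac A)"
  unfolding QAfrac_eq by (rule def_subring_frac[OF def_subring_QA])

lemma QAfrac_mono: "fext A \<subseteq> fext B \<Longrightarrow> QAfrac A \<subseteq> QAfrac B"
  unfolding QAfrac_eq frac_def using QA_mono by blast

text \<open>Definable algebraicity is stated over the ring \<open>QA A\<close>, while the values
  that occur lie in its fraction field. A common denominator over a hyperfinite support is a
  non-standard product, built by \<open>FSup_induct\<close>.\<close>

lemma clear_denominators:
  assumes B: "def_subring B" and u: "u \<in> Pol (frac B) m"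
  shows "\<exists>D\<in>B. D \<noteq> 0 \<and> (\<lambda>I. D * u I) \<in> Pol B m"
proof -
  have Dp: "dp Pc (\<lambda>u. (\<forall>I\<in>car Sc. ap u I \<in> frac B) \<longrightarrow> (\<exists>D. D \<in> B \<and> \<not> D = 0 \<and> (\<forall>I\<in>car Sc. D * ap u I \<in> B)))"
    by (rule dp_imp dp_ball dp_ex_K dp_conj dp_not dp_subring[OF B] dp_subring[OF def_subring_frac[OF B]] dp_eq_K df_times df_apP df_fst df_snd df_id df_const_K cset_cprod cset_Kc cset_Sc cset_Pc)+
  have "(\<forall>I\<in>car Sc. ap u I \<in> frac B) \<longrightarrow> (\<exists>D. D \<in> B \<and> \<not> D = 0 \<and> (\<forall>I\<in>car Sc. D * ap u I \<in> B))"
  proof (rule FSup_induct[OF PolD(1)[OF u] cset_Sc Dp])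
    show "(\<forall>I\<in>car Sc. ap (\<lambda>_. 0) I \<in> frac B) \<longrightarrow> (\<exists>D. D \<in> B \<and> \<not> D = 0 \<and> (\<forall>I\<in>car Sc. D * ap (\<lambda>_. 0) I \<in> B))"
      using def_subringD[OF B] by (intro impI exI[of _ 1]) (auto simp: ap_def)
    fix u I and c :: 'k assume a: "u \<in> FSs Sc" "I \<in> car Sc" "u I = 0"
      and IH: "(\<forall>I\<in>car Sc. ap u I \<in> frac B) \<longrightarrow> (\<exists>D. D \<in> B \<and> \<not> D = 0 \<and> (\<forall>I\<in>car Sc. D * ap u I \<in> B))"
    show "(\<forall>J\<in>car Sc. ap (u(I := c)) J \<in> frac B) \<longrightarrow> (\<exists>D. D \<in> B \<and> \<not> D = 0 \<and> (\<forall>J\<in>car Sc. D * ap (u(I := c)) J \<in> B))"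
    proof
      assume H: "\<forall>J\<in>car Sc. ap (u(I := c)) J \<in> frac B"
      then have "ap u J \<in> frac B" if "J \<in> car Sc" for J
        using bspec[OF H that] a(3) def_subringD(2)[OF def_subring_frac[OF B]] by (cases "J = I") (auto simp: ap_def)
      then obtain D where D: "D \<in> B" "D \<noteq> 0" "\<And>J. J \<in> car Sc \<Longrightarrow> D * u J \<in> B" using IH by (auto simp: ap_def)
      have "c \<in> frac B" using bspec[OF H a(2)] by (simp add: ap_def)
      then obtain x y where c: "c = x / y" "x \<in> B" "y \<in> B" "y \<noteq> 0" by (rule fracE)
      have "(D * y) * (u(I := c)) J \<in> B" if "J \<in> car Sc" for J
      proof (cases "J = I")
        case True
        then have e: "(D * y) * (u(I := c)) J = D * x" using c by simp
        show ?thesis unfolding e by (rule def_subringD(6)[OF B D(1) c(2)])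
      next
        case False
        then have e: "(D * y) * (u(I := c)) J = y * (D * u J)" by simp
        show ?thesis unfolding e by (rule def_subringD(6)[OF B c(3) D(3)[OF that]])
      qed
      then show "\<exists>D. D \<in> B \<and> \<not> D = 0 \<and> (\<forall>J\<in>car Sc. D * ap (u(I := c)) J \<in> B)"
        using def_subringD(6)[OF B D(1) c(3)] D(2) c(4) by (intro exI[of _ "D * y"]) (simp add: ap_def)
    qed
  qed
  then obtain D where D: "D \<in> B" "D \<noteq> 0" "\<And>I. I \<in> FSs K \<Longrightarrow> D * u I \<in> B"
    using Pol_coef[OF def_subring_frac[OF B] u] by (auto simp: ap_def)
  have "(\<lambda>I. D * u I) \<in> Pol B m"
    by (rule PolI) (use FSs_cmult[OF cset_Sc PolD(1)[OF u]] PolD(2,3,5)[OF u] D in auto)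
  then show ?thesis using D by blast
qed

text \<open>Read in two ways: as the argument of a polynomial in one variable, and as the exponent
  sequence of the monomial of degree \<open>x\<close>.\<close>

definition pt :: "'k \<Rightarrow> 'k \<Rightarrow> 'k" where "pt x = (\<lambda>_. 0)(0 := x)"

lemma pt_FSs: "pt x \<in> FSs K"
  unfolding pt_def by (rule S_upd[OF S_zero])

lemma ev1_eq: assumes "def_subring R" "u \<in> Pol R 1" shows "ev1 u x = E 1 u (pt x)"
proof -
  have "(\<lambda>i. if i = 0 then x else 0) = pt x" by (auto simp: pt_def)
  then show ?thesis unfolding ev1_def using ev_eq[OF N_1 def_subringD(1)[OF assms(1)] _ pt_FSs] assms polys_Pol[OF assms(1) N_1] by simp
qed

lemma not_algebraic:
  assumes "\<not> definably_algebraic A x" and u: "u \<in> Pol (QAfrac A) 1" "u \<noteq> (\<lambda>_. 0)"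
  shows "E 1 u (pt x) \<noteq> 0"
proof
  assume z: "E 1 u (pt x) = 0"
  obtain D where D: "D \<in> QA A" "D \<noteq> 0" "(\<lambda>I. D * u I) \<in> Pol (QA A) 1"
    using clear_denominators[OF def_subring_QA u(1)[unfolded QAfrac_eq]] by blast
  have "ev1 (\<lambda>I. D * u I) x = 0"
    unfolding ev1_eq[OF def_subring_QA D(3)] E_cmult[OF pt_FSs PolD(1)[OF u(1)]] z by simp
  moreover have "(\<lambda>I. D * u I) \<noteq> (\<lambda>_. 0)" using u(2) D(2) by (auto simp: fun_eq_iff)
  ultimately show False using assms(1) D(3) polys_Pol[OF def_subring_QA N_1] unfolding definably_algebraic_def by blast
qed

section \<open>Splitting off one variable\<close>

lemma df_supd: assumes I: "df W Sc I" and k: "df W K k" and v: "df W K v" shows "df W Sc (\<lambda>w. (I w)(k w := v w))"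
proof (rule df_FSup)
  note W = df_cset(1)[OF I]
  show "cset W" "cset K" by (rule W cset_Kc)+
  show "(I w)(k w := v w) \<in> FSs K" if "w \<in> car W" for w
    using S_upd df_mem[OF I that] by simp
  have "df (W \<times>\<^sub>c K) K (\<lambda>z. if snd z = k (fst z) then v (fst z) else ap (I (fst z)) (snd z))"
    by (rule df_If dp_eq_K df_apS df_comp[OF I] df_comp[OF k] df_comp[OF v] df_fst df_snd df_id cset_cprod cset_Kc W)+
  then show "df (W \<times>\<^sub>c K) K (\<lambda>z. ((I (fst z))(k (fst z) := v (fst z))) (snd z))"
    unfolding ap_def fun_upd_def .
qed

definition xp :: "'k \<Rightarrow> 'k \<Rightarrow> 'k \<Rightarrow> 'k" where "xp r e = (\<lambda>_. 0)(r := e)"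
definition Xp :: "'k \<Rightarrow> 'k \<Rightarrow> ('k \<Rightarrow> 'k) \<Rightarrow> 'k" where "Xp r e = mono 1 (xp r e)"

text \<open>A strict bound stands in for the degree, which the zero polynomial would lack:
  \<open>deg_less r 0\<close> holds of the zero polynomial alone.\<close>

definition deg_less :: "'k \<Rightarrow> 'k \<Rightarrow> (('k \<Rightarrow> 'k) \<Rightarrow> 'k) \<Rightarrow> bool" where
  "deg_less r e q \<longleftrightarrow> (\<forall>I. q I \<noteq> 0 \<longrightarrow> I r \<in> below e)"

lemma xp_FSs: "xp r e \<in> FSs K"
  unfolding xp_def by (rule S_upd[OF S_zero])

lemma Xp_pm: "q \<in> FSs Sc \<Longrightarrow> pm (Xp r e) q = (\<lambda>I. q (I(r := I r - e)))"
proof -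
  assume q: "q \<in> FSs Sc"
  have "(\<lambda>k. I k - xp r e k) = I(r := I r - e)" for I by (auto simp: xp_def)
  then show ?thesis unfolding Xp_def pm_mono[OF q xp_FSs] by (simp add: mshift_def)
qed

lemma Xp_add: "Xp r (e + t) = pm (Xp r t) (Xp r e)"
proof -
  have "(I = xp r (e + t)) = (I(r := I r - t) = xp r e)" for I
    by (auto simp: xp_def fun_eq_iff algebra_simps)
  then show ?thesis unfolding Xp_pm[OF P_mono[OF xp_FSs], of r t 1 r e, folded Xp_def]
    by (auto simp: Xp_def mono_def)
qed

lemma Xp_0: "q \<in> FSs Sc \<Longrightarrow> pm (Xp r 0) q = q"
  by (simp add: Xp_pm)

lemma Xp_Pol: assumes "def_subring R" "e \<in> NN" "r \<in> NN" shows "Xp r e \<in> Pol R (r + 1)"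
  unfolding Xp_def
proof (rule Pol_mono_term[OF xp_FSs])
  show "xp r e i = 0" if "i \<notin> below (r + 1)" for i using that below_Suc[OF assms(3)] by (auto simp: xp_def)
qed (use assms def_subringD(3) N_0 in \<open>auto simp: xp_def\<close>)

lemma dp_deg_less: assumes e: "df W K e" and q: "df W Pc q" shows "dp W (\<lambda>w. deg_less r (e w) (q w))"
proof -
  note W = df_cset(1)[OF e]
  have "dp W (\<lambda>w. \<forall>I\<in>car Sc. \<not> ap (q w) I = 0 \<longrightarrow> ap I r \<in> below (e w))"
    by (rule dp_ball dp_imp dp_not dp_below dp_eq_K df_apP df_apS df_comp[OF e] df_comp[OF q]
      df_fst df_snd df_id df_const_K cset_cprod cset_Kc cset_Sc W)+
  then show ?thesis
  proof (rule dp_congI)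
    fix w assume w: "w \<in> car W"
    have qw: "q w \<in> FSs Sc" using df_mem[OF q w] by simp
    then show "deg_less r (e w) (q w) \<longleftrightarrow> (\<forall>I\<in>car Sc. \<not> ap (q w) I = 0 \<longrightarrow> ap I r \<in> below (e w))"
      unfolding deg_less_def ap_def car_FSup using P_off[OF qw] by blast
  qed
qed

lemma deg_less_mono: "nle d e \<Longrightarrow> deg_less r d q \<Longrightarrow> deg_less r e q"
  unfolding deg_less_def using below_mono by blast

lemma deg_less_add: "deg_less r e p \<Longrightarrow> deg_less r e q \<Longrightarrow> deg_less r e (padd p q)"
  unfolding deg_less_def padd_def by (metis add.right_neutral)

lemma deg_less_0: "deg_less r 0 q \<Longrightarrow> q = (\<lambda>_. 0)"
  unfolding deg_less_def below_0 by auto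

lemma deg_less_zero: "deg_less r e (\<lambda>_. 0)"
  by (simp add: deg_less_def)

lemma below_irrefl: "r \<notin> below r" by (simp add: below_iff)

lemma deg_less_pm: assumes c: "c \<in> Pol R r" and q: "deg_less r e q" shows "deg_less r e (pm c q)"
  unfolding deg_less_def
proof (intro allI impI)
  fix L assume "pm c q L \<noteq> 0"
  then obtain I J where I: "c I \<noteq> 0" "q J \<noteq> 0" "L = (\<lambda>k. I k + J k)" by (rule pm_supp[OF PolD(1)[OF c]])
  then show "L r \<in> below e" using PolD(2)[OF c, OF I(1) below_irrefl] q by (simp add: deg_less_def)
qed

lemma deg_less_Xp: assumes q: "q \<in> FSs Sc" "deg_less r e q" and e: "e \<in> NN" "t \<in> NN" shows "deg_less r (e + t) (pm (Xp r t) q)"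
  unfolding deg_less_def Xp_pm[OF q(1)]
proof (intro allI impI)
  fix I assume "q (I(r := I r - t)) \<noteq> 0"
  then have "I r - t \<in> below e" using q(2) unfolding deg_less_def by fastforce
  then show "I r \<in> below (e + t)" using below_add(1)[OF e(2,1), of "I r"] by (simp add: add.commute)
qed

lemma deg_less_const: "c \<in> Pol R r \<Longrightarrow> deg_less r 1 c"
  unfolding deg_less_def using PolD(2)[of c R r _ r] below_irrefl below_Suc[OF N_0] by fastforce

lemma deg_less_ex: assumes q: "q \<in> PN" shows "\<exists>m\<in>NN. deg_less r m q"
proof -
  have q': "q \<in> FSs Sc" using q by (simp add: PN_def)
  have D: "dp Pc (\<lambda>q. q \<in> PN \<longrightarrow> (\<exists>m. m \<in> NN \<and> deg_less r m q))"
    by (rule dp_imp dp_comp[OF dp_PN] dp_ex_K dp_conj dp_K0 dp_deg_less df_fst df_snd df_id cset_cprod cset_Kc cset_Pc)+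
  have "q \<in> PN \<longrightarrow> (\<exists>m. m \<in> NN \<and> deg_less r m q)"
  proof (rule FSup_induct[OF q' cset_Sc D])
    show "(\<lambda>_. 0) \<in> PN \<longrightarrow> (\<exists>m. m \<in> NN \<and> deg_less r m (\<lambda>_. 0))" using N_0 deg_less_zero by blast
    fix q I and c :: 'k assume a: "q \<in> FSs Sc" "I \<in> car Sc" "q I = 0" "c \<noteq> 0"
      and IH: "q \<in> PN \<longrightarrow> (\<exists>m. m \<in> NN \<and> deg_less r m q)"
    show "q(I := c) \<in> PN \<longrightarrow> (\<exists>m. m \<in> NN \<and> deg_less r m (q(I := c)))"
    proof
      assume "q(I := c) \<in> PN"
      then have b: "q \<in> PN" "I r \<in> NN" using PN_upd_D[OF _ a(1,3,4)] by blast+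
      then obtain m where m: "m \<in> NN" "deg_less r m q" using IH by blast
      obtain k where k: "k \<in> NN" "nle m k" "nle (I r + 1) k"
        using nle_linear[OF m(1) N_Suc[OF b(2)]] nle_refl m(1) N_Suc[OF b(2)] by blast
      have "I r \<in> below k" using below_mono[OF k(3)] below_Suc[OF b(2)] by blast
      then have "deg_less r k (q(I := c))" using deg_less_mono[OF k(2) m(2)] unfolding deg_less_def by simp
      then show "\<exists>m. m \<in> NN \<and> deg_less r m (q(I := c))" using k(1) by blast
    qed
  qed
  then show ?thesis using q by blast
qed

text \<open>The inductions on the degree that follow peel off the term of degree \<open>m\<close> in
  the last variable with this lemma. The coefficient \<open>c\<close> may be zero.\<close>

lemma deg_less_split:
  assumes q: "q \<in> Pol R (r + 1)" and r: "r \<in> NN" and m: "m \<in> NN" and d: "deg_less r (m + 1) q"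
  obtains c q1 where "c \<in> Pol R r" "q1 \<in> Pol R (r + 1)" "deg_less r m q1" "q = padd (pm (Xp r m) c) q1"
proof -
  define c where "c = (\<lambda>J. if J r = 0 then q (J(r := m)) else 0)"
  define q1 where "q1 = (\<lambda>I. if I r = m then 0 else q I)"
  have qS: "q \<in> FSs Sc" by (rule PolD(1)[OF q])
  have qd: "df Sc K q" and qs: "supp q \<in> HFs Sc" using qS unfolding FSs_iff[OF cset_Sc] by auto
  have up: "df Sc Sc (\<lambda>J. J(r := v))" for v
    by (rule df_supd df_id df_const_K cset_Sc)+
  have "df Sc K (\<lambda>J. if ap J r = 0 then q (J(r := m)) else 0)"
    by (rule df_If dp_eq_K df_apS df_comp[OF qd] up df_const_K df_id cset_Sc)+
  then have cd: "df Sc K c" by (simp add: ap_def c_def)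
  have "supp c \<subseteq> (\<lambda>J. J(r := 0)) ` supp q"
  proof
    fix J assume "J \<in> supp c"
    then have "J r = 0" "q (J(r := m)) \<noteq> 0" by (auto simp: supp_def c_def split: if_splits)
    then show "J \<in> (\<lambda>J. J(r := 0)) ` supp q"
      by (intro image_eqI[of _ _ "J(r := m)"]) (auto simp: supp_def)
  qed
  then have cS: "c \<in> FSs Sc"
    by (rule FSs_I[OF cset_Sc HFs_image'[OF cset_Sc cset_Sc up qs] _ cd])
  have "df Sc K (\<lambda>I. if ap I r = m then 0 else q I)"
    by (rule df_If dp_eq_K df_apS qd df_const_K df_id cset_Sc)+
  then have q1d: "df Sc K q1" by (simp add: ap_def q1_def)
  have q1S: "q1 \<in> FSs Sc"
    by (rule FSs_I[OF cset_Sc qs _ q1d]) (auto simp: supp_def q1_def)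
  show thesis
  proof
    show "c \<in> Pol R r"
    proof (rule PolI[OF cS])
      fix J assume "c J \<noteq> 0"
      then have J: "J r = 0" "q (J(r := m)) \<noteq> 0" by (auto simp: c_def split: if_splits)
      show "c J \<in> R" using J PolD(4)[OF q, OF J(2)] by (simp add: c_def)
      show "J i = 0" if "i \<notin> below r" for i
        using J(1) that PolD(2)[OF q, OF J(2), of i] below_Suc[OF r] by (cases "i = r") auto
      show "J i \<in> NN" for i using J(1) N_0 PolD(3)[OF q, OF J(2), of i] by (cases "i = r") auto
    qed
    show "q1 \<in> Pol R (r + 1)"
    proof (rule PolI[OF q1S])
      fix J assume "q1 J \<noteq> 0"
      then have J: "q J \<noteq> 0" "q1 J = q J" by (auto simp: q1_def split: if_splits)
      show "q1 J \<in> R" using PolD(4)[OF q, OF J(1)] J(2) by simp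
      show "J i = 0" if "i \<notin> below (r + 1)" for i using PolD(2)[OF q, OF J(1) that] .
      show "J i \<in> NN" for i using PolD(3)[OF q, OF J(1)] .
    qed
    show "deg_less r m q1" using d below_Suc[OF m] unfolding deg_less_def q1_def by auto
    show "q = padd (pm (Xp r m) c) q1"
    proof
      fix I :: "'k \<Rightarrow> 'k"
      have "I(r := I r) = I" by simp
      then show "q I = padd (pm (Xp r m) c) q1 I" unfolding padd_def Xp_pm[OF cS] unfolding c_def q1_def by (cases "I r = m") auto
    qed
  qed
qed

lemma E_Xp:
  assumes a: "a \<in> FSs K" and n: "r \<in> below n" "n \<in> NN" and m: "m \<in> NN" and c: "c \<in> Pol R r" and q: "q \<in> Pol R (r + 1)"
  shows "E n (padd (pm (Xp r m) c) q) (a(r := b)) = npow b m * E n c a + E n q (a(r := b))"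
proof -
  have r: "r \<in> NN" "nle r n" using n(1) by (auto simp: below_iff)
  note ab = S_upd[OF a, of r b]
  have "E n (pm (Xp r m) c) (a(r := b)) = E n (Xp r m) (a(r := b)) * E n c (a(r := b))"
    by (rule E_pm[OF Pol_PN[OF Xp_Pol[OF def_subring_UNIV m r(1)]] Pol_PN[OF c] ab n(2)])
  moreover have "E n (Xp r m) (a(r := b)) = npow b m"
    unfolding Xp_def E_mono[OF ab xp_FSs] unfolding xp_def mev_single[OF ab n] by simp
  moreover have "E n c (a(r := b)) = E r c a"
    by (rule E_Pol_cong[OF c r ab a]) (use below_irrefl in auto)
  moreover have "E n c a = E r c a"
    by (rule E_Pol_cong[OF c r a a]) simp
  ultimately show ?thesis
    unfolding padd_def using E_add[OF ab P_pm[OF PolD(1)[OF Xp_Pol[OF def_subring_UNIV m r(1)]] PolD(1)[OF c]] PolD(1)[OF q]] by simp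
qed

lemma E_univariate:
  assumes a: "a \<in> FSs K" and n: "r \<in> below n" "n \<in> NN" and m: "m \<in> NN" and c: "c \<in> Pol R r" and q: "q \<in> Pol R (r + 1)"
    and u: "u \<in> FSs Sc" "E 1 u (pt x) = E n q (a(r := x))"
  shows "E 1 (padd (mono (E n c a) (pt m)) u) (pt x) = E n (padd (pm (Xp r m) c) q) (a(r := x))"
proof -
  have "mev 1 (pt m) (pt x) = npow x m"
    using mev_single[OF pt_FSs[of x], of 0 1 m] below_Suc[OF N_0] N_1 by (simp add: pt_def)
  then show ?thesis
    unfolding E_Xp[OF a n m c q]
    unfolding padd_def E_add[OF pt_FSs P_mono[OF pt_FSs] u(1)] E_mono[OF pt_FSs pt_FSs] u(2) by simp
qed

text \<open>Substituting \<open>a\<close> for the first variables leaves a polynomial in one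
  variable over the ring \<open>L\<close> of values. The induction is on the degree bound, with
  \<open>q\<close> quantified inside.\<close>

lemma univariate:
  assumes R: "def_subring R" and L: "def_subring L" and a: "a \<in> FSs K" and n: "r \<in> below n" "n \<in> NN"
    and La: "\<And>c. c \<in> Pol R r \<Longrightarrow> E n c a \<in> L" and m: "m \<in> NN" and q: "q \<in> Pol R (r + 1)" "deg_less r m q"
  shows "\<exists>u\<in>Pol L 1. deg_less 0 m u \<and> (\<forall>x. E 1 u (pt x) = E n q (a(r := x)))"
proof -
  have r: "r \<in> NN" using n(1) by (auto simp: below_iff)
  have dpt: "df W Sc (\<lambda>w. pt (x w))" if "df W K x" for W :: "('x, 'k, 'f) coded" and x
    unfolding pt_def by (rule df_supd df_const_K that df_const[of _ Sc "\<lambda>_. 0"] df_cset(1)[OF that] cset_Sc | simp only: car_FSup S_zero)+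
  have D: "dp K (\<lambda>m. \<forall>q\<in>car Pc. q \<in> Pol R (r + 1) \<and> deg_less r m q \<longrightarrow>
      (\<exists>u\<in>car Pc. u \<in> Pol L 1 \<and> deg_less 0 m u \<and> (\<forall>x. E 1 u (pt x) = E n q (a(r := x)))))"
    by (rule dp_ball dp_bex dp_imp dp_conj dp_all_K dp_deg_less dp_Pol[OF R] dp_Pol[OF L] dp_eq_K df_E dpt df_supd
      df_const[of _ Sc a] df_fst df_snd df_id df_const_K cset_cprod cset_Kc cset_Sc cset_Pc | simp only: car_FSup a)+
  have "\<forall>q\<in>car Pc. q \<in> Pol R (r + 1) \<and> deg_less r m q \<longrightarrow>
      (\<exists>u\<in>car Pc. u \<in> Pol L 1 \<and> deg_less 0 m u \<and> (\<forall>x. E 1 u (pt x) = E n q (a(r := x))))"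
  proof (rule N_induct[OF m D]; intro ballI impI; elim conjE)
    fix q assume "q \<in> Pol R (r + 1)" "deg_less r 0 q"
    then have "q = (\<lambda>_. 0)" using deg_less_0 by blast
    then show "\<exists>u\<in>car Pc. u \<in> Pol L 1 \<and> deg_less 0 0 u \<and> (\<forall>x. E 1 u (pt x) = E n q (a(r := x)))"
      by (intro bexI[of _ "\<lambda>_. 0"]) (simp_all add: Pol_0 deg_less_zero E_0 pt_FSs S_upd a P_zero)
  next
    fix m q assume m: "m \<in> NN" and q: "q \<in> Pol R (r + 1)" "deg_less r (m + 1) q"
      and IH: "\<forall>q\<in>car Pc. q \<in> Pol R (r + 1) \<and> deg_less r m q \<longrightarrow>
      (\<exists>u\<in>car Pc. u \<in> Pol L 1 \<and> deg_less 0 m u \<and> (\<forall>x. E 1 u (pt x) = E n q (a(r := x))))"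
    obtain c q1 where c: "c \<in> Pol R r" and q1: "q1 \<in> Pol R (r + 1)" "deg_less r m q1" and qe: "q = padd (pm (Xp r m) c) q1"
      by (rule deg_less_split[OF q(1) r m q(2)])
    obtain u1 where u1: "u1 \<in> Pol L 1" "deg_less 0 m u1" "\<And>x. E 1 u1 (pt x) = E n q1 (a(r := x))"
      using IH q1 PolD(1)[OF q1(1)] by auto
    let ?M = "mono (E n c a) (pt m)"
    have M: "?M \<in> Pol L 1"
      by (rule Pol_mono_term[OF pt_FSs]) (use La[OF c] m N_0 below_Suc[OF N_0] in \<open>auto simp: pt_def\<close>)
    have E: "E 1 (padd ?M u1) (pt x) = E n q (a(r := x))" for x
      unfolding qe by (rule E_univariate[OF a n m c q1(1) PolD(1)[OF u1(1)] u1(3)])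
    have "deg_less 0 (m + 1) ?M" using below_Suc[OF m] unfolding deg_less_def mono_def by (auto simp: pt_def)
    moreover have "deg_less 0 (m + 1) u1" using deg_less_mono[OF nle_SucI[OF nle_refl] u1(2)] .
    ultimately have d: "deg_less 0 (m + 1) (padd ?M u1)" by (rule deg_less_add)
    have p: "padd ?M u1 \<in> Pol L 1" unfolding padd_def by (rule Pol_add[OF L M u1(1)])
    show "\<exists>u\<in>car Pc. u \<in> Pol L 1 \<and> deg_less 0 (m + 1) u \<and> (\<forall>x. E 1 u (pt x) = E n q (a(r := x)))"
      by (rule bexI[of _ "padd ?M u1"]) (use p d E PolD(1)[OF p] in auto)
  qed
  then show ?thesis using q PolD(1)[OF q(1)] by auto
qed

text \<open>Keeps track of the coefficient of degree \<open>m\<close>, through which non-vanishing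
  of \<open>c\<close> at \<open>a\<close> is compared with non-vanishing of
  \<open>u\<close>.\<close>

lemma univariate_lead:
  assumes R: "def_subring R" and L: "def_subring L" and a: "a \<in> FSs K" and n: "r \<in> below n" "n \<in> NN"
    and La: "\<And>c. c \<in> Pol R r \<Longrightarrow> E n c a \<in> L" and m: "m \<in> NN"
    and c: "c \<in> Pol R r" and q1: "q1 \<in> Pol R (r + 1)" "deg_less r m q1"
  shows "\<exists>u\<in>Pol L 1. u (pt m) = E n c a \<and> (\<forall>x. E 1 u (pt x) = E n (padd (pm (Xp r m) c) q1) (a(r := x)))"
proof -
  obtain u1 where u1: "u1 \<in> Pol L 1" "deg_less 0 m u1" "\<And>x. E 1 u1 (pt x) = E n q1 (a(r := x))"
    using univariate[OF R L a n La m q1] by blast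
  let ?M = "mono (E n c a) (pt m)"
  have M: "?M \<in> Pol L 1"
    by (rule Pol_mono_term[OF pt_FSs]) (use La[OF c] m N_0 below_Suc[OF N_0] in \<open>auto simp: pt_def\<close>)
  have E: "E 1 (padd ?M u1) (pt x) = E n (padd (pm (Xp r m) c) q1) (a(r := x))" for x
    by (rule E_univariate[OF a n m c q1(1) PolD(1)[OF u1(1)] u1(3)])
  have "u1 (pt m) = 0"
  proof (rule ccontr)
    assume "u1 (pt m) \<noteq> 0"
    then have "pt m 0 \<in> below m" using u1(2) unfolding deg_less_def by blast
    then show False using below_irrefl by (simp add: pt_def)
  qed
  then have "padd ?M u1 (pt m) = E n c a" by (simp add: padd_def mono_def)
  moreover have "padd ?M u1 \<in> Pol L 1" unfolding padd_def by (rule Pol_add[OF L M u1(1)])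
  ultimately show ?thesis using E by blast
qed

subsection \<open>Values at a sequence of parameters\<close>

lemma npow_in: assumes L: "def_subring L" and "x \<in> L" and k: "k \<in> NN" shows "npow x k \<in> L"
  using k
proof (rule N_induct)
  show "dp K (\<lambda>k. npow x k \<in> L)" by (rule dp_subring[OF L] df_npow df_const_K df_id cset_Kc)+
qed (use def_subringD[OF L] assms(2) in \<open>auto simp: npow_0 npow_Suc\<close>)

lemma mev_in:
  assumes L: "def_subring L" and I: "I \<in> FSs K" "\<And>i. I i \<in> NN" and a: "a \<in> FSs K" "\<And>i. i \<in> below r \<Longrightarrow> a i \<in> L" and r: "r \<in> NN"
  shows "mev r I a \<in> L"
proof -
  have D: "dp K (\<lambda>k. nle k r \<longrightarrow> mev k I a \<in> L)"
    by (rule dp_imp dp_nle dp_subring[OF L] df_mev_n I(1) a(1) df_const_K df_id cset_Kc)+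
  have "nle r r \<longrightarrow> mev r I a \<in> L"
  proof (rule N_induct[OF r D])
    show "nle 0 r \<longrightarrow> mev 0 I a \<in> L" using def_subringD(3)[OF L] by (simp add: mev_0[OF I(1) a(1)])
    fix k assume k: "k \<in> NN" and IH: "nle k r \<longrightarrow> mev k I a \<in> L"
    show "nle (k + 1) r \<longrightarrow> mev (k + 1) I a \<in> L"
    proof
      assume "nle (k + 1) r"
      then have kr: "k \<in> below r" using below_mono below_Suc[OF k] by blast
      then have "mev k I a \<in> L" using IH by (simp add: below_iff)
      moreover have "npow (a k) (I k) \<in> L" by (rule npow_in[OF L a(2)[OF kr] I(2)])
      ultimately show "mev (k + 1) I a \<in> L" unfolding mev_Suc[OF I(1) a(1) k] by (rule def_subringD(6)[OF L])
    qed
  qed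
  then show ?thesis using nle_refl by blast
qed

lemma E_in:
  assumes L: "def_subring L" and p: "p \<in> Pol L r" and a: "a \<in> FSs K" "\<And>i. i \<in> below r \<Longrightarrow> a i \<in> L" and r: "r \<in> NN"
  shows "E r p a \<in> L"
  unfolding E_def
proof (rule lin_in[OF cset_Sc mev_df[OF a(1)] def_subringD(1,2,5)[OF L] PolD(1)[OF p]])
  fix I assume I: "p I \<noteq> 0"
  have "mev r I a \<in> L" by (rule mev_in[OF L PolD(5)[OF p, OF I] PolD(3)[OF p, OF I] a r])
  then show "p I * mev r I a \<in> L" by (rule def_subringD(6)[OF L PolD(4)[OF p, OF I]])
qed

end

section \<open>Prime ideals and generic zeros\<close>

text \<open>One round of pseudo-division: the dividend has leading term T Y c and the divisor Y c',
  with T and Y powers of the last variable. The negative of c appears as a d with sum zero because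
  polynomials are negated coefficientwise, not by the operation of the abstract ring.\<close>

lemma (in cring) eliminate_leading_term:
  assumes "T \<in> carrier R" "Y \<in> carrier R" "c \<in> carrier R" "c' \<in> carrier R" "d \<in> carrier R" "k \<in> carrier R" "q \<in> carrier R"
    and cd: "c \<oplus> d = \<zero>"
  shows "c' \<otimes> ((T \<otimes> Y) \<otimes> c \<oplus> k) \<oplus> (T \<otimes> d) \<otimes> (Y \<otimes> c' \<oplus> q) = c' \<otimes> k \<oplus> T \<otimes> (d \<otimes> q)"
proof -
  have "d = \<ominus> c" using minus_equality[of d c] assms by (simp add: a_comm)
  then show ?thesis using assms(1-4,6,7) by algebra
qed

lemma (in cring) collect_quotients:
  assumes "c \<in> carrier R" "c' \<in> carrier R" "k \<in> carrier R" "u \<in> carrier R" "q \<in> carrier R" "s \<in> carrier R"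
  shows "c \<otimes> (c' \<otimes> k \<oplus> u \<otimes> q) \<oplus> s \<otimes> q = (c \<otimes> c') \<otimes> k \<oplus> (c \<otimes> u \<oplus> s) \<otimes> q"
  using assms by algebra

locale prime_pol = hyperfield +
  fixes R :: "'a set" and n :: 'a and P :: "(('a \<Rightarrow> 'a) \<Rightarrow> 'a) set"
  assumes R: "def_subring R" and n: "n \<in> NN" and Pd: "dp Pc (\<lambda>p. p \<in> P)" and prime: "primeideal P (poly_ring R n)"
begin

abbreviation G where "G \<equiv> poly_ring R n"

text \<open>\<open>primeideal\<close> extends \<open>cring\<close>: the laws of the polynomial ring,
  associativity of \<open>pm\<close> among them, come with the hypothesis on
  \<open>P\<close>.\<close>

sublocale G: primeideal P G by (rule prime)

lemma G_carrier: "carrier G = Pol R n"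
  by (simp add: poly_ring_def polys_Pol[OF R n])

lemma G_mult: "x \<in> Pol R n \<Longrightarrow> y \<in> Pol R n \<Longrightarrow> x \<otimes>\<^bsub>G\<^esub> y = pm x y"
  using pmul_eq[OF n def_subringD(1,2,5,6)[OF R]] by (simp add: poly_ring_def polys_Pol[OF R n])

lemma G_add: "x \<oplus>\<^bsub>G\<^esub> y = padd x y" and G_zero: "\<zero>\<^bsub>G\<^esub> = (\<lambda>_. 0)" and G_one: "\<one>\<^bsub>G\<^esub> = mono 1 (\<lambda>_. 0)"
  by (auto simp: poly_ring_def mono_def)

lemma padd_Pol: "x \<in> Pol R m \<Longrightarrow> y \<in> Pol R m \<Longrightarrow> padd x y \<in> Pol R m"
  unfolding padd_def by (rule Pol_add[OF R])

lemma pm_one: "x \<in> FSs Sc \<Longrightarrow> pm (mono 1 (\<lambda>_. 0)) x = x"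
  by (simp add: pm_mono[OF _ S_zero] mshift_def)

lemma neg_eq: "x \<in> FSs Sc \<Longrightarrow> (\<lambda>I. - x I) = pm (mono (- 1) (\<lambda>_. 0)) x"
  by (simp add: pm_mono[OF _ S_zero] mshift_def)

lemma neg_Pol: assumes x: "x \<in> Pol R m" and m: "m \<in> NN" shows "(\<lambda>I. - x I) \<in> Pol R m"
  unfolding neg_eq[OF PolD(1)[OF x]] by (rule Pol_pm[OF R Pol_const[OF def_subringD(4)[OF R]] x m])

lemma P_Pol: "x \<in> P \<Longrightarrow> x \<in> Pol R n"
  using G.a_subset G_carrier by blast

lemma P_add: "x \<in> P \<Longrightarrow> y \<in> P \<Longrightarrow> padd x y \<in> P"
  using additive_subgroup.a_closed[OF G.additive_subgroup_axioms, of x y] by (simp add: G_add)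

lemma P_zero: "(\<lambda>_. 0) \<in> P"
  using additive_subgroup.zero_closed[OF G.additive_subgroup_axioms] by (simp add: G_zero)

lemma P_mul: "s \<in> Pol R n \<Longrightarrow> x \<in> P \<Longrightarrow> pm s x \<in> P"
  using G.I_l_closed[of x s] G_mult[of s x] P_Pol by (simp add: G_carrier)

lemma P_prime: "x \<in> Pol R n \<Longrightarrow> y \<in> Pol R n \<Longrightarrow> pm x y \<in> P \<Longrightarrow> x \<in> P \<or> y \<in> P"
  using G.I_prime[of x y] G_mult[of x y] by (simp add: G_carrier)

lemma P_one: "mono 1 (\<lambda>_. 0) \<notin> P"
  using G.one_imp_carrier G.I_notcarr G_one by metis

lemma P_neg: "x \<in> P \<Longrightarrow> (\<lambda>I. - x I) \<in> P"
  using P_mul[OF Pol_const[OF def_subringD(4)[OF R]], of x] neg_eq PolD(1)[OF P_Pol] by metis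

lemma P_cancel: assumes "padd x y \<in> P" "y \<in> P" shows "x \<in> P"
proof -
  have "x = padd (padd x y) (\<lambda>I. - y I)" by (simp add: padd_def)
  then show ?thesis using P_add[OF assms(1) P_neg[OF assms(2)]] by simp
qed

lemma P_cancel': assumes "padd x y \<in> P" "x \<in> P" shows "y \<in> P"
proof (rule P_cancel[OF _ assms(2)])
  show "padd y x \<in> P" using assms(1) by (simp add: padd_def add.commute)
qed

lemma df_padd: "df W Pc p \<Longrightarrow> df W Pc q \<Longrightarrow> df W Pc (\<lambda>w. padd (p w) (q w))"
  unfolding padd_def by (rule df_Padd)

lemma below_n: assumes "r \<in> below n" shows "r \<in> NN" "nle r n" "nle (r + 1) n"
proof -
  show r: "r \<in> NN" "nle r n" using assms by (simp_all add: below_iff)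
  have "n - r \<in> NN" "n - r \<noteq> 0" using assms by (auto simp: below_iff nle_def)
  then have "n - r - 1 \<in> NN" by (rule N_pred)
  then show "nle (r + 1) n" by (simp add: nle_def algebra_simps)
qed

lemma Pol_Suc: "r \<in> NN \<Longrightarrow> c \<in> Pol R r \<Longrightarrow> c \<in> Pol R (r + 1)"
  by (rule Pol_mono[OF nle_SucI[OF nle_refl]])

text \<open>Multiplying \<open>k\<close> by the leading coefficient \<open>c'\<close> of
  \<open>q\<close> and subtracting a multiple of \<open>q\<close> lowers the degree. After
  \<open>t\<close> rounds the remainder lies in \<open>J\<close> with degree below \<open>e\<close>,
  so in \<open>Z\<close> by \<open>small\<close>. The multiplier is a product of copies of
  \<open>c'\<close> and stays outside \<open>P\<close> because \<open>P\<close> is prime.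
  \<open>J\<close> is left general, as it will be the part of \<open>P\<close> in r + 1 variables
  and then the kernel of an evaluation.\<close>

lemma pseudo_division:
  assumes r: "r \<in> below n"
    and J: "J \<subseteq> Pol R (r + 1)" "dp Pc (\<lambda>q. q \<in> J)" and Z: "dp Pc (\<lambda>q. q \<in> Z)"
    and Jadd: "\<And>x y. x \<in> J \<Longrightarrow> y \<in> J \<Longrightarrow> padd x y \<in> J"
    and Jmul: "\<And>s x. s \<in> Pol R (r + 1) \<Longrightarrow> x \<in> J \<Longrightarrow> pm s x \<in> J"
    and e: "e \<in> NN" and q: "q \<in> J" "q = padd (pm (Xp r e) c') q1" "q1 \<in> Pol R (r + 1)" "deg_less r e q1"
    and c': "c' \<in> Pol R r" "c' \<notin> P" and small: "\<And>k. k \<in> J \<Longrightarrow> deg_less r e k \<Longrightarrow> k \<in> Z"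
    and t: "t \<in> NN" and k: "k \<in> J" "deg_less r (e + t) k"
  shows "\<exists>c\<in>Pol R r. c \<notin> P \<and> (\<exists>s\<in>Pol R (r + 1). deg_less r t s \<and> padd (pm c k) (pm s q) \<in> Z)"
proof -
  note r' = below_n[OF r] and S1 = Pol_mono[OF below_n(3)[OF r]]
  note rS = N_Suc[OF r'(1)] and pmS = Pol_pm[OF R _ _ N_Suc[OF r'(1)]] and CS = Pol_Suc[OF r'(1)]
  have qS: "q \<in> FSs Sc" using PolD(1) q(1) J by blast
  have D: "dp K (\<lambda>t. \<forall>k\<in>car Pc. k \<in> J \<and> deg_less r (e + t) k \<longrightarrow> (\<exists>c\<in>car Pc. c \<in> Pol R r \<and> \<not> c \<in> P \<and>
      (\<exists>s\<in>car Pc. s \<in> Pol R (r + 1) \<and> deg_less r t s \<and> padd (pm c k) (pm s q) \<in> Z)))"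
    by (rule dp_ball dp_bex dp_imp dp_conj dp_not dp_deg_less dp_Pol[OF R] dp_comp[OF Pd] dp_comp[OF Z] dp_comp[OF J(2)]
      df_padd df_pm df_plus df_const[of _ Pc q] df_fst df_snd df_id df_const_K cset_cprod cset_Kc cset_Pc | simp only: car_FSup qS)+
  have "\<forall>k\<in>car Pc. k \<in> J \<and> deg_less r (e + t) k \<longrightarrow> (\<exists>c\<in>car Pc. c \<in> Pol R r \<and> \<not> c \<in> P \<and>
      (\<exists>s\<in>car Pc. s \<in> Pol R (r + 1) \<and> deg_less r t s \<and> padd (pm c k) (pm s q) \<in> Z))"
  proof (rule N_induct[OF t D]; intro ballI impI; elim conjE)
    fix k assume k: "k \<in> J" "deg_less r (e + 0) k"
    have "padd (pm (mono 1 (\<lambda>_. 0)) k) (pm (\<lambda>_. 0) q) = k"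
      using pm_one[of k] pm_0[OF qS] k(1) J PolD(1) by (auto simp: padd_def)
    then have "padd (pm (mono 1 (\<lambda>_. 0)) k) (pm (\<lambda>_. 0) q) \<in> Z" using small k by simp
    then show "\<exists>c\<in>car Pc. c \<in> Pol R r \<and> c \<notin> P \<and>
        (\<exists>s\<in>car Pc. s \<in> Pol R (r + 1) \<and> deg_less r 0 s \<and> padd (pm c k) (pm s q) \<in> Z)"
      using Pol_const[OF def_subringD(3)[OF R]] P_one Pol_0 deg_less_zero PolD(1) car_FSup by blast
  next
    fix t k assume t: "t \<in> NN" and k: "k \<in> J" "deg_less r (e + (t + 1)) k"
      and IH: "\<forall>k\<in>car Pc. k \<in> J \<and> deg_less r (e + t) k \<longrightarrow> (\<exists>c\<in>car Pc. c \<in> Pol R r \<and> c \<notin> P \<and>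
      (\<exists>s\<in>car Pc. s \<in> Pol R (r + 1) \<and> deg_less r t s \<and> padd (pm c k) (pm s q) \<in> Z))"
    have k': "k \<in> Pol R (r + 1)" "deg_less r ((e + t) + 1) k" using J(1) k by (auto simp: add.assoc)
    obtain c'' k1 where c'': "c'' \<in> Pol R r" and k1: "k1 \<in> Pol R (r + 1)" "deg_less r (e + t) k1"
      and ke: "k = padd (pm (Xp r (e + t)) c'') k1"
      by (rule deg_less_split[OF k'(1) r'(1) N_add[OF e t] k'(2)])
    define d where "d = (\<lambda>I. - c'' I)"
    define u where "u = pm (Xp r t) d"
    have dC: "d \<in> Pol R r" unfolding d_def by (rule neg_Pol[OF c'' r'(1)])
    have cd: "padd c'' d = (\<lambda>_. 0)" by (simp add: d_def padd_def)
    note XT = Xp_Pol[OF R t r'(1)] and XE = Xp_Pol[OF R e r'(1)]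
    have uS: "u \<in> Pol R (r + 1)" unfolding u_def by (rule pmS[OF XT CS[OF dC]])
    have "deg_less r (1 + t) u" unfolding u_def by (rule deg_less_Xp[OF PolD(1)[OF dC] deg_less_const[OF dC] N_1 t])
    then have ud: "deg_less r (t + 1) u" by (simp add: add.commute)
    \<comment> \<open>In this combination the terms of degree \<open>e + t\<close> cancel; the
      second expression \<open>k2e\<close> contains only the lower parts \<open>k1\<close> and
      \<open>q1\<close>, from which the degree bound is read off.\<close>
    define k2 where "k2 = padd (pm c' k) (pm u q)"
    have dq1: "pm d q1 \<in> Pol R (r + 1)" by (rule pmS[OF CS[OF dC] q(3)])
    have k2e: "k2 = padd (pm c' k1) (pm (Xp r t) (pm d q1))"
    proof -
      have "pm c' (padd (pm (pm (Xp r t) (Xp r e)) c'') k1) = pm c' k" by (simp add: ke Xp_add)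
      then show ?thesis
        using G.eliminate_leading_term[of "Xp r t" "Xp r e" c'' c' d k1 q1]
          S1[OF XT] S1[OF XE] S1[OF CS[OF c'']] S1[OF CS[OF c'(1)]] S1[OF CS[OF dC]] S1[OF k1(1)] S1[OF q(3)]
        by (simp add: G_carrier G_mult G_add G_zero cd Pol_pm[OF R _ _ n] padd_Pol k2_def u_def q(2))
    qed
    have "deg_less r (e + t) (pm (Xp r t) (pm d q1))"
      by (rule deg_less_Xp[OF PolD(1)[OF dq1] deg_less_pm[OF dC q(4)] e t])
    then have k2d: "deg_less r (e + t) k2" unfolding k2e by (rule deg_less_add[OF deg_less_pm[OF c'(1) k1(2)]])
    have k2J: "k2 \<in> J" unfolding k2_def by (rule Jadd[OF Jmul[OF CS[OF c'(1)] k(1)] Jmul[OF uS q(1)]])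
    then have "k2 \<in> car Pc" using J(1) PolD(1) by auto
    then obtain c s where c: "c \<in> Pol R r" "c \<notin> P" and s: "s \<in> Pol R (r + 1)" "deg_less r t s"
      and z: "padd (pm c k2) (pm s q) \<in> Z"
      using IH k2d k2J by blast
    have qn: "q \<in> Pol R n" using S1 q(1) J(1) by blast
    \<comment> \<open>The two rounds are combined: the new multiplier is the product of
      \<open>c\<close> and \<open>c'\<close>, and the new quotient is \<open>c\<close> times
      \<open>u\<close> plus \<open>s\<close>.\<close>
    have "padd (pm c k2) (pm s q) = padd (pm (pm c c') k) (pm (padd (pm c u) s) q)"
      unfolding k2_def using G.collect_quotients[of c c' k u q s]
        S1[OF CS[OF c'(1)]] S1[OF CS[OF c(1)]] S1[OF k'(1)] S1[OF uS] S1[OF s(1)] qn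
      by (simp add: G_carrier G_mult G_add Pol_pm[OF R _ _ n] padd_Pol)
    then have "padd (pm (pm c c') k) (pm (padd (pm c u) s) q) \<in> Z" using z by simp
    moreover have "pm c c' \<in> Pol R r" by (rule Pol_pm[OF R c(1) c'(1) r'(1)])
    moreover have "pm c c' \<notin> P" using P_prime[OF S1[OF CS[OF c(1)]] S1[OF CS[OF c'(1)]]] c(2) c'(2) by blast
    moreover have "padd (pm c u) s \<in> Pol R (r + 1)" by (rule padd_Pol[OF pmS[OF CS[OF c(1)] uS] s(1)])
    moreover have "deg_less r (t + 1) (padd (pm c u) s)"
      by (rule deg_less_add[OF deg_less_pm[OF c(1) ud] deg_less_mono[OF nle_SucI[OF nle_refl] s(2)]])
    ultimately show "\<exists>c\<in>car Pc. c \<in> Pol R r \<and> c \<notin> P \<and>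
        (\<exists>s\<in>car Pc. s \<in> Pol R (r + 1) \<and> deg_less r (t + 1) s \<and> padd (pm c k) (pm s q) \<in> Z)"
      using PolD(1) car_FSup by blast
  qed
  moreover have "k \<in> car Pc" using k(1) J(1) PolD(1) by auto
  ultimately show ?thesis using k by blast
qed

lemma least_degree:
  assumes r: "r \<in> NN" and Q: "dp Pc Q" "\<not> Q (\<lambda>_. 0)" and q: "q \<in> Pol R (r + 1)" "Q q"
  shows "\<exists>e\<in>NN. \<exists>q\<in>Pol R (r + 1). Q q \<and> deg_less r (e + 1) q \<and> (\<forall>k\<in>Pol R (r + 1). Q k \<longrightarrow> \<not> deg_less r e k)"
proof -
  have D: "dp K (\<lambda>m. \<exists>q\<in>car Pc. q \<in> Pol R (r + 1) \<and> Q q \<and> deg_less r m q)"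
    by (rule dp_bex dp_conj dp_deg_less dp_Pol[OF R] dp_comp[OF Q(1)] df_fst df_snd df_id df_const_K cset_cprod cset_Kc cset_Pc)+
  obtain k where k: "k \<in> NN" "deg_less r k q" using deg_less_ex[OF Pol_PN[OF q(1)]] by blast
  then have "\<exists>q\<in>car Pc. q \<in> Pol R (r + 1) \<and> Q q \<and> deg_less r k q" using q PolD(1) by auto
  then obtain m where m: "m \<in> NN" "\<exists>q\<in>car Pc. q \<in> Pol R (r + 1) \<and> Q q \<and> deg_less r m q"
    "\<And>j. j \<in> NN \<Longrightarrow> \<exists>q\<in>car Pc. q \<in> Pol R (r + 1) \<and> Q q \<and> deg_less r j q \<Longrightarrow> nle m j"
    using N_least[OF D k(1)] by blast
  \<comment> \<open>The bound 0 belongs to the zero polynomial alone, which fails \<open>Q\<close>.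
    The least bound is therefore e + 1 with e the degree.\<close>
  have "m \<noteq> 0" using m(2) Q(2) deg_less_0 by blast
  then have e: "m - 1 \<in> NN" by (rule N_pred[OF m(1)])
  have "\<not> deg_less r (m - 1) k" if "k \<in> Pol R (r + 1)" "Q k" for k
    using m(3)[OF e] that PolD(1)[OF that(1)] neg_1_not_K0 by (auto simp: nle_def)
  then show ?thesis using m(2) e by (intro bexI[of _ "m - 1"]) auto
qed

text \<open>Evaluation takes place in all \<open>n\<close> variables and membership in the one ideal
  \<open>P\<close>, so that \<open>r\<close> is the only quantity that moves in an induction on the
  number of variables.\<close>

definition gen :: "'a \<Rightarrow> ('a \<Rightarrow> 'a) \<Rightarrow> bool" where
  "gen r a \<longleftrightarrow> a \<in> FSs K \<and> (\<forall>i. i \<notin> below r \<longrightarrow> a i = 0) \<and> (\<forall>p\<in>Pol R r. E n p a = 0 \<longleftrightarrow> p \<in> P)"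

text \<open>The entries of \<open>a\<close> form a hyperfinite set, so they can be adjoined to
  \<open>A\<close> within a single code \<open>B\<close>. This gives the field over which
  \<open>\<tau>\<close> will have to be transcendental.\<close>

lemma values_field:
  assumes RA: "R = QAfrac A" and a: "a \<in> FSs K" and r: "r \<in> NN" "nle r n"
  shows "\<exists>B. \<forall>c\<in>Pol R r. E n c a \<in> QAfrac B"
proof -
  have "a ` below r \<in> HFs K" by (rule HFs_image'[OF cset_Kc cset_Kc S_df[OF a] below_HFs[OF r(1)]])
  then have "fext A \<union> a ` below r \<in> HFs K" by (rule HFs_Un'[OF cset_Kc fext_HFs])
  then obtain B where B: "fext B = fext A \<union> a ` below r" using HFs_K by auto
  have RB: "R \<subseteq> QAfrac B" unfolding RA by (rule QAfrac_mono) (simp add: B)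
  have aB: "a i \<in> QAfrac B" if "i \<in> below r" for i
    using QA_gen[of "a i" B] frac_incl[OF def_subring_QA, of B] that B by (auto simp: QAfrac_eq)
  have "E n c a \<in> QAfrac B" if c: "c \<in> Pol R r" for c
  proof -
    have "E n c a = E r c a" by (rule E_Pol_cong[OF c r a a]) simp
    then show ?thesis using E_in[OF def_subring_QAfrac Pol_subset[OF RB c] a aB r(1)] by simp
  qed
  then show ?thesis by blast
qed

section \<open>Extending a generic zero by one variable\<close>

context
  fixes r a \<tau> B
  assumes r: "r \<in> below n" and gen: "gen r a" and vals: "\<And>c. c \<in> Pol R r \<Longrightarrow> E n c a \<in> QAfrac B"
    and tau: "\<not> definably_algebraic B \<tau>" and closed: definably_alg_closed
begin

lemma a_FSs: "a \<in> FSs K" using gen by (simp add: gen_def)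

lemma C_iff: "c \<in> Pol R r \<Longrightarrow> E n c a = 0 \<longleftrightarrow> c \<in> P" using gen by (simp add: gen_def)

lemma S_n: "p \<in> Pol R (r + 1) \<Longrightarrow> p \<in> Pol R n" by (rule Pol_mono[OF below_n(3)[OF r]])

lemma C_S: "p \<in> Pol R r \<Longrightarrow> p \<in> Pol R (r + 1)" by (rule Pol_Suc[OF below_n(1)[OF r]])

definition ph :: "'a \<Rightarrow> (('a \<Rightarrow> 'a) \<Rightarrow> 'a) \<Rightarrow> 'a" where "ph b q = E n q (a(r := b))"

lemma ph_FSs: "a(r := b) \<in> FSs K" by (rule S_upd[OF a_FSs])

lemma ph_pm: "p \<in> Pol R (r + 1) \<Longrightarrow> q \<in> Pol R (r + 1) \<Longrightarrow> ph b (pm p q) = ph b p * ph b q"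
  unfolding ph_def by (rule E_pm[OF Pol_PN Pol_PN ph_FSs n])

lemma ph_add: "p \<in> Pol R (r + 1) \<Longrightarrow> q \<in> Pol R (r + 1) \<Longrightarrow> ph b (padd p q) = ph b p + ph b q"
  unfolding ph_def padd_def by (rule E_add[OF ph_FSs PolD(1) PolD(1)])

lemma ph_0: "ph b (\<lambda>_. 0) = 0"
  unfolding ph_def by (rule E_0[OF ph_FSs])

lemma ph_const: assumes c: "c \<in> Pol R r" shows "ph b c = E n c a"
proof -
  have "E n c (a(r := b)) = E r c a" "E n c a = E r c a"
    by (rule E_Pol_cong[OF c below_n(1,2)[OF r] ph_FSs a_FSs] E_Pol_cong[OF c below_n(1,2)[OF r] a_FSs a_FSs];
      use below_irrefl in auto)+
  then show ?thesis by (simp add: ph_def)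
qed

lemma ph_split: "m \<in> NN \<Longrightarrow> c \<in> Pol R r \<Longrightarrow> q \<in> Pol R (r + 1) \<Longrightarrow>
  ph b (padd (pm (Xp r m) c) q) = npow b m * E n c a + ph b q"
  unfolding ph_def by (rule E_Xp[OF a_FSs r n])

lemma S_pm: "p \<in> Pol R (r + 1) \<Longrightarrow> q \<in> Pol R (r + 1) \<Longrightarrow> pm p q \<in> Pol R (r + 1)"
  by (rule Pol_pm[OF R _ _ N_Suc[OF below_n(1)[OF r]]])

lemma Xp_S: "m \<in> NN \<Longrightarrow> Xp r m \<in> Pol R (r + 1)" by (rule Xp_Pol[OF R _ below_n(1)[OF r]])

lemma dp_ker: "dp Pc (\<lambda>q. q \<in> {q \<in> Pol R (r + 1). ph b q = 0})"
  unfolding mem_Collect_eq ph_def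
  by (rule dp_conj dp_Pol[OF R] dp_eq_K df_E df_const[of _ Sc "a(r := b)"] df_id df_const_K cset_Pc cset_Sc | simp only: car_FSup ph_FSs)+

text \<open>Plays the part of the zero ideal among polynomials over the residue ring of the first
  \<open>r\<close> variables. Describing it by one evaluation, instead of by coefficients, makes it
  definable at once.\<close>

definition Z where "Z = {q \<in> Pol R (r + 1). ph \<tau> q = 0}"

lemma dp_Z: "dp Pc (\<lambda>q. q \<in> Z)" unfolding Z_def by (rule dp_ker)

text \<open>A polynomial that vanishes at the transcendental \<open>\<tau>\<close> vanishes coefficientwise.\<close>

lemma Z_step:
  assumes m: "m \<in> NN" and c: "c \<in> Pol R r" and q1: "q1 \<in> Pol R (r + 1)" "deg_less r m q1" and z: "padd (pm (Xp r m) c) q1 \<in> Z"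
  shows "c \<in> P" "q1 \<in> Z"
proof -
  obtain u where u: "u \<in> Pol (QAfrac B) 1" "u (pt m) = E n c a"
    "\<And>x. E 1 u (pt x) = E n (padd (pm (Xp r m) c) q1) (a(r := x))"
    using univariate_lead[OF R def_subring_QAfrac a_FSs r n vals m c q1] by blast
  have "E 1 u (pt \<tau>) = 0" using z u(3)[of \<tau>] by (simp add: Z_def ph_def)
  \<comment> \<open>The coefficients of \<open>u\<close> lie in \<open>QAfrac B\<close>, over which
    \<open>\<tau>\<close> satisfies no non-trivial equation. With \<open>u\<close> its coefficient
    of degree \<open>m\<close> vanishes, which is the value of \<open>c\<close> at
    \<open>a\<close>.\<close>
  then have "u = (\<lambda>_. 0)" using not_algebraic[OF tau u(1)] by blast
  then have c0: "E n c a = 0" using u(2) by simp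
  then show "c \<in> P" using C_iff[OF c] by simp
  show "q1 \<in> Z" using z q1(1) ph_split[OF m c q1(1), of \<tau>] c0 by (simp add: Z_def)
qed

text \<open>By \<open>Z_step\<close> an element of \<open>Z\<close> is built from powers of the last
  variable with coefficients in \<open>P\<close>. The ideal absorbs these terms, and their
  coefficients vanish at \<open>a\<close>, whatever the last entry \<open>b\<close> is.\<close>

lemma Z_sub: assumes q: "q \<in> Z" shows "q \<in> P" "ph b q = 0"
proof -
  have qS: "q \<in> Pol R (r + 1)" using q by (simp add: Z_def)
  obtain m where m: "m \<in> NN" "deg_less r m q" using deg_less_ex[OF Pol_PN[OF qS]] by blast
  have D: "dp K (\<lambda>m. \<forall>q\<in>car Pc. q \<in> Z \<and> deg_less r m q \<longrightarrow> q \<in> P \<and> q \<in> {q \<in> Pol R (r + 1). ph b q = 0})"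
    by (rule dp_ball dp_imp dp_conj dp_deg_less dp_comp[OF dp_Z] dp_comp[OF Pd] dp_comp[OF dp_ker] df_fst df_snd df_id df_const_K cset_cprod cset_Kc cset_Pc)+
  have "\<forall>q\<in>car Pc. q \<in> Z \<and> deg_less r m q \<longrightarrow> q \<in> P \<and> q \<in> {q \<in> Pol R (r + 1). ph b q = 0}"
  proof (rule N_induct[OF m(1) D]; intro ballI impI; elim conjE)
    fix q assume "deg_less r 0 q"
    then have "q = (\<lambda>_. 0)" by (rule deg_less_0)
    then show "q \<in> P \<and> q \<in> {q \<in> Pol R (r + 1). ph b q = 0}" using P_zero Pol_0 ph_0 by simp
  next
    fix m q assume m: "m \<in> NN" and q: "q \<in> Z" "deg_less r (m + 1) q"
      and IH: "\<forall>q\<in>car Pc. q \<in> Z \<and> deg_less r m q \<longrightarrow> q \<in> P \<and> q \<in> {q \<in> Pol R (r + 1). ph b q = 0}"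
    have qS: "q \<in> Pol R (r + 1)" using q(1) by (simp add: Z_def)
    obtain c q1 where c: "c \<in> Pol R r" and q1: "q1 \<in> Pol R (r + 1)" "deg_less r m q1" and qe: "q = padd (pm (Xp r m) c) q1"
      by (rule deg_less_split[OF qS below_n(1)[OF r] m q(2)])
    note z = Z_step[OF m c q1 q(1)[unfolded qe]]
    have "q1 \<in> P" "ph b q1 = 0" using IH z(2) q1(2) PolD(1)[OF q1(1)] by auto
    moreover have "pm (Xp r m) c \<in> P" by (rule P_mul[OF S_n[OF Xp_S[OF m]] z(1)])
    ultimately show "q \<in> P \<and> q \<in> {q \<in> Pol R (r + 1). ph b q = 0}"
      using qS C_iff[OF c] z(1) ph_split[OF m c q1(1), of b] P_add by (simp add: qe)
  qed
  then show "q \<in> P" "ph b q = 0" using q m(2) PolD(1)[OF qS] by auto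
qed

lemma gen_Suc: assumes eq: "\<And>p. p \<in> Pol R (r + 1) \<Longrightarrow> ph b p = 0 \<longleftrightarrow> p \<in> P" shows "gen (r + 1) (a(r := b))"
  unfolding gen_def
proof (intro conjI ballI allI impI)
  show "a(r := b) \<in> FSs K" by (rule ph_FSs)
  show "(a(r := b)) i = 0" if "i \<notin> below (r + 1)" for i
    using that gen below_Suc[OF below_n(1)[OF r]] by (auto simp: gen_def)
  show "E n p (a(r := b)) = 0 \<longleftrightarrow> p \<in> P" if "p \<in> Pol R (r + 1)" for p using eq[OF that] by (simp add: ph_def)
qed

text \<open>
  For \<open>b\<close> a zero of an element \<open>p \<in> P - Z\<close> of least degree, pseudo-division by \<open>p\<close> shows that \<open>P\<close>
  vanishes at \<open>b\<close>, and pseudo-division of \<open>p\<close> by an element of least degree of the kernel at \<open>b\<close>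
  shows the converse.
\<close>

lemma algebraic_extension:
  assumes p0: "p0 \<in> Pol R (r + 1)" "p0 \<in> P" "p0 \<notin> Z"
  shows "\<exists>b. \<forall>p\<in>Pol R (r + 1). ph b p = 0 \<longleftrightarrow> p \<in> P"
proof -
  note rN = below_n(1)[OF r]
  have Z0: "(\<lambda>_. 0) \<in> Z" by (simp add: Z_def Pol_0 ph_0)
  have Q1: "dp Pc (\<lambda>q. q \<in> P \<and> \<not> q \<in> Z)" by (rule dp_conj dp_not Pd dp_Z)+
  obtain d p where d: "d \<in> NN" and p: "p \<in> Pol R (r + 1)" "p \<in> P" "p \<notin> Z" "deg_less r (d + 1) p"
    and dmin: "\<And>k. k \<in> Pol R (r + 1) \<Longrightarrow> k \<in> P \<Longrightarrow> deg_less r d k \<Longrightarrow> k \<in> Z"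
    using least_degree[OF rN Q1 _ p0(1)] p0 Z0 by blast
  obtain c p1 where c: "c \<in> Pol R r" and p1: "p1 \<in> Pol R (r + 1)" "deg_less r d p1" and pe: "p = padd (pm (Xp r d) c) p1"
    by (rule deg_less_split[OF p(1) rN d p(4)])
  \<comment> \<open>Otherwise the leading term lies in \<open>P\<close> and vanishes at
    \<open>\<tau>\<close>, and the rest \<open>p1\<close> would be an element of \<open>P\<close>
    outside \<open>Z\<close> of smaller degree.\<close>
  have cP: "c \<notin> P"
  proof
    assume cP: "c \<in> P"
    have "p1 \<in> P" by (rule P_cancel'[OF p(2)[unfolded pe] P_mul[OF S_n[OF Xp_S[OF d]] cP]])
    then have "p1 \<in> Z" using dmin p1 by blast
    then have "ph \<tau> p = 0" using ph_split[OF d c p1(1)] cP C_iff[OF c] by (simp add: pe Z_def)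
    then show False using p by (simp add: Z_def)
  qed
  \<comment> \<open>Positive degree makes the substituted polynomial non-constant, so that it has a
    zero.\<close>
  have d0: "d \<noteq> 0"
  proof
    assume "d = 0"
    then have "p = c" using deg_less_0[of r p1] p1(2) Xp_0[OF PolD(1)[OF c]] by (simp add: pe padd_def)
    then show False using p(2) cP by simp
  qed
  obtain b where b: "ph b p = 0"
  proof -
    obtain u where u: "u \<in> Pol UNIV 1" "u (pt d) = E n c a" "\<And>x. E 1 u (pt x) = ph x p"
      using univariate_lead[OF R def_subring_UNIV a_FSs r n UNIV_I d c p1] unfolding pe ph_def by blast
    have "u (pt d) \<noteq> 0" using u(2) C_iff[OF c] cP by simp
    moreover have "pt d \<noteq> (\<lambda>_. 0)" using d0 by (auto simp: pt_def dest: fun_cong[of _ _ 0])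
    ultimately have "\<not> pdom u \<subseteq> {\<lambda>_. 0}" by (auto simp: pdom_def)
    then obtain x where "ev1 u x = 0" using closed u(1) polys_Pol[OF def_subring_UNIV N_1] unfolding definably_alg_closed_def by blast
    then show thesis using that[of x] ev1_eq[OF def_subring_UNIV u(1)] u(3) by simp
  qed
  let ?J = "\<lambda>X. {q \<in> Pol R (r + 1). q \<in> X}"
  define J2 where "J2 = {q \<in> Pol R (r + 1). ph b q = 0}"
  \<comment> \<open>Modulo \<open>Z\<close>, which vanishes at every choice of the last entry, some
    multiple of \<open>k\<close> by a \<open>c'\<close> outside \<open>P\<close> is a multiple of
    \<open>p\<close>. Evaluation at \<open>b\<close> kills \<open>p\<close>, while \<open>c'\<close>
    keeps a non-zero value.\<close>
  have PJ: "ph b k = 0" if k: "k \<in> Pol R (r + 1)" "k \<in> P" for k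
  proof -
    obtain m where m: "m \<in> NN" "deg_less r m k" using deg_less_ex[OF Pol_PN[OF k(1)]] by blast
    have "nle m (d + m)" using d by (simp add: nle_def)
    then have km: "deg_less r (d + m) k" using deg_less_mono m(2) by blast
    have D: "dp Pc (\<lambda>q. q \<in> ?J P)" unfolding mem_Collect_eq by (rule dp_conj dp_Pol[OF R] Pd df_const_K df_id cset_Pc)+
    have "\<exists>c'\<in>Pol R r. c' \<notin> P \<and> (\<exists>s\<in>Pol R (r + 1). deg_less r m s \<and> padd (pm c' k) (pm s p) \<in> Z)"
      by (rule pseudo_division[OF r _ D dp_Z _ _ d _ pe p1 c cP _ m(1) _ km])
        (use k p dmin padd_Pol P_add S_pm P_mul S_n in auto)
    then obtain c' s where c': "c' \<in> Pol R r" "c' \<notin> P" and s: "s \<in> Pol R (r + 1)" and z: "padd (pm c' k) (pm s p) \<in> Z"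
      by blast
    have "ph b (padd (pm c' k) (pm s p)) = E n c' a * ph b k"
      unfolding ph_add[OF S_pm[OF C_S[OF c'(1)] k(1)] S_pm[OF s p(1)]] ph_pm[OF C_S[OF c'(1)] k(1)] ph_pm[OF s p(1)] ph_const[OF c'(1)] b by simp
    then show "ph b k = 0" using Z_sub(2)[OF z] C_iff[OF c'(1)] c'(2) by simp
  qed
  \<comment> \<open>If the kernel at \<open>b\<close> lies in \<open>Z\<close>, it lies in
    \<open>P\<close>. Otherwise an element \<open>q\<close> of least degree in the kernel but
    outside \<open>Z\<close> serves as divisor: once \<open>q\<close> is known to be in
    \<open>P\<close>, pseudo-division by \<open>q\<close> carries every element of the kernel into
    \<open>P\<close>.\<close>
  have JP: "k \<in> P" if k: "k \<in> J2" for k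
  proof (cases "J2 \<subseteq> Z")
    case True
    then show ?thesis using k Z_sub(1) by blast
  next
    case False
    then obtain q0 where q0: "q0 \<in> J2" "q0 \<notin> Z" by blast
    have D: "dp Pc (\<lambda>q. q \<in> J2)" unfolding J2_def by (rule dp_ker)
    have Q2: "dp Pc (\<lambda>q. q \<in> J2 \<and> \<not> q \<in> Z)" by (rule dp_conj dp_not D dp_Z)+
    have JS: "J2 \<subseteq> Pol R (r + 1)" by (auto simp: J2_def)
    have Jadd: "padd x y \<in> J2" if "x \<in> J2" "y \<in> J2" for x y using that ph_add padd_Pol by (simp add: J2_def)
    have Jmul: "pm s x \<in> J2" if "s \<in> Pol R (r + 1)" "x \<in> J2" for s x using that ph_pm S_pm by (simp add: J2_def)
    obtain e q where e: "e \<in> NN" and q: "q \<in> Pol R (r + 1)" "q \<in> J2" "q \<notin> Z" "deg_less r (e + 1) q"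
      and emin: "\<And>k. k \<in> Pol R (r + 1) \<Longrightarrow> k \<in> J2 \<Longrightarrow> deg_less r e k \<Longrightarrow> k \<in> Z"
      using least_degree[OF rN Q2 _ _] q0 Z0 JS by blast
    obtain c' q1 where c': "c' \<in> Pol R r" and q1: "q1 \<in> Pol R (r + 1)" "deg_less r e q1" and qe: "q = padd (pm (Xp r e) c') q1"
      by (rule deg_less_split[OF q(1) rN e q(4)])
    have c'P: "c' \<notin> P"
    proof
      assume cP: "c' \<in> P"
      then have c0: "E n c' a = 0" using C_iff[OF c'] by simp
      then have "q1 \<in> J2" using q(2) q1(1) ph_split[OF e c' q1(1), of b] by (simp add: J2_def qe)
      then have "q1 \<in> Z" using emin q1 by blast
      then have "q \<in> Z" using ph_split[OF e c' q1(1), of \<tau>] c0 q(1) by (simp add: Z_def qe)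
      then show False using q(3) by simp
    qed
    have e0: "e \<noteq> 0"
    proof
      assume "e = 0"
      then have "q = c'" using deg_less_0[of r q1] q1(2) Xp_0[OF PolD(1)[OF c']] by (simp add: qe padd_def)
      then show False using q(2) ph_const[OF c'] C_iff[OF c'] c'P by (simp add: J2_def)
    qed
    have pJ: "p \<in> J2" using p(1) b by (simp add: J2_def)
    \<comment> \<open>\<open>p\<close> itself is in the kernel and outside \<open>Z\<close>, so its
      degree \<open>d\<close> bounds the least degree \<open>e\<close>.\<close>
    have ed: "nle e d"
    proof (rule ccontr)
      assume "\<not> nle e d"
      then have "nle d e" "d \<noteq> e" using nle_linear[OF d e] nle_refl by auto
      then have "nle (d + 1) e" using N_pred[of "e - d"] by (simp add: nle_def algebra_simps)
      then show False using emin[OF p(1) pJ deg_less_mono[OF _ p(4)]] p(3) by blast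
    qed
    \<comment> \<open>Then \<open>e + t\<close> is \<open>d + 1\<close>, the degree bound of
      \<open>p\<close>, and \<open>t\<close> is at most \<open>d\<close> because \<open>e\<close> is
      positive. The second fact lets the minimality of \<open>d\<close> act on the quotient
      \<open>s\<close>.\<close>
    define t where "t = d - e + 1"
    have t: "t \<in> NN" "e + t = d + 1" using N_Suc[of "d - e"] ed by (simp_all add: t_def nle_def)
    have td: "nle t d" using N_pred[OF e e0] by (simp add: t_def nle_def)
    have division: "\<exists>c\<in>Pol R r. c \<notin> P \<and> (\<exists>s\<in>Pol R (r + 1). deg_less r t s \<and> padd (pm c k) (pm s q) \<in> Z)"
      if "t \<in> NN" "k \<in> J2" "deg_less r (e + t) k" for t k
      by (rule pseudo_division[OF r JS D dp_Z _ _ e q(2) qe q1 c' c'P _ that]) (use Jadd Jmul emin JS in blast)+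
    \<comment> \<open>Pseudo-division of \<open>p\<close> by \<open>q\<close> puts the product of
      \<open>s\<close> and \<open>q\<close> into \<open>P\<close>, so one factor is in
      \<open>P\<close>. If it were \<open>s\<close>, its degree below \<open>d\<close> would force
      it into \<open>Z\<close>; evaluation at \<open>\<tau>\<close> would then put \<open>p\<close>
      into \<open>Z\<close>, as \<open>c1\<close> has a non-zero value.\<close>
    have "q \<in> P"
    proof -
      obtain c1 s where c1: "c1 \<in> Pol R r" "c1 \<notin> P" and s: "s \<in> Pol R (r + 1)" "deg_less r t s"
        and z: "padd (pm c1 p) (pm s q) \<in> Z"
        using division[OF t(1) pJ] p(4) t(2) by auto
      have "pm c1 p \<in> P" by (rule P_mul[OF S_n[OF C_S[OF c1(1)]] p(2)])
      then have "pm s q \<in> P" by (rule P_cancel'[OF Z_sub(1)[OF z]])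
      then consider "q \<in> P" | "s \<in> P" using P_prime[OF S_n[OF s(1)] S_n[OF q(1)]] by blast
      then show "q \<in> P"
      proof cases
        case 2
        then have "s \<in> Z" using dmin[OF s(1)] deg_less_mono[OF td s(2)] by blast
        then have "ph \<tau> s = 0" by (simp add: Z_def)
        then have "E n c1 a * ph \<tau> p = 0"
          using z ph_add[OF S_pm[OF C_S[OF c1(1)] p(1)] S_pm[OF s(1) q(1)], of \<tau>] ph_pm[OF C_S[OF c1(1)] p(1), of \<tau>]
            ph_pm[OF s(1) q(1), of \<tau>] ph_const[OF c1(1), of \<tau>] by (simp add: Z_def)
        then show ?thesis using C_iff[OF c1(1)] c1(2) p(1,3) by (simp add: Z_def)
      qed
    qed
    obtain m where m: "m \<in> NN" "deg_less r m k" using deg_less_ex[OF Pol_PN] k JS by blast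
    have "nle m (e + m)" using e by (simp add: nle_def)
    then have km: "deg_less r (e + m) k" using deg_less_mono m(2) by blast
    obtain c1 s where c1: "c1 \<in> Pol R r" "c1 \<notin> P" and s: "s \<in> Pol R (r + 1)" and z: "padd (pm c1 k) (pm s q) \<in> Z"
      using division[OF m(1) k km] by blast
    have "pm s q \<in> P" by (rule P_mul[OF S_n[OF s] \<open>q \<in> P\<close>])
    then have "pm c1 k \<in> P" by (rule P_cancel[OF Z_sub(1)[OF z]])
    then show "k \<in> P" using P_prime[OF S_n[OF C_S[OF c1(1)]] S_n, of k] k JS c1(2) by blast
  qed
  show ?thesis using PJ JP by (auto simp: J2_def)
qed

lemma gen_extend: "\<exists>b. gen (r + 1) (a(r := b))"
proof (cases "\<forall>p\<in>Pol R (r + 1). p \<in> P \<longrightarrow> p \<in> Z")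
  case True
  then have "ph \<tau> p = 0 \<longleftrightarrow> p \<in> P" if "p \<in> Pol R (r + 1)" for p
    using that Z_sub(1)[of p] by (auto simp: Z_def)
  then show ?thesis using gen_Suc by blast
next
  case False
  then show ?thesis using algebraic_extension gen_Suc by blast
qed

end

section \<open>Generic zeros by induction on the number of variables\<close>

lemma dp_gen: assumes s: "df W K s" and a: "df W Sc a" shows "dp W (\<lambda>w. gen (s w) (a w))"
proof -
  note W = df_cset(1)[OF s]
  have "dp W (\<lambda>w. (\<forall>i. \<not> i \<in> below (s w) \<longrightarrow> ap (a w) i = 0) \<and>
      (\<forall>p\<in>car Pc. p \<in> Pol R (s w) \<longrightarrow> (E n p (a w) = 0 \<longleftrightarrow> p \<in> P)))"
    by (rule dp_conj dp_all_K dp_ball dp_imp dp_iff dp_not dp_below dp_Pol[OF R] dp_comp[OF Pd] dp_eq_K df_E df_apS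
      df_comp[OF s] df_comp[OF a] df_fst df_snd df_id df_const_K cset_cprod cset_Kc cset_Pc W)+
  then show ?thesis
  proof (rule dp_congI)
    fix w assume "w \<in> car W"
    then have "a w \<in> FSs K" using df_mem[OF a] by simp
    then show "gen (s w) (a w) \<longleftrightarrow> (\<forall>i. \<not> i \<in> below (s w) \<longrightarrow> ap (a w) i = 0) \<and>
      (\<forall>p\<in>car Pc. p \<in> Pol R (s w) \<longrightarrow> (E n p (a w) = 0 \<longleftrightarrow> p \<in> P))"
      unfolding gen_def ap_def car_FSup using PolD(1) by blast
  qed
qed

lemma gen_generic_zero:
  assumes r: "r \<in> NN" "nle r n" shows "generic_zero R r (P \<inter> polys R r) a \<longleftrightarrow> gen r a"
proof -
  have "ev r p a = E n p a" if "p \<in> Pol R r" "a \<in> FSs K" for p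
  proof -
    have "ev r p a = E r p a"
      using ev_eq[OF r(1) def_subringD(1)[OF R] _ that(2)] that(1) polys_Pol[OF R r(1)] by simp
    also have "\<dots> = E n p a" by (rule E_Pol_cong[OF that(1) r that(2,2), symmetric]) simp
    finally show ?thesis .
  qed
  then show ?thesis
    unfolding generic_zero_def gen_def seqs_UNIV[OF r(1)] polys_Pol[OF R r(1)] by auto
qed

context
  fixes A
  assumes RA: "R = QAfrac A" and closed: definably_alg_closed and trdeg: hyperinfinite_trdeg
begin

text \<open>Polynomials in no variables are constants. A non-zero constant in \<open>P\<close> could
  be inverted, since \<open>R\<close> is a field, and \<open>P\<close> would contain 1.\<close>

lemma gen_0: "gen 0 (\<lambda>_. 0)"
  unfolding gen_def
proof (intro conjI ballI allI impI)
  show "(\<lambda>_. 0) \<in> FSs K" by (rule S_zero)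
  fix p assume p: "p \<in> Pol R 0"
  define c where "c = p (\<lambda>_. 0)"
  have "p I = 0" if "I \<noteq> (\<lambda>_. 0)" for I using PolD(2)[OF p, of I] that below_0 by auto
  then have pc: "p = mono c (\<lambda>_. 0)" by (auto simp: mono_def c_def)
  have cR: "c \<in> R" unfolding c_def by (rule Pol_coef[OF R p])
  have "c = 0" if pP: "p \<in> P"
  proof (rule ccontr)
    assume c: "c \<noteq> 0"
    have "1 / c \<in> R"
      using frac_inverse[OF def_subringD(2)[OF def_subring_QA] _ c] cR unfolding RA QAfrac_eq by blast
    then have "pm (mono (1 / c) (\<lambda>_. 0)) p \<in> P" by (rule P_mul[OF Pol_const pP])
    moreover have "pm (mono (1 / c) (\<lambda>_. 0)) p = mono 1 (\<lambda>_. 0)"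
      unfolding pm_mono[OF PolD(1)[OF p] S_zero] using c by (auto simp: pc mshift_def mono_def)
    ultimately show False using P_one by simp
  qed
  moreover have "p \<in> P" if "c = 0"
  proof -
    have "p = (\<lambda>_. 0)" using that by (subst pc) (auto simp: mono_def)
    then show ?thesis using P_zero by simp
  qed
  moreover have "E n p (\<lambda>_. 0) = c" unfolding pc by (rule E_const[OF S_zero n])
  ultimately show "E n p (\<lambda>_. 0) = 0 \<longleftrightarrow> p \<in> P" by auto
qed simp

text \<open>Definable induction on the number \<open>t\<close> of entries added to \<open>a\<close>.
  At each stage a new \<open>B\<close> collects the parameters together with the entries found so
  far, and hyper-infinite transcendence degree provides an element transcendental over it.\<close>

lemma gen_prolong:
  assumes r: "r \<in> NN" "gen r a" and rn: "nle r n"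
  shows "\<exists>b. (\<forall>i\<in>below r. b i = a i) \<and> gen n b"
proof -
  have aS: "a \<in> FSs K" using r(2) by (simp add: gen_def)
  have D: "dp K (\<lambda>t. nle (r + t) n \<longrightarrow> (\<exists>b\<in>car Sc. (\<forall>i. i \<in> below r \<longrightarrow> ap b i = a i) \<and> gen (r + t) b))"
    by (rule dp_imp dp_nle dp_bex dp_conj dp_all_K dp_below dp_eq_K dp_gen df_apS df_comp[OF S_df[OF aS]] df_plus
      df_fst df_snd df_id df_const_K cset_cprod cset_Kc cset_Sc)+
  have t: "n - r \<in> NN" using rn by (simp add: nle_def)
  have "nle (r + (n - r)) n \<longrightarrow> (\<exists>b\<in>car Sc. (\<forall>i. i \<in> below r \<longrightarrow> ap b i = a i) \<and> gen (r + (n - r)) b)"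
  proof (rule N_induct[OF t D]; intro impI)
    show "\<exists>b\<in>car Sc. (\<forall>i. i \<in> below r \<longrightarrow> ap b i = a i) \<and> gen (r + 0) b"
      using r(2) aS by (intro bexI[of _ a]) (simp_all add: ap_def)
    fix t assume t: "t \<in> NN" and le: "nle (r + (t + 1)) n"
      and IH: "nle (r + t) n \<longrightarrow> (\<exists>b\<in>car Sc. (\<forall>i. i \<in> below r \<longrightarrow> ap b i = a i) \<and> gen (r + t) b)"
    note rt = N_add[OF r(1) t]
    have rtn: "r + t \<in> below n"
      using below_mono[OF le] below_Suc[OF rt] by (auto simp: add.assoc)
    then obtain b where b: "\<And>i. i \<in> below r \<Longrightarrow> b i = a i" "gen (r + t) b" "b \<in> FSs K"
      using IH by (auto simp: below_iff ap_def)
    obtain B where B: "\<And>c. c \<in> Pol R (r + t) \<Longrightarrow> E n c b \<in> QAfrac B"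
      using values_field[OF RA b(3) below_n(1,2)[OF rtn]] by blast
    obtain x where x: "\<not> definably_algebraic B x" using trdeg unfolding hyperinfinite_trdeg_def by blast
    obtain y where y: "gen (r + t + 1) (b(r + t := y))" using gen_extend[OF rtn b(2) B x closed] by blast
    have "below r \<subseteq> below (r + t)" by (rule below_mono) (simp add: nle_def t)
    then have "r + t \<notin> below r" using below_irrefl by blast
    then show "\<exists>b\<in>car Sc. (\<forall>i. i \<in> below r \<longrightarrow> ap b i = a i) \<and> gen (r + (t + 1)) b"
      using y b(1) S_upd[OF b(3)] by (intro bexI[of _ "b(r + t := y)"]) (auto simp: ap_def add.assoc)
  qed
  then show ?thesis using nle_refl by (auto simp: ap_def)
qed

lemma generic_zero_exists: "\<exists>\<alpha>. generic_zero R n P \<alpha>"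
proof -
  obtain b where "gen n b" using gen_prolong[OF N_0 gen_0 nle_0[OF n]] by blast
  moreover have "P \<inter> polys R n = P" using P_Pol polys_Pol[OF R n] by blast
  ultimately show ?thesis using gen_generic_zero[OF n nle_refl] by metis
qed

lemma generic_zero_extends:
  assumes r: "r \<in> NN" "nle r n" and a: "generic_zero R r (P \<inter> polys R r) \<alpha>"
  shows "\<exists>\<beta>\<in>seqs UNIV (n - r). generic_zero R n P (seq_append r \<alpha> \<beta>)"
proof -
  obtain b where b: "\<And>i. i \<in> below r \<Longrightarrow> b i = \<alpha> i" "gen n b"
    using gen_prolong[OF r(1) _ r(2)] a gen_generic_zero[OF r] by blast
  have bS: "b \<in> FSs K" "\<And>i. i \<notin> below n \<Longrightarrow> b i = 0" using b(2) by (simp_all add: gen_def)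
  define \<beta> where "\<beta> = (\<lambda>i. if i \<in> below (n - r) then b (r + i) else 0)"
  have nr: "n - r \<in> NN" using r(2) by (simp add: nle_def)
  have bd: "df K K \<beta>" unfolding \<beta>_def
    by (rule df_If dp_below df_comp[OF S_df[OF bS(1)]] df_plus df_id df_const_K cset_Kc)+
  have "\<beta> \<in> FSs K"
    by (rule FSs_I[OF cset_Kc below_HFs[OF nr] _ bd]) (auto simp: supp_def \<beta>_def)
  then have "\<beta> \<in> seqs UNIV (n - r)" unfolding seqs_UNIV[OF nr] by (simp add: \<beta>_def)
  moreover have "seq_append r \<alpha> \<beta> = b"
  proof
    fix i
    have "i \<in> below n \<longleftrightarrow> i \<in> below r \<or> i - r \<in> below (n - r)" using below_add(1)[OF r(1) nr, of i] by simp
    then show "seq_append r \<alpha> \<beta> i = b i" using b(1) bS(2) by (auto simp: seq_append_def \<beta>_def)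
  qed
  moreover have "P \<inter> polys R n = P" using P_Pol polys_Pol[OF R n] by blast
  ultimately show ?thesis using gen_generic_zero[OF n nle_refl] b(2) by metis
qed

end

end

theorem proposition9p3:
  fixes mem :: "'k::field \<Rightarrow> 'f \<Rightarrow> bool"
    and A :: 'f and R :: "'k set" and n :: 'k and P :: "(('k \<Rightarrow> 'k) \<Rightarrow> 'k) set"
  assumes "kfield.is_power_set_structure mem"
    and "kfield.definable_char_zero mem"
    and "kfield.definably_alg_closed mem"
    and "kfield.hyperinfinite_trdeg mem"
    and "R = kfield.QAfrac mem A"
    and "n \<in> kfield.NN mem"
    and "kfield.definable_poly_set mem R n P"
    and "primeideal P (kfield.poly_ring mem R n)"
  shows "(\<exists>\<alpha>. kfield.generic_zero mem R n P \<alpha>) \<and>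
    (\<forall>r\<in>kfield.NN mem. kfield.nle mem r n \<longrightarrow>
      (\<forall>\<alpha>. kfield.generic_zero mem R r (P \<inter> kfield.polys mem R r) \<alpha> \<longrightarrow>
        (\<exists>\<beta>\<in>kfield.seqs mem UNIV (n - r).
          kfield.generic_zero mem R n P (kfield.seq_append mem r \<alpha> \<beta>))))"
proof -
  interpret hyperfield mem by unfold_locales (fact assms(1,2))+
  have R: "def_subring R" unfolding assms(5) by (rule def_subring_QAfrac)
  interpret prime_pol mem R n P
    by (intro prime_pol.intro prime_pol_axioms.intro hyperfield_axioms R assms(6,8)
      definable_poly_set_dp[OF assms(6) def_subringD(1)[OF R] assms(7)])
  show ?thesis
    using generic_zero_exists[OF assms(5,3,4)] generic_zero_extends[OF assms(5,3,4)] by blast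
qed

end
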